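(* Let $0\le\tau\le1$ and $0\le\sigma\le\sqrt{1-\tau^2}$. Consider the curve $C_1$ in the $xz$-plane given parametrically for $u\in[-\tau,\tau]$ by $$x=x_\tau(u)=\frac{u\sqrt{1-(\tau-|u|)^2}}{\sqrt{1-u^2(\tau-|u|)^2}},\qquad z=z_\tau(u)=\int\frac{dz}{dx}\,dx=\int\frac{u}{\sqrt{1-u^2}}\,\frac{du}{\kappa_\tau(u)},$$ where $$\kappa_\tau(u)=\frac{\sqrt{\bigl(1-u^2(\tau-|u|)^2\bigr)^3\bigl(1-(\tau-|u|)^2\bigr)}}{1-(\tau-|u|)^2+(\tau-|u|)\,|u|\,(1-u^2)}$$ and the constant of integration for $z$ is chosen so that $z(0)+z(\tau)=-\sqrt{1-\tau^2}$. Then there is a curve $C_2$ in the $yz$-plane, congruent to $C_1$ and lying at distance exactly $1$ from $C_1$, such that $\tilde C=C_1\cup C_2$ is $2{*}2$-symmetric, has $\mathrm{Thi}_\sigma(\tilde C)=1$, and is critical for the $(\tau,\sigma)$-clasp problem (the ends being extended by tangent straight segments to the constraining planes).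
   Context: Symmetry. The group $2{*}2\subset O(3)$ (order 8) is generated by $(x,y,z)\mapsto(-x,y,z)$, $(x,y,z)\mapsto(x,-y,z)$ and $(x,y,z)\mapsto(-y,x,-z)$. Clasp problem. Fix $h$ large. The $(\tau,\sigma)$-clasp problem concerns links $L$ of two arcs, the first with one endpoint on each of the planes $\pm\sqrt{1-\tau^2}\,x+\tau z=h$, the second with one endpoint on each of the planes $\pm\sqrt{1-\tau^2}\,y-\tau z=h$ (faces of a large tetrahedron), tangents at endpoints free, and hooked through each other (giving a Hopf link if each component is closed up by segments in its own boundary faces); one minimizes length subject to $\mathrm{Thi}_\sigma(L)\ge1$. Thickness. For $\sigma\ge\frac12$ and a $C^{1,1}$ link $L$, $\mathrm{Thi}_\sigma(L)=\min\{2\,\mathrm{reach}(L),\ \frac1\sigma\min_L\rho\}$, where $\mathrm{reach}(L)$ is the supremal $r$ such that every point within distance less than $r$ of $L$ has a unique nearest point on $L$, and $\rho(x)=\bigl(\limsup_{y\to x}|\kappa(y)|\bigr)^{-1}$, the limsup over points $y$ where $L$ is twice differentiable. For $0<\sigma<\frac12$, in the clasp problem $\mathrm{Thi}_\sigma(L)$ means instead the minimum of the distance between the two components and $\frac1\sigma\min_L\rho$ (i.e. link-thickness with a curvature constraint); for $\sigma=0$ only the distance between the two components is used (and $L$ need only be $C^1$). Critical for the $(\tau,\sigma)$-clasp problem: $L$ satisfies the endpoint constraints, $\mathrm{Thi}_\sigma(L)=1$, and for every $\xi\in C^2(\mathbb{R}^3,\mathbb{R}^3)$ tangent at each endpoint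 of $L$ to its constraining plane, $\delta_\xi\mathrm{len}(L)<0$ implies $\delta_\xi\mathrm{Thi}_\sigma(L)<0$. Here $\delta_\xi\mathrm{len}(L)=\int_L\langle\xi',T\rangle ds$ and $\delta_\xi\mathrm{Thi}_\sigma(L)$ is the right derivative at $t=0$ of $\mathrm{Thi}_\sigma(\phi^t(L))$ for any $C^1$ family of $C^2$ diffeomorphisms $\phi^t$ with $\phi^0=\mathrm{Id}$ and initial velocity $\xi$. Here $u$ is the sine of the angle of the tangent to $C_1$ with the $x$-axis and $\kappa_\tau$ is the curvature; at parameter values where the formulas have a removable $0/0$ (e.g. $\tau=1$, $u=0$) they are read as limits ($1/\kappa_\tau\to0$ there). *)

theory Defs
  imports "HOL-Analysis.Analysis"
begin

section \<open>Arcs, tangents and curvature\<close>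

text \<open>An arc is given by an injective regular \<open>C\<^sup>1\<close> parametrization over \<open>{0..1}\<close>; everything
  below depends only on its image, up to orientation.\<close>

abbreviation velocity :: "(real \<Rightarrow> real^3) \<Rightarrow> real \<Rightarrow> real^3" where
  "velocity \<gamma> t \<equiv> vector_derivative \<gamma> (at t within {0..1})"

definition C1_arc :: "(real \<Rightarrow> real^3) \<Rightarrow> bool" where
  "C1_arc \<gamma> \<longleftrightarrow> arc \<gamma> \<and>
     (\<forall>t\<in>{0..1}. \<gamma> differentiable (at t within {0..1}) \<and> velocity \<gamma> t \<noteq> 0) \<and>
     continuous_on {0..1} (velocity \<gamma>)"

definition unit_tangent :: "(real \<Rightarrow> real^3) \<Rightarrow> real \<Rightarrow> real^3" where
  "unit_tangent \<gamma> t = sgn (velocity \<gamma> t)"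

text \<open>Along a regular \<open>C\<^sup>1\<close> arc the parameter and the arclength are bi-Lipschitz functions of each
  other, with continuous derivatives. Hence the regularity of \<open>unit_tangent \<gamma>\<close> in the parameter is
  the regularity of the first derivative of the arclength parametrization.\<close>

definition C11_arc :: "(real \<Rightarrow> real^3) \<Rightarrow> bool" where
  "C11_arc \<gamma> \<longleftrightarrow> C1_arc \<gamma> \<and> (\<exists>K. K-lipschitz_on {0..1} (unit_tangent \<gamma>))"

definition twice_diff_points :: "(real \<Rightarrow> real^3) \<Rightarrow> real set" where
  "twice_diff_points \<gamma> = {t\<in>{0..1}. unit_tangent \<gamma> differentiable (at t within {0..1})}"

definition curvature :: "(real \<Rightarrow> real^3) \<Rightarrow> real \<Rightarrow> real" where
  "curvature \<gamma> t = norm (vector_derivative (unit_tangent \<gamma>) (at t within {0..1})) / norm (velocity \<gamma> t)"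

text \<open>In \<open>ereal\<close>, \<open>inverse 0 = \<infinity>\<close>: straight arcs have infinite radius of curvature.\<close>

definition curv_radius :: "(real \<Rightarrow> real^3) \<Rightarrow> real \<Rightarrow> ereal" where
  "curv_radius \<gamma> t = inverse (Limsup (at t within twice_diff_points \<gamma>) (\<lambda>s. ereal (curvature \<gamma> s)))"

definition min_curv_radius :: "(real \<Rightarrow> real^3) \<Rightarrow> (real \<Rightarrow> real^3) \<Rightarrow> ereal" where
  "min_curv_radius \<gamma>1 \<gamma>2 = min (INF t\<in>{0..1}. curv_radius \<gamma>1 t) (INF t\<in>{0..1}. curv_radius \<gamma>2 t)"

section \<open>Thickness of two-component links\<close>

definition reach :: "(real^3) set \<Rightarrow> ereal" where
  "reach L = Sup {ereal r |r. \<forall>x. infdist x L < r \<longrightarrow> (\<exists>!y. y \<in> L \<and> dist x y = infdist x L)}"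

definition thickness :: "real \<Rightarrow> (real \<Rightarrow> real^3) \<Rightarrow> (real \<Rightarrow> real^3) \<Rightarrow> ereal" where
  "thickness \<sigma> \<gamma>1 \<gamma>2 =
     (if \<sigma> \<ge> 1/2 then
        min (2 * reach (path_image \<gamma>1 \<union> path_image \<gamma>2)) (min_curv_radius \<gamma>1 \<gamma>2 / ereal \<sigma>)
      else if \<sigma> > 0 then
        min (ereal (setdist (path_image \<gamma>1) (path_image \<gamma>2))) (min_curv_radius \<gamma>1 \<gamma>2 / ereal \<sigma>)
      else ereal (setdist (path_image \<gamma>1) (path_image \<gamma>2)))"

section \<open>First variations\<close>

definition C2_map :: "(real^3 \<Rightarrow> real^3) \<Rightarrow> bool" where
  "C2_map f \<longleftrightarrow> (\<exists>(f' :: real^3 \<Rightarrow> ((real^3) \<Rightarrow>\<^sub>L (real^3))) (f'' :: real^3 \<Rightarrow> ((real^3) \<Rightarrow>\<^sub>L ((real^3) \<Rightarrow>\<^sub>L (real^3)))).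
     (\<forall>x. (f has_derivative blinfun_apply (f' x)) (at x)) \<and>
     (\<forall>x. (f' has_derivative blinfun_apply (f'' x)) (at x)) \<and>
     continuous_on UNIV f'')"

definition C2_diffeo :: "(real^3 \<Rightarrow> real^3) \<Rightarrow> bool" where
  "C2_diffeo f \<longleftrightarrow> bij f \<and> C2_map f \<and> C2_map (inv f)"

text \<open>A \<open>C\<^sup>1\<close> family of \<open>C\<^sup>2\<close> diffeomorphisms: \<open>t \<mapsto> \<phi> t\<close> is \<open>C\<^sup>1\<close> into the space of \<open>C\<^sup>2\<close> maps with
  locally uniform convergence of derivatives up to order two. \<open>D1\<close>, \<open>D2\<close> are the spatial
  derivatives of \<open>\<phi>\<close>, and \<open>V0\<close>, \<open>V1\<close>, \<open>V2\<close> the time derivatives of \<open>\<phi>\<close>, \<open>D1\<close>, \<open>D2\<close>.\<close>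

definition C1_family_C2_diffeos :: "(real \<Rightarrow> real^3 \<Rightarrow> real^3) \<Rightarrow> (real^3 \<Rightarrow> real^3) \<Rightarrow> bool" where
  "C1_family_C2_diffeos \<phi> \<xi> \<longleftrightarrow>
     (\<exists>\<epsilon>>0. \<exists>(D1 :: real \<Rightarrow> real^3 \<Rightarrow> ((real^3) \<Rightarrow>\<^sub>L (real^3)))
        (D2 :: real \<Rightarrow> real^3 \<Rightarrow> ((real^3) \<Rightarrow>\<^sub>L ((real^3) \<Rightarrow>\<^sub>L (real^3)))) V0 V1 V2.
        (\<forall>t\<in>{-\<epsilon><..<\<epsilon>}. C2_diffeo (\<phi> t) \<and>
           (\<forall>x. (\<phi> t has_derivative blinfun_apply (D1 t x)) (at x) \<and>
                (D1 t has_derivative blinfun_apply (D2 t x)) (at x) \<and>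
                ((\<lambda>s. \<phi> s x) has_vector_derivative V0 t x) (at t) \<and>
                ((\<lambda>s. D1 s x) has_vector_derivative V1 t x) (at t) \<and>
                ((\<lambda>s. D2 s x) has_vector_derivative V2 t x) (at t))) \<and>
        continuous_on ({-\<epsilon><..<\<epsilon>} \<times> UNIV) (\<lambda>(t, x). V0 t x) \<and>
        continuous_on ({-\<epsilon><..<\<epsilon>} \<times> UNIV) (\<lambda>(t, x). V1 t x) \<and>
        continuous_on ({-\<epsilon><..<\<epsilon>} \<times> UNIV) (\<lambda>(t, x). V2 t x) \<and>
        \<phi> 0 = id \<and> V0 0 = \<xi>)"

definition length_variation :: "(real^3 \<Rightarrow> real^3) \<Rightarrow> (real \<Rightarrow> real^3) \<Rightarrow> real" where
  "length_variation \<xi> \<gamma> = integral {0..1} (\<lambda>t. velocity (\<xi> \<circ> \<gamma>) t \<bullet> unit_tangent \<gamma> t)"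

text \<open>The first variation of thickness is \<open>d\<close>: along every admissible family the right derivative
  at \<open>0\<close> exists and equals \<open>d\<close>. The conversion to \<open>real\<close> is harmless, since thickness never exceeds
  the distance between the components.\<close>

definition has_thickness_variation ::
    "real \<Rightarrow> (real \<Rightarrow> real^3) \<Rightarrow> (real \<Rightarrow> real^3) \<Rightarrow> (real^3 \<Rightarrow> real^3) \<Rightarrow> real \<Rightarrow> bool" where
  "has_thickness_variation \<sigma> \<gamma>1 \<gamma>2 \<xi> d \<longleftrightarrow>
     (\<forall>\<phi>. C1_family_C2_diffeos \<phi> \<xi> \<longrightarrow>
        ((\<lambda>t. real_of_ereal (thickness \<sigma> (\<phi> t \<circ> \<gamma>1) (\<phi> t \<circ> \<gamma>2))) has_real_derivative d) (at_right 0))"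

section \<open>The clasp problem\<close>

text \<open>Unit normals of the constraining planes, for \<open>s = 1\<close> and \<open>s = -1\<close>.\<close>

definition normal1 :: "real \<Rightarrow> real \<Rightarrow> real^3" where
  "normal1 \<tau> s = vector [s * sqrt (1 - \<tau>\<^sup>2), 0, \<tau>]"

definition normal2 :: "real \<Rightarrow> real \<Rightarrow> real^3" where
  "normal2 \<tau> s = vector [0, s * sqrt (1 - \<tau>\<^sup>2), - \<tau>]"

definition face1 :: "real \<Rightarrow> real \<Rightarrow> real \<Rightarrow> (real^3) set" where
  "face1 \<tau> h s = {p. normal1 \<tau> s \<bullet> p = h}"

definition face2 :: "real \<Rightarrow> real \<Rightarrow> real \<Rightarrow> (real^3) set" where
  "face2 \<tau> h s = {p. normal2 \<tau> s \<bullet> p = h}"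

definition tetrahedron :: "real \<Rightarrow> real \<Rightarrow> (real^3) set" where
  "tetrahedron \<tau> h = {p. \<forall>s\<in>{1, -1}. normal1 \<tau> s \<bullet> p \<le> h \<and> normal2 \<tau> s \<bullet> p \<le> h}"

text \<open>The Hopf link up to homeomorphism of space. As an unoriented link it is isotopic to its mirror
  image, so orientation-reversing homeomorphisms may be admitted.\<close>

definition hopf_link :: "(real^3) set \<Rightarrow> (real^3) set \<Rightarrow> bool" where
  "hopf_link A B \<longleftrightarrow> (\<exists>f g :: real^3 \<Rightarrow> real^3. homeomorphism UNIV UNIV f g \<and>
     f ` A = {p. p$3 = 0 \<and> (p$1)\<^sup>2 + (p$2)\<^sup>2 = 1} \<and>
     f ` B = {p. p$2 = 0 \<and> (p$1 - 1)\<^sup>2 + (p$3)\<^sup>2 = 1})"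

text \<open>For \<open>\<tau> > 0\<close> the two faces of a component share an edge of the tetrahedron, and the component is
  closed up by one segment in each face, meeting at a point \<open>e\<close> of that edge. For \<open>\<tau> = 0\<close> these
  faces are parallel and the edge has moved to infinity (upwards for the first component,
  downwards for the second); the segments in the faces are then vertical and are joined far away.\<close>

definition edge_closure :: "(real \<Rightarrow> real^3) \<Rightarrow> real^3 \<Rightarrow> (real^3) set" where
  "edge_closure \<gamma> e =
     path_image \<gamma> \<union> closed_segment (pathfinish \<gamma>) e \<union> closed_segment e (pathstart \<gamma>)"

definition far_closure :: "(real \<Rightarrow> real^3) \<Rightarrow> real \<Rightarrow> (real^3) set" where
  "far_closure \<gamma> R = (let v = vector [0, 0, R] in
     path_image \<gamma> \<union> closed_segment (pathfinish \<gamma>) (pathfinish \<gamma> + v)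
       \<union> closed_segment (pathfinish \<gamma> + v) (pathstart \<gamma> + v)
       \<union> closed_segment (pathstart \<gamma> + v) (pathstart \<gamma>))"

definition hooked :: "real \<Rightarrow> real \<Rightarrow> (real \<Rightarrow> real^3) \<Rightarrow> (real \<Rightarrow> real^3) \<Rightarrow> bool" where
  "hooked \<tau> h \<gamma>1 \<gamma>2 \<longleftrightarrow>
     (if \<tau> = 0 then \<forall>\<^sub>F R in at_top. hopf_link (far_closure \<gamma>1 R) (far_closure \<gamma>2 (- R))
      else \<exists>e1 \<in> tetrahedron \<tau> h \<inter> face1 \<tau> h 1 \<inter> face1 \<tau> h (-1).
           \<exists>e2 \<in> tetrahedron \<tau> h \<inter> face2 \<tau> h 1 \<inter> face2 \<tau> h (-1).
             hopf_link (edge_closure \<gamma>1 e1) (edge_closure \<gamma>2 e2))"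

text \<open>Arcs are oriented, as a convention, from the plane with \<open>s = -1\<close> to the plane with \<open>s = 1\<close>.\<close>

definition endpoint_constraints :: "real \<Rightarrow> real \<Rightarrow> (real \<Rightarrow> real^3) \<Rightarrow> (real \<Rightarrow> real^3) \<Rightarrow> bool" where
  "endpoint_constraints \<tau> h \<gamma>1 \<gamma>2 \<longleftrightarrow>
     pathstart \<gamma>1 \<in> face1 \<tau> h (-1) \<and> pathfinish \<gamma>1 \<in> face1 \<tau> h 1 \<and>
     pathstart \<gamma>2 \<in> face2 \<tau> h (-1) \<and> pathfinish \<gamma>2 \<in> face2 \<tau> h 1"

definition clasp_link :: "real \<Rightarrow> real \<Rightarrow> real \<Rightarrow> (real \<Rightarrow> real^3) \<Rightarrow> (real \<Rightarrow> real^3) \<Rightarrow> bool" where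
  "clasp_link \<tau> \<sigma> h \<gamma>1 \<gamma>2 \<longleftrightarrow>
     C1_arc \<gamma>1 \<and> C1_arc \<gamma>2 \<and> (\<sigma> > 0 \<longrightarrow> C11_arc \<gamma>1 \<and> C11_arc \<gamma>2) \<and>
     path_image \<gamma>1 \<inter> path_image \<gamma>2 = {} \<and>
     endpoint_constraints \<tau> h \<gamma>1 \<gamma>2 \<and> hooked \<tau> h \<gamma>1 \<gamma>2"

definition tangent_at_endpoints ::
    "real \<Rightarrow> (real \<Rightarrow> real^3) \<Rightarrow> (real \<Rightarrow> real^3) \<Rightarrow> (real^3 \<Rightarrow> real^3) \<Rightarrow> bool" where
  "tangent_at_endpoints \<tau> \<gamma>1 \<gamma>2 \<xi> \<longleftrightarrow>
     normal1 \<tau> (-1) \<bullet> \<xi> (pathstart \<gamma>1) = 0 \<and> normal1 \<tau> 1 \<bullet> \<xi> (pathfinish \<gamma>1) = 0 \<and>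
     normal2 \<tau> (-1) \<bullet> \<xi> (pathstart \<gamma>2) = 0 \<and> normal2 \<tau> 1 \<bullet> \<xi> (pathfinish \<gamma>2) = 0"

definition clasp_critical :: "real \<Rightarrow> real \<Rightarrow> real \<Rightarrow> (real \<Rightarrow> real^3) \<Rightarrow> (real \<Rightarrow> real^3) \<Rightarrow> bool" where
  "clasp_critical \<tau> \<sigma> h \<gamma>1 \<gamma>2 \<longleftrightarrow>
     clasp_link \<tau> \<sigma> h \<gamma>1 \<gamma>2 \<and> thickness \<sigma> \<gamma>1 \<gamma>2 = 1 \<and>
     (\<forall>\<xi>. C2_map \<xi> \<longrightarrow> tangent_at_endpoints \<tau> \<gamma>1 \<gamma>2 \<xi> \<longrightarrow>
        length_variation \<xi> \<gamma>1 + length_variation \<xi> \<gamma>2 < 0 \<longrightarrow>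
        (\<exists>d<0. has_thickness_variation \<sigma> \<gamma>1 \<gamma>2 \<xi> d))"

section \<open>The symmetry group\<close>

text \<open>The generators have finite order, so closing under composition already gives the group.\<close>

inductive_set group_2star2 :: "(real^3 \<Rightarrow> real^3) set" where
  one: "id \<in> group_2star2"
| refl_x: "g \<in> group_2star2 \<Longrightarrow> (\<lambda>p. vector [- p$1, p$2, p$3]) \<circ> g \<in> group_2star2"
| refl_y: "g \<in> group_2star2 \<Longrightarrow> (\<lambda>p. vector [p$1, - p$2, p$3]) \<circ> g \<in> group_2star2"
| rotorefl: "g \<in> group_2star2 \<Longrightarrow> (\<lambda>p. vector [- p$2, p$1, - p$3]) \<circ> g \<in> group_2star2"

definition symmetric_2star2 :: "(real^3) set \<Rightarrow> bool" where
  "symmetric_2star2 S \<longleftrightarrow> (\<forall>g\<in>group_2star2. g ` S = S)"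

section \<open>The explicit curve\<close>

definition clasp_x :: "real \<Rightarrow> real \<Rightarrow> real" where
  "clasp_x \<tau> u = u * sqrt (1 - (\<tau> - \<bar>u\<bar>)\<^sup>2) / sqrt (1 - u\<^sup>2 * (\<tau> - \<bar>u\<bar>)\<^sup>2)"

definition clasp_kappa :: "real \<Rightarrow> real \<Rightarrow> real" where
  "clasp_kappa \<tau> u =
     sqrt ((1 - u\<^sup>2 * (\<tau> - \<bar>u\<bar>)\<^sup>2) ^ 3 * (1 - (\<tau> - \<bar>u\<bar>)\<^sup>2)) /
     (1 - (\<tau> - \<bar>u\<bar>)\<^sup>2 + (\<tau> - \<bar>u\<bar>) * \<bar>u\<bar> * (1 - u\<^sup>2))"

text \<open>The only \<open>0/0\<close> in \<open>clasp_kappa\<close> is at \<open>\<tau> = 1\<close>, \<open>u = 0\<close>, where \<open>1 / clasp_kappa 1 0\<close> evaluates to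
  \<open>0\<close>, its limit. The pole of \<open>v / sqrt (1 - v\<^sup>2)\<close> for \<open>\<tau> = 1\<close> is an integrable singularity at the
  ends.\<close>

definition clasp_rise :: "real \<Rightarrow> real \<Rightarrow> real" where
  "clasp_rise \<tau> u = (LBINT v=0..ereal u. v / sqrt (1 - v\<^sup>2) * (1 / clasp_kappa \<tau> v))"

text \<open>The constant of integration is determined by \<open>clasp_z \<tau> 0 + clasp_z \<tau> \<tau> = - sqrt (1 - \<tau>\<^sup>2)\<close>.\<close>

definition clasp_z :: "real \<Rightarrow> real \<Rightarrow> real" where
  "clasp_z \<tau> u = clasp_rise \<tau> u - (clasp_rise \<tau> \<tau> + sqrt (1 - \<tau>\<^sup>2)) / 2"

lemma clasp_z_normalization: "clasp_z \<tau> 0 + clasp_z \<tau> \<tau> = - sqrt (1 - \<tau>\<^sup>2)"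
  by (simp add: clasp_z_def clasp_rise_def zero_ereal_def[symmetric])

definition clasp_point :: "real \<Rightarrow> real \<Rightarrow> real^3" where
  "clasp_point \<tau> u = vector [clasp_x \<tau> u, 0, clasp_z \<tau> u]"

definition clasp_curve :: "real \<Rightarrow> (real^3) set" where
  "clasp_curve \<tau> = clasp_point \<tau> ` {-\<tau>..\<tau>}"

text \<open>The tangent direction at parameter \<open>u\<close> is \<open>(sqrt (1 - u\<^sup>2), 0, u)\<close>, so the outward tangents at
  \<open>u = \<tau>\<close> and \<open>u = -\<tau>\<close> are the unit normals of the two planes: the tangent ray from \<open>p\<close> meets its
  plane at \<open>p + (h - n \<bullet> p) *\<^sub>R n\<close>.\<close>

definition tangent_segment :: "real \<Rightarrow> real \<Rightarrow> real \<Rightarrow> (real^3) set" where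
  "tangent_segment \<tau> h s = (let p = clasp_point \<tau> (s * \<tau>); n = normal1 \<tau> s
     in closed_segment p (p + (h - n \<bullet> p) *\<^sub>R n))"

definition extended_clasp_curve :: "real \<Rightarrow> real \<Rightarrow> (real^3) set" where
  "extended_clasp_curve \<tau> h =
     clasp_curve \<tau> \<union> tangent_segment \<tau> h 1 \<union> tangent_segment \<tau> h (-1)"

definition space_isometry :: "(real^3 \<Rightarrow> real^3) \<Rightarrow> bool" where
  "space_isometry f \<longleftrightarrow> (\<forall>p q. dist (f p) (f q) = dist p q)"

end

theory Submission
  imports Defs
begin

text \<open>Near the clasp the thickness is the minimum of two quantities: the distance between the two
  components, and \<open>1 / \<sigma>\<close> times the least radius of curvature. For \<open>\<sigma> \<ge> 1/2\<close> this holds because, as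
  long as the curvature stays below \<open>1 / r\<close>, two nearest points at distance \<open>r\<close> on one component are
  separated by an arc longer than \<open>\<pi> r\<close>, and on (perturbations of) the clasp such arcs have chords
  longer than \<open>1\<close>. Both quantities are minima over compact sets of functions that are differentiable
  in time, so Danskin's theorem gives their right derivatives, which depend on \<open>\<xi>\<close> only.

  The points with tangent \<open>sin = u\<close> on one component and \<open>sin = \<tau> - u\<close> on the other one realize the
  distance \<open>1\<close>; for a fixed point of one component the derivative of the squared distance along the
  other one changes sign exactly at such a partner, whence the distance is never less than \<open>1\<close>. The
  curvature force of the two arcs is balanced by these struts with density \<open>du / (2 Z)\<close>, where \<open>Z\<close>
  is the vertical extent of a strut. Hence the first variation of length is a positive combination
  of first variations of strut lengths, and if it is negative, some strut shrinks.\<close>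

section \<open>Uniform time derivatives\<close>

text \<open>Two degeneracies shape the proof. At \<tau> = 1 the radius of curvature vanishes at the
  tip, so the curvature cannot be used to build the curve: arclength is taken as a function of the
  tangent angle and inverted, and the tangent is integrated. The first variation of length is
  likewise integrated by parts in the angle, where curvature does not appear. Accelerations are used
  only for \<sigma> > 0, which forces \<tau> < 1. At the junctions with the straight ends the
  curvature jumps, so an arc carries finitely many pieces with one-sided accelerations. The bound on
  \<sigma> is the radius of curvature at the tip, where it is least. For \<sigma> at least 1/2 it
  also keeps the end angle at most pi/3, which makes chords of arcs of length near pi times that
  radius exceed 1. The curvature constraint contributes no force of its own: its derivative has to
  exist, but it enters through a minimum and cannot raise a negative strut variation. Linking is
  proved without isotopies, by closing both components to curves star-shaped about the
  origin.\<close>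

lemma uniform_limit_difference_quotient:
  fixes F :: "real \<Rightarrow> 'a::metric_space \<Rightarrow> 'b::banach"
  assumes "compact K" "e > 0"
    and V: "continuous_on ({-e<..<e} \<times> K) (\<lambda>(t, x). V t x)"
    and D: "\<And>t x. t \<in> {-e<..<e} \<Longrightarrow> x \<in> K \<Longrightarrow> ((\<lambda>s. F s x) has_vector_derivative V t x) (at t)"
  shows "uniform_limit K (\<lambda>t x. (F t x - F 0 x) /\<^sub>R t) (V 0) (at_right 0)"
proof (rule uniform_limitI)
  fix \<epsilon> :: real assume "\<epsilon> > 0"
  have "compact ({-e/2..e/2} \<times> K)" using assms by (simp add: compact_Times)
  moreover have "continuous_on ({-e/2..e/2} \<times> K) (\<lambda>(t, x). V t x)"
    using V by (rule continuous_on_subset) (use \<open>e > 0\<close> in auto)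
  ultimately have "uniformly_continuous_on ({-e/2..e/2} \<times> K) (\<lambda>(t, x). V t x)"
    by (rule compact_uniformly_continuous[rotated])
  then obtain d where d: "d > 0"
    "\<And>p q. p \<in> {-e/2..e/2} \<times> K \<Longrightarrow> q \<in> {-e/2..e/2} \<times> K \<Longrightarrow> dist q p < d \<Longrightarrow>
      dist ((\<lambda>(t, x). V t x) q) ((\<lambda>(t, x). V t x) p) < \<epsilon>/2"
    unfolding uniformly_continuous_on_def using \<open>\<epsilon> > 0\<close> by (metis half_gt_zero)
  have est: "dist ((F t x - F 0 x) /\<^sub>R t) (V 0 x) < \<epsilon>" if t: "t > 0" "t < min d (e/2)" and x: "x \<in> K" for t x
  proof -
    \<comment> \<open>Mean value inequality on the time segment; uniform continuity of
      \<open>V\<close> on the compact slab bounds its deviation from \<open>V 0 x\<close>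
      independently of \<open>x\<close>.\<close>
    have "norm (F t x - F 0 x - (t - 0) *\<^sub>R V 0 x) \<le> norm (t - 0) * (\<epsilon>/2)"
    proof (rule vector_differentiable_bound_linearization[where S="{0..t}"])
      fix s assume s: "s \<in> {0..t}"
      show "((\<lambda>s. F s x) has_vector_derivative V s x) (at s within {0..t})"
        using D[of s x] s t x by (auto intro: has_vector_derivative_at_within)
      have "dist (s, x) (0::real, x) < d" using s t by (simp add: dist_Pair_Pair)
      then show "norm (V s x - V 0 x) \<le> \<epsilon>/2"
        using d(2)[of "(0,x)" "(s,x)"] s t x \<open>e > 0\<close> by (auto simp: dist_norm)
    qed (use t in \<open>auto simp: closed_segment_eq_real_ivl\<close>)
    moreover have "F t x - F 0 x - (t - 0) *\<^sub>R V 0 x = t *\<^sub>R ((F t x - F 0 x) /\<^sub>R t - V 0 x)"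
      using t by (simp add: algebra_simps)
    ultimately have "t * norm ((F t x - F 0 x) /\<^sub>R t - V 0 x) \<le> t * (\<epsilon>/2)" using t by simp
    then show ?thesis using t \<open>\<epsilon> > 0\<close> by (simp add: dist_norm)
  qed
  have "eventually (\<lambda>t. t > 0 \<and> t < min d (e/2)) (at_right (0::real))"
    using d(1) \<open>e > 0\<close> by (auto simp: eventually_at_right_field intro: exI[of _ "min d (e/2)"])
  then show "\<forall>\<^sub>F t in at_right 0. \<forall>x\<in>K. dist ((F t x - F 0 x) /\<^sub>R t) (V 0 x) < \<epsilon>"
    by eventually_elim (use est in auto)
qed

text \<open>\<open>F t x\<close> is \<open>F 0 x\<close> plus \<open>t\<close> times the mean of
  \<open>V\<close> over the times between 0 and \<open>t\<close>; rescaled to the fixed interval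
  from 0 to 1, this mean is a continuous parameter integral. The lemma recovers joint continuity of
  a family and of its spatial derivatives, of which \<open>C1_family_C2_diffeos\<close> postulates
  only the time derivatives to be continuous.\<close>

lemma jointly_continuous_from_time_derivative:
  fixes F :: "real \<Rightarrow> 'a::metric_space \<Rightarrow> 'b::banach"
  assumes V: "continuous_on ({-e<..<e} \<times> K) (\<lambda>(t, x). V t x)"
    and D: "\<And>t x. t \<in> {-e<..<e} \<Longrightarrow> x \<in> K \<Longrightarrow> ((\<lambda>s. F s x) has_vector_derivative V t x) (at t)"
    and F0: "continuous_on K (F 0)"
  shows "continuous_on ({-e<..<e} \<times> K) (\<lambda>(t, x). F t x)"
proof -
  have mem: "u * t \<in> {-e<..<e}" if "u \<in> {0..1}" "t \<in> {-e<..<e}" for u t :: real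
  proof -
    have "\<bar>u * t\<bar> \<le> 1 * \<bar>t\<bar>" unfolding abs_mult by (rule mult_right_mono) (use that in auto)
    moreover have "\<bar>t\<bar> < e" using that by auto
    ultimately have "\<bar>u * t\<bar> < e" by linarith
    then show ?thesis by (simp add: abs_less_iff)
  qed
  have eq: "F t x = F 0 x + t *\<^sub>R integral (cbox 0 1) (\<lambda>u. V (u * t) x)" if "t \<in> {-e<..<e}" "x \<in> K" for t x
  proof -
    have "((\<lambda>u. t *\<^sub>R V (u * t) x) has_integral (F (1 * t) x - F (0 * t) x)) {0..1}"
    proof (rule fundamental_theorem_of_calculus)
      fix u :: real assume u: "u \<in> {0..1}"
      have "((\<lambda>s. F s x) has_vector_derivative V (u * t) x) (at (u * t))"
        using D mem[OF u] that by blast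
      moreover have "((\<lambda>u. u * t) has_vector_derivative t) (at u within {0..1})"
        by (auto intro!: derivative_eq_intros)
      ultimately have "((\<lambda>s. F s x) \<circ> (\<lambda>u. u * t) has_vector_derivative t *\<^sub>R V (u * t) x) (at u within {0..1})"
        by (metis vector_diff_chain_within has_vector_derivative_at_within)
      then show "((\<lambda>u. F (u * t) x) has_vector_derivative t *\<^sub>R V (u * t) x) (at u within {0..1})"
        by (simp add: o_def)
    qed simp
    from integral_unique[OF this] have "integral {0..1} (\<lambda>u. t *\<^sub>R V (u * t) x) = F t x - F 0 x"
      by (simp del: integral_cmul)
    then show ?thesis by simp
  qed
  have "continuous_on (({-e<..<e} \<times> K) \<times> cbox 0 1) (\<lambda>(p, u). V (u * fst p) (snd p))"
  proof -
    have "continuous_on (({-e<..<e} \<times> K) \<times> cbox 0 1) (\<lambda>q. (\<lambda>(t, x). V t x) (snd q * fst (fst q), snd (fst q)))"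
      by (rule continuous_on_compose2[OF V]) (auto intro!: continuous_intros mem)
    then show ?thesis by (simp add: case_prod_unfold)
  qed
  then have c: "continuous_on ({-e<..<e} \<times> K) (\<lambda>p. integral (cbox 0 1) (\<lambda>u. V (u * fst p) (snd p)))"
    by (rule integral_continuous_on_param)
  have "continuous_on ({-e<..<e} \<times> K)
      (\<lambda>p. F 0 (snd p) + fst p *\<^sub>R integral (cbox 0 1) (\<lambda>u. V (u * fst p) (snd p)))"
    by (intro continuous_on_add continuous_on_scaleR continuous_on_fst continuous_on_id c
        continuous_on_compose2[OF F0 continuous_on_snd[OF continuous_on_id]]) auto
  then show ?thesis
    by (rule continuous_on_eq) (clarsimp simp only: case_prod_unfold fst_conv snd_conv mem_Times_iff eq[symmetric])
qed

section \<open>Danskin's theorem\<close>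

lemma INF_eq_attained:
  fixes f :: "'a \<Rightarrow> real"
  assumes "x \<in> K" "\<And>y. y \<in> K \<Longrightarrow> f x \<le> f y"
  shows "(INF y\<in>K. f y) = f x"
  using assms by (intro cInf_eq_minimum) auto

text \<open>Upper bound: follow the minimizer at time 0 whose speed is least. Lower bound: a point
  that is faster downwards than \<open>d - \<eta>\<close> is no minimizer at time 0, and by
  compactness all such points start a fixed amount \<open>\<delta>\<close> above the minimum, which
  they cannot make up in a short time.\<close>

theorem danskin:
  fixes f :: "real \<Rightarrow> 'a::metric_space \<Rightarrow> real"
  assumes "compact K" "K \<noteq> {}"
    and f0: "continuous_on K (f 0)" and g: "continuous_on K g"
    and lim: "uniform_limit K (\<lambda>t x. (f t x - f 0 x) /\<^sub>R t) g (at_right 0)"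
  shows "((\<lambda>t. INF x\<in>K. f t x) has_real_derivative
           (INF x\<in>{x\<in>K. f 0 x = (INF x\<in>K. f 0 x)}. g x)) (at_right 0)"
proof -
  define m where "m t = (INF x\<in>K. f t x)" for t
  define A where "A = {x\<in>K. f 0 x = m 0}"
  define d where "d = (INF x\<in>A. g x)"
  obtain x0 where x0: "x0 \<in> K" "\<And>x. x \<in> K \<Longrightarrow> f 0 x0 \<le> f 0 x"
    using continuous_attains_inf[OF assms(1,2) f0] by blast
  have m0: "m 0 = f 0 x0"
    unfolding m_def by (rule INF_eq_attained) (use x0 in auto)
  have "compact A"
  proof -
    have "A = K \<inter> f 0 -` {m 0}" by (auto simp: A_def)
    then show ?thesis
      using continuous_closedin_preimage[OF f0, of "{m 0}"] assms(1)
      by (auto intro: closedin_compact)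
  qed
  moreover have "A \<noteq> {}" using x0 m0 by (auto simp: A_def)
  ultimately obtain y where y: "y \<in> A" "\<And>x. x \<in> A \<Longrightarrow> g y \<le> g x"
    using continuous_attains_inf[of A g] continuous_on_subset[OF g, of A] by (auto simp: A_def)
  have d: "d = g y" unfolding d_def by (rule INF_eq_attained) (use y in auto)
  obtain G where G: "\<And>x. x \<in> K \<Longrightarrow> \<bar>g x\<bar> \<le> G"
    using compact_imp_bounded[OF compact_continuous_image[OF g assms(1)]]
    by (auto simp: bounded_iff)
  have "((\<lambda>t. (m t - m 0) / (t - 0)) \<longlongrightarrow> d) (at_right 0)"
  proof (rule tendstoI)
    fix \<epsilon> :: real assume "\<epsilon> > 0"
    define \<eta> where "\<eta> = \<epsilon>/4"
    have \<eta>: "\<eta> > 0" using \<open>\<epsilon> > 0\<close> by (simp add: \<eta>_def)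
    \<comment> \<open>The points whose speed undercuts \<open>d\<close> noticeably; this compact set
      misses \<open>A\<close>.\<close>
    define C where "C = K \<inter> g -` {..d - \<eta>}"
    have "compact C"
      using continuous_closedin_preimage[OF g, of "{..d - \<eta>}"] assms(1)
      by (auto simp: C_def intro: closedin_compact)
    have "\<exists>\<delta>>0. \<forall>x\<in>C. f 0 x \<ge> m 0 + \<delta>"
    proof (cases "C = {}")
      case False
      have "continuous_on C (f 0)" using f0 by (rule continuous_on_subset) (auto simp: C_def)
      then obtain c where c: "c \<in> C" "\<And>x. x \<in> C \<Longrightarrow> f 0 c \<le> f 0 x"
        using continuous_attains_inf[OF \<open>compact C\<close> False] by blast
      have "c \<notin> A" using c(1) y(2)[of c] d \<eta> by (auto simp: C_def)
      then have "f 0 c > m 0" using c(1) x0 m0 by (force simp: C_def A_def)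
      then show ?thesis using c(2) by (intro exI[of _ "f 0 c - m 0"]) auto
    qed (auto intro: exI[of _ 1])
    then obtain \<delta> where \<delta>: "\<delta> > 0" "\<And>x. x \<in> C \<Longrightarrow> f 0 x \<ge> m 0 + \<delta>" by blast
    \<comment> \<open>Before \<open>t0\<close> no point of \<open>C\<close>, moving with speed
      bounded by \<open>G\<close>, can descend by \<open>\<delta>\<close>.\<close>
    define t0 where "t0 = \<delta> / (\<bar>d\<bar> + \<bar>G\<bar> + 1 + \<eta>)"
    have t0: "t0 > 0" using \<delta> \<eta> by (simp add: t0_def)
    have "eventually (\<lambda>t. t > 0 \<and> t < t0) (at_right (0::real))"
      using t0 by (auto simp: eventually_at_right_field intro: exI[of _ t0])
    moreover have "\<forall>\<^sub>F t in at_right 0. \<forall>x\<in>K. dist ((f t x - f 0 x) /\<^sub>R t) (g x) < \<eta>"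
      using lim \<eta> by (rule uniform_limitD)
    ultimately show "\<forall>\<^sub>F t in at_right 0. dist ((m t - m 0) / (t - 0)) d < \<epsilon>"
    proof eventually_elim
      case (elim t)
      have bnd: "f 0 x + t * (g x - \<eta>) \<le> f t x" "f t x \<le> f 0 x + t * (g x + \<eta>)" if "x \<in> K" for x
      proof -
        have "\<bar>(f t x - f 0 x) / t - g x\<bar> < \<eta>" using elim that by (auto simp: dist_real_def divide_inverse mult.commute)
        then have "(f t x - f 0 x) / t < g x + \<eta>" "(f t x - f 0 x) / t > g x - \<eta>" by linarith+
        then show "f 0 x + t * (g x - \<eta>) \<le> f t x" "f t x \<le> f 0 x + t * (g x + \<eta>)"
          using elim by (auto simp: field_simps)
      qed
      have low: "m 0 + t * (d - 2 * \<eta>) \<le> f t x" if x: "x \<in> K" for x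
      proof (cases "x \<in> C")
        case True
        have "t * (\<bar>d\<bar> + \<bar>G\<bar> + 1 + \<eta>) \<le> \<delta>"
          using elim \<eta> by (auto simp: t0_def field_simps)
        then have "t * (d - 2 * \<eta>) \<le> \<delta> + t * (g x - \<eta>)"
        proof -
          have "t * (d - 2 * \<eta> - (g x - \<eta>)) \<le> t * (\<bar>d\<bar> + \<bar>G\<bar> + 1 + \<eta>)"
            using G[OF x] elim \<eta> by (intro mult_left_mono) auto
          with \<open>t * (\<bar>d\<bar> + \<bar>G\<bar> + 1 + \<eta>) \<le> \<delta>\<close> show ?thesis by (simp add: algebra_simps)
        qed
        then show ?thesis using bnd(1)[OF x] \<delta>(2)[OF True] by linarith
      next
        case False
        then have "d - \<eta> \<le> g x" using x by (auto simp: C_def)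
        then have "t * (d - 2 * \<eta>) \<le> t * (g x - \<eta>)" using elim by (intro mult_left_mono) auto
        then show ?thesis using bnd(1)[OF x] x0(2)[OF x] m0 by linarith
      qed
      have "m 0 + t * (d - 2 * \<eta>) \<le> m t"
        unfolding m_def[of t] using low assms(2) by (intro cINF_greatest) auto
      moreover have "m t \<le> f t y"
        unfolding m_def[of t] using low y by (intro cINF_lower bdd_belowI2[of _ "m 0 + t * (d - 2 * \<eta>)"]) (auto simp: A_def)
      then have "m t \<le> m 0 + t * (d + \<eta>)"
        using bnd(2)[of y] y(1) d by (auto simp: A_def)
      ultimately have "d - 2 * \<eta> \<le> (m t - m 0) / t" "(m t - m 0) / t \<le> d + \<eta>"
        using elim by (auto simp: field_simps)
      then show ?case using \<eta> by (auto simp: dist_real_def \<eta>_def)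
    qed
  qed
  then show ?thesis
    by (simp add: has_field_derivative_iff m_def A_def d_def)
qed

text \<open>With a common value at \<open>a\<close>, and a positive increment, taking the minimum
  commutes with forming difference quotients. From the left it would turn into a maximum.\<close>

lemma has_real_derivative_min_right:
  fixes f g :: "real \<Rightarrow> real"
  assumes f: "(f has_real_derivative f') (at_right a)" and g: "(g has_real_derivative g') (at_right a)"
    and "f a = g a"
  shows "((\<lambda>t. min (f t) (g t)) has_real_derivative min f' g') (at_right a)"
proof -
  have F: "((\<lambda>t. (f t - f a) / (t - a)) \<longlongrightarrow> f') (at_right a)"
    using f unfolding has_field_derivative_iff .
  have G: "((\<lambda>t. (g t - g a) / (t - a)) \<longlongrightarrow> g') (at_right a)"
    using g unfolding has_field_derivative_iff .
  have "\<forall>\<^sub>F t in at_right a. min ((f t - f a) / (t - a)) ((g t - g a) / (t - a)) =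
      (min (f t) (g t) - min (f a) (g a)) / (t - a)"
    using eventually_at_right_less[of a]
  proof eventually_elim
    case (elim t)
    have "min (p / (t - a)) (q / (t - a)) = min p q / (t - a)" for p q :: real
      using elim by (cases "p \<le> q") (auto simp: min_def divide_le_cancel)
    then show ?case unfolding \<open>f a = g a\<close> by (simp add: min_diff_distrib_left)
  qed
  then show ?thesis
    unfolding has_field_derivative_iff by (rule Lim_transform_eventually[OF tendsto_min[OF F G]])
qed

section \<open>Families of diffeomorphisms\<close>

lemma uniform_limit_jointly_continuous:
  fixes G :: "real \<Rightarrow> 'a::metric_space \<Rightarrow> 'b::metric_space"
  assumes "compact K" "e > 0" and G: "continuous_on ({-e<..<e} \<times> K) (\<lambda>(t, x). G t x)"
  shows "uniform_limit K G (G 0) (at_right 0)"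
proof (rule uniform_limitI)
  fix \<epsilon> :: real assume "\<epsilon> > 0"
  then have "\<epsilon>/2 > 0" by simp
  moreover have "0 \<in> {-e<..<e}" using \<open>e > 0\<close> by simp
  ultimately obtain X where X: "0 \<in> X" "open X"
    "\<forall>t\<in>X \<inter> {-e<..<e}. \<forall>x\<in>K. dist ((\<lambda>(t, x). G t x) (t, x)) ((\<lambda>(t, x). G t x) (0, x)) \<le> \<epsilon>/2"
    using continuous_on_prod_compactE[OF G \<open>compact K\<close>] by metis
  have "open (X \<inter> {-e<..<e})" "0 \<in> X \<inter> {-e<..<e}" using X \<open>e > 0\<close> by auto
  then have "\<forall>\<^sub>F t in at_right 0. t \<in> X \<inter> {-e<..<e}" unfolding eventually_at_topological by blast
  then show "\<forall>\<^sub>F t in at_right 0. \<forall>x\<in>K. dist (G t x) (G 0 x) < \<epsilon>"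
  proof eventually_elim
    case (elim t)
    show ?case
    proof
      fix x assume "x \<in> K"
      then have "dist (G t x) (G 0 x) \<le> \<epsilon>/2" using X(3) elim by auto
      then show "dist (G t x) (G 0 x) < \<epsilon>" using \<open>\<epsilon> > 0\<close> by simp
    qed
  qed
qed

lemma has_vector_derivative_imp_quotient_tendsto:
  fixes f :: "real \<Rightarrow> 'a::real_normed_vector"
  assumes "(f has_vector_derivative f') (at 0)"
  shows "((\<lambda>t. (f t - f 0) /\<^sub>R t) \<longlongrightarrow> f') (at 0)"
proof -
  have "((\<lambda>h. norm (f (0 + h) - f 0 - h *\<^sub>R f') / norm h) \<longlongrightarrow> 0) (at 0)"
    using assms unfolding has_vector_derivative_def has_derivative_at by blast
  moreover have "\<forall>\<^sub>F h in at 0. norm (f (0 + h) - f 0 - h *\<^sub>R f') / norm h = norm ((f h - f 0) /\<^sub>R h - f')"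
    using eventually_neq_at_within[of 0 0]
  proof eventually_elim
    case (elim h)
    then have "f (0 + h) - f 0 - h *\<^sub>R f' = h *\<^sub>R ((f h - f 0) /\<^sub>R h - f')"
      by (simp add: algebra_simps)
    then show ?case using elim by (simp only: norm_scaleR) simp
  qed
  ultimately have "((\<lambda>h. norm ((f h - f 0) /\<^sub>R h - f')) \<longlongrightarrow> 0) (at 0)"
    by (rule Lim_transform_eventually)
  then show ?thesis by (simp only: tendsto_norm_zero_iff LIM_zero_iff)
qed

text \<open>The difference quotients in time at 0 converge pointwise to \<open>V 0\<close>, and
  their spatial derivatives converge uniformly near \<open>x\<close> to \<open>W 0\<close>; hence
  the limit may be differentiated. This identifies the mixed derivatives of a flow with derivatives
  of its initial velocity, so that first variations depend on that velocity alone.\<close>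

lemma time_space_derivatives_commute:
  fixes F :: "real \<Rightarrow> 'a::euclidean_space \<Rightarrow> 'b::banach"
  assumes "e > 0"
    and D: "\<And>t x. t \<in> {-e<..<e} \<Longrightarrow> (F t has_derivative blinfun_apply (D t x)) (at x)"
    and V: "\<And>t x. t \<in> {-e<..<e} \<Longrightarrow> ((\<lambda>s. F s x) has_vector_derivative V t x) (at t)"
    and W: "\<And>t x. t \<in> {-e<..<e} \<Longrightarrow> ((\<lambda>s. D s x) has_vector_derivative W t x) (at t)"
    and cW: "continuous_on ({-e<..<e} \<times> UNIV) (\<lambda>(t, x). W t x)"
  shows "(V 0 has_derivative blinfun_apply (W 0 x)) (at x)"
proof -
  define S where "S = cball x 1"
  \<comment> \<open>The summand 2 keeps the whole sequence strictly below \<open>e\<close>,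
    including its term at 0.\<close>
  define \<tau> where "\<tau> n = e / (real n + 2)" for n
  have \<tau>: "\<tau> n \<in> {-e<..<e}" "\<tau> n > 0" for n
  proof -
    have "1 * e < (real n + 2) * e" using \<open>e > 0\<close> by (intro mult_strict_right_mono) auto
    then have "\<tau> n < e" by (simp add: \<tau>_def field_simps)
    moreover show "\<tau> n > 0" using \<open>e > 0\<close> by (simp add: \<tau>_def)
    ultimately show "\<tau> n \<in> {-e<..<e}" using \<open>e > 0\<close> by simp
  qed
  have zero: "0 \<in> {-e<..<e}" using \<open>e > 0\<close> by simp
  have "(\<lambda>n. e * inverse (real (n + 2))) \<longlonglongrightarrow> e * 0"
    by (intro tendsto_mult_left LIMSEQ_ignore_initial_segment[OF lim_inverse_n])
  then have "\<tau> \<longlonglongrightarrow> 0" by (simp add: \<tau>_def[abs_def] divide_inverse add.commute)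
  then have lim: "filterlim \<tau> (at_right 0) sequentially"
    using \<tau>(2) less_imp_neq[OF \<tau>(2)] by (auto simp: filterlim_at intro!: always_eventually)
  have "filterlim \<tau> (at 0) sequentially"
    using lim by (rule filterlim_mono) (auto simp: at_le)
  then have quot: "(\<lambda>n. (F (\<tau> n) y - F 0 y) /\<^sub>R \<tau> n) \<longlonglongrightarrow> V 0 y" for y
    by (rule filterlim_compose[OF has_vector_derivative_imp_quotient_tendsto[OF V[OF zero]]])
  have "continuous_on ({-e<..<e} \<times> S) (\<lambda>(t, x). W t x)"
    by (rule continuous_on_subset[OF cW]) auto
  then have ul: "uniform_limit S (\<lambda>t x. (D t x - D 0 x) /\<^sub>R t) (W 0) (at_right 0)"
    by (intro uniform_limit_difference_quotient[OF _ \<open>e > 0\<close>] W) (auto simp: S_def)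
  have "\<exists>g. \<forall>y\<in>S. (\<lambda>n. (F (\<tau> n) y - F 0 y) /\<^sub>R \<tau> n) \<longlonglongrightarrow> g y \<and>
      (g has_derivative blinfun_apply (W 0 y)) (at y within S)"
  proof (rule has_derivative_sequence)
    show "convex S" "x \<in> S" by (auto simp: S_def)
    fix n y assume "y \<in> S"
    have 1: "((\<lambda>y. (F (\<tau> n) y - F 0 y) /\<^sub>R \<tau> n) has_derivative
        (\<lambda>h. (blinfun_apply (D (\<tau> n) y) h - blinfun_apply (D 0 y) h) /\<^sub>R \<tau> n)) (at y)"
      by (intro has_derivative_scaleR_right has_derivative_diff D zero \<tau>)
    have 2: "(\<lambda>h. (blinfun_apply (D (\<tau> n) y) h - blinfun_apply (D 0 y) h) /\<^sub>R \<tau> n) =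
        blinfun_apply ((D (\<tau> n) y - D 0 y) /\<^sub>R \<tau> n)"
      by (auto simp: blinfun.diff_left blinfun.scaleR_left)
    show "((\<lambda>y. (F (\<tau> n) y - F 0 y) /\<^sub>R \<tau> n) has_derivative
        blinfun_apply ((D (\<tau> n) y - D 0 y) /\<^sub>R \<tau> n)) (at y within S)"
      using has_derivative_at_withinI[OF 1] unfolding 2 .
  next
    fix \<epsilon> :: real assume "\<epsilon> > 0"
    then have "\<forall>\<^sub>F t in at_right 0. \<forall>y\<in>S. dist ((D t y - D 0 y) /\<^sub>R t) (W 0 y) < \<epsilon>"
      by (rule uniform_limitD[OF ul])
    then have "\<forall>\<^sub>F n in sequentially. \<forall>y\<in>S. dist ((D (\<tau> n) y - D 0 y) /\<^sub>R \<tau> n) (W 0 y) < \<epsilon>"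
      using lim by (rule eventually_compose_filterlim)
    then show "\<forall>\<^sub>F n in sequentially. \<forall>y\<in>S. \<forall>h. norm (blinfun_apply ((D (\<tau> n) y - D 0 y) /\<^sub>R \<tau> n) h - blinfun_apply (W 0 y) h)
        \<le> \<epsilon> * norm h"
    proof eventually_elim
      case (elim n)
      show ?case
      proof (intro ballI allI)
        fix y h assume "y \<in> S"
        have "norm (blinfun_apply ((D (\<tau> n) y - D 0 y) /\<^sub>R \<tau> n - W 0 y) h)
            \<le> norm ((D (\<tau> n) y - D 0 y) /\<^sub>R \<tau> n - W 0 y) * norm h"
          by (rule norm_blinfun)
        also have "\<dots> \<le> \<epsilon> * norm h"
          using elim \<open>y \<in> S\<close> by (intro mult_right_mono) (auto simp: dist_norm intro: less_imp_le)
        finally show "norm (blinfun_apply ((D (\<tau> n) y - D 0 y) /\<^sub>R \<tau> n) h - blinfun_apply (W 0 y) h)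
            \<le> \<epsilon> * norm h" by (simp add: blinfun.diff_left)
      qed
    qed
  next
    show "(\<lambda>n. (F (\<tau> n) x - F 0 x) /\<^sub>R \<tau> n) \<longlonglongrightarrow> V 0 x"
      by (rule quot)
  qed
  then obtain g where g: "\<And>y. y \<in> S \<Longrightarrow> (\<lambda>n. (F (\<tau> n) y - F 0 y) /\<^sub>R \<tau> n) \<longlonglongrightarrow> g y"
    "\<And>y. y \<in> S \<Longrightarrow> (g has_derivative blinfun_apply (W 0 y)) (at y within S)" by blast
  have "V 0 y = g y" if "y \<in> S" for y
    using quot g(1)[OF that] by (rule LIMSEQ_unique)
  then have "(V 0 has_derivative blinfun_apply (W 0 x)) (at x within S)"
    by (intro has_derivative_transform[OF _ _ g(2)]) (auto simp: S_def)
  moreover have "at x within S = at x"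
    by (rule at_within_interior) (simp add: S_def)
  ultimately show ?thesis by simp
qed

text \<open>Fixes the witnesses that \<open>C1_family_C2_diffeos\<close> hides behind existential
  quantifiers.\<close>

locale C2_flow =
  fixes \<phi> :: "real \<Rightarrow> real^3 \<Rightarrow> real^3" and \<xi> :: "real^3 \<Rightarrow> real^3" and e :: real
    and D1 V1 :: "real \<Rightarrow> real^3 \<Rightarrow> ((real^3) \<Rightarrow>\<^sub>L (real^3))"
    and D2 V2 :: "real \<Rightarrow> real^3 \<Rightarrow> ((real^3) \<Rightarrow>\<^sub>L ((real^3) \<Rightarrow>\<^sub>L (real^3)))"
    and V0 :: "real \<Rightarrow> real^3 \<Rightarrow> real^3"
  assumes e: "e > 0"
    and D1: "\<And>t x. t \<in> {-e<..<e} \<Longrightarrow> (\<phi> t has_derivative blinfun_apply (D1 t x)) (at x)"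
    and D2: "\<And>t x. t \<in> {-e<..<e} \<Longrightarrow> (D1 t has_derivative blinfun_apply (D2 t x)) (at x)"
    and V0: "\<And>t x. t \<in> {-e<..<e} \<Longrightarrow> ((\<lambda>s. \<phi> s x) has_vector_derivative V0 t x) (at t)"
    and V1: "\<And>t x. t \<in> {-e<..<e} \<Longrightarrow> ((\<lambda>s. D1 s x) has_vector_derivative V1 t x) (at t)"
    and V2: "\<And>t x. t \<in> {-e<..<e} \<Longrightarrow> ((\<lambda>s. D2 s x) has_vector_derivative V2 t x) (at t)"
    and cV0: "continuous_on ({-e<..<e} \<times> UNIV) (\<lambda>(t, x). V0 t x)"
    and cV1: "continuous_on ({-e<..<e} \<times> UNIV) (\<lambda>(t, x). V1 t x)"
    and cV2: "continuous_on ({-e<..<e} \<times> UNIV) (\<lambda>(t, x). V2 t x)"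
    and \<phi>0: "\<phi> 0 = id" and V0_0: "V0 0 = \<xi>"
begin

lemma zero_mem: "0 \<in> {-e<..<e}"
  using e by simp

lemma D1_0: "D1 0 x = id_blinfun"
proof -
  have "blinfun_apply (D1 0 x) = id"
    using D1[OF zero_mem, of x] \<phi>0 by (intro has_derivative_unique[OF _ has_derivative_id]) simp
  then show ?thesis by (intro blinfun_eqI) simp
qed

lemma D2_0: "D2 0 x = 0"
proof -
  have "D1 0 = (\<lambda>x. id_blinfun)" using D1_0 by blast
  then have "blinfun_apply (D2 0 x) = (\<lambda>h. 0)"
    using D2[OF zero_mem, of x] has_derivative_const by (metis has_derivative_unique)
  then show ?thesis by (intro blinfun_eqI) simp
qed

lemma continuous_\<phi>: "continuous_on ({-e<..<e} \<times> UNIV) (\<lambda>(t, x). \<phi> t x)"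
  by (rule jointly_continuous_from_time_derivative[OF cV0]) (use V0 \<phi>0 in \<open>auto simp: id_def\<close>)

lemma continuous_D1: "continuous_on ({-e<..<e} \<times> UNIV) (\<lambda>(t, x). D1 t x)"
proof (rule jointly_continuous_from_time_derivative[OF cV1])
  have "D1 0 = (\<lambda>x. id_blinfun)" using D1_0 by blast
  then show "continuous_on UNIV (D1 0)" by simp
qed (use V1 in auto)

lemma continuous_D2: "continuous_on ({-e<..<e} \<times> UNIV) (\<lambda>(t, x). D2 t x)"
proof (rule jointly_continuous_from_time_derivative[OF cV2])
  have "D2 0 = (\<lambda>x. 0)" using D2_0 by blast
  then show "continuous_on UNIV (D2 0)" by simp
qed (use V2 in auto)

text \<open>Together with \<open>V2_0\<close> this replaces time derivatives of the flow by spatial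
  derivatives of \<open>\<xi>\<close>, so the answer is the same for all families with initial
  velocity \<open>\<xi>\<close>.\<close>

lemma V1_0:
  assumes "(\<xi> has_derivative blinfun_apply d) (at x)"
  shows "V1 0 x = d"
proof -
  have "(V0 0 has_derivative blinfun_apply (V1 0 x)) (at x)"
    by (rule time_space_derivatives_commute[OF e D1 V0 V1 cV1])
  then have "blinfun_apply (V1 0 x) = blinfun_apply d"
    using assms V0_0 has_derivative_unique by metis
  then show ?thesis by (intro blinfun_eqI) simp
qed

lemma V2_0:
  assumes "\<And>x. (\<xi> has_derivative blinfun_apply (d x)) (at x)"
    and "(d has_derivative blinfun_apply d2) (at x)"
  shows "V2 0 x = d2"
proof -
  have "V1 0 = d" using V1_0[OF assms(1)] by blast
  moreover have "(V1 0 has_derivative blinfun_apply (V2 0 x)) (at x)"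
    by (rule time_space_derivatives_commute[OF e D2 V1 V2 cV2])
  ultimately have "blinfun_apply (V2 0 x) = blinfun_apply d2"
    using assms(2) has_derivative_unique by metis
  then show ?thesis by (intro blinfun_eqI) simp
qed

lemma eventually_time: "\<forall>\<^sub>F t in at_right 0. t \<in> {-e<..<e}"
  unfolding eventually_at_topological using zero_mem by (intro exI[of _ "{-e<..<e}"]) auto

lemma D1_near_identity:
  assumes "compact K" "\<delta> > 0"
  shows "\<forall>\<^sub>F t in at_right 0. \<forall>x\<in>K. norm (D1 t x - id_blinfun) < \<delta>"
proof -
  have "uniform_limit K D1 (D1 0) (at_right 0)"
    by (rule uniform_limit_jointly_continuous[OF assms(1) e], rule continuous_on_subset[OF continuous_D1]) auto
  from uniform_limitD[OF this assms(2)] show ?thesis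
    by (simp add: dist_norm D1_0)
qed

text \<open>Mean value inequality for the displacement \<open>\<phi> t x - x\<close>, whose
  derivative is uniformly small on \<open>K\<close>. It transfers lower bounds on chords to the
  deformed curve.\<close>

lemma nearly_isometric:
  assumes "compact K" "convex K" "\<delta> > 0"
  shows "\<forall>\<^sub>F t in at_right 0. \<forall>p\<in>K. \<forall>q\<in>K. norm ((\<phi> t p - \<phi> t q) - (p - q)) \<le> \<delta> * norm (p - q)"
  using D1_near_identity[OF assms(1,3)] eventually_time
proof eventually_elim
  case (elim t)
  show ?case
  proof (intro ballI)
    fix p q assume pq: "p \<in> K" "q \<in> K"
    have "norm ((\<phi> t p - p) - (\<phi> t q - q)) \<le> \<delta> * norm (p - q)"
    proof (rule differentiable_bound[OF assms(2)])
      fix x assume x: "x \<in> K"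
      have 1: "((\<lambda>x. \<phi> t x - x) has_derivative (\<lambda>h. blinfun_apply (D1 t x) h - h)) (at x)"
        by (intro has_derivative_diff has_derivative_ident D1 elim)
      have 2: "(\<lambda>h. blinfun_apply (D1 t x) h - h) = blinfun_apply (D1 t x - id_blinfun)"
        by (auto simp: blinfun.diff_left)
      show "((\<lambda>x. \<phi> t x - x) has_derivative blinfun_apply (D1 t x - id_blinfun)) (at x within K)"
        using has_derivative_at_withinI[OF 1] unfolding 2 .
      show "onorm (blinfun_apply (D1 t x - id_blinfun)) \<le> \<delta>"
        using elim x by (auto simp: norm_blinfun.rep_eq[symmetric] intro: less_imp_le)
    qed (use pq in auto)
    then show "norm ((\<phi> t p - \<phi> t q) - (p - q)) \<le> \<delta> * norm (p - q)"
      by (simp add: algebra_simps)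
  qed
qed

end

lemma C1_family_C2_diffeosE:
  assumes "C1_family_C2_diffeos \<phi> \<xi>"
  obtains e D1 V1 D2 V2 V0 where "C2_flow \<phi> \<xi> e D1 V1 D2 V2 V0"
proof -
  from assms obtain e D1 D2 V0 V1 V2 where *: "e > 0"
    "\<forall>t\<in>{-e<..<e}. C2_diffeo (\<phi> t) \<and>
           (\<forall>x. (\<phi> t has_derivative blinfun_apply (D1 t x)) (at x) \<and>
                (D1 t has_derivative blinfun_apply (D2 t x)) (at x) \<and>
                ((\<lambda>s. \<phi> s x) has_vector_derivative V0 t x) (at t) \<and>
                ((\<lambda>s. D1 s x) has_vector_derivative V1 t x) (at t) \<and>
                ((\<lambda>s. D2 s x) has_vector_derivative V2 t x) (at t))"
        "continuous_on ({-e<..<e} \<times> UNIV) (\<lambda>(t, x). V0 t x)"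
        "continuous_on ({-e<..<e} \<times> UNIV) (\<lambda>(t, x). V1 t x)"
        "continuous_on ({-e<..<e} \<times> UNIV) (\<lambda>(t, x). V2 t x)"
        "\<phi> 0 = id" "V0 0 = \<xi>"
    unfolding C1_family_C2_diffeos_def by metis
  show ?thesis
    by (rule that[of e D1 V1 D2 V2 V0], unfold_locales) (use * in blast)+
qed

text \<open>The resting flow makes the thickness of the undeformed link the time 0 case of the
  formula for deformed links.\<close>

lemma constant_flow: "C2_flow (\<lambda>_. id) (\<lambda>_. 0) 1 (\<lambda>_ _. id_blinfun) (\<lambda>_ _. 0) (\<lambda>_ _. 0) (\<lambda>_ _. 0) (\<lambda>_ _. 0)"
proof -
  have "blinfun_apply (id_blinfun :: (real^3) \<Rightarrow>\<^sub>L (real^3)) = (\<lambda>x. x)"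
    "blinfun_apply (0 :: (real^3) \<Rightarrow>\<^sub>L ((real^3) \<Rightarrow>\<^sub>L (real^3))) = (\<lambda>x. 0)" by auto
  then show ?thesis
    by unfold_locales (simp_all add: id_def case_prod_unfold)
qed

section \<open>Curvature of piecewise twice differentiable arcs\<close>

text \<open>Squared curvature for an arbitrary parametrization: the squared cross product of
  velocity and acceleration, written by Lagrange's identity, over the sixth power of the speed. The
  square is differentiable also where the curvature vanishes.\<close>

definition ksq :: "real^3 \<Rightarrow> real^3 \<Rightarrow> real" where
  "ksq V A = ((V \<bullet> V) * (A \<bullet> A) - (V \<bullet> A)\<^sup>2) / (V \<bullet> V) ^ 3"

text \<open>The derivative of the unit tangent: the part of \<open>A\<close> normal to
  \<open>V\<close>, divided by the speed.\<close>

definition turn :: "real^3 \<Rightarrow> real^3 \<Rightarrow> real^3" where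
  "turn V A = A /\<^sub>R norm V - ((V \<bullet> A) / norm V ^ 3) *\<^sub>R V"

lemma has_vector_derivative_sgn:
  fixes f :: "real \<Rightarrow> real^3"
  assumes f: "(f has_vector_derivative A) (at s within S)" and "f s \<noteq> 0"
  shows "((\<lambda>s. sgn (f s)) has_vector_derivative turn (f s) A) (at s within S)"
proof -
  have n: "((\<lambda>s. norm (f s)) has_real_derivative (A \<bullet> sgn (f s))) (at s within S)"
  proof -
    have "(\<lambda>h. (h *\<^sub>R A) \<bullet> sgn (f s)) = (*) (A \<bullet> sgn (f s))" by (auto simp: mult.commute)
    then show ?thesis
      using has_derivative_compose[OF f[unfolded has_vector_derivative_def]
          GDERIV_norm[OF assms(2), unfolded gderiv_def]]
      unfolding has_field_derivative_def by simp
  qed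
  have "((\<lambda>s. inverse (norm (f s))) has_real_derivative - (A \<bullet> sgn (f s) * inverse ((norm (f s))\<^sup>2))) (at s within S)"
    using DERIV_inverse_fun[OF n] assms(2) by (simp add: power2_eq_square)
  from has_vector_derivative_scaleR[OF this f]
  have "((\<lambda>s. inverse (norm (f s)) *\<^sub>R f s) has_vector_derivative
     inverse (norm (f s)) *\<^sub>R A + (- (A \<bullet> sgn (f s) * inverse ((norm (f s))\<^sup>2))) *\<^sub>R f s) (at s within S)" .
  moreover have "inverse (norm (f s)) *\<^sub>R A + (- (A \<bullet> sgn (f s) * inverse ((norm (f s))\<^sup>2))) *\<^sub>R f s = turn (f s) A"
    by (simp add: turn_def sgn_div_norm divide_inverse inner_commute power2_eq_square power3_eq_cube mult_ac)
  ultimately show ?thesis by (simp add: sgn_div_norm)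
qed

lemma norm_turn:
  assumes "V \<noteq> 0"
  shows "(norm (turn V A))\<^sup>2 = ksq V A * (V \<bullet> V)"
proof -
  define n where "n = norm V"
  have n: "n > 0" "V \<bullet> V = n\<^sup>2" using assms by (auto simp: n_def power2_norm_eq_inner)
  have "(norm (turn V A))\<^sup>2 = (A \<bullet> A) / n\<^sup>2 - (V \<bullet> A)\<^sup>2 / n ^ 4"
    unfolding power2_norm_eq_inner turn_def n_def[symmetric]
    using n(1) by (simp add: inner_diff_left inner_diff_right n(2) inner_commute[of A V] field_simps power2_eq_square power4_eq_xxxx power3_eq_cube)
  also have "\<dots> = ksq V A * (V \<bullet> V)"
    unfolding ksq_def n(2) using n(1) by (simp add: field_simps eval_nat_numeral)
  finally show ?thesis .
qed

lemma ksq_nonneg: "ksq V A \<ge> 0"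
  unfolding ksq_def using Cauchy_Schwarz_ineq[of V A] by (intro divide_nonneg_nonneg) auto

lemma norm_turn_div:
  assumes "V \<noteq> 0"
  shows "norm (turn V A) / norm V = sqrt (ksq V A)"
proof -
  have "(norm (turn V A) / norm V)\<^sup>2 = ksq V A"
    using norm_turn[OF assms, of A] assms by (simp add: power_divide power2_norm_eq_inner[symmetric])
  then show ?thesis by (intro real_sqrt_unique[symmetric]) auto
qed

lemma inner_turn: "V \<noteq> 0 \<Longrightarrow> sgn V \<bullet> turn V A = 0"
  by (simp add: turn_def sgn_div_norm inner_diff_right power2_norm_eq_inner[symmetric] power2_eq_square power3_eq_cube field_simps)

lemma continuous_on_ksq:
  assumes "continuous_on S V" "continuous_on S A" "\<And>s. s \<in> S \<Longrightarrow> V s \<noteq> 0"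
  shows "continuous_on S (\<lambda>s. ksq (V s) (A s))"
  unfolding ksq_def by (intro continuous_intros assms) (use assms(3) in auto)

lemma Limsup_filter_mono: "F \<le> G \<Longrightarrow> Limsup F f \<le> Limsup G f"
  unfolding Limsup_def by (rule INF_superset_mono) (auto simp: le_filter_def)

text \<open>Arcs that are once continuously differentiable and piecewise twice so. A triple in
  \<open>P\<close> is a closed parameter interval with the acceleration on it; at a common endpoint
  the one-sided accelerations of two pieces may differ, as they do where a straight end meets the
  clasp.\<close>

locale pw_curve =
  fixes \<gamma> v :: "real \<Rightarrow> real^3" and P :: "(real \<times> real \<times> (real \<Rightarrow> real^3)) set"
  assumes finite_pieces: "finite P"
    and cover: "\<And>s. s \<in> {0..1} \<Longrightarrow> \<exists>a b A. (a, b, A) \<in> P \<and> s \<in> {a..b}"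
    and piece: "\<And>a b A. (a, b, A) \<in> P \<Longrightarrow> 0 \<le> a \<and> a < b \<and> b \<le> 1"
    and vel: "\<And>s. s \<in> {0..1} \<Longrightarrow> (\<gamma> has_vector_derivative v s) (at s within {0..1})"
    and v_nz: "\<And>s. s \<in> {0..1} \<Longrightarrow> v s \<noteq> 0"
    and cont_v: "continuous_on {0..1} v"
    and acc: "\<And>a b A s. (a, b, A) \<in> P \<Longrightarrow> s \<in> {a..b} \<Longrightarrow> (v has_vector_derivative A s) (at s within {a..b})"
    and cont_acc: "\<And>a b A. (a, b, A) \<in> P \<Longrightarrow> continuous_on {a..b} A"
begin

text \<open>At a breakpoint the one-sided accelerations of both pieces are included. This makes the
  set compact, as Danskin's theorem requires.\<close>

definition jets :: "((real^3) \<times> (real^3) \<times> (real^3)) set" where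
  "jets = (\<Union>(a, b, A)\<in>P. (\<lambda>s. (\<gamma> s, v s, A s)) ` {a..b})"

lemma cont_\<gamma>: "continuous_on {0..1} \<gamma>"
  using vel by (rule continuous_on_vector_derivative)

lemma piece_subset: "(a, b, A) \<in> P \<Longrightarrow> {a..b} \<subseteq> {0..1}"
  using piece by fastforce

lemma jetsI: "(a, b, A) \<in> P \<Longrightarrow> s \<in> {a..b} \<Longrightarrow> (\<gamma> s, v s, A s) \<in> jets"
  unfolding jets_def by blast

lemma jetsE:
  assumes "j \<in> jets"
  obtains a b A s where "(a, b, A) \<in> P" "s \<in> {a..b}" "j = (\<gamma> s, v s, A s)"
  using assms unfolding jets_def by blast

lemma compact_jets: "compact jets"
  unfolding jets_def
proof (rule compact_UN[OF finite_pieces], clarify)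
  fix a b A assume P: "(a, b, A) \<in> P"
  note s = piece_subset[OF P]
  show "compact ((\<lambda>s. (\<gamma> s, v s, A s)) ` {a..b})"
    by (intro compact_continuous_image continuous_on_Pair continuous_on_subset[OF cont_\<gamma> s]
        continuous_on_subset[OF cont_v s] cont_acc[OF P] compact_Icc)
qed

lemma jets_nonempty: "jets \<noteq> {}"
proof -
  obtain a b A where "(a, b, A) \<in> P" "0 \<in> {a..b}" using cover[of 0] by auto
  then show ?thesis using jetsI by blast
qed

lemma velocity_eq: "s \<in> {0..1} \<Longrightarrow> velocity \<gamma> s = v s"
  using vel[of s] vector_derivative_within_cbox[of 0 1 s \<gamma> "v s"] by simp

lemma unit_tangent_eq: "s \<in> {0..1} \<Longrightarrow> unit_tangent \<gamma> s = sgn (v s)"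
  by (simp add: unit_tangent_def velocity_eq)

lemma unit_tangent_derivative:
  assumes P: "(a, b, A) \<in> P" and s: "s \<in> {a..b}"
  shows "(unit_tangent \<gamma> has_vector_derivative turn (v s) (A s)) (at s within {a..b})"
proof (rule has_vector_derivative_transform[OF s])
  show "((\<lambda>s. sgn (v s)) has_vector_derivative turn (v s) (A s)) (at s within {a..b})"
    using v_nz s piece_subset[OF P] by (intro has_vector_derivative_sgn acc[OF P s]) auto
qed (use unit_tangent_eq piece_subset[OF P] in auto)

text \<open>The tangent may be differentiable at a breakpoint; uniqueness of derivatives within the
  piece then makes the one-sided formula of either piece valid.\<close>

lemma curvature_eq:
  assumes P: "(a, b, A) \<in> P" and s: "s \<in> {a..b}" and "s \<in> twice_diff_points \<gamma>"
  shows "curvature \<gamma> s = sqrt (ksq (v s) (A s))"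
proof -
  have s01: "s \<in> {0..1}" using s piece_subset[OF P] by auto
  define d where "d = vector_derivative (unit_tangent \<gamma>) (at s within {0..1})"
  have "(unit_tangent \<gamma> has_vector_derivative d) (at s within {0..1})"
    using assms(3) vector_derivative_works by (auto simp: twice_diff_points_def d_def)
  then have "(unit_tangent \<gamma> has_vector_derivative d) (at s within {a..b})"
    by (rule has_vector_derivative_within_subset[OF _ piece_subset[OF P]])
  then have "d = turn (v s) (A s)"
    using unit_tangent_derivative[OF P s] piece[OF P] s
    by (intro vector_derivative_unique_within_closed_interval[of a b s]) auto
  then show ?thesis
    using norm_turn_div[OF v_nz[OF s01]] by (simp add: curvature_def d_def velocity_eq[OF s01])
qed

lemma interior_twice_diff:
  assumes P: "(a, b, A) \<in> P" and s: "s \<in> {a<..<b}"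
  shows "s \<in> twice_diff_points \<gamma>"
proof -
  have "(unit_tangent \<gamma> has_vector_derivative turn (v s) (A s)) (at s within {a..b})"
    using unit_tangent_derivative[OF P] s by auto
  moreover have "at s within {a..b} = at s"
    using s by (intro at_within_interior) auto
  ultimately have "(unit_tangent \<gamma> has_vector_derivative turn (v s) (A s)) (at s within {0..1})"
    by (simp add: has_vector_derivative_at_within)
  moreover have "s \<in> {0..1}" using s piece_subset[OF P] by fastforce
  ultimately show ?thesis
    unfolding twice_diff_points_def differentiable_def has_vector_derivative_def by blast
qed

definition max_ksq :: real where
  "max_ksq = (SUP (x, V, A)\<in>jets. ksq V A)"

lemma jet_velocity_nz: "(x, V, A) \<in> jets \<Longrightarrow> V \<noteq> 0"
proof (elim jetsE)
  fix a b B s assume P: "(a, b, B) \<in> P" "s \<in> {a..b}" and "(x, V, A) = (\<gamma> s, v s, B s)"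
  then have "V = v s" by simp
  moreover have "s \<in> {0..1}" using piece_subset[OF P(1)] P(2) by (rule subsetD)
  ultimately show ?thesis using v_nz by simp
qed

lemma max_ksq_attained:
  obtains x V A where "(x, V, A) \<in> jets" "ksq V A = max_ksq"
    "\<And>y W B. (y, W, B) \<in> jets \<Longrightarrow> ksq W B \<le> max_ksq"
proof -
  have "continuous_on jets (\<lambda>j. ksq (fst (snd j)) (snd (snd j)))"
    by (rule continuous_on_ksq) (auto intro!: continuous_intros dest: jet_velocity_nz)
  then obtain j where j: "j \<in> jets" "\<And>k. k \<in> jets \<Longrightarrow> ksq (fst (snd k)) (snd (snd k)) \<le> ksq (fst (snd j)) (snd (snd j))"
    using continuous_attains_sup[OF compact_jets jets_nonempty] by blast
  have "max_ksq = ksq (fst (snd j)) (snd (snd j))"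
    unfolding max_ksq_def case_prod_unfold by (rule cSup_eq_maximum) (use j in auto)
  moreover obtain x V A where "j = (x, V, A)" by (rule prod_cases3)
  ultimately show ?thesis
    using j(1) j(2)[of "(y, W, B)" for y W B] by (intro that[of x V A]) simp_all
qed

lemma max_ksq_nonneg: "max_ksq \<ge> 0"
  using max_ksq_attained ksq_nonneg by metis

text \<open>The open piece accumulates at each point of its closure and consists of points where the
  tangent is differentiable. So a limit along the piece is a lower bound for the limsup in
  \<open>curv_radius\<close>, even at a breakpoint.\<close>

lemma twice_diff_piece_filter:
  assumes P: "(a, b, A) \<in> P" and s: "s \<in> {a..b}"
  shows "at s within {a<..<b} \<noteq> bot" "at s within {a<..<b} \<le> at s within twice_diff_points \<gamma>"
proof -
  show "at s within {a<..<b} \<noteq> bot"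
  proof (cases "s \<in> {a<..<b}")
    case True
    then show ?thesis by (simp add: at_within_open[OF True])
  next
    case False
    then have "s = a \<or> s = b" using s by auto
    then show ?thesis
      using islimpt_greaterThanLessThan1[of a b] islimpt_greaterThanLessThan2[of a b] piece[OF P]
      by (auto simp: trivial_limit_within)
  qed
  show "at s within {a<..<b} \<le> at s within twice_diff_points \<gamma>"
    by (rule at_le) (use interior_twice_diff[OF P] in blast)
qed

lemma Limsup_curvature_le:
  assumes "s \<in> {0..1}"
  shows "Limsup (at s within twice_diff_points \<gamma>) (\<lambda>s. ereal (curvature \<gamma> s)) \<le> ereal (sqrt max_ksq)"
proof (rule Limsup_bounded)
  have "curvature \<gamma> s \<le> sqrt max_ksq" if s: "s \<in> twice_diff_points \<gamma>" for s
  proof -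
    have "s \<in> {0..1}" using s by (simp add: twice_diff_points_def)
    then obtain a b A where *: "(a, b, A) \<in> P" "s \<in> {a..b}" using cover by blast
    have "ksq (v s) (A s) \<le> max_ksq" using max_ksq_attained jetsI[OF *] by metis
    then show ?thesis using curvature_eq[OF * s] by simp
  qed
  then show "\<forall>\<^sub>F t in at s within twice_diff_points \<gamma>. ereal (curvature \<gamma> t) \<le> ereal (sqrt max_ksq)"
    by (auto simp: eventually_at_filter)
qed

lemma le_Limsup_curvature:
  assumes P: "(a, b, A) \<in> P" and s: "s \<in> {a..b}"
  shows "ereal (sqrt (ksq (v s) (A s))) \<le> Limsup (at s within twice_diff_points \<gamma>) (\<lambda>s. ereal (curvature \<gamma> s))"
proof -
  note sub = piece_subset[OF P]
  have "continuous_on {a..b} (\<lambda>s. ereal (sqrt (ksq (v s) (A s))))"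
    using v_nz sub by (intro continuous_on_ereal continuous_on_real_sqrt continuous_on_ksq
        continuous_on_subset[OF cont_v sub] cont_acc[OF P]) auto
  then have "((\<lambda>s. ereal (sqrt (ksq (v s) (A s)))) \<longlongrightarrow> ereal (sqrt (ksq (v s) (A s)))) (at s within {a..b})"
    using s by (simp add: continuous_on_def)
  then have "((\<lambda>s. ereal (sqrt (ksq (v s) (A s)))) \<longlongrightarrow> ereal (sqrt (ksq (v s) (A s)))) (at s within {a<..<b})"
    by (rule tendsto_within_subset) auto
  moreover have "\<forall>\<^sub>F s in at s within {a<..<b}. ereal (sqrt (ksq (v s) (A s))) = ereal (curvature \<gamma> s)"
    using curvature_eq[OF P] interior_twice_diff[OF P] by (auto simp: eventually_at_filter)
  ultimately have "((\<lambda>s. ereal (curvature \<gamma> s)) \<longlongrightarrow> ereal (sqrt (ksq (v s) (A s)))) (at s within {a<..<b})"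
    by (rule Lim_transform_eventually)
  then have "Limsup (at s within {a<..<b}) (\<lambda>s. ereal (curvature \<gamma> s)) = ereal (sqrt (ksq (v s) (A s)))"
    by (rule lim_imp_Limsup[OF twice_diff_piece_filter(1)[OF P s]])
  then show ?thesis
    using Limsup_filter_mono[OF twice_diff_piece_filter(2)[OF P s], of "\<lambda>s. ereal (curvature \<gamma> s)"] by simp
qed

text \<open>At the jet of largest curvature the limsup equals the maximum:
  \<open>le_Limsup_curvature\<close> bounds it from below along the open piece,
  \<open>Limsup_curvature_le\<close> from above. Hence the infimum of the radii is attained although
  the curvature may jump there.\<close>

lemma INF_curv_radius: "(INF s\<in>{0..1}. curv_radius \<gamma> s) = inverse (ereal (sqrt max_ksq))"
proof (rule INF_eqI)
  fix s :: real assume s: "s \<in> {0..1}"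
  then obtain a b A where P: "(a, b, A) \<in> P" "s \<in> {a..b}" using cover by blast
  have "0 \<le> Limsup (at s within twice_diff_points \<gamma>) (\<lambda>s. ereal (curvature \<gamma> s))"
    using le_Limsup_curvature[OF P] ksq_nonneg[of "v s" "A s"] by (simp add: order.trans[rotated])
  then show "inverse (ereal (sqrt max_ksq)) \<le> curv_radius \<gamma> s"
    unfolding curv_radius_def by (rule ereal_inverse_antimono[OF _ Limsup_curvature_le[OF s]])
next
  fix y assume y: "\<And>s. s \<in> {0..1} \<Longrightarrow> y \<le> curv_radius \<gamma> s"
  obtain x V A where "(x, V, A) \<in> jets" and m: "ksq V A = max_ksq" by (rule max_ksq_attained)
  then obtain a b B s where P: "(a, b, B) \<in> P" "s \<in> {a..b}" and j: "(x, V, A) = (\<gamma> s, v s, B s)"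
    by (elim jetsE)
  have s: "s \<in> {0..1}" using P piece_subset by blast
  have "Limsup (at s within twice_diff_points \<gamma>) (\<lambda>s. ereal (curvature \<gamma> s)) = ereal (sqrt max_ksq)"
    using le_Limsup_curvature[OF P] Limsup_curvature_le[OF s] m j by (intro antisym) auto
  then show "y \<le> inverse (ereal (sqrt max_ksq))"
    using y[OF s] by (simp add: curv_radius_def)
qed

end

section \<open>Nearest points on arcs of bounded curvature\<close>

text \<open>A form of the monotonicity criterion that tolerates breakpoints, obtained from the
  fundamental theorem with a finite exceptional set.\<close>

lemma mono_off_finite:
  fixes f :: "real \<Rightarrow> real"
  assumes "finite E" "a \<le> b" "continuous_on {a..b} f"
    and d: "\<And>x. x \<in> {a<..<b} - E \<Longrightarrow> (f has_real_derivative f' x) (at x) \<and> f' x \<ge> 0"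
  shows "f a \<le> f b"
proof -
  define g where "g x = (if x \<in> E \<union> {a, b} then 0 else f' x)" for x
  have "(g has_integral (f b - f a)) {a..b}"
  proof (rule fundamental_theorem_of_calculus_interior_strong[OF assms(1,2) _ assms(3)])
    fix x assume x: "x \<in> {a<..<b} - E"
    then have "g x = f' x" by (auto simp: g_def)
    then show "(f has_vector_derivative g x) (at x)"
      using d[OF x] by (simp add: has_real_derivative_iff_has_vector_derivative)
  qed
  then have "0 \<le> f b - f a"
    by (rule has_integral_nonneg) (use d in \<open>auto simp: g_def\<close>)
  then show ?thesis by simp
qed

section \<open>Arclength, turning of the tangent, and feet of perpendiculars\<close>

context pw_curve
begin

definition arclen :: "real \<Rightarrow> real" where
  "arclen s = integral {0..s} (\<lambda>r. norm (v r))"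

lemma arclen_derivative:
  "s \<in> {0..1} \<Longrightarrow> (arclen has_real_derivative norm (v s)) (at s within {0..1})"
  unfolding arclen_def[abs_def]
  by (intro integral_has_real_derivative continuous_on_norm cont_v) auto

lemma arclen_derivative_at:
  assumes "s \<in> {0<..<1}"
  shows "(arclen has_real_derivative norm (v s)) (at s)"
proof -
  have "at s within {0..1} = at s" using assms by (intro at_within_interior) auto
  then show ?thesis using arclen_derivative[of s] assms by simp
qed

lemma vel_at:
  assumes "s \<in> {0<..<1}"
  shows "(\<gamma> has_vector_derivative v s) (at s)"
proof -
  have "at s within {0..1} = at s" using assms by (intro at_within_interior) auto
  then show ?thesis using vel[of s] assms by simp
qed

lemma continuous_on_arclen: "continuous_on {0..1} arclen"
  by (rule DERIV_continuous_on) (rule arclen_derivative)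

lemma arclen_mono:
  assumes "0 \<le> a" "a \<le> b" "b \<le> 1"
  shows "arclen a \<le> arclen b"
proof (rule mono_off_finite[where f=arclen and a=a and b=b and E="{}" and f'="\<lambda>s. norm (v s)"])
  show "continuous_on {a..b} arclen"
    by (rule continuous_on_subset[OF continuous_on_arclen]) (use assms in auto)
qed (use assms arclen_derivative_at in auto)

definition exceptional :: "real set" where
  "exceptional = (\<lambda>(a, b, A). a) ` P \<union> (\<lambda>(a, b, A). b) ` P"

lemma finite_exceptional: "finite exceptional"
  using finite_pieces by (simp add: exceptional_def)

lemma sgn_derivative_at:
  assumes "s \<in> {0<..<1} - exceptional"
  obtains a b A where "(a, b, A) \<in> P" "s \<in> {a..b}"
    "((\<lambda>s. sgn (v s)) has_vector_derivative turn (v s) (A s)) (at s)"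
proof -
  obtain a b A where P: "(a, b, A) \<in> P" and s: "s \<in> {a..b}" using cover[of s] assms by auto
  have "a \<in> exceptional" "b \<in> exceptional" using P by (force simp: exceptional_def)+
  then have "s \<in> {a<..<b}" using s assms by (auto simp: order_less_le)
  then have "at s within {a..b} = at s" by (intro at_within_interior) auto
  then have "(v has_vector_derivative A s) (at s)" using acc[OF P s] by simp
  then show ?thesis using assms v_nz[of s] by (intro that[OF P s] has_vector_derivative_sgn) auto
qed

lemma continuous_on_sgn_v: "continuous_on {0..1} (\<lambda>s. sgn (v s))"
  using v_nz by (auto intro!: continuous_on_sgn cont_v)

text \<open>Scaling by \<open>\<mu> < 1\<close> keeps the argument of \<open>arccos\<close> away from the points where
  it is not differentiable.\<close>

lemma scaled_angle_bound:
  assumes n: "norm n = 1" and \<mu>: "0 < \<mu>" "\<mu> < 1" and k: "k \<ge> 0" "max_ksq \<le> k\<^sup>2"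
    and ab: "0 \<le> a" "a \<le> b" "b \<le> 1" and c: "\<bar>c\<bar> = 1"
  shows "c * (arccos (\<mu> * (n \<bullet> sgn (v b))) - arccos (\<mu> * (n \<bullet> sgn (v a)))) \<le> k * (arclen b - arclen a)"
proof -
  define g where "g s = \<mu> * (n \<bullet> sgn (v s))" for s
  have g1: "\<bar>g s\<bar> < 1" for s
  proof -
    have "\<bar>n \<bullet> sgn (v s)\<bar> \<le> 1"
      using Cauchy_Schwarz_ineq2[of n "sgn (v s)"] n by (auto simp: norm_sgn split: if_splits)
    then have "\<bar>g s\<bar> \<le> \<mu> * 1" using \<mu> unfolding g_def abs_mult by (intro mult_mono) auto
    then show ?thesis using \<mu> by simp
  qed
  have sub: "{a..b} \<subseteq> {0..1}" using ab by auto
  have "\<exists>d. ((\<lambda>s. k * arclen s - c * arccos (g s)) has_real_derivative d) (at s) \<and> d \<ge> 0"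
    if s: "s \<in> {a<..<b} - exceptional" for s
  proof -
    have s01: "s \<in> {0<..<1}" using s ab by auto
    then obtain p q A where P: "(p, q, A) \<in> P" "s \<in> {p..q}"
      and dU: "((\<lambda>s. sgn (v s)) has_vector_derivative turn (v s) (A s)) (at s)"
      using sgn_derivative_at[of s] s by blast
    define w where "w = turn (v s) (A s)"
    have vs: "v s \<noteq> 0" using v_nz s01 by auto
    have "((\<lambda>s. n \<bullet> sgn (v s)) has_derivative (\<lambda>h. n \<bullet> (h *\<^sub>R w))) (at s)"
      using dU unfolding has_vector_derivative_def w_def by (rule has_derivative_inner_right)
    then have "((\<lambda>s. n \<bullet> sgn (v s)) has_real_derivative n \<bullet> w) (at s)"
      by (simp add: has_field_derivative_def mult_commute_abs)
    then have "(g has_real_derivative \<mu> * (n \<bullet> w)) (at s)"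
      unfolding g_def[abs_def] by (rule DERIV_cmult)
    then have da: "((\<lambda>s. arccos (g s)) has_real_derivative (inverse (- sqrt (1 - (g s)\<^sup>2))) * (\<mu> * (n \<bullet> w))) (at s)"
      using g1[of s] by (intro DERIV_chain2[OF DERIV_arccos]) auto
    have orth: "sgn (v s) \<bullet> w = 0" using inner_turn[OF vs] by (simp add: w_def)
    have "\<bar>\<mu> * (n \<bullet> w)\<bar> \<le> sqrt (1 - (g s)\<^sup>2) * (k * norm (v s))"
    proof -
      \<comment> \<open>The part of \<open>n\<close> normal to the tangent. The derivative
        \<open>w\<close> of the tangent sees only this part, and its length, scaled by
        \<open>\<mu>\<close>, is at most the root in the derivative of \<open>arccos\<close>, which
        therefore cancels.\<close>
      define m where "m = n - (n \<bullet> sgn (v s)) *\<^sub>R sgn (v s)"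
      have U: "sgn (v s) \<bullet> sgn (v s) = 1" using vs by (simp add: norm_sgn power2_norm_eq_inner[symmetric])
      have "m \<bullet> m = 1 - (n \<bullet> sgn (v s))\<^sup>2"
        using U n by (simp add: m_def inner_diff_left inner_diff_right inner_commute power2_eq_square norm_eq_1)
      then have "(\<mu> * norm m)\<^sup>2 = \<mu>\<^sup>2 * (1 - (n \<bullet> sgn (v s))\<^sup>2)"
        by (simp add: power_mult_distrib power2_norm_eq_inner)
      also have "\<dots> = \<mu>\<^sup>2 - (g s)\<^sup>2" by (simp add: g_def power_mult_distrib right_diff_distrib)
      also have "\<dots> \<le> 1 - (g s)\<^sup>2" using \<mu> by (simp add: power_le_one)
      finally have m: "\<mu> * norm m \<le> sqrt (1 - (g s)\<^sup>2)" by (rule real_le_rsqrt)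
      have "(norm w)\<^sup>2 = ksq (v s) (A s) * (norm (v s))\<^sup>2"
        using norm_turn[OF vs, of "A s"] by (simp add: w_def power2_norm_eq_inner)
      also have "\<dots> \<le> k\<^sup>2 * (norm (v s))\<^sup>2"
        using max_ksq_attained jetsI[OF P] k by (metis mult_right_mono order_trans zero_le_power2)
      finally have "(norm w)\<^sup>2 \<le> (k * norm (v s))\<^sup>2" by (simp add: power_mult_distrib)
      then have w: "norm w \<le> k * norm (v s)" using k by (simp add: abs_le_square_iff[symmetric])
      have "n \<bullet> w = m \<bullet> w" using orth by (simp add: m_def inner_diff_left)
      then have "\<bar>n \<bullet> w\<bar> \<le> norm m * norm w" using Cauchy_Schwarz_ineq2[of m w] by simp
      then have "\<bar>\<mu> * (n \<bullet> w)\<bar> \<le> \<mu> * (norm m * norm w)"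
        using \<mu> by (simp add: abs_mult)
      also have "\<dots> = (\<mu> * norm m) * norm w" by simp
      also have "\<dots> \<le> sqrt (1 - (g s)\<^sup>2) * (k * norm (v s))"
        using m w \<mu> by (intro mult_mono) (auto simp: abs_square_le_1 less_imp_le[OF g1])
      finally show ?thesis .
    qed
    moreover have pos: "sqrt (1 - (g s)\<^sup>2) > 0"
      using g1[of s] by (simp add: abs_square_less_1)
    ultimately have "\<bar>(inverse (- sqrt (1 - (g s)\<^sup>2))) * (\<mu> * (n \<bullet> w))\<bar> \<le> k * norm (v s)"
      by (simp add: abs_mult field_simps)
    then have "\<bar>c * ((inverse (- sqrt (1 - (g s)\<^sup>2))) * (\<mu> * (n \<bullet> w)))\<bar> \<le> k * norm (v s)"
      using c by (simp only: abs_mult mult_1_left)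
    then have "0 \<le> k * norm (v s) - c * ((inverse (- sqrt (1 - (g s)\<^sup>2))) * (\<mu> * (n \<bullet> w)))" by linarith
    moreover have "((\<lambda>s. k * arclen s - c * arccos (g s)) has_real_derivative
        k * norm (v s) - c * ((inverse (- sqrt (1 - (g s)\<^sup>2))) * (\<mu> * (n \<bullet> w)))) (at s)"
      by (intro DERIV_diff DERIV_cmult arclen_derivative_at s01 da)
    ultimately show ?thesis by blast
  qed
  then obtain d where d: "\<And>s. s \<in> {a<..<b} - exceptional \<Longrightarrow>
      ((\<lambda>s. k * arclen s - c * arccos (g s)) has_real_derivative d s) (at s) \<and> d s \<ge> 0" by metis
  have cg: "continuous_on {a..b} g"
    unfolding g_def by (intro continuous_on_mult continuous_on_inner continuous_on_const
        continuous_on_subset[OF continuous_on_sgn_v sub])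
  have "continuous_on {a..b} (\<lambda>s. k * arclen s - c * arccos (g s))"
    using g1 by (intro continuous_on_diff continuous_on_mult continuous_on_const continuous_on_arccos cg
        continuous_on_subset[OF continuous_on_arclen sub]) (auto simp: abs_less_iff intro: less_imp_le minus_le_iff[THEN iffD1])
  from mono_off_finite[OF finite_exceptional ab(2) this d]
  show ?thesis by (simp add: g_def algebra_simps)
qed

text \<open>The angle to a fixed direction changes no faster than the tangent turns; this is the
  limit of \<open>scaled_angle_bound\<close> as \<open>\<mu>\<close> tends to 1, taken with both
  signs.\<close>

lemma angle_bound:
  assumes n: "norm n = 1" and k: "k \<ge> 0" "max_ksq \<le> k\<^sup>2"
    and ab: "0 \<le> a" "a \<le> b" "b \<le> 1"
  shows "\<bar>arccos (n \<bullet> sgn (v b)) - arccos (n \<bullet> sgn (v a))\<bar> \<le> k * (arclen b - arclen a)"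
proof -
  have *: "c * (arccos (n \<bullet> sgn (v b)) - arccos (n \<bullet> sgn (v a))) \<le> k * (arclen b - arclen a)"
    if c: "\<bar>c\<bar> = 1" for c
  proof (rule tendsto_le)
    have *: "((\<lambda>\<mu>. arccos (\<mu> * (n \<bullet> sgn (v s)))) \<longlongrightarrow> arccos (1 * (n \<bullet> sgn (v s)))) (at_left 1)" for s
    proof -
      have b: "\<bar>n \<bullet> sgn (v s)\<bar> \<le> 1"
        using Cauchy_Schwarz_ineq2[of n "sgn (v s)"] n by (auto simp: norm_sgn split: if_splits)
      have "continuous_on {0..1} (\<lambda>\<mu>. arccos (\<mu> * (n \<bullet> sgn (v s))))"
      proof (intro continuous_on_arccos continuous_on_mult continuous_on_const continuous_on_id ballI)
        fix \<mu> :: real assume "\<mu> \<in> {0..1}"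
        then have "\<bar>\<mu> * (n \<bullet> sgn (v s))\<bar> \<le> 1 * 1" using b unfolding abs_mult by (intro mult_mono) auto
        then show "- 1 \<le> \<mu> * (n \<bullet> sgn (v s)) \<and> \<mu> * (n \<bullet> sgn (v s)) \<le> 1" by linarith
      qed
      then have "((\<lambda>\<mu>. arccos (\<mu> * (n \<bullet> sgn (v s)))) \<longlongrightarrow> arccos (1 * (n \<bullet> sgn (v s)))) (at 1 within {0..1})"
        unfolding continuous_on_def by (auto dest: bspec[where x=1])
      moreover have "at_left 1 = at 1 within {0..(1::real)}"
        by (simp add: at_within_Icc_at_left)
      ultimately show ?thesis by simp
    qed
    show "((\<lambda>\<mu>. c * (arccos (\<mu> * (n \<bullet> sgn (v b))) - arccos (\<mu> * (n \<bullet> sgn (v a))))) \<longlongrightarrow>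
        c * (arccos (n \<bullet> sgn (v b)) - arccos (n \<bullet> sgn (v a)))) (at_left 1)"
      using tendsto_mult_left[OF tendsto_diff[OF *[of b] *[of a]], of c] by simp
    have "\<forall>\<^sub>F \<mu> in at_left 1. \<mu> \<in> {0<..<(1::real)}"
      by (rule eventually_at_leftI[of 0]) auto
    then show "\<forall>\<^sub>F \<mu> in at_left 1. c * (arccos (\<mu> * (n \<bullet> sgn (v b))) - arccos (\<mu> * (n \<bullet> sgn (v a)))) \<le> k * (arclen b - arclen a)"
      by eventually_elim (use scaled_angle_bound[OF n _ _ k ab c] in auto)
  qed (auto simp: tendsto_const)
  from *[of 1] *[of "-1"] show ?thesis by simp
qed

text \<open>\<open>a\<close> may be the start of the arc, where only motion to the right is
  possible; so the first order condition is a sign and not perpendicularity.\<close>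

lemma inner_at_first_nearest:
  assumes ab: "0 \<le> a" "a < b" "b \<le> 1" and near: "\<And>s. s \<in> {0..1} \<Longrightarrow> dist (\<gamma> a) x \<le> dist (\<gamma> s) x"
  shows "(\<gamma> a - x) \<bullet> v a \<ge> 0"
proof (rule ccontr)
  assume neg: "\<not> ?thesis"
  have a: "a \<in> {0..1}" using ab by auto
  have "((\<lambda>s. \<gamma> s - x) has_vector_derivative v a) (at a within {0..1})"
    using has_vector_derivative_diff[OF vel[OF a] has_vector_derivative_const[of x]] by simp
  from has_derivative_inner[OF this[unfolded has_vector_derivative_def] this[unfolded has_vector_derivative_def]]
  have "((\<lambda>s. (\<gamma> s - x) \<bullet> (\<gamma> s - x)) has_derivative (\<lambda>h. h * (2 * ((\<gamma> a - x) \<bullet> v a)))) (at a within {0..1})"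
    by (simp add: inner_commute algebra_simps)
  then have "((\<lambda>s. (\<gamma> s - x) \<bullet> (\<gamma> s - x)) has_real_derivative 2 * ((\<gamma> a - x) \<bullet> v a)) (at a within {0..1})"
    by (simp only: has_field_derivative_def mult_commute_abs)
  from has_real_derivative_neg_dec_right[OF this] neg obtain d where d: "d > 0"
    "\<And>h. h > 0 \<Longrightarrow> a + h \<in> {0..1} \<Longrightarrow> h < d \<Longrightarrow>
      (\<gamma> (a + h) - x) \<bullet> (\<gamma> (a + h) - x) < (\<gamma> a - x) \<bullet> (\<gamma> a - x)" by auto
  define h where "h = min (d/2) (b - a)"
  have h: "h > 0" "a + h \<in> {0..1}" "h < d" using ab d(1) by (auto simp: h_def min_def)
  have "norm (\<gamma> (a + h) - x) < norm (\<gamma> a - x)"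
    using d(2)[OF h] by (simp add: norm_eq_sqrt_inner)
  then show False using near[OF h(2)] by (simp add: dist_norm)
qed

lemma inner_at_last_nearest:
  assumes ab: "0 \<le> a" "a < b" "b \<le> 1" and near: "\<And>s. s \<in> {0..1} \<Longrightarrow> dist (\<gamma> b) x \<le> dist (\<gamma> s) x"
  shows "(\<gamma> b - x) \<bullet> v b \<le> 0"
proof (rule ccontr)
  assume pos: "\<not> ?thesis"
  have b: "b \<in> {0..1}" using ab by auto
  have "((\<lambda>s. \<gamma> s - x) has_vector_derivative v b) (at b within {0..1})"
    using has_vector_derivative_diff[OF vel[OF b] has_vector_derivative_const[of x]] by simp
  from has_derivative_inner[OF this[unfolded has_vector_derivative_def] this[unfolded has_vector_derivative_def]]
  have "((\<lambda>s. (\<gamma> s - x) \<bullet> (\<gamma> s - x)) has_derivative (\<lambda>h. h * (2 * ((\<gamma> b - x) \<bullet> v b)))) (at b within {0..1})"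
    by (simp add: inner_commute algebra_simps)
  then have "((\<lambda>s. (\<gamma> s - x) \<bullet> (\<gamma> s - x)) has_real_derivative 2 * ((\<gamma> b - x) \<bullet> v b)) (at b within {0..1})"
    by (simp only: has_field_derivative_def mult_commute_abs)
  from has_real_derivative_pos_inc_left[OF this] pos obtain d where d: "d > 0"
    "\<And>h. h > 0 \<Longrightarrow> b - h \<in> {0..1} \<Longrightarrow> h < d \<Longrightarrow>
      (\<gamma> (b - h) - x) \<bullet> (\<gamma> (b - h) - x) < (\<gamma> b - x) \<bullet> (\<gamma> b - x)" by auto
  define h where "h = min (d/2) (b - a)"
  have h: "h > 0" "b - h \<in> {0..1}" "h < d" using ab d(1) by (auto simp: h_def min_def)
  have "norm (\<gamma> (b - h) - x) < norm (\<gamma> b - x)"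
    using d(2)[OF h] by (simp add: norm_eq_sqrt_inner)
  then show False using near[OF h(2)] by (simp add: dist_norm)
qed

text \<open>Both radii to \<open>x\<close> and the chord are compared with the tangent at the midpoint \<open>m\<close> of the arc:
  the bound on turning makes the chord too long for two feet of perpendiculars at distance
  \<open>r < 1 / k\<close>.\<close>

lemma arc_between_nearest_points_long:
  assumes k: "k > 0" "max_ksq \<le> k\<^sup>2" and ab: "0 \<le> a" "a < b" "b \<le> 1"
    and r: "dist (\<gamma> a) x = r" "dist (\<gamma> b) x = r" "r * k < 1"
    and near: "\<And>s. s \<in> {0..1} \<Longrightarrow> r \<le> dist (\<gamma> s) x"
  shows "arclen b - arclen a > pi / k"
proof (rule ccontr)
  define L where "L = arclen b - arclen a"
  assume "\<not> ?thesis"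
  then have L: "k * L \<le> pi" using k by (simp add: L_def field_simps)
  have bound: "\<bar>arccos (n \<bullet> sgn (v q)) - arccos (n \<bullet> sgn (v p))\<bar> \<le> k * (arclen q - arclen p)"
    if "norm n = 1" "0 \<le> p" "p \<le> q" "q \<le> 1" for n p q
    using angle_bound[OF that(1) _ k(2) that(2-4)] k(1) by simp
  have "continuous_on {a..b} arclen"
    by (rule continuous_on_subset[OF continuous_on_arclen]) (use ab in auto)
  moreover have Lge: "L \<ge> 0" using arclen_mono[of a b] ab by (simp add: L_def)
  ultimately obtain m where m: "a \<le> m" "m \<le> b" "arclen m = (arclen a + arclen b) / 2"
    using IVT'[of arclen a "(arclen a + arclen b) / 2" b] ab by (auto simp: L_def)
  define n where "n = sgn (v m)"
  have nz: "v s \<noteq> 0" if "s \<in> {0..1}" for s using v_nz that by blast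
  have n1: "norm n = 1" using nz[of m] m ab by (simp add: n_def norm_sgn)
  have nm: "n \<bullet> sgn (v m) = 1" using n1 by (simp add: n_def norm_eq_1)
  have lm: "arclen b - arclen m = L/2" "arclen m - arclen a = L/2" using m by (simp_all add: L_def field_simps)
  \<comment> \<open>From the midpoint the tangent turns by at most \<open>k\<close> times the
    distance travelled, and up to angle pi the cosine is decreasing.\<close>
  have near_mid: "n \<bullet> sgn (v s) \<ge> cos (k * (arclen s - arclen m))" if s: "s \<in> {a..b}" for s
  proof -
    have in1: "\<bar>n \<bullet> sgn (v s)\<bar> \<le> 1"
      using Cauchy_Schwarz_ineq2[of n "sgn (v s)"] n1 by (auto simp: norm_sgn split: if_splits)
    have "arccos (n \<bullet> sgn (v s)) \<le> \<bar>k * (arclen s - arclen m)\<bar>"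
    proof (cases "s \<le> m")
      case True
      then show ?thesis
        using bound[OF n1, of s m] s ab m(1,2) nm arclen_mono[of s m] k(1) by (auto simp: abs_mult)
    next
      case False
      then show ?thesis
        using bound[OF n1, of m s] s ab m(1,2) nm arclen_mono[of m s] k(1) by (auto simp: abs_mult)
    qed
    moreover have "\<bar>k * (arclen s - arclen m)\<bar> \<le> pi"
    proof -
      have "arclen a \<le> arclen s" "arclen s \<le> arclen b" using arclen_mono s ab by auto
      then have "\<bar>arclen s - arclen m\<bar> \<le> L" using lm Lge by linarith
      then have "k * \<bar>arclen s - arclen m\<bar> \<le> k * L" using k by (intro mult_left_mono) auto
      then have "k * \<bar>arclen s - arclen m\<bar> \<le> pi" using L by linarith
      then show ?thesis using k(1) by (simp add: abs_mult)
    qed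
    ultimately have "cos \<bar>k * (arclen s - arclen m)\<bar> \<le> cos (arccos (n \<bullet> sgn (v s)))"
      using arccos_bounded in1 by (intro cos_monotone_0_pi_le) (auto simp: abs_le_iff)
    then show ?thesis using in1 by (simp add: abs_le_iff cos_abs_real)
  qed
  \<comment> \<open>Integration of the previous bound: in direction \<open>n\<close> the arc
    advances at least as far as a circular arc of radius \<open>1 / k\<close> and equal
    length.\<close>
  have chord: "n \<bullet> (\<gamma> b - \<gamma> a) \<ge> 2 * sin (k * L / 2) / k"
  proof -
    define F where "F s = n \<bullet> \<gamma> s - sin (k * (arclen s - arclen m)) / k" for s
    have "F a \<le> F b"
    proof (rule mono_off_finite[where f=F and a=a and b=b and E="{}" and f'="\<lambda>s. n \<bullet> v s - cos (k * (arclen s - arclen m)) * norm (v s)"])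
      show "continuous_on {a..b} F"
        unfolding F_def
        by (intro continuous_intros continuous_on_subset[OF cont_\<gamma>] continuous_on_subset[OF continuous_on_arclen])
          (use ab k in auto)
      fix s assume s: "s \<in> {a<..<b} - {}"
      then have s01: "s \<in> {0<..<1}" using ab by auto
      have "((\<lambda>s. n \<bullet> \<gamma> s) has_derivative (\<lambda>h. n \<bullet> (h *\<^sub>R v s))) (at s)"
        using vel_at[OF s01] unfolding has_vector_derivative_def by (rule has_derivative_inner_right)
      then have 1: "((\<lambda>s. n \<bullet> \<gamma> s) has_real_derivative n \<bullet> v s) (at s)"
        by (simp add: has_field_derivative_def mult_commute_abs)
      have "(F has_real_derivative n \<bullet> v s - (cos (k * (arclen s - arclen m)) * (k * (norm (v s) - 0))) / k) (at s)"
        unfolding F_def[abs_def]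
        by (intro DERIV_diff 1 DERIV_cdivide DERIV_chain2[OF DERIV_sin] DERIV_cmult
            arclen_derivative_at[OF s01] DERIV_const)
      then have "(F has_real_derivative n \<bullet> v s - cos (k * (arclen s - arclen m)) * norm (v s)) (at s)"
        using k by simp
      moreover have "cos (k * (arclen s - arclen m)) * norm (v s) \<le> (n \<bullet> sgn (v s)) * norm (v s)"
        using near_mid[of s] s by (intro mult_right_mono) auto
      moreover have "(n \<bullet> sgn (v s)) * norm (v s) = n \<bullet> v s"
        using nz[of s] s01 by (simp add: sgn_div_norm)
      ultimately show "(F has_real_derivative n \<bullet> v s - cos (k * (arclen s - arclen m)) * norm (v s)) (at s) \<and>
          0 \<le> n \<bullet> v s - cos (k * (arclen s - arclen m)) * norm (v s)" by auto
    qed (use ab in auto)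
    moreover have "k * (arclen b - arclen m) = k * L / 2" "k * (arclen a - arclen m) = - (k * L / 2)"
      using lm by (simp_all add: field_simps)
    ultimately show ?thesis by (simp add: F_def inner_diff_right)
  qed
  \<comment> \<open>The angle of a radius with the tangent at its foot is at most a right angle, and
    the tangent turns by at most \<open>k * L / 2\<close> on the way to the midpoint.\<close>
  have perp: "u \<bullet> n \<ge> - r * sin (k * L / 2)"
    if u: "norm u = r" "u \<bullet> sgn (v s) \<ge> 0" "s = a \<or> s = b" for u s
  proof (cases "r = 0")
    case False
    then have "r > 0" using r(1) zero_le_dist[of "\<gamma> a" x] by linarith
    define e where "e = u /\<^sub>R r"
    have e1: "norm e = 1" using u \<open>r > 0\<close> by (simp add: e_def)
    have "0 \<le> e \<bullet> sgn (v s)" "e \<bullet> sgn (v s) \<le> 1"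
      using u \<open>r > 0\<close> Cauchy_Schwarz_ineq2[of e "sgn (v s)"] e1 by (auto simp: e_def norm_sgn split: if_splits)
    then have "arccos (e \<bullet> sgn (v s)) \<le> pi / 2" by (rule arccos_le_pi2)
    moreover have "\<bar>arccos (e \<bullet> sgn (v m)) - arccos (e \<bullet> sgn (v s))\<bar> \<le> k * (L/2)"
      using u(3) bound[OF e1, of a m, unfolded lm] bound[OF e1, of m b, unfolded lm] ab m(1,2)
      by (auto simp: abs_minus_commute)
    ultimately have "arccos (e \<bullet> n) \<le> pi/2 + k * L/2" unfolding n_def by linarith
    moreover have in1: "\<bar>e \<bullet> n\<bar> \<le> 1" using Cauchy_Schwarz_ineq2[of e n] e1 n1 by simp
    ultimately have "cos (pi/2 + k * L/2) \<le> cos (arccos (e \<bullet> n))"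
      using arccos_bounded L by (intro cos_monotone_0_pi_le) (auto simp: abs_le_iff)
    then have "- sin (k * L / 2) \<le> e \<bullet> n"
      using in1 by (simp add: abs_le_iff cos_add)
    then have "r * (- sin (k * L / 2)) \<le> r * (e \<bullet> n)" using \<open>r > 0\<close> by (intro mult_left_mono) auto
    moreover have "r * (e \<bullet> n) = u \<bullet> n" using \<open>r > 0\<close> by (simp add: e_def field_simps)
    ultimately show ?thesis by simp
  qed (use u in simp)
  have "0 \<le> (\<gamma> a - x) \<bullet> v a" by (rule inner_at_first_nearest[OF ab]) (use r near in auto)
  then have A: "(\<gamma> a - x) \<bullet> n \<ge> - r * sin (k * L / 2)"
    using r(1) by (intro perp[of _ a]) (auto simp: dist_norm sgn_div_norm)
  have "(\<gamma> b - x) \<bullet> v b \<le> 0" by (rule inner_at_last_nearest[OF ab]) (use r near in auto)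
  then have "0 \<le> (x - \<gamma> b) \<bullet> sgn (v b)"
    by (simp add: sgn_div_norm inner_diff_left divide_simps)
  then have B: "(x - \<gamma> b) \<bullet> n \<ge> - r * sin (k * L / 2)"
    using r(2) by (intro perp[of _ b]) (auto simp: dist_norm norm_minus_commute)
  have "n \<bullet> (\<gamma> b - \<gamma> a) = - ((x - \<gamma> b) \<bullet> n) - (\<gamma> a - x) \<bullet> n"
    by (simp add: inner_diff_left inner_diff_right inner_commute)
  then have "2 * sin (k * L / 2) / k \<le> 2 * r * sin (k * L / 2)" using A B chord by linarith
  then have "sin (k * L / 2) * (1 - r * k) \<le> 0" using k(1) by (simp add: field_simps)
  \<comment> \<open>Strict positivity of the sine needs an arc of positive length: a constant
    \<open>arclen\<close> would mean zero speed.\<close>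
  moreover have "L > 0"
  proof -
    have "arclen a < arclen b"
    proof (rule ccontr)
      assume "\<not> arclen a < arclen b"
      then have eq: "arclen s = arclen a" if "s \<in> {a..b}" for s
        using arclen_mono[of a s] arclen_mono[of s b] that ab by fastforce
      define s where "s = (a + b) / 2"
      have s: "s \<in> {a<..<b}" "s \<in> {0<..<1}" using ab by (auto simp: s_def)
      have "((\<lambda>_. arclen a) has_real_derivative norm (v s)) (at s)"
      proof (rule has_field_derivative_transform_within[OF arclen_derivative_at[OF s(2)], of "min (s - a) (b - s)"])
        fix y assume "dist y s < min (s - a) (b - s)"
        then have "y \<in> {a..b}" by (simp add: dist_real_def) linarith
        then show "arclen y = arclen a" by (rule eq)
      qed (use s(1) in auto)
      then have "norm (v s) = 0" by (rule DERIV_unique) (rule DERIV_const)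
      then show False using nz[of s] s by auto
    qed
    then show ?thesis by (simp add: L_def)
  qed
  then have "sin (k * L / 2) > 0" using L k(1) pi_gt_zero by (intro sin_gt_zero mult_pos_pos divide_pos_pos) linarith+
  ultimately show False using r(3) by (simp add: mult_le_0_iff)
qed

end

section \<open>Reach and thickness of links\<close>

text \<open>Nearest points on different components at distance below \<open>R\<close> would join the
  components by a path shorter than \<open>2 * R\<close>. A nearest point of the union is nearest on
  its own component too, so what remains is uniqueness on single components, which is the hypothesis
  \<open>U\<close>.\<close>

lemma reach_ge:
  assumes "compact L1" "compact L2" "L1 \<noteq> {}" "L2 \<noteq> {}"
    and R: "2 * R \<le> setdist L1 L2"
    and U: "\<And>L x p q r. L = L1 \<or> L = L2 \<Longrightarrow> p \<in> L \<Longrightarrow> q \<in> L \<Longrightarrow> dist p x = r \<Longrightarrow> dist q x = r \<Longrightarrow>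
      (\<And>y. y \<in> L \<Longrightarrow> r \<le> dist y x) \<Longrightarrow> r < R \<Longrightarrow> p = q"
  shows "ereal R \<le> reach (L1 \<union> L2)"
proof -
  define L where "L = L1 \<union> L2"
  have L: "closed L" "L \<noteq> {}" using assms by (auto simp: L_def intro!: compact_imp_closed)
  have "\<exists>!y. y \<in> L \<and> dist x y = infdist x L" if x: "infdist x L < R" for x
  proof -
    obtain p where p: "p \<in> L" "infdist x L = dist x p"
      using infdist_attains_inf[OF L] by blast
    have le: "infdist x L \<le> dist y x" if "y \<in> L" for y
      using infdist_le[OF that, of x] by (simp add: dist_commute)
    have far: False if "y \<in> L1" "z \<in> L2" "dist x y = infdist x L" "dist x z = infdist x L" for y z
    proof -
      have "setdist L1 L2 \<le> dist y z" using that by (intro setdist_le_dist)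
      also have "\<dots> \<le> dist x y + dist x z" using dist_triangle3[of y z x] by simp
      finally show False using that x R by simp
    qed
    have "y = p" if y: "y \<in> L" "dist x y = infdist x L" for y
    proof -
      have d: "dist y x = infdist x L" "dist p x = infdist x L" using y p by (auto simp: dist_commute)
      consider "y \<in> L1" "p \<in> L1" | "y \<in> L2" "p \<in> L2" | "y \<in> L1" "p \<in> L2" | "y \<in> L2" "p \<in> L1"
        using y(1) p(1) by (auto simp: L_def)
      then show ?thesis
      proof cases
        case 1 show ?thesis by (rule U[OF _ 1 d le x]) (simp_all add: L_def)
      next
        case 2 show ?thesis by (rule U[OF _ 2 d le x]) (simp_all add: L_def)
      next
        case 3 show ?thesis using far[OF 3 y(2) p(2)[symmetric]] ..
      next
        case 4 show ?thesis using far[OF 4(2) 4(1) p(2)[symmetric] y(2)] ..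
      qed
    qed
    note uniq = this
    show ?thesis
    proof (rule ex1I[of _ p])
      show "p \<in> L \<and> dist x p = infdist x L" using p by simp
      show "y = p" if "y \<in> L \<and> dist x y = infdist x L" for y
        using uniq that by blast
    qed
  qed
  then show ?thesis
    unfolding reach_def L_def[symmetric] by (intro Sup_upper) blast
qed

text \<open>The midpoint of a shortest segment between the components has both ends of the segment
  at equal distance, and nothing on the link is closer.\<close>

lemma reach_le_half_setdist:
  assumes "compact L1" "compact L2" "L1 \<noteq> {}" "L2 \<noteq> {}" and pos: "0 < setdist L1 L2"
  shows "reach (L1 \<union> L2) \<le> ereal (setdist L1 L2 / 2)"
  unfolding reach_def
proof (rule Sup_least, clarify)
  fix r assume r: "\<forall>x. infdist x (L1 \<union> L2) < r \<longrightarrow> (\<exists>!y. y \<in> L1 \<union> L2 \<and> dist x y = infdist x (L1 \<union> L2))"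
  define D where "D = setdist L1 L2"
  obtain p q where pq: "p \<in> L1" "q \<in> L2" "dist p q = D"
    using setdist_compact_closed[OF assms(1) compact_imp_closed[OF assms(2)]] assms(3,4) D_def by metis
  define x where "x = midpoint p q"
  have x: "dist x p = D/2" "dist x q = D/2"
    using pq by (simp_all add: x_def dist_midpoint)
  have "D/2 \<ge> r"
  proof (rule ccontr)
    assume *: "\<not> ?thesis"
    have le: "infdist x (L1 \<union> L2) \<le> D/2" using infdist_le[of p "L1 \<union> L2" x] pq x by simp
    then have "infdist x (L1 \<union> L2) < r" using * by linarith
    then have "\<exists>!y. y \<in> L1 \<union> L2 \<and> dist x y = infdist x (L1 \<union> L2)" using r by blast
    then obtain y where y: "y \<in> L1 \<union> L2" "dist x y = infdist x (L1 \<union> L2)"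
      and uniq: "\<And>z. z \<in> L1 \<union> L2 \<Longrightarrow> dist x z = infdist x (L1 \<union> L2) \<Longrightarrow> z = y"
      by (elim ex1E conjE) blast
    show False
    proof (cases "infdist x (L1 \<union> L2) = D/2")
      case True
      then have "p = q" using uniq[of p] uniq[of q] pq x by auto
      then show False using pq pos by (simp add: D_def)
    next
      case False
      then have lt: "dist x y < D/2" using le y by simp
      have "dist y q < D" "dist p y < D"
        using dist_triangle[of y q x] dist_triangle[of p y x] lt x by (auto simp: dist_commute)
      moreover have "y \<in> L1 \<Longrightarrow> D \<le> dist y q" "y \<in> L2 \<Longrightarrow> D \<le> dist p y"
        using pq by (auto simp: D_def intro: setdist_le_dist)
      ultimately show False using y by auto
    qed
  qed
  then show "ereal r \<le> ereal (setdist L1 L2 / 2)" by (simp add: D_def)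
qed

text \<open>Thickness as a real function of the largest squared curvature \<open>M\<close> and the
  distance \<open>D\<close>. The test by multiplication gives \<open>D\<close> for a straight link,
  where \<open>1 / (\<sigma> * sqrt M)\<close> would be 0 by convention instead of infinite.\<close>

definition thick_val :: "real \<Rightarrow> real \<Rightarrow> real \<Rightarrow> real" where
  "thick_val \<sigma> M D = (if \<sigma> * sqrt M * D \<le> 1 then D else 1 / (\<sigma> * sqrt M))"

text \<open>Either the lower bound on the reach is \<open>D/2\<close>, which is also its upper
  bound, or the reach is at least \<open>1 / sqrt M\<close>. In the latter case \<sigma> at least
  1/2 makes the curvature term at most twice the reach, so it decides. The floor 1/2 under
  \<open>sqrt M\<close> keeps the divisor positive and, as \<open>D\<close> is at most 4, is never
  the active bound in the second case.\<close>

lemma thickness_eq_thick_val: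
  assumes \<sigma>: "0 \<le> \<sigma>" and c: "compact (path_image \<gamma>1)" "compact (path_image \<gamma>2)"
    and D: "D = setdist (path_image \<gamma>1) (path_image \<gamma>2)" "0 < D" "D \<le> 4"
    and M: "0 \<le> M" and curv: "0 < \<sigma> \<Longrightarrow> min_curv_radius \<gamma>1 \<gamma>2 = inverse (ereal (sqrt M))"
    and reach: "1/2 \<le> \<sigma> \<Longrightarrow>
      ereal (min (D/2) (1 / max (sqrt M) (1/2))) \<le> reach (path_image \<gamma>1 \<union> path_image \<gamma>2)"
  shows "thickness \<sigma> \<gamma>1 \<gamma>2 = ereal (thick_val \<sigma> M D)"
proof (cases "\<sigma> = 0")
  case True
  then show ?thesis by (simp add: thickness_def thick_val_def D)
next
  case False
  then have \<sigma>: "\<sigma> > 0" using \<sigma> by simp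
  have min_eq: "min (ereal D) (min_curv_radius \<gamma>1 \<gamma>2 / ereal \<sigma>) = ereal (thick_val \<sigma> M D)"
  proof (cases "M = 0")
    case True
    then show ?thesis using \<sigma> by (simp add: curv thick_val_def)
  next
    case False
    then have sM: "sqrt M > 0" using M by simp
    have "min_curv_radius \<gamma>1 \<gamma>2 / ereal \<sigma> = ereal (1 / (\<sigma> * sqrt M))"
      using curv \<sigma> sM by (simp add: divide_ereal_def field_simps)
    then show ?thesis
      using \<sigma> sM by (auto simp: thick_val_def min_def field_simps)
  qed
  show ?thesis
  proof (cases "\<sigma> \<ge> 1/2")
    case False
    then show ?thesis using min_eq \<sigma> by (simp add: thickness_def D)
  next
    case big: True
    define L where "L = path_image \<gamma>1 \<union> path_image \<gamma>2"
    have ne: "path_image \<gamma>1 \<noteq> {}" "path_image \<gamma>2 \<noteq> {}" by (auto simp: path_image_def)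
    have up: "reach L \<le> ereal (D/2)"
      unfolding L_def D(1) by (rule reach_le_half_setdist) (use c ne D in auto)
    have low: "ereal (min (D/2) (1 / max (sqrt M) (1/2))) \<le> reach L"
      unfolding L_def by (rule reach[OF big])
    have "reach L \<noteq> - \<infinity>"
    proof
      assume "reach L = - \<infinity>"
      with low have "ereal (min (D/2) (1 / max (sqrt M) (1/2))) \<le> - \<infinity>" by (simp only:)
      then show False by (simp del: ereal_min)
    qed
    then obtain \<rho> where \<rho>: "reach L = ereal \<rho>"
      using up by (cases "reach L") auto
    have th: "thickness \<sigma> \<gamma>1 \<gamma>2 = min (ereal (2 * \<rho>)) (min_curv_radius \<gamma>1 \<gamma>2 / ereal \<sigma>)"
      using big \<rho> by (simp add: thickness_def L_def)
    show ?thesis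
    proof (cases "D/2 \<le> 1 / max (sqrt M) (1/2)")
      case True
      then have "2 * \<rho> = D" using up low \<rho> by (simp add: min_def)
      then show ?thesis using th min_eq by simp
    next
      case False
      have "1 / max (sqrt M) (1/2) < 2" using False D(3) by simp
      then have m: "sqrt M > 1/2" by (auto simp: max_def field_simps split: if_splits)
      then have mx: "max (sqrt M) (1/2) = sqrt M" by simp
      then have \<rho>1: "\<rho> \<ge> 1 / sqrt M" using low \<rho> False by (simp add: min_def)
      have "1 / \<sigma> \<le> 2" using big by (simp add: field_simps)
      then have "1 / \<sigma> / sqrt M \<le> 2 / sqrt M" using m by (intro divide_right_mono) linarith+
      then have "1 / (\<sigma> * sqrt M) \<le> 2 / sqrt M" by simp
      have "M \<noteq> 0" using m by auto
      then have curv': "min_curv_radius \<gamma>1 \<gamma>2 / ereal \<sigma> = ereal (1 / (\<sigma> * sqrt M))"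
        using curv \<sigma> m by (simp add: divide_ereal_def field_simps)
      have "D > 2 / sqrt M" using False mx by simp
      then have "D > 1 / (\<sigma> * sqrt M)" "2 * \<rho> \<ge> 1 / (\<sigma> * sqrt M)"
        using \<open>1 / (\<sigma> * sqrt M) \<le> 2 / sqrt M\<close> \<rho>1 by auto
      then show ?thesis using th min_eq curv' by (simp add: min_def)
    qed
  qed
qed

locale two_pw_curves = c1: pw_curve \<gamma>1 v1 P1 + c2: pw_curve \<gamma>2 v2 P2
  for \<gamma>1 v1 P1 \<gamma>2 v2 P2
begin

definition all_jets where "all_jets = c1.jets \<union> c2.jets"

definition all_max_ksq :: real where
  "all_max_ksq = (SUP (x, V, A)\<in>all_jets. ksq V A)"

lemma all_max_ksq_eq: "all_max_ksq = max c1.max_ksq c2.max_ksq"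
proof -
  have b: "bdd_above ((\<lambda>(x, V, A). ksq V A) ` c1.jets)" "bdd_above ((\<lambda>(x, V, A). ksq V A) ` c2.jets)"
    by (rule c1.max_ksq_attained, force intro!: bdd_aboveI2, rule c2.max_ksq_attained, force intro!: bdd_aboveI2)
  then show ?thesis
    unfolding all_max_ksq_def all_jets_def image_Un c1.max_ksq_def c2.max_ksq_def
    by (subst cSup_union_distrib) (auto simp: c1.jets_nonempty c2.jets_nonempty sup_max)
qed

lemma all_max_ksq_nonneg: "0 \<le> all_max_ksq"
  using c1.max_ksq_nonneg by (simp add: all_max_ksq_eq le_max_iff_disj)

lemma min_curv_radius_eq: "min_curv_radius \<gamma>1 \<gamma>2 = inverse (ereal (sqrt all_max_ksq))"
proof (cases "c1.max_ksq \<le> c2.max_ksq")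
  case True
  then have "inverse (ereal (sqrt c2.max_ksq)) \<le> inverse (ereal (sqrt c1.max_ksq))"
    by (intro ereal_inverse_antimono) (auto simp: c1.max_ksq_nonneg)
  then show ?thesis
    using True by (simp add: min_curv_radius_def c1.INF_curv_radius c2.INF_curv_radius all_max_ksq_eq min_def max_def)
next
  case False
  then have "inverse (ereal (sqrt c1.max_ksq)) \<le> inverse (ereal (sqrt c2.max_ksq))"
    by (intro ereal_inverse_antimono) (auto simp: c2.max_ksq_nonneg)
  then show ?thesis
    using False by (auto simp: min_curv_radius_def c1.INF_curv_radius c2.INF_curv_radius all_max_ksq_eq min_def max_def)
qed

lemma compact_images: "compact (path_image \<gamma>1)" "compact (path_image \<gamma>2)"
  unfolding path_image_def
  by (auto intro!: compact_continuous_image c1.cont_\<gamma> c2.cont_\<gamma>)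

end

text \<open>Two nearest points at distance below \<open>R\<close> are separated by an arc longer
  than \<open>pi / k\<close>, hence by a chord of at least \<open>2 * R\<close>, against the
  triangle inequality through \<open>x\<close>.\<close>

lemma (in pw_curve) nearest_point_unique:
  assumes k: "k > 0" "max_ksq \<le> k\<^sup>2" "R * k \<le> 1"
    and far: "\<And>a b. 0 \<le> a \<Longrightarrow> a < b \<Longrightarrow> b \<le> 1 \<Longrightarrow> arclen b - arclen a > pi / k \<Longrightarrow> 2 * R \<le> dist (\<gamma> a) (\<gamma> b)"
    and p: "p \<in> path_image \<gamma>" "dist p x = r" and q: "q \<in> path_image \<gamma>" "dist q x = r"
    and near: "\<And>y. y \<in> path_image \<gamma> \<Longrightarrow> r \<le> dist y x" and "r < R"
  shows "p = q"
proof -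
  have rk: "r * k < 1" using mult_strict_right_mono[OF \<open>r < R\<close> k(1)] k(3) by linarith
  have *: False if ab: "0 \<le> a" "a < b" "b \<le> 1" and d: "dist (\<gamma> a) x = r" "dist (\<gamma> b) x = r" for a b
  proof -
    have "arclen b - arclen a > pi / k"
      by (rule arc_between_nearest_points_long[OF k(1,2) ab d rk]) (use near in \<open>auto simp: path_image_def\<close>)
    from far[OF ab this] have "2 * R \<le> dist (\<gamma> a) x + dist (\<gamma> b) x"
      using dist_triangle2[of "\<gamma> a" "\<gamma> b" x] by linarith
    then show False using d \<open>r < R\<close> by simp
  qed
  obtain a b where ab: "a \<in> {0..1}" "b \<in> {0..1}" "p = \<gamma> a" "q = \<gamma> b"
    using p q by (auto simp: path_image_def)
  consider "a < b" | "b < a" | "a = b" by linarith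
  then show ?thesis
    using *[of a b] *[of b a] ab p q by cases auto
qed

section \<open>The first variation of thickness\<close>

text \<open>Squared distances depend smoothly on the positions, so Danskin's theorem is applied to
  their infimum and the root is taken afterwards.\<close>

lemma setdist_image_eq_sqrt_INF:
  fixes f :: "'a::topological_space \<Rightarrow> real^3"
  assumes "compact A" "compact B" "A \<noteq> {}" "B \<noteq> {}" "continuous_on A f" "continuous_on B f"
  shows "setdist (f ` A) (f ` B) = sqrt (INF (p, q)\<in>A \<times> B. (f p - f q) \<bullet> (f p - f q))"
proof -
  have c: "compact (f ` A)" "compact (f ` B)" using assms by (auto intro: compact_continuous_image)
  obtain x y where "x \<in> f ` A" "y \<in> f ` B" "dist x y = setdist (f ` A) (f ` B)"
    using setdist_compact_closed[OF c(1) compact_imp_closed[OF c(2)]] assms(3,4) by blast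
  then obtain p q where pq: "p \<in> A" "q \<in> B" "dist (f p) (f q) = setdist (f ` A) (f ` B)" by auto
  have sq: "(f a - f b) \<bullet> (f a - f b) = (dist (f a) (f b))\<^sup>2" for a b
    by (simp add: dist_norm power2_norm_eq_inner)
  have "(INF (p, q)\<in>A \<times> B. (f p - f q) \<bullet> (f p - f q)) = (\<lambda>(p, q). (f p - f q) \<bullet> (f p - f q)) (p, q)"
  proof (rule INF_eq_attained)
    fix y assume "y \<in> A \<times> B"
    then obtain a b where y: "y = (a, b)" "a \<in> A" "b \<in> B" by auto
    then have "dist (f p) (f q) \<le> dist (f a) (f b)" unfolding pq(3) by (intro setdist_le_dist) auto
    then show "(\<lambda>(p, q). (f p - f q) \<bullet> (f p - f q)) (p, q) \<le> (\<lambda>(p, q). (f p - f q) \<bullet> (f p - f q)) y"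
      unfolding y(1) prod.case sq by (intro power_mono) auto
  qed (use pq in auto)
  then show ?thesis using pq(3) sq by simp
qed

lemma has_real_derivative_right_cong:
  fixes f g :: "real \<Rightarrow> real"
  assumes "(f has_real_derivative d) (at_right 0)" "\<forall>\<^sub>F t in at_right 0. g t = f t" "g 0 = f 0"
  shows "(g has_real_derivative d) (at_right 0)"
proof -
  have "\<forall>\<^sub>F t in at_right 0. (f t - f 0) / (t - 0) = (g t - g 0) / (t - 0)"
    using assms(2) by eventually_elim (simp add: assms(3))
  with assms(1) show ?thesis
    unfolding has_field_derivative_iff by (rule Lim_transform_eventually)
qed

lemma has_real_derivative_right_tendsto:
  assumes "(f has_real_derivative d) (at_right 0)"
  shows "(f \<longlongrightarrow> f 0) (at_right (0::real))"
  using DERIV_continuous[OF assms] by (simp add: continuous_within)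

text \<open>The directional derivative of \<open>ksq\<close> at \<open>(W, B)\<close> in the
  direction \<open>(W', B')\<close>, as the quotient rule yields it.\<close>

definition kdot :: "real^3 \<Rightarrow> real^3 \<Rightarrow> real^3 \<Rightarrow> real^3 \<Rightarrow> real" where
  "kdot W B W' B' =
    ((2 * (W \<bullet> W') * (B \<bullet> B) + (W \<bullet> W) * (2 * (B \<bullet> B')) - 2 * (W \<bullet> B) * (W' \<bullet> B + W \<bullet> B')) * (W \<bullet> W) ^ 3
      - ((W \<bullet> W) * (B \<bullet> B) - (W \<bullet> B)\<^sup>2) * (3 * (W \<bullet> W)\<^sup>2 * (2 * (W \<bullet> W')))) / ((W \<bullet> W) ^ 3 * (W \<bullet> W) ^ 3)"

lemma inner_has_real_derivative:
  fixes f g :: "real \<Rightarrow> 'a::real_inner"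
  assumes "(f has_vector_derivative f') (at t)" "(g has_vector_derivative g') (at t)"
  shows "((\<lambda>t. f t \<bullet> g t) has_real_derivative (f' \<bullet> g t + f t \<bullet> g')) (at t)"
proof -
  have "((\<lambda>t. f t \<bullet> g t) has_vector_derivative (f t \<bullet> g' + f' \<bullet> g t)) (at t)"
    by (rule bounded_bilinear.has_vector_derivative[OF bounded_bilinear_inner assms])
  then show ?thesis
    by (simp add: has_real_derivative_iff_has_vector_derivative add.commute)
qed

lemma ksq_has_real_derivative:
  assumes W: "(W has_vector_derivative W') (at t)" and B: "(B has_vector_derivative B') (at t)"
    and nz: "W t \<noteq> 0"
  shows "((\<lambda>t. ksq (W t) (B t)) has_real_derivative kdot (W t) (B t) W' B') (at t)"
proof -
  note d = inner_has_real_derivative[OF W W] inner_has_real_derivative[OF B B] inner_has_real_derivative[OF W B]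
  have "((\<lambda>t. ((W t \<bullet> W t) * (B t \<bullet> B t) - (W t \<bullet> B t)\<^sup>2) / (W t \<bullet> W t) ^ 3) has_real_derivative
     kdot (W t) (B t) W' B') (at t)"
    by (rule derivative_eq_intros d refl)+ (use nz in \<open>auto simp: kdot_def inner_commute power2_eq_square algebra_simps\<close>)
  then show ?thesis by (simp add: ksq_def)
qed

section \<open>Derivatives of the distance and of the largest curvature along a flow\<close>

context C2_flow
begin

text \<open>\<open>uniform_limit_difference_quotient\<close> asks for time derivatives on a
  two-sided interval, and \<open>ksq\<close> is differentiable only as long as the transported
  velocities do not vanish.\<close>

lemma D1_near_identity_two_sided:
  assumes "compact K"
  obtains e' where "0 < e'" "e' \<le> e" "\<And>t x. t \<in> {-e'<..<e'} \<Longrightarrow> x \<in> K \<Longrightarrow> norm (D1 t x - id_blinfun) < 1"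
proof -
  have c: "continuous_on ({-e<..<e} \<times> K) (\<lambda>(t, x). D1 t x)"
    by (rule continuous_on_subset[OF continuous_D1]) auto
  have "(0::real) < 1/2" by simp
  then obtain X where X: "0 \<in> X" "open X"
    "\<forall>t\<in>X \<inter> {-e<..<e}. \<forall>x\<in>K. dist ((\<lambda>(t, x). D1 t x) (t, x)) ((\<lambda>(t, x). D1 t x) (0, x)) \<le> 1/2"
    using continuous_on_prod_compactE[OF c assms zero_mem] by metis
  then obtain d where d: "d > 0" "ball 0 d \<subseteq> X" using open_contains_ball by metis
  show ?thesis
  proof (rule that[of "min d e"])
    fix t x assume t: "t \<in> {- min d e<..<min d e}" and x: "x \<in> K"
    then have "t \<in> ball 0 d" "t \<in> {-e<..<e}" by (auto simp: dist_real_def)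
    then have "t \<in> X \<inter> {-e<..<e}" using d by blast
    then have "dist (D1 t x) (D1 0 x) \<le> 1/2" using X(3) x by auto
    then show "norm (D1 t x - id_blinfun) < 1" by (simp add: dist_norm D1_0)
  qed (use d e in auto)
qed

lemma apply_near_identity:
  assumes "norm (D1 t x - id_blinfun) \<le> \<delta>"
  shows "norm (blinfun_apply (D1 t x) V - V) \<le> \<delta> * norm V"
proof -
  have "norm (blinfun_apply (D1 t x - id_blinfun) V) \<le> norm (D1 t x - id_blinfun) * norm V" by (rule norm_blinfun)
  also have "\<dots> \<le> \<delta> * norm V" using assms by (intro mult_right_mono) auto
  finally show ?thesis by (simp add: blinfun.diff_left)
qed

lemma continuous_at_time: "t \<in> {-e<..<e} \<Longrightarrow> continuous_on S (\<phi> t)"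
  by (rule has_derivative_continuous_on) (rule has_derivative_at_withinI[OF D1])

text \<open>At time 0 the minimizing pairs are exactly the struts, so \<open>danskin\<close> gives
  the infimum over struts; the last factor 1/2 is the derivative of the root at 1.\<close>

lemma setdist_has_derivative:
  assumes A: "compact A" "A \<noteq> {}" and B: "compact B" "B \<noteq> {}" and one: "setdist A B = 1"
  shows "((\<lambda>t. setdist (\<phi> t ` A) (\<phi> t ` B)) has_real_derivative
    (INF (p, q)\<in>{(p, q)\<in>A \<times> B. (p - q) \<bullet> (p - q) = 1}. 2 * ((p - q) \<bullet> (\<xi> p - \<xi> q))) / 2) (at_right 0)"
proof -
  define K where "K = A \<times> B"
  define f where "f t = (\<lambda>(p, q). (\<phi> t p - \<phi> t q) \<bullet> (\<phi> t p - \<phi> t q))" for t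
  define f' where "f' t = (\<lambda>(p, q). 2 * ((\<phi> t p - \<phi> t q) \<bullet> (V0 t p - V0 t q)))" for t
  have K: "compact K" "K \<noteq> {}" using A B by (auto simp: K_def compact_Times)
  have c\<phi>: "continuous_on ({-e<..<e} \<times> K) (\<lambda>z. \<phi> (fst z) (h (snd z)))"
    and cV: "continuous_on ({-e<..<e} \<times> K) (\<lambda>z. V0 (fst z) (h (snd z)))" if "h = fst \<or> h = snd" for h
  proof -
    have h: "continuous_on ({-e<..<e} \<times> K) (\<lambda>z. (fst z, h (snd z)))"
      using that by (auto intro!: continuous_intros)
    have "continuous_on ({-e<..<e} \<times> K) (\<lambda>z. (\<lambda>(t, x). \<phi> t x) (fst z, h (snd z)))"
      by (rule continuous_on_compose2[OF continuous_\<phi> h]) auto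
    then show "continuous_on ({-e<..<e} \<times> K) (\<lambda>z. \<phi> (fst z) (h (snd z)))" by simp
    have "continuous_on ({-e<..<e} \<times> K) (\<lambda>z. (\<lambda>(t, x). V0 t x) (fst z, h (snd z)))"
      by (rule continuous_on_compose2[OF cV0 h]) auto
    then show "continuous_on ({-e<..<e} \<times> K) (\<lambda>z. V0 (fst z) (h (snd z)))" by simp
  qed
  have cf': "continuous_on ({-e<..<e} \<times> K) (\<lambda>(t, z). f' t z)"
    unfolding f'_def case_prod_unfold
    by (intro continuous_on_mult continuous_on_const continuous_on_inner continuous_on_diff c\<phi> cV) auto
  have ul: "uniform_limit K (\<lambda>t z. (f t z - f 0 z) /\<^sub>R t) (f' 0) (at_right 0)"
  proof (rule uniform_limit_difference_quotient[OF K(1) e cf'])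
    fix t z assume t: "t \<in> {-e<..<e}" and "z \<in> K"
    obtain p q where z: "z = (p, q)" by (rule prod.exhaust)
    have "((\<lambda>t. \<phi> t p - \<phi> t q) has_vector_derivative V0 t p - V0 t q) (at t)"
      by (intro has_vector_derivative_diff V0 t)
    from inner_has_real_derivative[OF this this]
    show "((\<lambda>s. f s z) has_vector_derivative f' t z) (at t)"
      by (simp add: f_def f'_def z has_real_derivative_iff_has_vector_derivative inner_commute)
  qed
  have c0: "continuous_on K (f 0)" "continuous_on K (f' 0)"
  proof -
    show "continuous_on K (f 0)"
      unfolding f_def case_prod_unfold \<phi>0 id_def by (intro continuous_intros)
    have "continuous_on K (\<lambda>z. (\<lambda>(t, z). f' t z) (0, z))"
      by (rule continuous_on_compose2[OF cf']) (use e in \<open>auto intro!: continuous_intros\<close>)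
    then show "continuous_on K (f' 0)" by simp
  qed
  define m where "m t = (INF z\<in>K. f t z)" for t
  have sd: "setdist (\<phi> t ` A) (\<phi> t ` B) = sqrt (m t)" if "t \<in> {-e<..<e}" for t
    unfolding m_def f_def K_def
    by (rule setdist_image_eq_sqrt_INF) (use A B that continuous_at_time in auto)
  have m0: "m 0 = 1" using sd[OF zero_mem] one by (simp add: \<phi>0)
  have "(m has_real_derivative (INF z\<in>{z\<in>K. f 0 z = (INF z\<in>K. f 0 z)}. f' 0 z)) (at_right 0)"
    unfolding m_def[abs_def] by (rule danskin[OF K c0 ul])
  moreover have "{z\<in>K. f 0 z = (INF z\<in>K. f 0 z)} = {(p, q)\<in>A \<times> B. (p - q) \<bullet> (p - q) = 1}"
    using m0 by (auto simp: m_def K_def f_def \<phi>0)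
  moreover have "f' 0 = (\<lambda>(p, q). 2 * ((p - q) \<bullet> (\<xi> p - \<xi> q)))"
    by (simp add: f'_def \<phi>0 V0_0)
  ultimately have dm: "(m has_real_derivative
      (INF (p, q)\<in>{(p, q)\<in>A \<times> B. (p - q) \<bullet> (p - q) = 1}. 2 * ((p - q) \<bullet> (\<xi> p - \<xi> q)))) (at_right 0)"
    by simp
  have "((\<lambda>t. sqrt (m t)) has_real_derivative (inverse (sqrt (m 0)) / 2) *
      (INF (p, q)\<in>{(p, q)\<in>A \<times> B. (p - q) \<bullet> (p - q) = 1}. 2 * ((p - q) \<bullet> (\<xi> p - \<xi> q)))) (at_right 0)"
    by (rule DERIV_chain2[OF DERIV_real_sqrt dm]) (simp add: m0)
  then have "((\<lambda>t. sqrt (m t)) has_real_derivative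
      (INF (p, q)\<in>{(p, q)\<in>A \<times> B. (p - q) \<bullet> (p - q) = 1}. 2 * ((p - q) \<bullet> (\<xi> p - \<xi> q))) / 2) (at_right 0)"
    by (simp add: m0)
  then show ?thesis
  proof (rule has_real_derivative_right_cong)
    show "\<forall>\<^sub>F t in at_right 0. setdist (\<phi> t ` A) (\<phi> t ` B) = sqrt (m t)"
      using eventually_time by eventually_elim (rule sd)
  qed (rule sd[OF zero_mem])
qed

text \<open>Squared curvature of the image curve as a function of the jet of the original one: the
  chain rule gives velocity and acceleration of the image.\<close>

definition pushed_ksq :: "real \<Rightarrow> (real^3) \<times> (real^3) \<times> (real^3) \<Rightarrow> real" where
  "pushed_ksq t = (\<lambda>(x, V, A). ksq (blinfun_apply (D1 t x) V) (blinfun_apply (blinfun_apply (D2 t x) V) V + blinfun_apply (D1 t x) A))"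

lemma pushed_ksq_0: "pushed_ksq 0 (x, V, A) = ksq V A"
  by (simp add: pushed_ksq_def D1_0 D2_0)

text \<open>Danskin's theorem on the compact set of jets, for the negated squared curvature because
  a maximum is wanted; this explains the signs.\<close>

lemma max_pushed_ksq_has_derivative:
  assumes J: "compact J" "J \<noteq> {}" and nz: "\<And>x V A. (x, V, A) \<in> J \<Longrightarrow> V \<noteq> 0"
    and \<xi>1: "\<And>x. (\<xi> has_derivative blinfun_apply (\<xi>1 x)) (at x)"
    and \<xi>2: "\<And>x. (\<xi>1 has_derivative blinfun_apply (\<xi>2 x)) (at x)"
  shows "((\<lambda>t. SUP j\<in>J. pushed_ksq t j) has_real_derivative
    - (INF (x, V, A)\<in>{(x, V, A)\<in>J. - ksq V A = (INF (x, V, A)\<in>J. - ksq V A)}.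
        - kdot V A (blinfun_apply (\<xi>1 x) V) (blinfun_apply (blinfun_apply (\<xi>2 x) V) V + blinfun_apply (\<xi>1 x) A))) (at_right 0)"
proof -
  define W where "W t j = blinfun_apply (D1 t (fst j)) (fst (snd j))" for t and j :: "(real^3) \<times> (real^3) \<times> (real^3)"
  define B where "B t j = blinfun_apply (blinfun_apply (D2 t (fst j)) (fst (snd j))) (fst (snd j))
      + blinfun_apply (D1 t (fst j)) (snd (snd j))" for t and j :: "(real^3) \<times> (real^3) \<times> (real^3)"
  define W' where "W' t j = blinfun_apply (V1 t (fst j)) (fst (snd j))" for t and j :: "(real^3) \<times> (real^3) \<times> (real^3)"
  define B' where "B' t j = blinfun_apply (blinfun_apply (V2 t (fst j)) (fst (snd j))) (fst (snd j))
      + blinfun_apply (V1 t (fst j)) (snd (snd j))" for t and j :: "(real^3) \<times> (real^3) \<times> (real^3)"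
  define f where "f t j = - ksq (W t j) (B t j)" for t j
  define f' where "f' t j = - kdot (W t j) (B t j) (W' t j) (B' t j)" for t j
  have f_eq: "f t j = - pushed_ksq t j" for t j
    by (simp add: f_def W_def B_def pushed_ksq_def case_prod_unfold)
  have "compact (fst ` J)" by (intro compact_continuous_image continuous_on_fst continuous_on_id J)
  from D1_near_identity_two_sided[OF this] obtain e' where e': "0 < e'" "e' \<le> e"
    "\<And>t x. t \<in> {-e'<..<e'} \<Longrightarrow> x \<in> fst ` J \<Longrightarrow> norm (D1 t x - id_blinfun) < 1" by blast
  have sub: "{-e'<..<e'} \<subseteq> {-e<..<e}" using e' by auto
  have Wnz: "W t j \<noteq> 0" if "t \<in> {-e'<..<e'}" "j \<in> J" for t j
  proof
    assume "W t j = 0"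
    obtain x V A where j: "j = (x, V, A)" by (rule prod_cases3)
    have "V \<noteq> 0" using nz that j by simp
    have "norm (blinfun_apply (D1 t x - id_blinfun) V) \<le> norm (D1 t x - id_blinfun) * norm V" by (rule norm_blinfun)
    also have "\<dots> < 1 * norm V"
      using e'(3)[OF that(1), of x] that(2) j \<open>V \<noteq> 0\<close> by (intro mult_strict_right_mono) force+
    finally show False using \<open>W t j = 0\<close> j by (simp add: W_def blinfun.diff_left)
  qed
  define S where "S = {-e'<..<e'} \<times> J"
  have cj: "continuous_on S (\<lambda>z. (fst z, fst (snd z)))" unfolding S_def by (intro continuous_intros)
  have jc: "continuous_on S (\<lambda>z. G (fst z) (fst (snd z)))"
    if "continuous_on ({-e<..<e} \<times> UNIV) (\<lambda>(t, x). G t x)" for G :: "real \<Rightarrow> real^3 \<Rightarrow> 'z::real_normed_vector"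
  proof -
    have "continuous_on S (\<lambda>z. (\<lambda>(t, x). G t x) (fst z, fst (snd z)))"
      by (rule continuous_on_compose2[OF that cj]) (use sub in \<open>auto simp: S_def\<close>)
    then show ?thesis by simp
  qed
  note ba = bounded_bilinear.continuous_on[OF bounded_bilinear_blinfun_apply]
  have c: "continuous_on S (\<lambda>z. W (fst z) (snd z))" "continuous_on S (\<lambda>z. B (fst z) (snd z))"
    "continuous_on S (\<lambda>z. W' (fst z) (snd z))" "continuous_on S (\<lambda>z. B' (fst z) (snd z))"
    unfolding W_def B_def W'_def B'_def
    by (intro continuous_on_add ba jc continuous_D1 continuous_D2 cV1 cV2
        continuous_on_fst continuous_on_snd continuous_on_id)+
  have cf': "continuous_on ({-e'<..<e'} \<times> J) (\<lambda>(t, j). f' t j)"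
    unfolding f'_def kdot_def case_prod_unfold S_def[symmetric]
    by (intro continuous_intros c) (use Wnz in \<open>auto simp: S_def\<close>)
  have ul: "uniform_limit J (\<lambda>t j. (f t j - f 0 j) /\<^sub>R t) (f' 0) (at_right 0)"
  proof (rule uniform_limit_difference_quotient[OF J(1) e'(1) cf'])
    fix t j assume t: "t \<in> {-e'<..<e'}" and j: "j \<in> J"
    have te: "t \<in> {-e<..<e}" using t sub by blast
    have bl: "((\<lambda>t. blinfun_apply (F t) y) has_vector_derivative blinfun_apply F' y) (at t)"
      if "(F has_vector_derivative F') (at t)"
      for F :: "real \<Rightarrow> (real^3) \<Rightarrow>\<^sub>L 'z::real_normed_vector" and F' y
      using bounded_bilinear.has_vector_derivative[OF bounded_bilinear_blinfun_apply that
          has_vector_derivative_const[of y]] by simp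
    have dW: "((\<lambda>t. W t j) has_vector_derivative W' t j) (at t)"
      unfolding W_def W'_def by (rule bl[OF V1[OF te]])
    have dB: "((\<lambda>t. B t j) has_vector_derivative B' t j) (at t)"
      unfolding B_def B'_def by (intro has_vector_derivative_add bl[OF bl[OF V2[OF te]]] bl[OF V1[OF te]])
    have "((\<lambda>t. f t j) has_real_derivative f' t j) (at t)"
      unfolding f_def f'_def by (intro DERIV_minus ksq_has_real_derivative dW dB Wnz t j)
    then show "((\<lambda>s. f s j) has_vector_derivative f' t j) (at t)"
      by (simp only: has_real_derivative_iff_has_vector_derivative)
  qed
  have f0: "f 0 = (\<lambda>(x, V, A). - ksq V A)"
    by (auto simp: f_eq pushed_ksq_0)
  have "continuous_on J (\<lambda>j. - ksq (fst (snd j)) (snd (snd j)))"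
    by (intro continuous_on_minus continuous_on_ksq continuous_on_fst continuous_on_snd continuous_on_id)
      (use nz in force)
  then have c0: "continuous_on J (f 0)" by (simp add: f0 case_prod_unfold)
  have "continuous_on J (\<lambda>z. (\<lambda>(t, z). f' t z) (0, z))"
    by (rule continuous_on_compose2[OF cf']) (use e' in \<open>auto intro!: continuous_intros\<close>)
  then have c1: "continuous_on J (f' 0)" by simp
  have "f' 0 = (\<lambda>(x, V, A). - kdot V A (blinfun_apply (\<xi>1 x) V) (blinfun_apply (blinfun_apply (\<xi>2 x) V) V + blinfun_apply (\<xi>1 x) A))"
    by (auto simp: f'_def W_def B_def W'_def B'_def D1_0 D2_0 V1_0[OF \<xi>1] V2_0[OF \<xi>1 \<xi>2])
  moreover have "{j\<in>J. f 0 j = (INF j\<in>J. f 0 j)} = {(x, V, A)\<in>J. - ksq V A = (INF (x, V, A)\<in>J. - ksq V A)}"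
    by (auto simp: f0)
  ultimately have "((\<lambda>t. INF j\<in>J. f t j) has_real_derivative
     (INF (x, V, A)\<in>{(x, V, A)\<in>J. - ksq V A = (INF (x, V, A)\<in>J. - ksq V A)}.
        - kdot V A (blinfun_apply (\<xi>1 x) V) (blinfun_apply (blinfun_apply (\<xi>2 x) V) V + blinfun_apply (\<xi>1 x) A))) (at_right 0)"
    using danskin[OF J c0 c1 ul] by simp
  from DERIV_minus[OF this] show ?thesis
    by (simp add: f_eq Inf_real_def image_image)
qed

end

section \<open>Images of arcs and links under a flow\<close>

locale flow_on_curve = pw_curve \<gamma> v P + C2_flow \<phi> \<xi> e D1 V1 D2 V2 V0
  for \<gamma> v P \<phi> \<xi> e D1 V1 D2 V2 V0
begin

definition pushed_v :: "real \<Rightarrow> real \<Rightarrow> real^3" where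
  "pushed_v t s = blinfun_apply (D1 t (\<gamma> s)) (v s)"

definition pushed_acc :: "real \<Rightarrow> (real \<Rightarrow> real^3) \<Rightarrow> real \<Rightarrow> real^3" where
  "pushed_acc t A s = blinfun_apply (blinfun_apply (D2 t (\<gamma> s)) (v s)) (v s) + blinfun_apply (D1 t (\<gamma> s)) (A s)"

definition pushed_P :: "real \<Rightarrow> (real \<times> real \<times> (real \<Rightarrow> real^3)) set" where
  "pushed_P t = (\<lambda>(a, b, A). (a, b, pushed_acc t A)) ` P"

lemma pushed_PE:
  assumes "(a, b, A') \<in> pushed_P t"
  obtains A where "(a, b, A) \<in> P" "A' = pushed_acc t A"
  using assms by (auto simp: pushed_P_def)

lemma continuous_on_along:
  fixes G :: "real \<Rightarrow> real^3 \<Rightarrow> 'z::real_normed_vector"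
  assumes "continuous_on ({-e<..<e} \<times> UNIV) (\<lambda>(t, x). G t x)" "t \<in> {-e<..<e}" "S \<subseteq> {0..1}"
  shows "continuous_on S (\<lambda>s. G t (\<gamma> s))"
proof -
  have "continuous_on S (\<lambda>s. (\<lambda>(t, x). G t x) (t, \<gamma> s))"
    by (rule continuous_on_compose2[OF assms(1)])
      (use assms(2) in \<open>auto intro!: continuous_on_Pair continuous_on_const continuous_on_subset[OF cont_\<gamma> assms(3)]\<close>)
  then show ?thesis by simp
qed

text \<open>The pieces are kept and the accelerations follow the chain rule. Closeness of
  \<open>D1\<close> to the identity keeps the velocity nonzero; the bound 1/100 returns in the
  estimates of length and chords.\<close>

lemma pushed_pw_curve:
  assumes t: "t \<in> {-e<..<e}" and near: "\<And>x. x \<in> path_image \<gamma> \<Longrightarrow> norm (D1 t x - id_blinfun) \<le> 1/100"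
  shows "pw_curve (\<phi> t \<circ> \<gamma>) (pushed_v t) (pushed_P t)"
proof
  show "finite (pushed_P t)" using finite_pieces by (simp add: pushed_P_def)
  show "\<exists>a b A. (a, b, A) \<in> pushed_P t \<and> s \<in> {a..b}" if "s \<in> {0..1}" for s
    using cover[OF that] unfolding pushed_P_def by force
  show "0 \<le> a \<and> a < b \<and> b \<le> 1" if "(a, b, A) \<in> pushed_P t" for a b A
    using that piece by (auto elim: pushed_PE)
  note ba = bounded_bilinear.continuous_on[OF bounded_bilinear_blinfun_apply]
  show "(\<phi> t \<circ> \<gamma> has_vector_derivative pushed_v t s) (at s within {0..1})" if s: "s \<in> {0..1}" for s
    unfolding pushed_v_def
    by (rule vector_derivative_diff_chain_within[OF vel[OF s] has_derivative_at_withinI[OF D1[OF t]]])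
  show "pushed_v t s \<noteq> 0" if s: "s \<in> {0..1}" for s
  proof
    assume "pushed_v t s = 0"
    moreover have "norm (blinfun_apply (D1 t (\<gamma> s)) (v s) - v s) \<le> 1/100 * norm (v s)"
      by (rule apply_near_identity[OF near]) (use s in \<open>auto simp: path_image_def\<close>)
    ultimately show False using v_nz[OF s] by (simp add: pushed_v_def)
  qed
  show "continuous_on {0..1} (pushed_v t)"
    unfolding pushed_v_def[abs_def]
    by (intro ba continuous_on_along[OF continuous_D1 t] cont_v) auto
  fix a b A' assume "(a, b, A') \<in> pushed_P t"
  then obtain A where P: "(a, b, A) \<in> P" and A': "A' = pushed_acc t A" by (rule pushed_PE)
  note sub = piece_subset[OF P]
  show "continuous_on {a..b} A'"
    unfolding A' pushed_acc_def[abs_def]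
    by (intro continuous_on_add ba continuous_on_along[OF continuous_D1 t sub] continuous_on_along[OF continuous_D2 t sub]
        continuous_on_subset[OF cont_v sub] cont_acc[OF P])
  fix s assume s: "s \<in> {a..b}"
  then have s01: "s \<in> {0..1}" using sub by blast
  have "(\<gamma> has_vector_derivative v s) (at s within {a..b})"
    using vel[OF s01] by (rule has_vector_derivative_within_subset[OF _ sub])
  from vector_derivative_diff_chain_within[OF this has_derivative_at_withinI[OF D2[OF t]]]
  have "((\<lambda>s. D1 t (\<gamma> s)) has_vector_derivative blinfun_apply (D2 t (\<gamma> s)) (v s)) (at s within {a..b})"
    by (simp add: o_def)
  from bounded_bilinear.has_vector_derivative[OF bounded_bilinear_blinfun_apply this acc[OF P s]]
  show "(pushed_v t has_vector_derivative A' s) (at s within {a..b})"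
    unfolding A' pushed_acc_def pushed_v_def[abs_def] by (simp add: add.commute)
qed

lemma pushed_ksq_image:
  assumes "pw_curve (\<phi> t \<circ> \<gamma>) (pushed_v t) (pushed_P t)"
  shows "(\<lambda>(x, V, A). ksq V A) ` pw_curve.jets (\<phi> t \<circ> \<gamma>) (pushed_v t) (pushed_P t) = pushed_ksq t ` jets"
proof -
  have eq: "ksq (pushed_v t s) (pushed_acc t A s) = pushed_ksq t (\<gamma> s, v s, A s)" for s A
    by (simp add: pushed_ksq_def pushed_v_def pushed_acc_def)
  show ?thesis
    unfolding pw_curve.jets_def[OF assms] jets_def
    by (simp add: pushed_P_def image_UN image_image case_prod_unfold eq)
qed

lemma pushed_arclen_le:
  assumes t: "t \<in> {-e<..<e}" and near: "\<And>x. x \<in> path_image \<gamma> \<Longrightarrow> norm (D1 t x - id_blinfun) \<le> 1/100"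
    and ab: "0 \<le> a" "a \<le> b" "b \<le> 1"
  shows "pw_curve.arclen (pushed_v t) b - pw_curve.arclen (pushed_v t) a \<le> 101/100 * (arclen b - arclen a)"
proof -
  interpret im: pw_curve "\<phi> t \<circ> \<gamma>" "pushed_v t" "pushed_P t" by (rule pushed_pw_curve[OF t near])
  define F where "F s = 101/100 * arclen s - im.arclen s" for s
  have "F a \<le> F b"
  proof (rule mono_off_finite[where f=F and a=a and b=b and E="{}" and f'="\<lambda>s. 101/100 * norm (v s) - norm (pushed_v t s)"])
    have sub: "{a..b} \<subseteq> {0..1}" using ab by auto
    show "continuous_on {a..b} F"
      unfolding F_def
      by (intro continuous_on_diff continuous_on_mult continuous_on_const
          continuous_on_subset[OF continuous_on_arclen sub] continuous_on_subset[OF im.continuous_on_arclen sub])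
    fix s assume "s \<in> {a<..<b} - {}"
    then have s: "s \<in> {0<..<1}" using ab by auto
    have "norm (blinfun_apply (D1 t (\<gamma> s)) (v s) - v s) \<le> 1/100 * norm (v s)"
      by (rule apply_near_identity[OF near]) (use s in \<open>auto simp: path_image_def\<close>)
    moreover have "norm (pushed_v t s) \<le> norm (v s) + norm (blinfun_apply (D1 t (\<gamma> s)) (v s) - v s)"
      unfolding pushed_v_def using norm_triangle_ineq[of "v s" "blinfun_apply (D1 t (\<gamma> s)) (v s) - v s"] by simp
    ultimately have "0 \<le> 101/100 * norm (v s) - norm (pushed_v t s)" by simp
    moreover have "(F has_real_derivative 101/100 * norm (v s) - norm (pushed_v t s)) (at s)"
      unfolding F_def[abs_def]
      by (intro DERIV_diff DERIV_cmult arclen_derivative_at[OF s] im.arclen_derivative_at[OF s])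
    ultimately show "(F has_real_derivative 101/100 * norm (v s) - norm (pushed_v t s)) (at s) \<and>
        0 \<le> 101/100 * norm (v s) - norm (pushed_v t s)" by blast
  qed (use ab in auto)
  then show ?thesis by (simp add: F_def)
qed

end

locale flow_on_link = two_pw_curves \<gamma>1 v1 P1 \<gamma>2 v2 P2 + C2_flow \<phi> \<xi> e D1 V1 D2 V2 V0
  for \<gamma>1 v1 P1 \<gamma>2 v2 P2 \<phi> \<xi> e D1 V1 D2 V2 V0
begin

sublocale f1: flow_on_curve \<gamma>1 v1 P1 \<phi> \<xi> e D1 V1 D2 V2 V0 ..
sublocale f2: flow_on_curve \<gamma>2 v2 P2 \<phi> \<xi> e D1 V1 D2 V2 V0 ..

definition dist_at where "dist_at t = setdist (\<phi> t ` path_image \<gamma>1) (\<phi> t ` path_image \<gamma>2)"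

definition ksq_at where "ksq_at t = (SUP j\<in>all_jets. pushed_ksq t j)"

text \<open>The constants leave room for a perturbation. An image arc longer than
  \<open>pi / k\<close> comes from an arc longer than 100/101 of that. As \<open>c * k\<close> is at
  most 11/10, and 9/10 times 11/10 is 99/100, still below 100/101, the original arc has length at
  least \<open>9/10 * pi * c\<close>. By \<open>far1\<close> and \<open>far2\<close> its chord is at
  least 26/25, and 99/100 of this exceeds 102/100, an upper bound for \<open>2 * R\<close>.\<close>

lemma thickness_pushed:
  assumes \<sigma>: "0 < \<sigma>" and t: "t \<in> {-e<..<e}"
    and near: "\<And>x. x \<in> path_image \<gamma>1 \<union> path_image \<gamma>2 \<Longrightarrow> norm (D1 t x - id_blinfun) \<le> 1/100"
    and iso: "\<And>p q. p \<in> path_image \<gamma>1 \<union> path_image \<gamma>2 \<Longrightarrow> q \<in> path_image \<gamma>1 \<union> path_image \<gamma>2 \<Longrightarrow>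
      norm ((\<phi> t p - \<phi> t q) - (p - q)) \<le> 1/100 * norm (p - q)"
    and D: "0 < dist_at t" "dist_at t \<le> 102/100"
    and c: "0 < c" "c \<le> 1" "c * sqrt (ksq_at t) \<le> 11/10"
    and far1: "\<And>a b. 1/2 \<le> \<sigma> \<Longrightarrow> 0 \<le> a \<Longrightarrow> a < b \<Longrightarrow> b \<le> 1 \<Longrightarrow> c1.arclen b - c1.arclen a \<ge> 9/10 * pi * c \<Longrightarrow> dist (\<gamma>1 a) (\<gamma>1 b) \<ge> 26/25"
    and far2: "\<And>a b. 1/2 \<le> \<sigma> \<Longrightarrow> 0 \<le> a \<Longrightarrow> a < b \<Longrightarrow> b \<le> 1 \<Longrightarrow> c2.arclen b - c2.arclen a \<ge> 9/10 * pi * c \<Longrightarrow> dist (\<gamma>2 a) (\<gamma>2 b) \<ge> 26/25"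
  shows "thickness \<sigma> (\<phi> t \<circ> \<gamma>1) (\<phi> t \<circ> \<gamma>2) = ereal (thick_val \<sigma> (ksq_at t) (dist_at t))"
proof -
  have near1: "norm (D1 t x - id_blinfun) \<le> 1/100" if "x \<in> path_image \<gamma>1" for x using near that by simp
  have near2: "norm (D1 t x - id_blinfun) \<le> 1/100" if "x \<in> path_image \<gamma>2" for x using near that by simp
  interpret i1: pw_curve "\<phi> t \<circ> \<gamma>1" "f1.pushed_v t" "f1.pushed_P t"
    by (rule f1.pushed_pw_curve[OF t near1])
  interpret i2: pw_curve "\<phi> t \<circ> \<gamma>2" "f2.pushed_v t" "f2.pushed_P t"
    by (rule f2.pushed_pw_curve[OF t near2])
  interpret im: two_pw_curves "\<phi> t \<circ> \<gamma>1" "f1.pushed_v t" "f1.pushed_P t" "\<phi> t \<circ> \<gamma>2" "f2.pushed_v t" "f2.pushed_P t" ..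
  have M: "im.all_max_ksq = ksq_at t"
    unfolding im.all_max_ksq_def im.all_jets_def ksq_at_def all_jets_def image_Un
      f1.pushed_ksq_image[OF i1.pw_curve_axioms] f2.pushed_ksq_image[OF i2.pw_curve_axioms] ..
  have M0: "0 \<le> ksq_at t" using im.all_max_ksq_nonneg M by simp
  define k where "k = max (sqrt (ksq_at t)) (1/2)"
  have k: "k > 0" by (simp add: k_def)
  have Mk: "ksq_at t \<le> k\<^sup>2"
  proof -
    have "sqrt (ksq_at t) \<le> k" by (simp add: k_def)
    then have "(sqrt (ksq_at t))\<^sup>2 \<le> k\<^sup>2" using M0 by (intro power_mono) auto
    then show ?thesis using M0 by simp
  qed
  have mk: "i1.max_ksq \<le> k\<^sup>2" "i2.max_ksq \<le> k\<^sup>2"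
    using Mk im.all_max_ksq_eq M by auto
  have ck: "c * k \<le> 11/10" using c by (auto simp: k_def max_def)
  define R where "R = min (dist_at t / 2) (1 / k)"
  have Rk: "R * k \<le> 1" using k by (simp add: R_def min_def field_simps)
  have long: "9/10 * pi * c \<le> len" if "pi / k < 101/100 * len" for len
  proof -
    have "c \<le> 11/10 / k" using ck k by (simp add: field_simps)
    then have "9/10 * pi * c \<le> 9/10 * pi * (11/10 / k)" by (intro mult_left_mono) auto
    also have "\<dots> = 99/100 * (pi / k)" by simp
    also have "\<dots> \<le> 100/101 * (pi / k)" using k pi_gt_zero by (intro mult_right_mono) auto
    also have "\<dots> \<le> len" using that by linarith
    finally show ?thesis .
  qed
  have chord: "2 * R \<le> dist (\<phi> t p) (\<phi> t q)"
    if "26/25 \<le> dist p q" "p \<in> path_image \<gamma>1 \<union> path_image \<gamma>2" "q \<in> path_image \<gamma>1 \<union> path_image \<gamma>2" for p q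
  proof -
    have "norm (p - q) \<le> norm (\<phi> t p - \<phi> t q) + norm ((\<phi> t p - \<phi> t q) - (p - q))"
      using norm_triangle_ineq4[of "\<phi> t p - \<phi> t q" "(\<phi> t p - \<phi> t q) - (p - q)"] by simp
    then have "99/100 * norm (p - q) \<le> norm (\<phi> t p - \<phi> t q)" using iso[OF that(2,3)] by simp
    moreover have "2 * R \<le> 102/100" using D by (simp add: R_def)
    ultimately show ?thesis using that(1) by (simp add: dist_norm)
  qed
  show ?thesis
  proof (rule thickness_eq_thick_val)
    show "0 \<le> \<sigma>" using \<sigma> by simp
    show "compact (path_image (\<phi> t \<circ> \<gamma>1))" "compact (path_image (\<phi> t \<circ> \<gamma>2))"
      by (rule im.compact_images)+
    show "dist_at t = setdist (path_image (\<phi> t \<circ> \<gamma>1)) (path_image (\<phi> t \<circ> \<gamma>2))"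
      by (simp add: dist_at_def path_image_compose)
    show "0 < dist_at t" "dist_at t \<le> 4" using D by auto
    show "0 \<le> ksq_at t" by (rule M0)
    show "min_curv_radius (\<phi> t \<circ> \<gamma>1) (\<phi> t \<circ> \<gamma>2) = inverse (ereal (sqrt (ksq_at t)))"
      using im.min_curv_radius_eq M by simp
    assume big: "1/2 \<le> \<sigma>"
    have "ereal R \<le> reach (path_image (\<phi> t \<circ> \<gamma>1) \<union> path_image (\<phi> t \<circ> \<gamma>2))"
    proof (rule reach_ge[OF im.compact_images])
      show "2 * R \<le> setdist (path_image (\<phi> t \<circ> \<gamma>1)) (path_image (\<phi> t \<circ> \<gamma>2))"
        by (simp add: R_def dist_at_def path_image_compose)
      fix L x p q r
      assume L: "L = path_image (\<phi> t \<circ> \<gamma>1) \<or> L = path_image (\<phi> t \<circ> \<gamma>2)"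
        and p: "p \<in> L" "dist p x = r" and q: "q \<in> L" "dist q x = r"
        and nearest: "\<And>y. y \<in> L \<Longrightarrow> r \<le> dist y x" and r: "r < R"
      from L show "p = q"
      proof
        assume L: "L = path_image (\<phi> t \<circ> \<gamma>1)"
        show "p = q"
        proof (rule i1.nearest_point_unique[OF k mk(1) Rk])
          fix a b :: real assume ab: "0 \<le> a" "a < b" "b \<le> 1" and "pi / k < i1.arclen b - i1.arclen a"
          then have "pi / k < 101/100 * (c1.arclen b - c1.arclen a)"
            using f1.pushed_arclen_le[OF t near1 ab(1) less_imp_le[OF ab(2)] ab(3)] by linarith
          from far1[OF big ab long[OF this]]
          show "2 * R \<le> dist ((\<phi> t \<circ> \<gamma>1) a) ((\<phi> t \<circ> \<gamma>1) b)"
            unfolding o_def by (rule chord) (use ab in \<open>auto simp: path_image_def\<close>)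
        qed (use p q nearest r L in auto)
      next
        assume L: "L = path_image (\<phi> t \<circ> \<gamma>2)"
        show "p = q"
        proof (rule i2.nearest_point_unique[OF k mk(2) Rk])
          fix a b :: real assume ab: "0 \<le> a" "a < b" "b \<le> 1" and "pi / k < i2.arclen b - i2.arclen a"
          then have "pi / k < 101/100 * (c2.arclen b - c2.arclen a)"
            using f2.pushed_arclen_le[OF t near2 ab(1) less_imp_le[OF ab(2)] ab(3)] by linarith
          from far2[OF big ab long[OF this]]
          show "2 * R \<le> dist ((\<phi> t \<circ> \<gamma>2) a) ((\<phi> t \<circ> \<gamma>2) b)"
            unfolding o_def by (rule chord) (use ab in \<open>auto simp: path_image_def\<close>)
        qed (use p q nearest r L in auto)
      qed
    qed (auto simp: path_image_def)
    then show "ereal (min (dist_at t / 2) (1 / max (sqrt (ksq_at t)) (1 / 2)))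
        \<le> reach (path_image (\<phi> t \<circ> \<gamma>1) \<union> path_image (\<phi> t \<circ> \<gamma>2))"
      by (simp add: R_def k_def)
  qed
qed

lemma ksq_at_0: "ksq_at 0 = all_max_ksq"
proof -
  have "pushed_ksq 0 = (\<lambda>(x, V, A). ksq V A)"
    by (rule ext) (simp add: pushed_ksq_0 split: prod.split)
  then show ?thesis by (simp add: ksq_at_def all_max_ksq_def)
qed

end

text \<open>If the curvature bound is slack at time 0, thickness is the distance for small times. If
  it is tight, both terms of the minimum start at 1 and their derivatives compete.\<close>

lemma thick_val_has_derivative:
  assumes D: "(D has_real_derivative d) (at_right 0)" "D 0 = 1"
    and M: "(M has_real_derivative m) (at_right 0)" "0 \<le> M 0" "\<sigma> * sqrt (M 0) \<le> 1" and \<sigma>: "0 < \<sigma>"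
  shows "((\<lambda>t. thick_val \<sigma> (M t) (D t)) has_real_derivative
    (if \<sigma> * sqrt (M 0) < 1 then d
     else min d (- (\<sigma> * (inverse (sqrt (M 0)) / 2 * m)) / (\<sigma> * sqrt (M 0))\<^sup>2))) (at_right 0)"
proof (cases "\<sigma> * sqrt (M 0) < 1")
  case True
  have "((\<lambda>t. \<sigma> * sqrt (M t) * D t) \<longlongrightarrow> \<sigma> * sqrt (M 0) * D 0) (at_right 0)"
    by (intro tendsto_intros has_real_derivative_right_tendsto[OF D(1)] has_real_derivative_right_tendsto[OF M(1)])
  then have "\<forall>\<^sub>F t in at_right 0. \<sigma> * sqrt (M t) * D t < 1"
    by (rule order_tendstoD) (use True D in simp)
  then have "\<forall>\<^sub>F t in at_right 0. thick_val \<sigma> (M t) (D t) = D t"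
    by eventually_elim (simp add: thick_val_def)
  then have "((\<lambda>t. thick_val \<sigma> (M t) (D t)) has_real_derivative d) (at_right 0)"
    by (rule has_real_derivative_right_cong[OF D(1)]) (use True D in \<open>simp add: thick_val_def\<close>)
  then show ?thesis using True by simp
next
  case False
  then have eq: "\<sigma> * sqrt (M 0) = 1" using M(3) by simp
  then have M0: "M 0 > 0" using M(2) by (cases "M 0 = 0") auto
  have "((\<lambda>t. sqrt (M t)) has_real_derivative inverse (sqrt (M 0)) / 2 * m) (at_right 0)"
    by (rule DERIV_chain2[OF DERIV_real_sqrt[OF M0] M(1)])
  from DERIV_inverse_fun[OF DERIV_cmult[OF this, of \<sigma>]]
  have "((\<lambda>t. 1 / (\<sigma> * sqrt (M t))) has_real_derivative
      - (\<sigma> * (inverse (sqrt (M 0)) / 2 * m)) / (\<sigma> * sqrt (M 0))\<^sup>2) (at_right 0)"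
    using eq by (simp add: inverse_eq_divide power2_eq_square)
  from has_real_derivative_min_right[OF D(1) this]
  have dmin: "((\<lambda>t. min (D t) (1 / (\<sigma> * sqrt (M t)))) has_real_derivative
      min d (- (\<sigma> * (inverse (sqrt (M 0)) / 2 * m)) / (\<sigma> * sqrt (M 0))\<^sup>2)) (at_right 0)"
    using D(2) eq by simp
  have tv: "thick_val \<sigma> (M t) (D t) = min (D t) (1 / (\<sigma> * sqrt (M t)))" if "M t > 0" for t
    using that \<sigma> by (auto simp: thick_val_def min_def field_simps)
  have "\<forall>\<^sub>F t in at_right 0. M t > 0"
    using has_real_derivative_right_tendsto[OF M(1)] M0 by (rule order_tendstoD)
  then have "\<forall>\<^sub>F t in at_right 0. thick_val \<sigma> (M t) (D t) = min (D t) (1 / (\<sigma> * sqrt (M t)))"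
    by eventually_elim (rule tv)
  from has_real_derivative_right_cong[OF dmin this tv[OF M0]]
  have "((\<lambda>t. thick_val \<sigma> (M t) (D t)) has_real_derivative
      min d (- (\<sigma> * (inverse (sqrt (M 0)) / 2 * m)) / (\<sigma> * sqrt (M 0))\<^sup>2)) (at_right 0)" .
  then show ?thesis using False by simp
qed

section \<open>From a shrinking strut to shrinking thickness\<close>

definition strut_variation :: "(real^3 \<Rightarrow> real^3) \<Rightarrow> (real^3) set \<Rightarrow> (real^3) set \<Rightarrow> real" where
  "strut_variation \<xi> A B =
    (INF (p, q)\<in>{(p, q)\<in>A \<times> B. (p - q) \<bullet> (p - q) = 1}. 2 * ((p - q) \<bullet> (\<xi> p - \<xi> q))) / 2"

text \<open>An infimum of reals lies below its members only if it is bounded from below; compactness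
  of the product supplies this.\<close>

lemma strut_variation_neg:
  assumes "compact A" "compact B" "continuous_on UNIV \<xi>"
    and pq: "p \<in> A" "q \<in> B" "dist p q = 1" "(p - q) \<bullet> (\<xi> p - \<xi> q) < 0"
  shows "strut_variation \<xi> A B < 0"
proof -
  define f where "f = (\<lambda>(p, q). 2 * ((p - q) \<bullet> (\<xi> p - \<xi> q)))"
  have "continuous_on (A \<times> B) f"
    unfolding f_def case_prod_unfold
    by (intro continuous_intros continuous_on_compose2[OF assms(3)]) auto
  then have "bounded (f ` (A \<times> B))"
    by (intro compact_imp_bounded compact_continuous_image compact_Times assms)
  then have "bdd_below (f ` (A \<times> B))" by (rule bounded_imp_bdd_below)
  then have "bdd_below (f ` {(p, q)\<in>A \<times> B. (p - q) \<bullet> (p - q) = 1})"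
    by (rule bdd_below_mono) auto
  moreover have "(p, q) \<in> {(p, q)\<in>A \<times> B. (p - q) \<bullet> (p - q) = 1}"
    using pq by (simp add: dist_norm norm_eq_1)
  ultimately have "(INF z\<in>{(p, q)\<in>A \<times> B. (p - q) \<bullet> (p - q) = 1}. f z) \<le> f (p, q)"
    by (rule cINF_lower)
  also have "f (p, q) < 0" using pq by (simp add: f_def)
  finally show ?thesis by (simp add: strut_variation_def f_def)
qed

lemma C2_map_continuous: "C2_map \<xi> \<Longrightarrow> continuous_on UNIV \<xi>"
  unfolding C2_map_def by (metis has_derivative_continuous continuous_at_imp_continuous_on)

theorem thickness_0_variation:
  assumes "compact (path_image \<gamma>1)" "compact (path_image \<gamma>2)" "setdist (path_image \<gamma>1) (path_image \<gamma>2) = 1"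
    and "C2_map \<xi>" and pq: "p \<in> path_image \<gamma>1" "q \<in> path_image \<gamma>2" "dist p q = 1" "(p - q) \<bullet> (\<xi> p - \<xi> q) < 0"
  shows "\<exists>d<0. has_thickness_variation 0 \<gamma>1 \<gamma>2 \<xi> d"
proof (intro exI conjI)
  show "strut_variation \<xi> (path_image \<gamma>1) (path_image \<gamma>2) < 0"
    by (rule strut_variation_neg[OF assms(1,2) C2_map_continuous[OF assms(4)] pq])
  show "has_thickness_variation 0 \<gamma>1 \<gamma>2 \<xi> (strut_variation \<xi> (path_image \<gamma>1) (path_image \<gamma>2))"
    unfolding has_thickness_variation_def
  proof (intro allI impI)
    fix \<phi> assume "C1_family_C2_diffeos \<phi> \<xi>"
    then obtain e D1 V1 D2 V2 V0 where "C2_flow \<phi> \<xi> e D1 V1 D2 V2 V0" by (rule C1_family_C2_diffeosE)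
    from C2_flow.setdist_has_derivative[OF this assms(1) _ assms(2) _ assms(3)] pq
    show "((\<lambda>t. real_of_ereal (thickness 0 (\<phi> t \<circ> \<gamma>1) (\<phi> t \<circ> \<gamma>2))) has_real_derivative
        strut_variation \<xi> (path_image \<gamma>1) (path_image \<gamma>2)) (at_right 0)"
      unfolding strut_variation_def by (auto simp: thickness_def path_image_compose)
  qed
qed

context two_pw_curves
begin

text \<open>Here \<open>c\<close> is a common lower bound for the radii of curvature of both arcs,
  at most 1. Chords are controlled only for \<sigma> at least 1/2, where thickness involves the
  reach.\<close>

context
  fixes \<sigma> c :: real
  assumes \<sigma>: "0 < \<sigma>" "\<sigma> \<le> c" and c: "c \<le> 1" "c * sqrt all_max_ksq \<le> 1"
    and one: "setdist (path_image \<gamma>1) (path_image \<gamma>2) = 1"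
    and far1: "\<And>a b. 1/2 \<le> \<sigma> \<Longrightarrow> 0 \<le> a \<Longrightarrow> a < b \<Longrightarrow> b \<le> 1 \<Longrightarrow> c1.arclen b - c1.arclen a \<ge> 9/10 * pi * c \<Longrightarrow> dist (\<gamma>1 a) (\<gamma>1 b) \<ge> 26/25"
    and far2: "\<And>a b. 1/2 \<le> \<sigma> \<Longrightarrow> 0 \<le> a \<Longrightarrow> a < b \<Longrightarrow> b \<le> 1 \<Longrightarrow> c2.arclen b - c2.arclen a \<ge> 9/10 * pi * c \<Longrightarrow> dist (\<gamma>2 a) (\<gamma>2 b) \<ge> 26/25"
begin

lemma \<sigma>_ksq: "\<sigma> * sqrt all_max_ksq \<le> 1"
proof -
  have "\<sigma> * sqrt all_max_ksq \<le> c * sqrt all_max_ksq"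
    using \<sigma> all_max_ksq_nonneg by (intro mult_right_mono) auto
  then show ?thesis using c by simp
qed

lemma thickness_at_0:
  assumes "C2_flow \<phi> \<xi> e D1 V1 D2 V2 V0"
  shows "thickness \<sigma> (\<phi> 0 \<circ> \<gamma>1) (\<phi> 0 \<circ> \<gamma>2) = 1"
    "thickness \<sigma> (\<phi> 0 \<circ> \<gamma>1) (\<phi> 0 \<circ> \<gamma>2) = ereal (thick_val \<sigma> (flow_on_link.ksq_at \<gamma>1 v1 P1 \<gamma>2 v2 P2 D1 D2 0) (flow_on_link.dist_at \<gamma>1 \<gamma>2 \<phi> 0))"
proof -
  interpret C2_flow \<phi> \<xi> e D1 V1 D2 V2 V0 by fact
  interpret flow_on_link \<gamma>1 v1 P1 \<gamma>2 v2 P2 \<phi> \<xi> e D1 V1 D2 V2 V0 ..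
  have D: "dist_at 0 = 1" using one by (simp add: dist_at_def \<phi>0)
  show *: "thickness \<sigma> (\<phi> 0 \<circ> \<gamma>1) (\<phi> 0 \<circ> \<gamma>2) = ereal (thick_val \<sigma> (ksq_at 0) (dist_at 0))"
    by (rule thickness_pushed[where c=c, OF \<sigma>(1) zero_mem]) (use D D1_0 \<phi>0 \<sigma> c ksq_at_0 far1 far2 in auto)
  have "thick_val \<sigma> (ksq_at 0) (dist_at 0) = 1"
    using \<sigma>_ksq by (simp add: thick_val_def D ksq_at_0)
  then show "thickness \<sigma> (\<phi> 0 \<circ> \<gamma>1) (\<phi> 0 \<circ> \<gamma>2) = 1" using * by simp
qed

lemma thickness_eq_1: "thickness \<sigma> \<gamma>1 \<gamma>2 = 1"
  using thickness_at_0(1)[OF constant_flow] by simp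

theorem thickness_variation:
  assumes \<xi>: "C2_map \<xi>"
    and pq: "p \<in> path_image \<gamma>1" "q \<in> path_image \<gamma>2" "dist p q = 1" "(p - q) \<bullet> (\<xi> p - \<xi> q) < 0"
  shows "\<exists>d<0. has_thickness_variation \<sigma> \<gamma>1 \<gamma>2 \<xi> d"
proof -
  obtain \<xi>1 \<xi>2 where \<xi>1: "\<And>x. (\<xi> has_derivative blinfun_apply (\<xi>1 x)) (at x)"
    and \<xi>2: "\<And>x. (\<xi>1 has_derivative blinfun_apply (\<xi>2 x)) (at x)"
    using \<xi> unfolding C2_map_def by blast
  define d where "d = strut_variation \<xi> (path_image \<gamma>1) (path_image \<gamma>2)"
  \<comment> \<open>The candidate derivative of the largest squared curvature; with it the variation
    exists also when the curvature constraint is tight.\<close>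
  define m where "m = - (INF (x, V, A)\<in>{(x, V, A)\<in>all_jets. - ksq V A = (INF (x, V, A)\<in>all_jets. - ksq V A)}.
        - kdot V A (blinfun_apply (\<xi>1 x) V) (blinfun_apply (blinfun_apply (\<xi>2 x) V) V + blinfun_apply (\<xi>1 x) A))"
  define d' where "d' = (if \<sigma> * sqrt all_max_ksq < 1 then d
     else min d (- (\<sigma> * (inverse (sqrt all_max_ksq) / 2 * m)) / (\<sigma> * sqrt all_max_ksq)\<^sup>2))"
  have "d < 0"
    unfolding d_def by (rule strut_variation_neg[OF compact_images C2_map_continuous[OF \<xi>] pq])
  \<comment> \<open>A minimum with \<open>d\<close> can only be more negative than
    \<open>d\<close>.\<close>
  then have "d' < 0" by (simp add: d'_def min_def)
  moreover have "has_thickness_variation \<sigma> \<gamma>1 \<gamma>2 \<xi> d'"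
    unfolding has_thickness_variation_def
  proof (intro allI impI)
    fix \<phi> assume "C1_family_C2_diffeos \<phi> \<xi>"
    then obtain e D1 V1 D2 V2 V0 where flow: "C2_flow \<phi> \<xi> e D1 V1 D2 V2 V0" by (rule C1_family_C2_diffeosE)
    interpret C2_flow \<phi> \<xi> e D1 V1 D2 V2 V0 by (rule flow)
    interpret flow_on_link \<gamma>1 v1 P1 \<gamma>2 v2 P2 \<phi> \<xi> e D1 V1 D2 V2 V0 ..
    have D0: "dist_at 0 = 1" using one by (simp add: dist_at_def \<phi>0)
    have dD: "(dist_at has_real_derivative d) (at_right 0)"
      unfolding d_def strut_variation_def dist_at_def[abs_def]
      by (rule setdist_has_derivative[OF compact_images(1) _ compact_images(2) _ one]) (use pq in auto)
    have "compact all_jets" "all_jets \<noteq> {}"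
      using c1.compact_jets c2.compact_jets c1.jets_nonempty by (auto simp: all_jets_def)
    moreover have "V \<noteq> 0" if "(x, V, A) \<in> all_jets" for x V A
      using that c1.jet_velocity_nz c2.jet_velocity_nz unfolding all_jets_def by blast
    ultimately have dM: "(ksq_at has_real_derivative m) (at_right 0)"
      unfolding m_def ksq_at_def[abs_def] by (rule max_pushed_ksq_has_derivative[OF _ _ _ \<xi>1 \<xi>2])
    have dT: "((\<lambda>t. thick_val \<sigma> (ksq_at t) (dist_at t)) has_real_derivative d') (at_right 0)"
      unfolding d'_def ksq_at_0[symmetric]
      by (rule thick_val_has_derivative[OF dD D0 dM]) (use \<sigma> \<sigma>_ksq all_max_ksq_nonneg ksq_at_0 in auto)
    have "bounded (path_image \<gamma>1 \<union> path_image \<gamma>2)"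
      using compact_images by (auto intro: compact_imp_bounded)
    then obtain r where r: "path_image \<gamma>1 \<union> path_image \<gamma>2 \<subseteq> cball 0 r"
      by (force simp: bounded_iff)
    have tD: "\<forall>\<^sub>F t in at_right 0. dist_at t < 102/100" "\<forall>\<^sub>F t in at_right 0. 0 < dist_at t"
      by (rule order_tendstoD[OF has_real_derivative_right_tendsto[OF dD]], simp add: D0)+
    have "((\<lambda>t. c * sqrt (ksq_at t)) \<longlongrightarrow> c * sqrt (ksq_at 0)) (at_right 0)"
      by (intro tendsto_intros has_real_derivative_right_tendsto[OF dM])
    then have tM: "\<forall>\<^sub>F t in at_right 0. c * sqrt (ksq_at t) < 11/10"
      by (rule order_tendstoD) (use c ksq_at_0 in simp)
    have n1: "\<forall>\<^sub>F t in at_right 0. \<forall>x\<in>cball 0 r. norm (D1 t x - id_blinfun) < 1/100"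
      by (rule D1_near_identity) auto
    have n2: "\<forall>\<^sub>F t in at_right 0. \<forall>p\<in>cball 0 r. \<forall>q\<in>cball 0 r. norm ((\<phi> t p - \<phi> t q) - (p - q)) \<le> 1/100 * norm (p - q)"
      by (rule nearly_isometric) auto
    have "\<forall>\<^sub>F t in at_right 0. real_of_ereal (thickness \<sigma> (\<phi> t \<circ> \<gamma>1) (\<phi> t \<circ> \<gamma>2)) = thick_val \<sigma> (ksq_at t) (dist_at t)"
      using eventually_time tD tM n1 n2
    proof eventually_elim
      case (elim t)
      have "thickness \<sigma> (\<phi> t \<circ> \<gamma>1) (\<phi> t \<circ> \<gamma>2) = ereal (thick_val \<sigma> (ksq_at t) (dist_at t))"
      proof (rule thickness_pushed[where c=c, OF \<sigma>(1) elim(1)])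
        show "norm (D1 t x - id_blinfun) \<le> 1/100" if "x \<in> path_image \<gamma>1 \<union> path_image \<gamma>2" for x
          using elim(5) r that by (blast intro: less_imp_le)
        show "norm ((\<phi> t p - \<phi> t q) - (p - q)) \<le> 1/100 * norm (p - q)"
          if "p \<in> path_image \<gamma>1 \<union> path_image \<gamma>2" "q \<in> path_image \<gamma>1 \<union> path_image \<gamma>2" for p q
          using elim(6) r that by blast
      qed (use elim \<sigma> c far1 far2 in auto)
      then show ?case by simp
    qed
    then show "((\<lambda>t. real_of_ereal (thickness \<sigma> (\<phi> t \<circ> \<gamma>1) (\<phi> t \<circ> \<gamma>2))) has_real_derivative d') (at_right 0)"
      by (rule has_real_derivative_right_cong[OF dT]) (simp add: thickness_at_0(2)[OF flow])
  qed
  ultimately show ?thesis by blast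
qed

end

end

section \<open>The clasp curve by arclength\<close>

text \<open>The oriented integral from 0 to \<open>x\<close>: for each sign of \<open>x\<close> one
  of the two integrals is over an empty interval and vanishes.\<close>

definition prim :: "(real \<Rightarrow> real) \<Rightarrow> real \<Rightarrow> real" where
  "prim f x = integral {0..x} f - integral {x..0} f"

lemma prim_0 [simp]: "prim f 0 = 0"
  by (simp add: prim_def)

lemma prim_has_derivative:
  assumes f: "continuous_on UNIV f"
  shows "(prim f has_real_derivative f x) (at x)"
proof -
  define M where "M = \<bar>x\<bar> + 1"
  have int: "f integrable_on {a..b}" for a b
    by (intro integrable_continuous_interval continuous_on_subset[OF f]) simp
  have eq: "prim f y = integral {-M..y} f - integral {-M..0} f" if y: "y \<in> {-M<..<M}" for y
  proof (cases "y \<ge> 0")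
    case True
    have "integral {-M..0} f + integral {0..y} f = integral {-M..y} f"
      by (rule Henstock_Kurzweil_Integration.integral_combine) (use True int in \<open>auto simp: M_def\<close>)
    moreover have "integral {y..0} f = 0" using True by (cases "y = 0") auto
    ultimately show ?thesis by (simp add: prim_def)
  next
    case False
    have "integral {-M..y} f + integral {y..0} f = integral {-M..0} f"
      by (rule Henstock_Kurzweil_Integration.integral_combine) (use False y int in auto)
    then show ?thesis using False by (simp add: prim_def)
  qed
  have x: "x \<in> {-M<..<M}" by (auto simp: M_def)
  have "((\<lambda>y. integral {-M..y} f) has_real_derivative f x) (at x within {-M..M})"
    using x by (intro integral_has_real_derivative continuous_on_subset[OF f]) auto
  moreover have "at x within {-M..M} = at x" using x by (intro at_within_interior) auto
  ultimately have "((\<lambda>y. integral {-M..y} f - integral {-M..0} f) has_real_derivative f x - 0) (at x)"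
    by (intro DERIV_diff DERIV_const) simp
  then show ?thesis
    using has_field_derivative_transform_within_open[of _ "f x" x "{-M<..<M}" "prim f"] x eq by simp
qed

lemma prim_odd:
  assumes f: "continuous_on UNIV f" "\<And>x. f (- x) = f x"
  shows "prim f (- x) = - prim f x"
proof -
  have "((\<lambda>x. prim f (- x) + prim f x) has_real_derivative (f (- y) * (- 1) + f y)) (at y)" for y
    by (intro DERIV_add DERIV_chain2[OF prim_has_derivative] prim_has_derivative f DERIV_minus DERIV_ident)
  then have "\<forall>y. ((\<lambda>x. prim f (- x) + prim f x) has_real_derivative 0) (at y)" by (simp add: f(2))
  from DERIV_isconst_all[OF this, of x 0] show ?thesis by simp
qed

lemma prim_even:
  assumes f: "continuous_on UNIV f" "\<And>x. f (- x) = - f x"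
  shows "prim f (- x) = prim f x"
proof -
  have "((\<lambda>x. prim f (- x) - prim f x) has_real_derivative (f (- y) * (- 1) - f y)) (at y)" for y
    by (intro DERIV_diff DERIV_chain2[OF prim_has_derivative] prim_has_derivative f DERIV_minus DERIV_ident)
  then have "\<forall>y. ((\<lambda>x. prim f (- x) - prim f x) has_real_derivative 0) (at y)" by (simp add: f(2))
  from DERIV_isconst_all[OF this, of x 0] show ?thesis by simp
qed

text \<open>Derivatives are compared in the open interval only, because at \<tau> = 1 the formulas
  for the clasp are singular at ends of the parameter interval.\<close>

lemma eq_of_derivatives:
  fixes f g :: "real \<Rightarrow> real"
  assumes "continuous_on {a..b} f" "continuous_on {a..b} g" "f a = g a"
    and d: "\<And>x. x \<in> {a<..<b} \<Longrightarrow> (f has_real_derivative d x) (at x)" "\<And>x. x \<in> {a<..<b} \<Longrightarrow> (g has_real_derivative d x) (at x)"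
    and x: "x \<in> {a..b}"
  shows "f x = g x"
proof (cases "x = a")
  case False
  then have "a < x" using x by auto
  have "(\<lambda>y. f y - g y) x = (\<lambda>y. f y - g y) a"
  proof (rule DERIV_isconst2[of a x])
    show "continuous_on {a..x} (\<lambda>y. f y - g y)"
      using x by (intro continuous_on_diff continuous_on_subset[OF assms(1)] continuous_on_subset[OF assms(2)]) auto
    show "((\<lambda>y. f y - g y) has_real_derivative 0) (at y)" if "a < y" "y < x" for y
      using DERIV_diff[OF d(1) d(2), of y] that x by auto
  qed (use \<open>a < x\<close> in auto)
  then show ?thesis using assms(3) by simp
qed (use assms in simp)

lemma DERIV_sqrt:
  assumes "(f has_real_derivative f') (at x)" "f x > 0"
  shows "((\<lambda>x. sqrt (f x)) has_real_derivative f' / (2 * sqrt (f x))) (at x)"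
  using DERIV_chain2[OF DERIV_real_sqrt[OF assms(2)] assms(1)] by (simp add: field_simps)

section \<open>The end angle and the explicit formulas\<close>

locale clasp_param =
  fixes \<tau> :: real
  assumes \<tau>: "0 \<le> \<tau>" "\<tau> \<le> 1"
begin

definition \<theta> :: real where "\<theta> = arcsin \<tau>"
definition c :: real where "c = sqrt (1 - \<tau>\<^sup>2)"

lemma \<theta>: "0 \<le> \<theta>" "\<theta> \<le> pi/2" "sin \<theta> = \<tau>" "cos \<theta> = c" "\<theta> < pi"
proof -
  show "0 \<le> \<theta>" using \<tau> arcsin_le_arcsin[of 0 \<tau>] by (simp add: \<theta>_def)
  show "\<theta> \<le> pi/2" using \<tau> arcsin_ubound[of \<tau>] by (simp add: \<theta>_def)
  then show "\<theta> < pi" using pi_gt_zero by linarith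
  show "sin \<theta> = \<tau>" "cos \<theta> = c" using \<tau> by (simp_all add: \<theta>_def c_def cos_arcsin)
qed

lemma c: "0 \<le> c" "c \<le> 1" "c\<^sup>2 = 1 - \<tau>\<^sup>2"
  using \<tau> by (auto simp: c_def power_le_one)

lemma c_pos_iff: "0 < c \<longleftrightarrow> \<tau> < 1"
proof -
  have "0 < c \<longleftrightarrow> \<tau>\<^sup>2 < 1" by (simp add: c_def)
  also have "\<dots> \<longleftrightarrow> \<tau> < 1" using \<tau> by (simp add: abs_square_less_1)
  finally show ?thesis .
qed

lemma sin_mem: "\<alpha> \<in> {-\<theta>..\<theta>} \<Longrightarrow> sin \<alpha> \<in> {-\<tau>..\<tau>}"
  using sin_monotone_2pi_le[of "-\<theta>" \<alpha>] sin_monotone_2pi_le[of \<alpha> \<theta>] \<theta> by auto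

lemma arcsin_mem: "u \<in> {-\<tau>..\<tau>} \<Longrightarrow> arcsin u \<in> {-\<theta>..\<theta>}"
  using arcsin_le_arcsin[of "-\<tau>" u] arcsin_le_arcsin[of u \<tau>] \<tau> arcsin_minus[of \<tau>] by (auto simp: \<theta>_def)

text \<open>The arithmetic-geometric mean inequality for \<open>u\<close> and
  \<open>\<tau> - u\<close>; it keeps the denominators of the explicit formulas away from 0.\<close>

lemma prod_small:
  assumes "0 \<le> u" "u \<le> \<tau>"
  shows "0 \<le> u\<^sup>2 * (\<tau> - u)\<^sup>2" "u\<^sup>2 * (\<tau> - u)\<^sup>2 \<le> 1/16"
proof -
  have "4 * (u * (\<tau> - u)) \<le> \<tau>\<^sup>2" using zero_le_power2[of "u - (\<tau> - u)"] by (simp add: power2_eq_square algebra_simps)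
  also have "\<dots> \<le> 1" using \<tau> by (simp add: power_le_one)
  finally have "u * (\<tau> - u) \<le> 1/4" by simp
  then have "(u * (\<tau> - u))\<^sup>2 \<le> (1/4)\<^sup>2" using assms by (intro power_mono) auto
  moreover have "(1/4::real)\<^sup>2 = 1/16" by (simp add: power2_eq_square)
  ultimately show "u\<^sup>2 * (\<tau> - u)\<^sup>2 \<le> 1/16" by (simp only: power_mult_distrib)
qed simp

text \<open>The radius of curvature R at tangent sine \<open>u\<close>. It is also dx/du: arclength
  satisfies ds = R d\<alpha>, so dx = cos \<alpha> ds = R du.\<close>

definition g :: "real \<Rightarrow> real" where "g u = 1 / clasp_kappa \<tau> u"

lemma g_even: "g (- u) = g u"
  by (simp add: g_def clasp_kappa_def)

lemma g_eq:
  assumes "0 \<le> u"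
  shows "g u = (1 - (\<tau> - u)\<^sup>2 + (\<tau> - u) * u * (1 - u\<^sup>2)) / sqrt ((1 - u\<^sup>2 * (\<tau> - u)\<^sup>2) ^ 3 * (1 - (\<tau> - u)\<^sup>2))"
  using assms by (simp add: g_def clasp_kappa_def)

lemma g_pos:
  assumes "\<bar>u\<bar> \<le> \<tau>" "u \<noteq> 0 \<or> \<tau> < 1"
  shows "g u > 0"
proof -
  have *: "g u > 0" if u: "0 \<le> u" "u \<le> \<tau>" "u \<noteq> 0 \<or> \<tau> < 1" for u
  proof -
    have w: "0 \<le> \<tau> - u" "\<tau> - u < 1" using u \<tau> by auto
    then have "(\<tau> - u)\<^sup>2 < 1" by (simp add: abs_square_less_1)
    moreover have "u\<^sup>2 \<le> 1" using u \<tau> by (simp add: power_le_one)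
    moreover have "1 - u\<^sup>2 * (\<tau> - u)\<^sup>2 > 0" using prod_small[OF u(1,2)] by simp
    ultimately show ?thesis
      unfolding g_eq[OF u(1)] using u w by (intro divide_pos_pos real_sqrt_gt_zero mult_pos_pos add_pos_nonneg mult_nonneg_nonneg zero_less_power) auto
  qed
  show ?thesis using *[of u] *[of "- u"] g_even[of u] assms by (cases "u \<ge> 0") auto
qed

lemma g_nonneg: "\<bar>u\<bar> \<le> \<tau> \<Longrightarrow> g u \<ge> 0"
proof (cases "u \<noteq> 0 \<or> \<tau> < 1")
  case False
  then have "u = 0" "\<tau> = 1" using \<tau> by auto
  then show ?thesis unfolding g_def by (simp add: clasp_kappa_def)
qed (use g_pos[of u] in auto)

lemma g_at_\<tau>: "g \<tau> = 1"
  using g_eq[of \<tau>] \<tau> by simp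

text \<open>For \<tau> = 1 a factor \<open>sqrt u\<close> cancels between numerator and denominator.
  What remains is continuous and vanishes at 0, in agreement with the value that division by zero
  assigns there.\<close>

lemma continuous_on_g_nonneg: "continuous_on {0..\<tau>} g"
proof (cases "\<tau> < 1")
  case True
  have "continuous_on {0..\<tau>} (\<lambda>u. (1 - (\<tau> - u)\<^sup>2 + (\<tau> - u) * u * (1 - u\<^sup>2)) / sqrt ((1 - u\<^sup>2 * (\<tau> - u)\<^sup>2) ^ 3 * (1 - (\<tau> - u)\<^sup>2)))"
  proof (intro continuous_intros ballI)
    fix u assume u: "u \<in> {0..\<tau>}"
    have "1 - u\<^sup>2 * (\<tau> - u)\<^sup>2 > 0" using prod_small[of u] u by simp
    moreover have "(\<tau> - u)\<^sup>2 < 1" using u True by (simp add: abs_square_less_1)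
    ultimately show "sqrt ((1 - u\<^sup>2 * (\<tau> - u)\<^sup>2) ^ 3 * (1 - (\<tau> - u)\<^sup>2)) \<noteq> 0" by simp
  qed
  then show ?thesis by (rule continuous_on_eq) (simp add: g_eq)
next
  case False
  then have \<tau>1: "\<tau> = 1" using \<tau> by simp
  have "continuous_on {0..1} (\<lambda>u. sqrt u * (2 - u + (1 - u) * (1 - u\<^sup>2)) / sqrt ((1 - u\<^sup>2 * (1 - u)\<^sup>2) ^ 3 * (2 - u)))"
  proof (intro continuous_intros ballI)
    fix u :: real assume u: "u \<in> {0..1}"
    have "1 - u\<^sup>2 * (1 - u)\<^sup>2 > 0" using prod_small[of u] u \<tau>1 by simp
    then show "sqrt ((1 - u\<^sup>2 * (1 - u)\<^sup>2) ^ 3 * (2 - u)) \<noteq> 0" using u by simp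
  qed
  moreover have "sqrt u * (2 - u + (1 - u) * (1 - u\<^sup>2)) / sqrt ((1 - u\<^sup>2 * (1 - u)\<^sup>2) ^ 3 * (2 - u)) = g u" if u: "u \<in> {0..1}" for u
  proof (cases "u = 0")
    case True
    then show ?thesis unfolding g_def by (simp add: clasp_kappa_def \<tau>1)
  next
    case False
    then have u0: "u > 0" using u by simp
    have w: "1 - (1 - u)\<^sup>2 = u * (2 - u)" by (simp add: power2_eq_square algebra_simps)
    have "(1 - u\<^sup>2 * (1 - u)\<^sup>2) ^ 3 * (1 - (1 - u)\<^sup>2) = u * ((1 - u\<^sup>2 * (1 - u)\<^sup>2) ^ 3 * (2 - u))"
      unfolding w by (simp add: algebra_simps)
    then have "sqrt ((1 - u\<^sup>2 * (1 - u)\<^sup>2) ^ 3 * (1 - (1 - u)\<^sup>2)) = sqrt u * sqrt ((1 - u\<^sup>2 * (1 - u)\<^sup>2) ^ 3 * (2 - u))"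
      by (simp only: real_sqrt_mult)
    moreover have "1 - (1 - u)\<^sup>2 + (1 - u) * u * (1 - u\<^sup>2) = sqrt u * (sqrt u * (2 - u + (1 - u) * (1 - u\<^sup>2)))"
    proof -
      have "1 - (1 - u)\<^sup>2 + (1 - u) * u * (1 - u\<^sup>2) = u * (2 - u + (1 - u) * (1 - u\<^sup>2))"
        unfolding w by (simp add: algebra_simps)
      also have "\<dots> = (sqrt u * sqrt u) * (2 - u + (1 - u) * (1 - u\<^sup>2))" using u0 by simp
      finally show ?thesis by (simp only: mult.assoc)
    qed
    moreover have "g u = (1 - (1 - u)\<^sup>2 + (1 - u) * u * (1 - u\<^sup>2)) / sqrt ((1 - u\<^sup>2 * (1 - u)\<^sup>2) ^ 3 * (1 - (1 - u)\<^sup>2))"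
      using g_eq[of u] u0 by (simp only: \<tau>1 less_imp_le)
    ultimately show ?thesis using u0 by simp
  qed
  ultimately have "continuous_on {0..1} g" by (rule continuous_on_eq)
  then show ?thesis using \<tau>1 by simp
qed

lemma continuous_on_g: "continuous_on {-\<tau>..\<tau>} g"
proof -
  have "continuous_on {-\<tau>..\<tau>} (\<lambda>u. g \<bar>u\<bar>)"
    by (rule continuous_on_compose2[OF continuous_on_g_nonneg]) (auto intro!: continuous_intros)
  then show ?thesis
    by (rule continuous_on_eq) (auto simp: abs_if g_even)
qed

text \<open>The quotient rule confirms that the prescribed curvature fits the prescribed
  \<open>x\<close>: at tangent sine \<open>u\<close> the derivative dx/du has to be the reciprocal
  curvature.\<close>

lemma clasp_x_derivative:
  assumes u: "u \<in> {0<..<\<tau>}"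
  shows "(clasp_x \<tau> has_real_derivative g u) (at u)"
proof -
  define w where "w = \<tau> - u"
  define P where "P = sqrt (1 - w\<^sup>2)"
  define Q where "Q = sqrt (1 - u\<^sup>2 * w\<^sup>2)"
  have w2: "w\<^sup>2 < 1" using u \<tau> by (simp add: w_def abs_square_less_1)
  have q2: "u\<^sup>2 * w\<^sup>2 < 1" using prod_small[of u] u by (simp add: w_def)
  have P: "P > 0" "P\<^sup>2 = 1 - w\<^sup>2" using w2 by (simp_all add: P_def)
  have Q: "Q > 0" "Q\<^sup>2 = 1 - u\<^sup>2 * w\<^sup>2" using q2 by (simp_all add: Q_def)
  have d1: "((\<lambda>v. 1 - (\<tau> - v)\<^sup>2) has_real_derivative 2 * w) (at u)"
    by (auto intro!: derivative_eq_intros simp: w_def)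
  have d2: "((\<lambda>v. 1 - v\<^sup>2 * (\<tau> - v)\<^sup>2) has_real_derivative - (2 * u * w\<^sup>2 - 2 * u\<^sup>2 * w)) (at u)"
    by (auto intro!: derivative_eq_intros simp: w_def algebra_simps)
  have dP: "((\<lambda>v. sqrt (1 - (\<tau> - v)\<^sup>2)) has_real_derivative 2 * w / (2 * P)) (at u)"
    using DERIV_sqrt[OF d1] w2 by (simp add: w_def P_def)
  have dQ: "((\<lambda>v. sqrt (1 - v\<^sup>2 * (\<tau> - v)\<^sup>2)) has_real_derivative - (2 * u * w\<^sup>2 - 2 * u\<^sup>2 * w) / (2 * Q)) (at u)"
    using DERIV_sqrt[OF d2] q2 by (simp add: w_def Q_def)
  have "((\<lambda>v. v * sqrt (1 - (\<tau> - v)\<^sup>2) / sqrt (1 - v\<^sup>2 * (\<tau> - v)\<^sup>2)) has_real_derivative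
     ((1 * P + 2 * w / (2 * P) * u) * Q - u * P * (- (2 * u * w\<^sup>2 - 2 * u\<^sup>2 * w) / (2 * Q))) / (Q * Q)) (at u)"
    using DERIV_divide[OF DERIV_mult[OF DERIV_ident dP] dQ] Q(1) by (simp add: w_def[symmetric] P_def[symmetric] Q_def[symmetric])
  moreover have "((1 * P + 2 * w / (2 * P) * u) * Q - u * P * (- (2 * u * w\<^sup>2 - 2 * u\<^sup>2 * w) / (2 * Q))) / (Q * Q) = g u"
  proof -
    have "((1 * P + 2 * w / (2 * P) * u) * Q - u * P * (- (2 * u * w\<^sup>2 - 2 * u\<^sup>2 * w) / (2 * Q))) / (Q * Q)
      = ((P\<^sup>2 + u * w) * Q\<^sup>2 + u * P\<^sup>2 * (u * w\<^sup>2 - u\<^sup>2 * w)) / (Q ^ 3 * P)"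
      using P(1) Q(1) by (simp add: field_simps eval_nat_numeral)
    also have "(P\<^sup>2 + u * w) * Q\<^sup>2 + u * P\<^sup>2 * (u * w\<^sup>2 - u\<^sup>2 * w) = 1 - w\<^sup>2 + w * u * (1 - u\<^sup>2)"
      unfolding P(2) Q(2) by algebra
    also have "Q ^ 3 * P = sqrt ((1 - u\<^sup>2 * w\<^sup>2) ^ 3 * (1 - w\<^sup>2))"
      by (simp add: P_def Q_def real_sqrt_mult real_sqrt_power)
    finally show ?thesis using u by (simp add: g_eq w_def)
  qed
  ultimately have "((\<lambda>v. v * sqrt (1 - (\<tau> - v)\<^sup>2) / sqrt (1 - v\<^sup>2 * (\<tau> - v)\<^sup>2)) has_real_derivative g u) (at u)"
    by simp
  then show ?thesis
    by (rule has_field_derivative_transform_within_open[where S="{0<..<\<tau>}"]) (use u in \<open>auto simp: clasp_x_def\<close>)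
qed

lemma continuous_on_clasp_x: "continuous_on {-\<tau>..\<tau>} (clasp_x \<tau>)"
  unfolding clasp_x_def[abs_def]
proof (intro continuous_intros ballI)
  fix u assume u: "u \<in> {-\<tau>..\<tau>}"
  have "\<bar>u\<bar>\<^sup>2 * (\<tau> - \<bar>u\<bar>)\<^sup>2 \<le> 1/16" using u by (intro prod_small(2)) auto
  then show "sqrt (1 - u\<^sup>2 * (\<tau> - \<bar>u\<bar>)\<^sup>2) \<noteq> 0" by simp
qed

lemma clasp_x_odd: "clasp_x \<tau> (- u) = - clasp_x \<tau> u"
  by (simp add: clasp_x_def)

text \<open>The radius of curvature as a function of the tangent angle, extended beyond the clasp by
  its end value, which is 1 by \<open>g_at_\<tau>\<close>. Through this extension the primitive
  \<open>S\<close> becomes a bijection of the real line.\<close>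

definition Rx :: "real \<Rightarrow> real" where
  "Rx \<alpha> = g (sin (max (- \<theta>) (min \<theta> \<alpha>)))"

text \<open>Arclength measured from the tip as a function of the tangent angle.\<close>

definition S :: "real \<Rightarrow> real" where "S = prim Rx"

lemma clamp_mem: "max (- \<theta>) (min \<theta> \<alpha>) \<in> {-\<theta>..\<theta>}"
  using \<theta>(1) by auto

lemma clamp_eq: "\<alpha> \<in> {-\<theta>..\<theta>} \<Longrightarrow> max (- \<theta>) (min \<theta> \<alpha>) = \<alpha>"
  by (simp add: min_absorb2 max_absorb2)

lemma Rx_eq: "\<alpha> \<in> {-\<theta>..\<theta>} \<Longrightarrow> Rx \<alpha> = g (sin \<alpha>)"
  by (simp add: Rx_def clamp_eq)

lemma continuous_Rx: "continuous_on UNIV Rx"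
  unfolding Rx_def[abs_def]
  by (rule continuous_on_compose2[OF continuous_on_g]) (use sin_mem[OF clamp_mem] in \<open>auto intro!: continuous_intros\<close>)

lemma Rx_even: "Rx (- \<alpha>) = Rx \<alpha>"
proof -
  have "max (- \<theta>) (min \<theta> (- \<alpha>)) = - max (- \<theta>) (min \<theta> \<alpha>)"
    using \<theta>(1) by (auto simp: max_def min_def)
  then show ?thesis by (simp add: Rx_def g_even)
qed

lemma Rx_pos:
  assumes "\<alpha> \<noteq> 0 \<or> \<tau> < 1"
  shows "Rx \<alpha> > 0"
proof -
  define \<beta> where "\<beta> = max (- \<theta>) (min \<theta> \<alpha>)"
  have \<beta>: "\<beta> \<in> {-\<theta>..\<theta>}" unfolding \<beta>_def by (rule clamp_mem)
  have "sin \<beta> \<noteq> 0 \<or> \<tau> < 1"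
  proof (cases "\<tau> < 1")
    case False
    then have "\<tau> = 1" using \<tau> by simp
    then have "\<theta> = pi/2" unfolding \<theta>_def by simp
    then have "\<beta> \<noteq> 0" using assms False pi_gt_zero by (auto simp: \<beta>_def max_def min_def)
    then show ?thesis
      using \<beta> \<open>\<theta> = pi/2\<close> sin_gt_zero[of \<beta>] sin_gt_zero[of "-\<beta>"] pi_gt_zero
      by (cases "\<beta> > 0") auto
  qed simp
  then show ?thesis
    using sin_mem[OF \<beta>] by (auto simp: Rx_def \<beta>_def[symmetric] intro!: g_pos)
qed

lemma Rx_outside: "\<alpha> \<notin> {-\<theta><..<\<theta>} \<Longrightarrow> Rx \<alpha> = 1"
  using \<theta> g_at_\<tau> g_even[of \<tau>] by (auto simp: Rx_def max_def min_def not_less)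

lemma S_derivative: "(S has_real_derivative Rx \<alpha>) (at \<alpha>)"
  unfolding S_def by (rule prim_has_derivative[OF continuous_Rx])

lemma S_0: "S 0 = 0"
  by (simp add: S_def)

lemma S_odd: "S (- \<alpha>) = - S \<alpha>"
  unfolding S_def by (rule prim_odd[OF continuous_Rx Rx_even])

lemma isCont_S: "isCont S \<alpha>"
  using S_derivative by (rule DERIV_isCont)

text \<open>For \<tau> = 1 the derivative vanishes at 0, and nowhere else; so strictness is shown on
  each side of 0 and chained there.\<close>

lemma S_strict_mono: "strict_mono S"
proof (rule strict_monoI)
  have pos: "S a < S b" if ab: "a < b" "0 \<notin> {a<..<b}" for a b
  proof -
    obtain z where z: "a < z" "z < b" "S b - S a = (b - a) * Rx z"
      using MVT2[OF ab(1) S_derivative] by blast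
    have "z \<noteq> 0" using ab z by auto
    then have "(b - a) * Rx z > 0" using Rx_pos[of z] ab by simp
    then show ?thesis using z by simp
  qed
  fix a b :: real assume ab: "a < b"
  show "S a < S b"
  proof (cases "0 \<in> {a<..<b}")
    case True
    then have "S a < S 0" "S 0 < S b" by (auto intro!: pos)
    then show ?thesis by simp
  qed (use pos ab in blast)
qed

lemma S_surj: "surj S"
proof -
  have big: "\<exists>\<alpha>. S \<alpha> = y" if "y \<ge> 0" for y
  proof -
    have "S (\<theta> + y) = S \<theta> + y"
    proof (cases "y = 0")
      case False
      then have "y > 0" using that by simp
      then have "\<theta> < \<theta> + y" by simp
      then obtain z where z: "\<theta> < z" "z < \<theta> + y" "S (\<theta> + y) - S \<theta> = (\<theta> + y - \<theta>) * Rx z"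
        using MVT2[OF _ S_derivative] by blast
      then show ?thesis using Rx_outside[of z] by simp
    qed simp
    moreover have "0 \<le> S \<theta>" using strict_mono_less_eq[OF S_strict_mono, of 0 \<theta>] S_0 \<theta>(1) by simp
    ultimately have "S 0 \<le> y" "y \<le> S (\<theta> + y)" using S_0 that by auto
    then show ?thesis using IVT[of S 0 y "\<theta> + y"] isCont_S \<theta>(1) that by auto
  qed
  show ?thesis
    unfolding surj_def
  proof
    fix y show "\<exists>x. y = S x"
    proof (cases "y \<ge> 0")
      case False
      then obtain \<alpha> where "S \<alpha> = - y" using big[of "- y"] by auto
      then have "y = S (- \<alpha>)" by (simp add: S_odd)
      then show ?thesis ..
    qed (use big[of y] in auto)
  qed
qed

definition B :: "real \<Rightarrow> real" where "B = inv S"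

lemma S_B: "S (B s) = s"
  unfolding B_def by (rule surj_f_inv_f[OF S_surj])

lemma B_S: "B (S \<alpha>) = \<alpha>"
  unfolding B_def by (rule inv_f_f[OF strict_mono_imp_inj_on[OF S_strict_mono]])

lemma isCont_B: "isCont B s"
proof -
  have "isCont B (S (B s))"
    by (rule isCont_inverse_function[of 1]) (auto simp: B_S isCont_S)
  then show ?thesis by (simp add: S_B)
qed

lemma B_mono: "s \<le> t \<Longrightarrow> B s \<le> B t"
  using strict_mono_less_eq[OF S_strict_mono, of "B s" "B t"] by (simp add: S_B)

lemma B_odd: "B (- s) = - B s"
  using B_S[of "- B s"] by (simp add: S_odd S_B)

lemma B_derivative:
  assumes "B s \<noteq> 0 \<or> \<tau> < 1"
  shows "(B has_real_derivative inverse (Rx (B s))) (at s)"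
  by (rule DERIV_inverse_function[OF S_derivative, of _ _ "s - 1" "s + 1"])
    (use Rx_pos[OF assms] in \<open>auto simp: S_B isCont_B\<close>)

definition l :: real where "l = S \<theta>"

text \<open>The tangent angle of the extended curve, constant along the straight ends. The unclamped
  inverse \<open>B\<close> agrees with it on the clasp and, for \<tau> < 1, is differentiable across
  the junctions, where \<open>A\<close> may have a corner.\<close>

definition A :: "real \<Rightarrow> real" where "A s = max (- \<theta>) (min \<theta> (B s))"

lemma l_nonneg: "0 \<le> l"
  using strict_mono_less_eq[OF S_strict_mono, of 0 \<theta>] S_0 \<theta>(1) by (simp add: l_def)

lemma B_l: "B l = \<theta>" "B (- l) = - \<theta>"
  by (simp_all add: l_def B_S B_odd)

lemma continuous_A: "continuous_on UNIV A"
  unfolding A_def by (intro continuous_intros) (simp add: isCont_B continuous_at_imp_continuous_on)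

lemma A_mem: "A s \<in> {-\<theta>..\<theta>}"
  unfolding A_def by (rule clamp_mem)

lemma A_mono: "s \<le> t \<Longrightarrow> A s \<le> A t"
  using B_mono[of s t] by (auto simp: A_def max_def min_def)

lemma A_odd: "A (- s) = - A s"
  using \<theta>(1) by (auto simp: A_def B_odd max_def min_def)

lemma A_eq_B: "s \<in> {-l..l} \<Longrightarrow> A s = B s"
  using B_mono[of "-l" s] B_mono[of s l] B_l by (auto simp: A_def max_def min_def)

lemma A_S: "\<alpha> \<in> {-\<theta>..\<theta>} \<Longrightarrow> A (S \<alpha>) = \<alpha>"
  by (simp add: A_def B_S clamp_eq)

lemma A_right: "s \<ge> l \<Longrightarrow> A s = \<theta>"
  using B_mono[of l s] B_l \<theta>(1) by (auto simp: A_def max_def min_def)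

lemma A_left: "s \<le> - l \<Longrightarrow> A s = - \<theta>"
  using B_mono[of s "-l"] B_l \<theta>(1) by (auto simp: A_def max_def min_def)

lemma A_0: "A 0 = 0"
  using A_S[of 0] S_0 \<theta>(1) by simp

lemma S_mem: "\<alpha> \<in> {-\<theta>..\<theta>} \<Longrightarrow> S \<alpha> \<in> {-l..l}"
  using strict_mono_less_eq[OF S_strict_mono, of "-\<theta>" \<alpha>] strict_mono_less_eq[OF S_strict_mono, of \<alpha> \<theta>]
    S_odd[of \<theta>] by (auto simp: l_def)

lemma S_A: "s \<in> {-l..l} \<Longrightarrow> S (A s) = s"
  by (simp add: A_eq_B S_B)

end

section \<open>The curve integrated from its tangent angle, and its agreement with the
  formulas\<close>

context clasp_param
begin

definition xs :: "real \<Rightarrow> real" where "xs = prim (\<lambda>s. cos (A s))"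
definition zs :: "real \<Rightarrow> real" where "zs s = clasp_z \<tau> 0 + prim (\<lambda>s. sin (A s)) s"

lemma cont_cos_A: "continuous_on UNIV (\<lambda>s. cos (A s))" and cont_sin_A: "continuous_on UNIV (\<lambda>s. sin (A s))"
  by (intro continuous_on_cos continuous_on_sin continuous_A)+

lemma xs_derivative: "(xs has_real_derivative cos (A s)) (at s)"
  unfolding xs_def by (rule prim_has_derivative[OF cont_cos_A])

lemma zs_derivative: "(zs has_real_derivative sin (A s)) (at s)"
  using DERIV_add[OF DERIV_const prim_has_derivative[OF cont_sin_A]] by (simp add: zs_def[abs_def])

lemma xs_0: "xs 0 = 0" and zs_0: "zs 0 = clasp_z \<tau> 0"
  by (simp_all add: xs_def zs_def)

lemma xs_odd: "xs (- s) = - xs s"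
  unfolding xs_def by (rule prim_odd[OF cont_cos_A]) (simp add: A_odd)

lemma zs_even: "zs (- s) = zs s"
  unfolding zs_def using prim_even[OF cont_sin_A] by (simp add: A_odd)

lemma continuous_on_xs: "continuous_on D xs" and continuous_on_zs: "continuous_on D zs"
  using xs_derivative zs_derivative by (auto intro: continuous_at_imp_continuous_on DERIV_isCont)

lemma A_nonneg: "s \<ge> 0 \<Longrightarrow> A s \<ge> 0"
  using A_mono[of 0 s] A_0 by simp

lemma sin_A: "s \<ge> 0 \<Longrightarrow> 0 \<le> sin (A s)" "sin (A s) \<in> {-\<tau>..\<tau>}"
  using A_nonneg[of s] A_mem[of s] \<theta> by (auto intro: sin_ge_zero) (use sin_mem[OF A_mem] in auto)

lemma cos_A: "c \<le> cos (A s)" "cos (A s) = sqrt (1 - (sin (A s))\<^sup>2)"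
proof -
  have "cos \<theta> \<le> cos \<bar>A s\<bar>" using A_mem[of s] \<theta> by (intro cos_monotone_0_pi_le) auto
  then show "c \<le> cos (A s)" by (simp add: \<theta> cos_abs_real)
  then have "cos (A s) \<ge> 0" using c by simp
  then show "cos (A s) = sqrt (1 - (sin (A s))\<^sup>2)" by (simp add: cos_squared_eq[symmetric])
qed

lemma zs_mono:
  assumes "0 \<le> s" "s \<le> t"
  shows "zs s \<le> zs t"
  by (rule DERIV_nonneg_imp_nondecreasing[OF assms(2)]) (use zs_derivative sin_A(1) assms in fastforce)

lemma xs_right:
  assumes "s \<ge> l"
  shows "xs s = xs l + c * (s - l)"
proof -
  have "xs s = (\<lambda>s. xs l + c * (s - l)) s"
  proof (rule eq_of_derivatives[where f=xs and g="\<lambda>s. xs l + c * (s - l)" and a=l and b=s and d="\<lambda>_. c"])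
    fix y assume "y \<in> {l<..<s}"
    then have "cos (A y) = c" using A_right[of y] \<theta> by simp
    then show "(xs has_real_derivative c) (at y)" using xs_derivative[of y] by simp
    show "((\<lambda>s. xs l + c * (s - l)) has_real_derivative c) (at y)" by (auto intro!: derivative_eq_intros)
  qed (use assms in \<open>auto intro!: continuous_intros continuous_on_xs\<close>)
  then show ?thesis by simp
qed

lemma zs_right:
  assumes "s \<ge> l"
  shows "zs s = zs l + \<tau> * (s - l)"
proof -
  have "zs s = (\<lambda>s. zs l + \<tau> * (s - l)) s"
  proof (rule eq_of_derivatives[where f=zs and g="\<lambda>s. zs l + \<tau> * (s - l)" and a=l and b=s and d="\<lambda>_. \<tau>"])
    fix y assume "y \<in> {l<..<s}"
    then have "sin (A y) = \<tau>" using A_right[of y] \<theta> by simp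
    then show "(zs has_real_derivative \<tau>) (at y)" using zs_derivative[of y] by simp
    show "((\<lambda>s. zs l + \<tau> * (s - l)) has_real_derivative \<tau>) (at y)" by (auto intro!: derivative_eq_intros)
  qed (use assms in \<open>auto intro!: continuous_intros continuous_on_zs\<close>)
  then show ?thesis by simp
qed

lemma S_arcsin_derivative:
  assumes u: "u \<in> {0<..<\<tau>}"
  shows "((\<lambda>u. S (arcsin u)) has_real_derivative g u * inverse (sqrt (1 - u\<^sup>2))) (at u)"
proof -
  have u1: "-1 < u" "u < 1" using u \<tau> by auto
  have "arcsin u \<in> {-\<theta>..\<theta>}" by (rule arcsin_mem) (use u in auto)
  then have "Rx (arcsin u) = g u" using u1 by (simp add: Rx_eq)
  then show ?thesis
    using DERIV_chain2[OF S_derivative DERIV_arcsin[OF u1]] by simp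
qed

lemma continuous_on_S_arcsin: "continuous_on {-1..1} (\<lambda>u. S (arcsin u))"
  by (rule continuous_on_compose2[of UNIV S])
    (auto intro!: continuous_at_imp_continuous_on isCont_S continuous_on_arcsin')

lemma A_S_arcsin: "u \<in> {-\<tau>..\<tau>} \<Longrightarrow> A (S (arcsin u)) = arcsin u"
  by (rule A_S[OF arcsin_mem])

text \<open>Both sides vanish at 0 and have derivative \<open>g\<close>; oddness gives negative
  \<open>u\<close>.\<close>

lemma xs_S_arcsin:
  assumes "u \<in> {-\<tau>..\<tau>}"
  shows "xs (S (arcsin u)) = clasp_x \<tau> u"
proof -
  have pos: "xs (S (arcsin u)) = clasp_x \<tau> u" if u: "u \<in> {0..\<tau>}" for u
  proof (rule eq_of_derivatives[where f="\<lambda>u. xs (S (arcsin u))" and g="clasp_x \<tau>" and d=g, OF _ _ _ _ _ u])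
    show "continuous_on {0..\<tau>} (\<lambda>u. xs (S (arcsin u)))"
      by (rule continuous_on_compose2[OF continuous_on_xs[of UNIV] continuous_on_subset[OF continuous_on_S_arcsin]]) (use \<tau> in auto)
    show "continuous_on {0..\<tau>} (clasp_x \<tau>)"
      by (rule continuous_on_subset[OF continuous_on_clasp_x]) auto
    show "xs (S (arcsin 0)) = clasp_x \<tau> 0" by (simp add: S_0 xs_0 clasp_x_def)
    fix u assume u: "u \<in> {0<..<\<tau>}"
    then have u': "u \<in> {-\<tau>..\<tau>}" "u\<^sup>2 < 1" "-1 \<le> u" "u \<le> 1" using \<tau> by (auto simp: abs_square_less_1)
    show "(clasp_x \<tau> has_real_derivative g u) (at u)" by (rule clasp_x_derivative[OF u])
    have "((\<lambda>u. xs (S (arcsin u))) has_real_derivative cos (A (S (arcsin u))) * (g u * inverse (sqrt (1 - u\<^sup>2)))) (at u)"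
      by (rule DERIV_chain2[OF xs_derivative S_arcsin_derivative[OF u]])
    moreover have "cos (A (S (arcsin u))) * (g u * inverse (sqrt (1 - u\<^sup>2))) = g u"
      using u' by (simp add: A_S_arcsin cos_arcsin)
    ultimately show "((\<lambda>u. xs (S (arcsin u))) has_real_derivative g u) (at u)"
      by (simp only:)
  qed
  show ?thesis
  proof (cases "u \<ge> 0")
    case False
    then have "xs (S (arcsin (- u))) = clasp_x \<tau> (- u)" using assms by (intro pos) auto
    then show ?thesis using assms \<tau> by (simp add: arcsin_minus S_odd xs_odd clasp_x_odd)
  qed (use pos assms in auto)
qed

lemma clasp_rise_even: "clasp_rise \<tau> (- u) = clasp_rise \<tau> u"
proof -
  have "clasp_rise \<tau> (- u) = (LBINT v=ereal u..0. - (v / sqrt (1 - v\<^sup>2) * g v))"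
    unfolding clasp_rise_def g_def[symmetric]
    by (subst interval_integral_reflect) (simp add: g_even)
  also have "\<dots> = - (LBINT v=ereal u..0. v / sqrt (1 - v\<^sup>2) * g v)"
    by (rule interval_lebesgue_integral_uminus)
  also have "\<dots> = (LBINT v=0..ereal u. v / sqrt (1 - v\<^sup>2) * g v)"
    using interval_integral_endpoints_reverse[of "ereal u" 0 "\<lambda>v. v / sqrt (1 - v\<^sup>2) * g v"] by simp
  finally show ?thesis by (simp add: clasp_rise_def g_def)
qed

lemma zs_S_arcsin_derivative:
  assumes u: "u \<in> {0<..<\<tau>}"
  shows "((\<lambda>u. zs (S (arcsin u))) has_real_derivative u / sqrt (1 - u\<^sup>2) * g u) (at u)"
proof -
  have u': "u \<in> {-\<tau>..\<tau>}" "-1 \<le> u" "u \<le> 1" using u \<tau> by auto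
  have "((\<lambda>u. zs (S (arcsin u))) has_real_derivative sin (A (S (arcsin u))) * (g u * inverse (sqrt (1 - u\<^sup>2)))) (at u)"
    by (rule DERIV_chain2[OF zs_derivative S_arcsin_derivative[OF u]])
  then show ?thesis using u' by (simp add: A_S_arcsin divide_inverse mult_ac)
qed

lemma zs_S_arcsin:
  assumes "u \<in> {-\<tau>..\<tau>}"
  shows "zs (S (arcsin u)) = clasp_z \<tau> u"
proof -
  have rise: "clasp_rise \<tau> u = zs (S (arcsin u)) - zs 0" if u: "0 < u" "u \<le> \<tau>" for u
  proof -
    define F where "F u = zs (S (arcsin u))" for u
    have cF: "continuous_on {-1..1} F"
      unfolding F_def by (rule continuous_on_compose2[OF continuous_on_zs[of UNIV] continuous_on_S_arcsin]) auto
    have in1: "{0..u} \<subseteq> {-1..1}" using u \<tau> by auto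
    \<comment> \<open>At \<tau> = 1 the integrand can be unbounded at the upper end. For a
      nonnegative integrand the fundamental theorem asks only for limits of the primitive at the
      ends.\<close>
    have "(LBINT v=ereal 0..ereal u. v / sqrt (1 - v\<^sup>2) * g v) = F u - F 0"
    proof (rule interval_integral_FTC_nonneg(2))
      fix v assume "ereal 0 < ereal v" "ereal v < ereal u"
      then have v: "v \<in> {0<..<\<tau>}" "v\<^sup>2 < 1" using u \<tau> by (auto simp: abs_square_less_1)
      show "(F has_real_derivative v / sqrt (1 - v\<^sup>2) * g v) (at v)"
        unfolding F_def[abs_def] by (rule zs_S_arcsin_derivative[OF v(1)])
      have "isCont g v"
        using continuous_on_interior[OF continuous_on_g_nonneg, of v] v by simp
      then show "isCont (\<lambda>v. v / sqrt (1 - v\<^sup>2) * g v) v"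
        using v by (intro continuous_intros) auto
    next
      have "0 \<le> v / sqrt (1 - v\<^sup>2) * g v" if "0 < v" "v < u" for v
        using that u \<tau> g_nonneg[of v] by (intro mult_nonneg_nonneg divide_nonneg_nonneg) (auto simp: power_le_one)
      then show "AE v in lborel. ereal 0 < ereal v \<longrightarrow> ereal v < ereal u \<longrightarrow> 0 \<le> v / sqrt (1 - v\<^sup>2) * g v"
        by auto
      have lim: "(F \<longlongrightarrow> F x) (at x within {0..u})" if "x \<in> {0..u}" for x
        using continuous_on_subset[OF cF in1] that by (simp add: continuous_on_def)
      show "((F \<circ> real_of_ereal) \<longlongrightarrow> F 0) (at_right (ereal 0))"
        using lim[of 0] u by (simp add: ereal_tendsto_simps at_within_Icc_at_right)
      show "((F \<circ> real_of_ereal) \<longlongrightarrow> F u) (at_left (ereal u))"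
        using lim[of u] u by (simp add: ereal_tendsto_simps at_within_Icc_at_left)
    qed (use u in simp)
    then show ?thesis
      by (simp add: clasp_rise_def g_def F_def S_0 zero_ereal_def)
  qed
  have r0: "clasp_rise \<tau> 0 = 0" by (simp add: clasp_rise_def zero_ereal_def[symmetric])
  have pos: "zs (S (arcsin u)) = clasp_z \<tau> u" if "0 \<le> u" "u \<le> \<tau>" for u
  proof (cases "u = 0")
    case True
    then show ?thesis by (simp add: S_0 zs_0)
  next
    case False
    then show ?thesis using rise[of u] that r0 by (simp add: zs_0 clasp_z_def)
  qed
  show ?thesis
  proof (cases "u \<ge> 0")
    case False
    then have "zs (S (arcsin (- u))) = clasp_z \<tau> (- u)" using assms by (intro pos) auto
    then show ?thesis using assms \<tau> by (simp add: arcsin_minus S_odd zs_even clasp_z_def clasp_rise_even)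
  qed (use pos assms in auto)
qed

text \<open>The vertical extent of a strut in terms of the sine at one end. As \<open>rot\<close>
  reverses heights, the heights of the two end parameters add up to its negative.\<close>

definition Zb :: "real \<Rightarrow> real" where
  "Zb u = sqrt ((1 - u\<^sup>2) * (1 - (\<tau> - u)\<^sup>2) / (1 - u\<^sup>2 * (\<tau> - u)\<^sup>2))"

text \<open>The two geometric properties of a strut in explicit form: perpendicularity to the
  tangent at the end with sine \<open>u\<close>, and unit length.\<close>

lemma strut_algebra:
  assumes u: "u \<in> {0..\<tau>}"
  shows "clasp_x \<tau> u * sqrt (1 - u\<^sup>2) = u * Zb u"
    "(clasp_x \<tau> u)\<^sup>2 + (clasp_x \<tau> (\<tau> - u))\<^sup>2 + (Zb u)\<^sup>2 = 1"
proof -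
  have q: "1 - u\<^sup>2 * (\<tau> - u)\<^sup>2 > 0" using prod_small[of u] u by simp
  have w: "(\<tau> - u)\<^sup>2 \<le> 1" "u\<^sup>2 \<le> 1" using u \<tau> by (auto simp: power_le_one)
  show "clasp_x \<tau> u * sqrt (1 - u\<^sup>2) = u * Zb u"
    using u by (simp add: clasp_x_def Zb_def real_sqrt_mult real_sqrt_divide mult_ac)
  have "(clasp_x \<tau> u)\<^sup>2 = u\<^sup>2 * (1 - (\<tau> - u)\<^sup>2) / (1 - u\<^sup>2 * (\<tau> - u)\<^sup>2)"
    using u q w by (simp add: clasp_x_def power_mult_distrib power_divide)
  moreover have "(clasp_x \<tau> (\<tau> - u))\<^sup>2 = (\<tau> - u)\<^sup>2 * (1 - u\<^sup>2) / (1 - u\<^sup>2 * (\<tau> - u)\<^sup>2)"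
    using u q w by (simp add: clasp_x_def power_mult_distrib power_divide mult.commute)
  moreover have "(Zb u)\<^sup>2 = (1 - u\<^sup>2) * (1 - (\<tau> - u)\<^sup>2) / (1 - u\<^sup>2 * (\<tau> - u)\<^sup>2)"
    unfolding Zb_def using q w by (intro real_sqrt_pow2 divide_nonneg_nonneg mult_nonneg_nonneg) auto
  ultimately show "(clasp_x \<tau> u)\<^sup>2 + (clasp_x \<tau> (\<tau> - u))\<^sup>2 + (Zb u)\<^sup>2 = 1"
    using q by (simp add: add_divide_distrib[symmetric]) (simp add: algebra_simps)
qed

text \<open>The constant of integration is what makes the identity true at \<open>u = 0\<close>;
  from there on derivatives agree. \<open>Zb\<close> is differentiated as the root of 1 minus the
  squared horizontal extents, so that only the known derivative of \<open>clasp_x\<close>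
  occurs.\<close>

lemma clasp_z_sum:
  assumes u: "u \<in> {0..\<tau>}"
  shows "clasp_z \<tau> u + clasp_z \<tau> (\<tau> - u) = - Zb u"
proof -
  define f where "f u = zs (S (arcsin u)) + zs (S (arcsin (\<tau> - u)))" for u
  define d where "d u = u / sqrt (1 - u\<^sup>2) * g u - (\<tau> - u) / sqrt (1 - (\<tau> - u)\<^sup>2) * g (\<tau> - u)" for u
  have "f u = - Zb u"
  proof (rule eq_of_derivatives[where f=f and g="\<lambda>u. - Zb u" and d=d, OF _ _ _ _ _ u])
    have cF: "continuous_on {-1..1} (\<lambda>u. zs (S (arcsin u)))"
      by (rule continuous_on_compose2[OF continuous_on_zs[of UNIV] continuous_on_S_arcsin]) auto
    show "continuous_on {0..\<tau>} f"
      unfolding f_def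
      by (intro continuous_on_add continuous_on_subset[OF cF] continuous_on_compose2[OF cF, where f="\<lambda>u. \<tau> - u"] continuous_intros)
        (use \<tau> in auto)
    show "continuous_on {0..\<tau>} (\<lambda>u. - Zb u)"
      unfolding Zb_def
    proof (intro continuous_intros ballI)
      fix u assume "u \<in> {0..\<tau>}"
      then show "1 - u\<^sup>2 * (\<tau> - u)\<^sup>2 \<noteq> 0" using prod_small[of u] by auto
    qed
    show "f 0 = - Zb 0"
      using clasp_z_normalization[of \<tau>] zs_S_arcsin[of \<tau>] zs_S_arcsin[of 0] \<tau> by (simp add: f_def Zb_def)
  next
    fix u assume u: "u \<in> {0<..<\<tau>}"
    define w where "w = \<tau> - u"
    have w: "w \<in> {0<..<\<tau>}" using u by (simp add: w_def)
    have sq: "u\<^sup>2 < 1" "w\<^sup>2 < 1" using u w \<tau> by (auto simp: abs_square_less_1)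
    have flip: "((\<lambda>u. \<tau> - u) has_real_derivative 0 - 1) (at u)" by (intro DERIV_diff DERIV_const DERIV_ident)
    have "((\<lambda>u. zs (S (arcsin (\<tau> - u)))) has_real_derivative (w / sqrt (1 - w\<^sup>2) * g w) * (0 - 1)) (at u)"
      by (rule DERIV_chain2[OF _ flip]) (use zs_S_arcsin_derivative[OF w] in \<open>simp add: w_def\<close>)
    from DERIV_add[OF zs_S_arcsin_derivative[OF u] this]
    show "(f has_real_derivative d u) (at u)" by (simp add: f_def[abs_def] d_def w_def)
    have Zpos: "Zb u > 0" using sq prod_small[of u] u by (simp add: Zb_def w_def)
    have "((\<lambda>u. clasp_x \<tau> (\<tau> - u)) has_real_derivative g w * (0 - 1)) (at u)"
      by (rule DERIV_chain2[OF _ flip]) (use clasp_x_derivative[OF w] in \<open>simp add: w_def\<close>)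
    then have dw: "((\<lambda>u. clasp_x \<tau> (\<tau> - u)) has_real_derivative - g w) (at u)" by simp
    have dd: "((\<lambda>u. 1 - (clasp_x \<tau> u)\<^sup>2 - (clasp_x \<tau> (\<tau> - u))\<^sup>2) has_real_derivative
        - (2 * clasp_x \<tau> u * g u) + 2 * clasp_x \<tau> w * g w) (at u)"
      by (rule derivative_eq_intros clasp_x_derivative[OF u] dw refl)+ (simp add: w_def)
    have Z2: "1 - (clasp_x \<tau> v)\<^sup>2 - (clasp_x \<tau> (\<tau> - v))\<^sup>2 = (Zb v)\<^sup>2" if "v \<in> {0..\<tau>}" for v
      using strut_algebra(2)[OF that] by simp
    have "1 - (clasp_x \<tau> u)\<^sup>2 - (clasp_x \<tau> (\<tau> - u))\<^sup>2 > 0" using Z2[of u] u Zpos by simp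
    moreover have "sqrt (1 - (clasp_x \<tau> u)\<^sup>2 - (clasp_x \<tau> (\<tau> - u))\<^sup>2) = Zb u" using Z2[of u] u Zpos by simp
    ultimately have "((\<lambda>u. sqrt (1 - (clasp_x \<tau> u)\<^sup>2 - (clasp_x \<tau> (\<tau> - u))\<^sup>2)) has_real_derivative
        (- (2 * clasp_x \<tau> u * g u) + 2 * clasp_x \<tau> w * g w) / (2 * Zb u)) (at u)"
      using DERIV_sqrt[OF dd] by (simp only:)
    \<comment> \<open>Perpendicularity writes each horizontal extent as \<open>Zb u\<close> times
      the slope of the tangent; \<open>Zb u\<close> cancels and the derivatives of the heights are
      left.\<close>
    moreover have "(- (2 * clasp_x \<tau> u * g u) + 2 * clasp_x \<tau> w * g w) / (2 * Zb u) = - d u"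
    proof -
      have "clasp_x \<tau> u = u / sqrt (1 - u\<^sup>2) * Zb u"
        using strut_algebra(1)[of u] u sq by (simp add: field_simps)
      moreover have "Zb w = Zb u" by (simp add: Zb_def w_def mult.commute)
      then have "clasp_x \<tau> w = w / sqrt (1 - w\<^sup>2) * Zb u"
        using strut_algebra(1)[of w] w sq by (simp add: field_simps)
      ultimately show ?thesis using Zpos by (simp add: d_def w_def[symmetric] field_simps)
    qed
    ultimately have "((\<lambda>u. sqrt (1 - (clasp_x \<tau> u)\<^sup>2 - (clasp_x \<tau> (\<tau> - u))\<^sup>2)) has_real_derivative - d u) (at u)"
      by (simp only:)
    from DERIV_minus[OF this]
    have "((\<lambda>u. - sqrt (1 - (clasp_x \<tau> u)\<^sup>2 - (clasp_x \<tau> (\<tau> - u))\<^sup>2)) has_real_derivative d u) (at u)"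
      by (simp only: minus_minus)
    then show "((\<lambda>u. - Zb u) has_real_derivative d u) (at u)"
    proof (rule has_field_derivative_transform_within_open[where S="{0<..<\<tau>}"])
      fix v assume v: "v \<in> {0<..<\<tau>}"
      have "v\<^sup>2 < 1" "(\<tau> - v)\<^sup>2 < 1" using v \<tau> by (auto simp: abs_square_less_1)
      then have "0 \<le> Zb v" using prod_small[of v] v by (simp add: Zb_def)
      then show "- sqrt (1 - (clasp_x \<tau> v)\<^sup>2 - (clasp_x \<tau> (\<tau> - v))\<^sup>2) = - Zb v"
        using Z2[of v] v by simp
    qed (use u in auto)
  qed
  then show ?thesis using zs_S_arcsin[of u] zs_S_arcsin[of "\<tau> - u"] u by (simp add: f_def)
qed

end

section \<open>Struts\<close>

context clasp_param
begin

text \<open>A point of angle \<open>arcsin u\<close> on one component is joined by struts to the points of angle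
  \<open>arcsin (\<tau> - u)\<close> on the other one.\<close>

definition mate :: "real \<Rightarrow> real" where "mate s = S (arcsin (\<tau> - sin (A s)))"

lemma sin_A_mem: "s \<ge> 0 \<Longrightarrow> sin (A s) \<in> {0..\<tau>}"
  using sin_A by fastforce

lemma sin_A_mate:
  assumes "s \<ge> 0"
  shows "sin (A (mate s)) = \<tau> - sin (A s)"
proof -
  have "\<tau> - sin (A s) \<in> {-\<tau>..\<tau>}" "-1 \<le> \<tau> - sin (A s)" "\<tau> - sin (A s) \<le> 1" using sin_A_mem[OF assms] \<tau> by auto
  then show ?thesis by (simp add: mate_def A_S_arcsin)
qed

lemma S_arcsin_sin_A: "s \<in> {-l..l} \<Longrightarrow> S (arcsin (sin (A s))) = s"
  using A_mem[of s] \<theta> by (subst arcsin_sin) (auto simp: S_A)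

lemma mate_mem:
  assumes "s \<ge> 0"
  shows "mate s \<in> {0..l}"
proof -
  have u: "\<tau> - sin (A s) \<in> {0..\<tau>}" using sin_A_mem[OF assms] by auto
  then have "S 0 \<le> mate s" "mate s \<le> l"
    unfolding mate_def l_def strict_mono_less_eq[OF S_strict_mono]
    using arcsin_le_arcsin[of 0 "\<tau> - sin (A s)"] arcsin_le_arcsin[of "\<tau> - sin (A s)" \<tau>] \<tau> by (auto simp: \<theta>_def)
  then show ?thesis by (simp add: S_0)
qed

lemma mate_mate: "s \<in> {0..l} \<Longrightarrow> mate (mate s) = s"
  using sin_A_mate[of s] S_arcsin_sin_A[of s] by (simp add: mate_def[of "mate s"])

lemma mate_antimono:
  assumes "0 \<le> s" "s \<le> t"
  shows "mate t \<le> mate s"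
proof -
  have "sin (A s) \<le> sin (A t)"
    using A_mono[OF assms(2)] A_mem[of s] A_mem[of t] \<theta> by (intro sin_monotone_2pi_le) auto
  then show ?thesis
    unfolding mate_def strict_mono_less_eq[OF S_strict_mono]
    using sin_A_mem[of s] sin_A_mem[of t] assms \<tau> by (intro arcsin_le_arcsin) auto
qed

lemma strut:
  assumes s: "s \<in> {0..l}"
  shows "xs s * cos (A s) = - (zs s + zs (mate s)) * sin (A s)"
    "(xs s)\<^sup>2 + (xs (mate s))\<^sup>2 + (zs s + zs (mate s))\<^sup>2 = 1"
    "zs s + zs (mate s) \<le> 0"
proof -
  define u where "u = sin (A s)"
  have u: "u \<in> {0..\<tau>}" using sin_A_mem[of s] s by (simp add: u_def)
  have su: "S (arcsin u) = s" using S_arcsin_sin_A[of s] s by (simp add: u_def)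
  have cu: "S (arcsin (\<tau> - u)) = mate s" by (simp add: mate_def u_def)
  have x: "xs s = clasp_x \<tau> u" "xs (mate s) = clasp_x \<tau> (\<tau> - u)"
    using xs_S_arcsin[of u] xs_S_arcsin[of "\<tau> - u"] u su cu by auto
  have z: "zs s + zs (mate s) = - Zb u"
    using zs_S_arcsin[of u] zs_S_arcsin[of "\<tau> - u"] clasp_z_sum[OF u] u su cu by auto
  show "xs s * cos (A s) = - (zs s + zs (mate s)) * sin (A s)"
    using strut_algebra(1)[OF u] x z cos_A(2)[of s] by (simp add: u_def mult.commute)
  show "(xs s)\<^sup>2 + (xs (mate s))\<^sup>2 + (zs s + zs (mate s))\<^sup>2 = 1"
    using strut_algebra(2)[OF u] x z by simp
  have "u\<^sup>2 \<le> 1" "(\<tau> - u)\<^sup>2 \<le> 1" "0 \<le> 1 - u\<^sup>2 * (\<tau> - u)\<^sup>2"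
    using prod_small[of u] u \<tau> by (auto simp: power_le_one)
  then show "zs s + zs (mate s) \<le> 0" using z by (simp add: Zb_def)
qed

text \<open>The squared distance from \<open>\<Gamma> s\<close> to \<open>rot (\<Gamma> t)\<close>:
  the components lie in orthogonal planes, so both horizontal coordinates enter squared, and heights
  add because \<open>rot\<close> negates them.\<close>

definition dsq :: "real \<Rightarrow> real \<Rightarrow> real" where
  "dsq s t = (xs s)\<^sup>2 + (xs t)\<^sup>2 + (zs s + zs t)\<^sup>2"

lemma dsq_derivative: "((\<lambda>t. dsq s t) has_real_derivative 2 * (xs t * cos (A t) + (zs s + zs t) * sin (A t))) (at t)"
  unfolding dsq_def
  by (rule derivative_eq_intros xs_derivative zs_derivative refl)+ (simp add: algebra_simps)

text \<open>Perpendicularity of the strut at \<open>t\<close> eliminates \<open>xs t\<close>. For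
  arbitrary \<open>s\<close> the slope then compares the height of \<open>s\<close> with that of the
  partner of \<open>t\<close>, and its sign becomes a question of monotonicity.\<close>

lemma dsq_slope:
  assumes "t \<in> {0..l}"
  shows "xs t * cos (A t) + (zs s + zs t) * sin (A t) = sin (A t) * (zs s - zs (mate t))"
  using strut(1)[OF assms] by (simp add: algebra_simps)

text \<open>Along a straight end the squared distance is a quadratic function with leading
  coefficient 1, so the slope grows from its value at the junction; there the partner is the tip,
  the lowest point.\<close>

lemma dsq_slope_right:
  assumes "s \<ge> 0" "t \<ge> l"
  shows "xs t * cos (A t) + (zs s + zs t) * sin (A t) \<ge> 0"
proof -
  have l: "l \<in> {0..l}" using l_nonneg by simp
  have "sin (A l) * (zs s - zs (mate l)) \<ge> 0"
  proof -
    have "mate l = 0" unfolding mate_def using A_right[of l] \<theta> S_0 by simp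
    then show ?thesis using zs_mono[of 0 s] sin_A_mem[of l] assms l by auto
  qed
  then have "xs l * c + (zs s + zs l) * \<tau> \<ge> 0"
    using dsq_slope[OF l, of s] A_right[of l] \<theta> by simp
  moreover have "xs t * cos (A t) + (zs s + zs t) * sin (A t) = xs l * c + (zs s + zs l) * \<tau> + (t - l) * (c * c + \<tau> * \<tau>)"
    unfolding xs_right[OF assms(2)] zs_right[OF assms(2)] A_right[OF assms(2)] \<theta> by (simp add: algebra_simps)
  moreover have "(t - l) * (c * c + \<tau> * \<tau>) \<ge> 0" using assms by (intro mult_nonneg_nonneg) auto
  ultimately show ?thesis by simp
qed

text \<open>\<open>mate\<close> is antitone: parameters below \<open>mate s\<close> have partners at
  least as high as \<open>s\<close>, those above have partners no higher, and
  \<open>dsq_slope\<close> turns this into the sign of the slope.\<close>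

lemma dsq_ge_1_aux:
  assumes s: "s \<in> {0..l}" and t: "t \<ge> 0"
  shows "dsq s t \<ge> 1"
proof -
  have one: "dsq s (mate s) = 1" using strut(2)[OF s] by (simp add: dsq_def)
  have cs: "mate s \<in> {0..l}" using mate_mem s by simp
  show ?thesis
  proof (cases "t \<le> mate s")
    case True
    have "dsq s (mate s) \<le> dsq s t"
    proof (rule DERIV_nonpos_imp_nonincreasing[OF True])
      fix r assume r: "t \<le> r" "r \<le> mate s"
      then have rl: "r \<in> {0..l}" using t cs by auto
      have "s \<le> mate r" using mate_antimono[of r "mate s"] mate_mate[OF s] r rl by auto
      then have "zs s \<le> zs (mate r)" using s by (intro zs_mono) auto
      then have "sin (A r) * (zs s - zs (mate r)) \<le> 0" using sin_A_mem[of r] rl by (auto intro: mult_nonneg_nonpos)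
      then show "\<exists>y. ((\<lambda>t. dsq s t) has_real_derivative y) (at r) \<and> y \<le> 0"
        using dsq_derivative[of s r] dsq_slope[OF rl, of s] by auto
    qed
    then show ?thesis using one by simp
  next
    case False
    have "dsq s (mate s) \<le> dsq s t"
    proof (rule DERIV_nonneg_imp_nondecreasing[where f="\<lambda>t. dsq s t" and a="mate s" and b=t])
      fix r assume r: "mate s \<le> r" "r \<le> t"
      have "xs r * cos (A r) + (zs s + zs r) * sin (A r) \<ge> 0"
      proof (cases "r \<le> l")
        case True
        then have rl: "r \<in> {0..l}" using r cs by auto
        have "mate r \<le> s" using mate_antimono[of "mate s" r] mate_mate[OF s] r cs by auto
        then have "zs (mate r) \<le> zs s" using mate_mem[of r] rl by (intro zs_mono) auto
        then show ?thesis using dsq_slope[OF rl, of s] sin_A_mem[of r] rl by auto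
      qed (use dsq_slope_right[of s r] s in auto)
      then show "\<exists>y. ((\<lambda>t. dsq s t) has_real_derivative y) (at r) \<and> 0 \<le> y"
        using dsq_derivative[of s r] by auto
    qed (use False in auto)
    then show ?thesis using one by simp
  qed
qed

lemma dsq_sym: "dsq s t = dsq t s"
  by (simp add: dsq_def add.commute)

lemma dsq_abs: "dsq \<bar>s\<bar> \<bar>t\<bar> = dsq s t"
  by (cases "s \<ge> 0"; cases "t \<ge> 0") (simp_all add: dsq_def xs_odd zs_even)

text \<open>Symmetry settles pairs with one parameter on the clasp. If both lie on straight ends,
  \<open>s\<close> is higher than every partner, so the distance grows in \<open>t\<close> from
  \<open>t = 0\<close> on, and the pair of \<open>s\<close> and 0 is already settled.\<close>

lemma dsq_ge_1: "dsq s t \<ge> 1"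
proof -
  have pos: "dsq s t \<ge> 1" if "s \<ge> 0" "t \<ge> 0" for s t
  proof (cases "s \<le> l \<or> t \<le> l")
    case True
    then show ?thesis using dsq_ge_1_aux[of s t] dsq_ge_1_aux[of t s] dsq_sym[of s t] that by auto
  next
    case False
    have "dsq s 0 \<le> dsq s t"
    proof (rule DERIV_nonneg_imp_nondecreasing[OF that(2)])
      fix r assume r: "0 \<le> r" "r \<le> t"
      have "xs r * cos (A r) + (zs s + zs r) * sin (A r) \<ge> 0"
      proof (cases "r \<le> l")
        case True
        then have rl: "r \<in> {0..l}" using r by auto
        have "zs (mate r) \<le> zs s" using mate_mem[of r] rl False by (intro zs_mono) auto
        then show ?thesis using dsq_slope[OF rl, of s] sin_A_mem[of r] rl by auto
      qed (use dsq_slope_right[of s r] that in auto)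
      then show "\<exists>y. ((\<lambda>t. dsq s t) has_real_derivative y) (at r) \<and> 0 \<le> y"
        using dsq_derivative[of s r] by auto
    qed
    moreover have "dsq s 0 \<ge> 1" using dsq_ge_1_aux[of 0 s] dsq_sym[of s 0] l_nonneg that by auto
    ultimately show ?thesis by simp
  qed
  then show ?thesis using pos[of "\<bar>s\<bar>" "\<bar>t\<bar>"] by (simp add: dsq_abs)
qed

end

section \<open>The two components\<close>

definition rot :: "real^3 \<Rightarrow> real^3" where
  "rot p = vector [- p$2, p$1, - p$3]"

definition mirror :: "real^3 \<Rightarrow> real^3" where
  "mirror p = vector [- p$1, p$2, p$3]"

lemma vector3_eq: "vector [a, b, d] = a *\<^sub>R axis 1 1 + b *\<^sub>R axis 2 1 + d *\<^sub>R (axis 3 1 :: real^3)"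
  by (simp add: vec_eq_iff forall_3 axis_def)

lemma inner_vector3: "(vector [a, b, d] :: real^3) \<bullet> vector [a', b', d'] = a * a' + b * b' + d * d'"
  by (simp add: inner_vec_def sum_3)

lemma has_vector_derivative_vector3:
  assumes "(f has_real_derivative f') F" "(g has_real_derivative g') F" "(h has_real_derivative h') F"
  shows "((\<lambda>s. vector [f s, g s, h s] :: real^3) has_vector_derivative vector [f', g', h']) F"
proof -
  have "((\<lambda>s. f s *\<^sub>R axis 1 1) has_vector_derivative f' *\<^sub>R (axis 1 1 :: real^3)) F"
    "((\<lambda>s. g s *\<^sub>R axis 2 1) has_vector_derivative g' *\<^sub>R (axis 2 1 :: real^3)) F"
    "((\<lambda>s. h s *\<^sub>R axis 3 1) has_vector_derivative h' *\<^sub>R (axis 3 1 :: real^3)) F"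
    using assms by (auto simp: has_real_derivative_iff_has_vector_derivative has_vector_derivative_def
        intro!: has_derivative_scaleR_left[THEN has_derivative_eq_rhs])
  then show ?thesis unfolding vector3_eq by (intro has_vector_derivative_add)
qed

lemma continuous_on_vector3:
  assumes "continuous_on D f" "continuous_on D g" "continuous_on D h"
  shows "continuous_on D (\<lambda>s. vector [f s, g s, h s] :: real^3)"
  unfolding vector3_eq by (intro continuous_intros assms)

lemma linear_rot: "linear rot"
  by (rule linearI) (simp_all add: rot_def vec_eq_iff forall_3)

lemma rot_inner: "rot p \<bullet> rot q = p \<bullet> q"
  by (simp add: rot_def inner_vec_def sum_3)

lemma rot_norm: "norm (rot p) = norm p"
  by (simp add: norm_eq_sqrt_inner rot_inner)

lemma rot_dist: "dist (rot p) (rot q) = dist p q"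
  using linear_diff[OF linear_rot, of p q] rot_norm[of "p - q"] by (simp add: dist_norm)

lemma rot_vector: "rot (vector [a, b, d]) = vector [- b, a, - d]"
  by (simp add: rot_def)

section \<open>The curve in space with its tangent and normal\<close>

context clasp_param
begin

definition \<Gamma> :: "real \<Rightarrow> real^3" where "\<Gamma> s = vector [xs s, 0, zs s]"
definition T :: "real \<Rightarrow> real^3" where "T a = vector [cos a, 0, sin a]"
definition N :: "real \<Rightarrow> real^3" where "N a = vector [- sin a, 0, cos a]"

lemma \<Gamma>_derivative: "(\<Gamma> has_vector_derivative T (A s)) (at s)"
  unfolding \<Gamma>_def[abs_def] T_def
  by (rule has_vector_derivative_vector3[OF xs_derivative DERIV_const zs_derivative])

lemma T_derivative: "(T has_vector_derivative N a) (at a)"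
  unfolding T_def[abs_def] N_def
  by (rule has_vector_derivative_vector3) (auto intro!: derivative_eq_intros)

lemma continuous_T: "continuous_on D T" and continuous_N: "continuous_on D N"
  unfolding T_def[abs_def] N_def[abs_def] by (intro continuous_on_vector3 continuous_intros)+

lemma norm_T: "norm (T a) = 1" and norm_N: "norm (N a) = 1" and T_N: "T a \<bullet> N a = 0"
  by (simp_all add: T_def N_def norm_eq_sqrt_inner inner_vector3 power2_eq_square[symmetric])

lemma T_inner: "T a \<bullet> T b = cos (a - b)"
  by (simp add: T_def inner_vector3 cos_diff)

lemma continuous_\<Gamma>: "continuous_on D \<Gamma>"
  unfolding \<Gamma>_def[abs_def] by (intro continuous_on_vector3 continuous_on_const continuous_on_xs continuous_on_zs)

lemma dist_\<Gamma>_rot: "dist (\<Gamma> s) (rot (\<Gamma> t)) = sqrt (dsq s t)"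
  by (simp add: \<Gamma>_def rot_vector dist_norm norm_eq_sqrt_inner inner_vec_def sum_3 dsq_def power2_eq_square)

lemma clasp_curve_eq: "clasp_curve \<tau> = \<Gamma> ` {-l..l}"
proof -
  have 1: "clasp_point \<tau> u = \<Gamma> (S (arcsin u))" if "u \<in> {-\<tau>..\<tau>}" for u
    using that by (simp add: clasp_point_def \<Gamma>_def xs_S_arcsin zs_S_arcsin)
  have 2: "S (arcsin u) \<in> {-l..l}" if "u \<in> {-\<tau>..\<tau>}" for u
    by (rule S_mem[OF arcsin_mem[OF that]])
  have 3: "\<Gamma> s = clasp_point \<tau> (sin (A s))" "sin (A s) \<in> {-\<tau>..\<tau>}" if "s \<in> {-l..l}" for s
    using 1[OF sin_A(2), of s] S_arcsin_sin_A[OF that] sin_A(2) by auto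
  show ?thesis unfolding clasp_curve_def
  proof (intro set_eqI iffI)
    fix p assume "p \<in> clasp_point \<tau> ` {-\<tau>..\<tau>}"
    then show "p \<in> \<Gamma> ` {-l..l}" using 1 2 by blast
  next
    fix p assume "p \<in> \<Gamma> ` {-l..l}"
    then show "p \<in> clasp_point \<tau> ` {-\<tau>..\<tau>}" using 3 by blast
  qed
qed

lemma clasp_point_end: "clasp_point \<tau> \<tau> = \<Gamma> l" "clasp_point \<tau> (- \<tau>) = \<Gamma> (- l)"
  using xs_S_arcsin[of \<tau>] zs_S_arcsin[of \<tau>] xs_S_arcsin[of "-\<tau>"] zs_S_arcsin[of "-\<tau>"] \<tau>
  by (auto simp: clasp_point_def \<Gamma>_def l_def \<theta>_def S_odd arcsin_minus)

lemma normal1_eq: "normal1 \<tau> 1 = T \<theta>" "normal1 \<tau> (- 1) = - T (- \<theta>)"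
  by (simp_all add: normal1_def T_def \<theta> vec_eq_iff forall_3 c_def)

lemma \<Gamma>_right: "s \<ge> l \<Longrightarrow> \<Gamma> s = \<Gamma> l + (s - l) *\<^sub>R T \<theta>"
  by (simp add: \<Gamma>_def T_def xs_right[of s] zs_right[of s] \<theta> vec_eq_iff forall_3)

lemma \<Gamma>_minus: "\<Gamma> (- s) = mirror (\<Gamma> s)"
  by (simp add: \<Gamma>_def mirror_def xs_odd zs_even)

end

section \<open>Regularity and chords of the extended arcs\<close>

lemma pi_ge_3: "pi \<ge> 3"
  using sin_x_le_x[of "pi/6"] pi_gt_zero by (simp add: sin_30)

section \<open>Bounds on curvature, length and height; long chords; injectivity\<close>

context clasp_param
begin

text \<open>The lower bound says that the curvature is at most \<open>1 / c\<close>, with equality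
  at the tip; it is the reason why \<sigma> may go up to \<open>c\<close>. The upper bound serves to
  estimate the length of the clasp.\<close>

lemma g_bounds:
  assumes u: "\<bar>u\<bar> \<le> \<tau>"
  shows "c \<le> g u" "g u \<le> 3"
proof -
  have *: "c \<le> g u \<and> g u \<le> 3" if u: "0 \<le> u" "u \<le> \<tau>" for u
  proof (cases "\<tau> = 1 \<and> u = 0")
    case True
    then have "\<tau> = 1" "u = 0" by auto
    then have "g u = 0" "c = 0" unfolding g_def c_def by (simp_all add: clasp_kappa_def)
    then show ?thesis by simp
  next
    case False
    define w where "w = \<tau> - u"
    define q where "q = 1 - u\<^sup>2 * w\<^sup>2"
    define D where "D = sqrt (q ^ 3 * (1 - w\<^sup>2))"
    have w: "0 \<le> w" "w < 1" using u \<tau> False by (auto simp: w_def)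
    have w2: "w\<^sup>2 < 1" using w by (simp add: abs_square_less_1)
    have q: "15/16 \<le> q" "q \<le> 1" using prod_small[OF u] by (auto simp: q_def w_def)
    have D: "D > 0" using q w2 by (simp add: D_def)
    have geq: "g u = (1 - w\<^sup>2 + w * u * (1 - u\<^sup>2)) / D" using u by (simp add: g_eq w_def D_def q_def)
    have u2: "u\<^sup>2 \<le> 1" using u \<tau> by (simp add: power_le_one)
    have wu: "0 \<le> w * u * (1 - u\<^sup>2)" using w u u2 by simp
    have "c * D \<le> 1 - w\<^sup>2"
    proof -
      have "w\<^sup>2 \<le> \<tau>\<^sup>2" using u by (intro power_mono) (auto simp: w_def)
      then have "(1 - \<tau>\<^sup>2) * (q ^ 3 * (1 - w\<^sup>2)) \<le> (1 - w\<^sup>2) * (1 * (1 - w\<^sup>2))"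
        using q w2 \<tau> by (intro mult_mono) (auto simp: power_le_one)
      also have "\<dots> = (1 - w\<^sup>2)\<^sup>2" by (simp add: power2_eq_square)
      finally have "sqrt ((1 - \<tau>\<^sup>2) * (q ^ 3 * (1 - w\<^sup>2))) \<le> sqrt ((1 - w\<^sup>2)\<^sup>2)"
        by (rule real_sqrt_le_mono)
      then show ?thesis using w2 by (simp add: c_def D_def real_sqrt_mult)
    qed
    then have "c * D \<le> 1 - w\<^sup>2 + w * u * (1 - u\<^sup>2)" using wu by linarith
    then have "c \<le> g u" using D geq by (simp add: pos_le_divide_eq)
    moreover have "g u \<le> 3"
    proof -
      \<comment> \<open>Here \<open>u \<le> 1 - w\<close>, since
        \<open>u + w = \<tau>\<close>.\<close>
      have "w * u * (1 - u\<^sup>2) \<le> 1 * (1 - w) * 1"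
        using u \<tau> w u2 by (intro mult_mono) (auto simp: w_def)
      also have "\<dots> \<le> (1 - w) * (1 + w)" using w by simp
      finally have n: "1 - w\<^sup>2 + w * u * (1 - u\<^sup>2) \<le> 2 * (1 - w\<^sup>2)" by (simp add: power2_eq_square algebra_simps)
      \<comment> \<open>4/9 is a convenient square below this cube: its root 2/3 turns the factor 2
        in the bound of the numerator into 3.\<close>
      have "(15/16::real) ^ 3 \<le> q ^ 3" using q by (intro power_mono) auto
      then have "4/9 \<le> q ^ 3" by (simp add: power3_eq_cube)
      then have "4/9 * ((1 - w\<^sup>2) * (1 - w\<^sup>2)) \<le> q ^ 3 * (1 * (1 - w\<^sup>2))" using w2 q by (intro mult_mono) auto
      moreover have "(2/3 * x)\<^sup>2 = 4/9 * (x * x)" for x :: real by (simp add: power2_eq_square)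
      ultimately have "(2/3 * (1 - w\<^sup>2))\<^sup>2 \<le> q ^ 3 * (1 - w\<^sup>2)" by (simp only: mult_1_left)
      then have "2/3 * (1 - w\<^sup>2) \<le> D" unfolding D_def by (rule real_le_rsqrt)
      then show ?thesis using n D geq by (simp add: pos_divide_le_eq)
    qed
    ultimately show ?thesis by simp
  qed
  show "c \<le> g u" "g u \<le> 3" using *[of "\<bar>u\<bar>"] u g_even[of u] by (auto simp: abs_if split: if_splits)
qed

lemma Rx_bounds: "c \<le> Rx \<alpha>" "Rx \<alpha> \<le> 3"
  using g_bounds[of "sin (max (- \<theta>) (min \<theta> \<alpha>))"] sin_mem[OF clamp_mem[of \<alpha>]] by (auto simp: Rx_def)

text \<open>The slope of \<open>S\<close> is at most 3 and the end angle at most pi/2, hence below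
  2.\<close>

lemma l_le: "l \<le> 6"
proof -
  have "S \<theta> \<le> 3 * \<theta>"
  proof (cases "\<theta> = 0")
    case False
    then have "0 < \<theta>" using \<theta>(1) by simp
    then obtain z where "S \<theta> - S 0 = (\<theta> - 0) * Rx z" using MVT2[OF _ S_derivative] by blast
    moreover have "\<theta> * Rx z \<le> \<theta> * 3" using Rx_bounds(2) \<theta>(1) by (intro mult_left_mono)
    ultimately show ?thesis by (simp add: S_0)
  qed (simp add: S_0)
  then show ?thesis using \<theta>(2) pi_less_4 by (simp add: l_def)
qed

lemma l_pos: "0 < \<tau> \<Longrightarrow> 0 < l"
  using strict_monoD[OF S_strict_mono, of 0 \<theta>] S_0 \<theta> by (auto simp: l_def) (metis \<theta>(3) sin_zero order_less_le)

lemma zs_bounds: "zs 0 \<le> 0" "- 4 \<le> zs 0" "zs l \<le> 4" "zs 0 + zs l = - c"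
proof -
  show s: "zs 0 + zs l = - c"
    using clasp_z_normalization[of \<tau>] zs_S_arcsin[of \<tau>] \<tau> by (simp add: zs_0 l_def \<theta>_def c_def)
  have m: "zs 0 \<le> zs l" using zs_mono l_nonneg by simp
  have "zs l - zs 0 \<le> l"
  proof (cases "l = 0")
    case False
    then have "0 < l" using l_nonneg by simp
    then obtain z where "zs l - zs 0 = (l - 0) * sin (A z)" using MVT2[OF _ zs_derivative] by blast
    moreover have "l * sin (A z) \<le> l * 1" using l_nonneg by (intro mult_left_mono) auto
    ultimately show ?thesis by simp
  qed simp
  then show "zs 0 \<le> 0" "- 4 \<le> zs 0" "zs l \<le> 4" using s m l_le c by auto
qed

text \<open>The tip has to lie strictly below the origin, the centre of star-shapedness in the
  linking proof. For \<open>c > 0\<close> the normalization gives this; for \<open>c = 0\<close> it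
  needs that the curve rises strictly.\<close>

lemma zs_0_neg: "zs 0 < 0"
proof (cases "c = 0")
  case False
  then have "c > 0" using c by simp
  then show ?thesis using zs_bounds(4) zs_mono[of 0 l] l_nonneg by simp
next
  case True
  then have \<tau>1: "\<tau> = 1" using c_pos_iff \<tau> by auto
  then have "0 < l" by (intro l_pos) simp
  have "zs 0 < zs l"
  proof -
    obtain z where z: "0 < z" "z < l" "zs l - zs 0 = (l - 0) * sin (A z)"
      using MVT2[OF \<open>0 < l\<close> zs_derivative] by blast
    have "S 0 < S (A z)" using z S_A[of z] S_0 by simp
    then have "0 < A z" using strict_mono_less[OF S_strict_mono] by simp
    then have "sin (A z) > 0" using A_mem[of z] \<theta> by (intro sin_gt_zero) auto
    then show ?thesis using z \<open>0 < l\<close> by (metis diff_gt_0_iff_gt diff_zero mult_pos_pos)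
  qed
  then show ?thesis using zs_bounds(4) True by simp
qed

lemma xs_l: "xs l = \<tau>"
  using xs_S_arcsin[of \<tau>] \<tau> by (simp add: l_def \<theta>_def clasp_x_def)

lemma A_lipschitz:
  assumes "\<tau> < 1" "s \<le> t"
  shows "A t - A s \<le> (t - s) / c"
proof -
  have c0: "c > 0" using assms c_pos_iff by simp
  have "B t - B s \<le> (t - s) / c"
  proof (cases "s = t")
    case False
    then have st: "s < t" using assms by simp
    then obtain z where z: "B t - B s = (t - s) * inverse (Rx (B z))"
      using MVT2[OF st, of B "\<lambda>z. inverse (Rx (B z))"] B_derivative assms by auto
    have "inverse (Rx (B z)) \<le> inverse c" using Rx_bounds(1)[of "B z"] c0 by (intro le_imp_inverse_le)
    then have "(t - s) * inverse (Rx (B z)) \<le> (t - s) * inverse c" using st by (intro mult_left_mono) auto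
    then show ?thesis using z by (simp add: divide_inverse)
  qed simp
  moreover have "A t - A s \<le> B t - B s"
    using B_mono[OF assms(2)] by (auto simp: A_def max_def min_def)
  ultimately show ?thesis by simp
qed

lemma \<Gamma>_inner_derivative: "((\<lambda>s. T \<beta> \<bullet> \<Gamma> s) has_real_derivative cos (A s - \<beta>)) (at s)"
proof -
  have "((\<lambda>s. T \<beta> \<bullet> \<Gamma> s) has_derivative (\<lambda>r. T \<beta> \<bullet> (r *\<^sub>R T (A s)))) (at s)"
    using \<Gamma>_derivative unfolding has_vector_derivative_def by (rule has_derivative_inner_right)
  moreover have "(\<lambda>r. T \<beta> \<bullet> (r *\<^sub>R T (A s))) = (*) (cos (A s - \<beta>))"
    by (auto simp: T_inner cos_diff mult.commute)
  ultimately show ?thesis by (simp add: has_field_derivative_def)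
qed

text \<open>Project on the tangent direction \<open>\<beta>\<close> at the point \<open>m\<close>
  where half of the turning is done. Turning by \<open>\<psi>\<close> to either side takes at least
  length \<open>c * \<psi>\<close>; within that distance of \<open>m\<close> the tangent deviates no
  more than on a circle of radius \<open>c\<close>, contributing \<open>2 * c * sin \<psi>\<close>,
  and elsewhere it deviates by at most \<open>\<psi>\<close>.\<close>

lemma chord_bound:
  assumes \<tau>1: "\<tau> < 1" and st: "s \<le> t"
  defines "\<psi> \<equiv> (A t - A s) / 2"
  shows "2 * c * sin \<psi> + (t - s - 2 * c * \<psi>) * cos \<psi> \<le> dist (\<Gamma> s) (\<Gamma> t)"
proof -
  have c0: "c > 0" using \<tau>1 c_pos_iff by simp
  define \<beta> where "\<beta> = (A s + A t) / 2"
  have \<psi>: "0 \<le> \<psi>" "\<psi> \<le> pi" using A_mono[OF st] A_mem[of s] A_mem[of t] \<theta> by (auto simp: \<psi>_def)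
  obtain m where m: "s \<le> m" "m \<le> t" "A m = \<beta>"
    using IVT'[of A s \<beta> t] A_mono[OF st] st continuous_on_subset[OF continuous_A] by (auto simp: \<beta>_def)
  have ends: "A t - \<beta> = \<psi>" "\<beta> - A s = \<psi>" by (simp_all add: \<psi>_def \<beta>_def field_simps)
  have room: "m + c * \<psi> \<le> t" "s \<le> m - c * \<psi>"
    using A_lipschitz[OF \<tau>1 m(1)] A_lipschitz[OF \<tau>1 m(2)] m(3) ends c0 by (auto simp: field_simps)
  define F where "F r = T \<beta> \<bullet> \<Gamma> r" for r
  have dF: "(F has_real_derivative cos (A r - \<beta>)) (at r)" for r
    unfolding F_def[abs_def] by (rule \<Gamma>_inner_derivative)
  have low: "cos \<psi> \<le> cos (A r - \<beta>)" if "s \<le> r" "r \<le> t" for r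
  proof -
    have "\<bar>A r - \<beta>\<bar> \<le> \<psi>" using A_mono[of s r] A_mono[of r t] that ends by auto
    then have "cos \<psi> \<le> cos \<bar>A r - \<beta>\<bar>" using \<psi> by (intro cos_monotone_0_pi_le) auto
    then show ?thesis by (simp add: cos_abs_real)
  qed
  have low2: "cos ((r - m) / c) \<le> cos (A r - \<beta>)" if "\<bar>r - m\<bar> \<le> c * \<psi>" for r
  proof -
    have "\<bar>A r - \<beta>\<bar> \<le> \<bar>r - m\<bar> / c"
      using A_lipschitz[OF \<tau>1, of m r] A_lipschitz[OF \<tau>1, of r m] A_mono[of m r] A_mono[of r m] m(3)
      by (cases "m \<le> r") (auto simp: abs_if)
    moreover have "\<bar>r - m\<bar> / c \<le> pi" using that \<psi> c0 by (simp add: pos_divide_le_eq) (metis mult.commute mult_left_mono order_trans less_imp_le)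
    ultimately have "cos (\<bar>r - m\<bar> / c) \<le> cos \<bar>A r - \<beta>\<bar>" by (intro cos_monotone_0_pi_le) auto
    moreover have "cos (\<bar>r - m\<bar> / c) = cos ((r - m) / c)" using cos_abs_real[of "(r - m) / c"] c0 by simp
    ultimately show ?thesis by (simp add: cos_abs_real)
  qed
  have inc: "F a - cos \<psi> * a \<le> F b - cos \<psi> * b" if "s \<le> a" "a \<le> b" "b \<le> t" for a b
  proof (rule DERIV_nonneg_imp_nondecreasing[where f="\<lambda>r. F r - cos \<psi> * r" and a=a and b=b, OF that(2)])
    fix r assume "a \<le> r" "r \<le> b"
    then have "0 \<le> cos (A r - \<beta>) - cos \<psi> * 1" using low that by simp
    moreover have "((\<lambda>r. F r - cos \<psi> * r) has_real_derivative cos (A r - \<beta>) - cos \<psi> * 1) (at r)"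
      by (intro DERIV_diff DERIV_cmult DERIV_ident dF)
    ultimately show "\<exists>y. ((\<lambda>r. F r - cos \<psi> * r) has_real_derivative y) (at r) \<and> 0 \<le> y" by blast
  qed
  have inc2: "F (m - c * \<psi>) - c * sin (- \<psi>) \<le> F (m + c * \<psi>) - c * sin \<psi>"
  proof -
    have "F (m - c * \<psi>) - c * sin ((m - c * \<psi> - m) / c) \<le> F (m + c * \<psi>) - c * sin ((m + c * \<psi> - m) / c)"
    proof (rule DERIV_nonneg_imp_nondecreasing[where f="\<lambda>r. F r - c * sin ((r - m) / c)" and a="m - c * \<psi>" and b="m + c * \<psi>"])
      show "m - c * \<psi> \<le> m + c * \<psi>" using c0 \<psi> by simp
      fix r assume "m - c * \<psi> \<le> r" "r \<le> m + c * \<psi>"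
      then have "0 \<le> cos (A r - \<beta>) - cos ((r - m) / c)" using low2[of r] by (simp add: abs_le_iff)
      moreover have "((\<lambda>r. F r - c * sin ((r - m) / c)) has_real_derivative cos (A r - \<beta>) - c * (cos ((r - m) / c) * ((1 - 0) / c))) (at r)"
        by (intro DERIV_diff DERIV_cmult DERIV_ident dF DERIV_chain2[OF DERIV_sin] DERIV_cdivide DERIV_const)
      ultimately show "\<exists>y. ((\<lambda>r. F r - c * sin ((r - m) / c)) has_real_derivative y) (at r) \<and> 0 \<le> y"
        using c0 by auto
    qed
    then show ?thesis using c0 by simp
  qed
  have b1: "F s - cos \<psi> * s \<le> F (m - c * \<psi>) - cos \<psi> * (m - c * \<psi>)"
    by (rule inc) (use room \<psi> c0 m mult_nonneg_nonneg[of c \<psi>] in linarith)+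
  have b2: "F (m + c * \<psi>) - cos \<psi> * (m + c * \<psi>) \<le> F t - cos \<psi> * t"
    by (rule inc) (use room \<psi> c0 m mult_nonneg_nonneg[of c \<psi>] in linarith)+
  have "2 * c * sin \<psi> + (t - s - 2 * c * \<psi>) * cos \<psi> \<le> F t - F s"
    using b1 b2 inc2 by (simp add: algebra_simps)
  also have "\<dots> = T \<beta> \<bullet> (\<Gamma> t - \<Gamma> s)" by (simp add: F_def inner_diff_right)
  also have "\<dots> \<le> norm (T \<beta>) * norm (\<Gamma> t - \<Gamma> s)" by (rule norm_cauchy_schwarz)
  finally show ?thesis by (simp add: norm_T dist_norm norm_minus_commute)
qed

lemma long_chord:
  assumes c2: "1/2 \<le> c" and st: "s \<le> t" "9/10 * pi * c \<le> t - s"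
  shows "26/25 \<le> dist (\<Gamma> s) (\<Gamma> t)"
proof -
  have \<tau>1: "\<tau> < 1" using c2 c_pos_iff by simp
  define \<psi> where "\<psi> = (A t - A s) / 2"
  \<comment> \<open>\<open>c * q \<psi>\<close> is the bound of \<open>chord_bound\<close> for the
    length \<open>9/10 * pi * c\<close>. It decreases in \<open>\<psi>\<close>, which is at most
    \<open>\<theta>\<close>, and \<open>c\<close> at least 1/2 means
    \<open>\<theta> \<le> pi / 3\<close>.\<close>
  define q where "q x = 2 * sin x + (9/10 * pi - 2 * x) * cos x" for x
  have "\<theta> \<le> pi / 3"
  proof (rule ccontr)
    assume "\<not> \<theta> \<le> pi / 3"
    then have "cos \<theta> < cos (pi / 3)" using \<theta> by (intro cos_monotone_0_pi) auto
    then show False using c2 \<theta> by (simp add: cos_60)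
  qed
  then have \<psi>: "0 \<le> \<psi>" "\<psi> \<le> pi / 3" using A_mono[OF st(1)] A_mem[of s] A_mem[of t] by (auto simp: \<psi>_def)
  have "q (pi / 3) \<le> q \<psi>"
  proof (rule DERIV_nonpos_imp_nonincreasing[where f=q, OF \<psi>(2)])
    fix x assume x: "\<psi> \<le> x" "x \<le> pi / 3"
    have "(q has_real_derivative - ((9/10 * pi - 2 * x) * sin x)) (at x)"
      unfolding q_def[abs_def] by (auto intro!: derivative_eq_intros simp: algebra_simps)
    moreover have "0 \<le> (9/10 * pi - 2 * x) * sin x"
      using x \<psi> pi_gt_zero by (intro mult_nonneg_nonneg sin_ge_zero) auto
    ultimately show "\<exists>y. (q has_real_derivative y) (at x) \<and> y \<le> 0" by auto
  qed
  \<comment> \<open>The value is \<open>sqrt 3 + 7/60 * pi\<close>, at least 1.73 + 0.35; half of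
    2.08 is 26/25.\<close>
  moreover have "q (pi / 3) \<ge> 208/100"
  proof -
    have "sqrt 3 \<ge> 173/100" by (rule real_le_rsqrt) (simp add: power2_eq_square)
    then show ?thesis using pi_ge_3 by (simp add: q_def sin_60 cos_60)
  qed
  ultimately have q: "208/100 \<le> q \<psi>" by simp
  have "26/25 \<le> c * (208/100)" using c2 by simp
  also have "\<dots> \<le> c * q \<psi>" using q c by (intro mult_left_mono) auto
  also have "\<dots> = 2 * c * sin \<psi> + (9/10 * pi * c - 2 * c * \<psi>) * cos \<psi>" by (simp add: q_def algebra_simps)
  also have "\<dots> \<le> 2 * c * sin \<psi> + (t - s - 2 * c * \<psi>) * cos \<psi>"
  proof -
    have "0 \<le> cos \<psi>" using \<psi> pi_gt_zero by (intro cos_ge_zero) auto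
    then show ?thesis using st(2) by (intro add_left_mono mult_right_mono) auto
  qed
  also have "\<dots> \<le> dist (\<Gamma> s) (\<Gamma> t)" unfolding \<psi>_def by (rule chord_bound[OF \<tau>1 st(1)])
  finally show ?thesis .
qed

lemma cos_A_pos: "s \<in> {-l<..<l} \<Longrightarrow> cos (A s) > 0"
proof -
  assume s: "s \<in> {-l<..<l}"
  then have "S (A s) = s" using S_A by auto
  then have "S (- \<theta>) < S (A s)" "S (A s) < S \<theta>" using s by (auto simp: l_def S_odd)
  then have "- \<theta> < A s" "A s < \<theta>" using strict_mono_less[OF S_strict_mono] by auto
  then show ?thesis using \<theta> by (intro cos_gt_zero_pi) auto
qed

lemma xs_mono: "s \<le> t \<Longrightarrow> xs s \<le> xs t"
  by (rule DERIV_nonneg_imp_nondecreasing[where f=xs and a=s and b=t]) (use xs_derivative cos_A(1) c in \<open>auto intro: order_trans\<close>)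

lemma xs_strict_mono_inside:
  assumes "s < t" "-l \<le> s" "t \<le> l"
  shows "xs s < xs t"
proof -
  obtain z where z: "s < z" "z < t" "xs t - xs s = (t - s) * cos (A z)"
    using MVT2[OF assms(1) xs_derivative] by blast
  then have "cos (A z) > 0" using assms by (intro cos_A_pos) auto
  then have "0 < (t - s) * cos (A z)" using assms by simp
  then show ?thesis using z by simp
qed

text \<open>For \<tau> < 1 the x-coordinate increases strictly. For \<tau> = 1 the ends are
  vertical, so strictness holds on the clasp only, and two parameters on one end are told apart
  along its line.\<close>

lemma inj_\<Gamma>: "inj \<Gamma>"
proof -
  have *: "\<Gamma> s \<noteq> \<Gamma> t" if st: "s < t" for s t
  proof
    assume eq: "\<Gamma> s = \<Gamma> t"
    then have x: "xs s = xs t" by (metis \<Gamma>_def vector_3(1))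
    have right: False if "\<Gamma> a = \<Gamma> b" "a < b" "l \<le> a" for a b
    proof -
      have "(b - a) *\<^sub>R T \<theta> = 0"
        using that(1) \<Gamma>_right[of a] \<Gamma>_right[of b] that by (simp add: algebra_simps)
      then show False using that norm_T[of \<theta>] by auto
    qed
    consider "l \<le> s" | "t \<le> - l" | "s < l" "- l < t" by linarith
    then show False
    proof cases
      case 1 then show False using right[of s t] eq st by simp
    next
      case 2
      have "\<Gamma> (- t) = \<Gamma> (- s)" by (simp add: \<Gamma>_minus eq)
      then show False using right[of "- t" "- s"] st 2 by simp
    next
      case 3
      show False
      proof (cases "\<tau> < 1")
        case True
        obtain z where z: "xs t - xs s = (t - s) * cos (A z)" using MVT2[OF st xs_derivative] by blast
        have "0 < cos (A z)" using cos_A(1)[of z] c_pos_iff True by linarith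
        then have "0 < (t - s) * cos (A z)" using st by simp
        then show False using z x by simp
      next
        case False
        then have "0 < l" using \<tau> by (intro l_pos) auto
        then have "xs (max s (- l)) < xs (min t l)" using 3 st by (intro xs_strict_mono_inside) auto
        moreover have "xs s \<le> xs (max s (- l))" "xs (min t l) \<le> xs t" by (auto intro: xs_mono)
        ultimately show False using x by simp
      qed
    qed
  qed
  show ?thesis
  proof (rule injI)
    fix s t assume "\<Gamma> s = \<Gamma> t"
    then show "s = t" using *[of s t] *[of t s] by (cases s t rule: linorder_cases) auto
  qed
qed

end

section \<open>The link as a pair of piecewise smooth arcs\<close>

definition isometric_linear :: "(real^3 \<Rightarrow> real^3) \<Rightarrow> bool" where
  "isometric_linear f \<longleftrightarrow> linear f \<and> (\<forall>x y. f x \<bullet> f y = x \<bullet> y)"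

lemma isometric_linear_rot: "isometric_linear rot"
  using linear_rot rot_inner by (simp add: isometric_linear_def)

lemma has_vector_derivative_linear:
  fixes f :: "real^3 \<Rightarrow> real^3"
  assumes "linear f" "(g has_vector_derivative g') F"
  shows "((\<lambda>s. f (g s)) has_vector_derivative f g') F"
  by (rule bounded_linear.has_vector_derivative[OF linear_conv_bounded_linear[THEN iffD1, OF assms(1)] assms(2)])

lemma ksq_isometric: "isometric_linear f \<Longrightarrow> ksq (f V) (f B) = ksq V B"
  by (simp add: isometric_linear_def ksq_def)

lemma isometric_norm: "isometric_linear f \<Longrightarrow> norm (f x) = norm x"
  by (simp add: isometric_linear_def norm_eq_sqrt_inner)

lemma pw_curve_isometric:
  assumes f: "isometric_linear f" and "pw_curve \<gamma> v P"
  shows "pw_curve (\<lambda>s. f (\<gamma> s)) (\<lambda>s. f (v s)) ((\<lambda>(a, b, A). (a, b, \<lambda>s. f (A s))) ` P)"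
proof -
  interpret pw_curve \<gamma> v P by fact
  have l: "linear f" using f by (simp add: isometric_linear_def)
  have cf: "continuous_on UNIV f" using l by (simp add: linear_continuous_on linear_conv_bounded_linear)
  have cg: "continuous_on X (\<lambda>s. f (g s))" if "continuous_on X g" for X :: "real set" and g
    by (rule continuous_on_compose2[OF cf that]) simp
  show ?thesis
  proof
    show "finite ((\<lambda>(a, b, A). (a, b, \<lambda>s. f (A s))) ` P)" using finite_pieces by simp
    show "\<exists>a b A. (a, b, A) \<in> (\<lambda>(a, b, A). (a, b, \<lambda>s. f (A s))) ` P \<and> s \<in> {a..b}" if "s \<in> {0..1}" for s
      using cover[OF that] by force
    show "f (v s) \<noteq> 0" if "s \<in> {0..1}" for s
      using v_nz[OF that] isometric_norm[OF f, of "v s"] by auto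
    show "((\<lambda>s. f (\<gamma> s)) has_vector_derivative f (v s)) (at s within {0..1})" if "s \<in> {0..1}" for s
      by (rule has_vector_derivative_linear[OF l vel[OF that]])
    show "continuous_on {0..1} (\<lambda>s. f (v s))" by (rule cg[OF cont_v])
    fix a b A' assume "(a, b, A') \<in> (\<lambda>(a, b, A). (a, b, \<lambda>s. f (A s))) ` P"
    then obtain A where P: "(a, b, A) \<in> P" and A': "A' = (\<lambda>s. f (A s))" by auto
    show "0 \<le> a \<and> a < b \<and> b \<le> 1" by (rule piece[OF P])
    show "continuous_on {a..b} A'" unfolding A' by (rule cg[OF cont_acc[OF P]])
    show "((\<lambda>s. f (v s)) has_vector_derivative A' s) (at s within {a..b})" if "s \<in> {a..b}" for s
      unfolding A' by (rule has_vector_derivative_linear[OF l acc[OF P that]])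
  qed
qed

text \<open>\<open>K\<close> lies in the plane y = 0, so the reflection in that plane fixes it, and
  \<open>rot\<close> applied twice acts on it as the reflection in x = 0. Mirror symmetry of
  \<open>K\<close> therefore gives closure under all generators.\<close>

lemma symmetric_2star2I:
  assumes plane: "\<And>p. p \<in> K \<Longrightarrow> p$2 = 0" and m: "\<And>p. p \<in> K \<Longrightarrow> vector [- p$1, p$2, p$3] \<in> K"
  shows "symmetric_2star2 (K \<union> rot ` K)"
proof -
  define S where "S = K \<union> rot ` K"
  have mm: "vector [- (vector [- p$1, p$2, p$3] :: real^3)$1, (vector [- p$1, p$2, p$3] :: real^3)$2, (vector [- p$1, p$2, p$3] :: real^3)$3] = p" for p :: "real^3"
    by (simp add: vec_eq_iff forall_3)
  have genx: "vector [- p$1, p$2, p$3] \<in> S" if "p \<in> S" for p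
    using that
  proof (unfold S_def, elim UnE)
    assume "p \<in> rot ` K"
    then obtain q where q: "q \<in> K" "p = rot q" by blast
    then have "vector [- p$1, p$2, p$3] = p" using plane[OF q(1)] by (simp add: rot_def vec_eq_iff forall_3)
    then show "vector [- p$1, p$2, p$3] \<in> K \<union> rot ` K" using q by simp
  qed (simp add: m)
  have geny: "vector [p$1, - p$2, p$3] \<in> S" if "p \<in> S" for p
    using that
  proof (unfold S_def, elim UnE)
    assume "p \<in> rot ` K"
    then obtain q where q: "q \<in> K" "p = rot q" by blast
    then have "vector [p$1, - p$2, p$3] = rot (vector [- q$1, q$2, q$3])"
      using plane[OF q(1)] by (simp add: rot_def vec_eq_iff forall_3)
    then show "vector [p$1, - p$2, p$3] \<in> K \<union> rot ` K" using m[OF q(1)] by simp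
  next
    assume "p \<in> K"
    then have "vector [p$1, - p$2, p$3] = p" using plane by (simp add: vec_eq_iff forall_3)
    then show "vector [p$1, - p$2, p$3] \<in> K \<union> rot ` K" using \<open>p \<in> K\<close> by simp
  qed
  have genr: "rot p \<in> S" if "p \<in> S" for p
    using that
  proof (unfold S_def, elim UnE)
    assume "p \<in> rot ` K"
    then obtain q where q: "q \<in> K" "p = rot q" by blast
    then have "rot p = vector [- q$1, q$2, q$3]" using plane[OF q(1)] by (simp add: rot_def vec_eq_iff forall_3)
    then show "rot p \<in> K \<union> rot ` K" using m[OF q(1)] by simp
  qed simp
  have ontox: "(\<lambda>p. vector [- p$1, p$2, p$3]) ` S = S"
  proof (intro equalityI subsetI)
    fix p assume "p \<in> S"
    then show "p \<in> (\<lambda>p. vector [- p$1, p$2, p$3]) ` S"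
      using genx[of p] by (intro image_eqI[of _ _ "vector [- p$1, p$2, p$3]"]) (simp_all add: vec_eq_iff forall_3)
  qed (use genx in blast)
  have ontoy: "(\<lambda>p. vector [p$1, - p$2, p$3]) ` S = S"
  proof (intro equalityI subsetI)
    fix p assume "p \<in> S"
    then show "p \<in> (\<lambda>p. vector [p$1, - p$2, p$3]) ` S"
      using geny[of p] by (intro image_eqI[of _ _ "vector [p$1, - p$2, p$3]"]) (simp_all add: vec_eq_iff forall_3)
  qed (use geny in blast)
  have ontor: "rot ` S = S"
  proof (intro equalityI subsetI)
    fix p assume "p \<in> S"
    \<comment> \<open>\<open>rot\<close> has order 4, so its third power is its inverse.\<close>
    then have "rot (rot (rot p)) \<in> S" by (intro genr)
    then show "p \<in> rot ` S"
      by (intro image_eqI[of _ _ "rot (rot (rot p))"]) (simp_all add: rot_def vec_eq_iff forall_3)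
  qed (use genr in blast)
  have "g ` S = S" if "g \<in> group_2star2" for g
    using that
  proof (induction rule: group_2star2.induct)
    case (refl_x g)
    then show ?case using ontox by (simp only: image_comp[symmetric])
  next
    case (refl_y g)
    then show ?case using ontoy by (simp only: image_comp[symmetric])
  next
    case (rotorefl g)
    then show ?case using ontor by (simp only: image_comp[symmetric] rot_def[abs_def])
  qed simp
  then show ?thesis by (simp add: symmetric_2star2_def S_def)
qed

text \<open>With \<open>h\<close> at least 10 the faces lie beyond the clasp:
  \<open>T \<theta> \<bullet> \<Gamma> l\<close> is at most 5, so each straight end has length at
  least 5. For \<tau> > 0 the closing point at height \<open>h / \<tau>\<close> is then also farther
  from the origin than the tip, which is at most 4 deep.\<close>

locale clasp_arcs = clasp_param +
  fixes h :: real
  assumes h: "10 \<le> h"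
begin

definition ext :: real where "ext = h - T \<theta> \<bullet> \<Gamma> l"
definition E :: real where "E = l + ext"
definition pt :: "real \<Rightarrow> real" where "pt t = (2 * t - 1) * E"
definition \<gamma>1 :: "real \<Rightarrow> real^3" where "\<gamma>1 t = \<Gamma> (pt t)"
definition \<gamma>2 :: "real \<Rightarrow> real^3" where "\<gamma>2 t = rot (\<gamma>1 t)"
definition v1 :: "real \<Rightarrow> real^3" where "v1 t = (2 * E) *\<^sub>R T (A (pt t))"

lemma T_\<Gamma>_l: "T \<theta> \<bullet> \<Gamma> l = c * \<tau> + \<tau> * zs l"
  by (simp add: T_def \<Gamma>_def inner_vector3 \<theta> xs_l)

lemma ext_ge: "5 \<le> ext"
proof -
  have "c * \<tau> \<le> 1 * 1" using c \<tau> by (intro mult_mono) auto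
  moreover have "\<tau> * zs l \<le> 1 * 4" using \<tau> zs_bounds(3) mult_right_mono[of \<tau> 1 4] mult_left_mono[of "zs l" 4 \<tau>] by linarith
  ultimately show ?thesis using h by (simp add: ext_def T_\<Gamma>_l)
qed

lemma E: "l < E" "0 < E" "0 < ext"
  using ext_ge l_nonneg by (auto simp: E_def)

lemma pt_derivative: "(pt has_real_derivative 2 * E) (at t)"
  unfolding pt_def[abs_def] by (auto intro!: derivative_eq_intros)

lemma pt_image: "pt ` {0..1} = {-E..E}"
proof (intro equalityI subsetI)
  fix s assume "s \<in> pt ` {0..1}"
  then obtain t where t: "0 \<le> t" "t \<le> 1" "s = (2 * t - 1) * E" by (auto simp: pt_def)
  have "(-1) * E \<le> (2 * t - 1) * E" by (rule mult_right_mono) (use t E in auto)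
  moreover have "(2 * t - 1) * E \<le> 1 * E" by (rule mult_right_mono) (use t E in auto)
  ultimately have "- E \<le> (2 * t - 1) * E" "(2 * t - 1) * E \<le> E" by simp_all
  then show "s \<in> {-E..E}" using t by auto
next
  fix s assume s: "s \<in> {-E..E}"
  then have "s = pt ((s / E + 1) / 2)" "(s / E + 1) / 2 \<in> {0..1}" using E by (auto simp: pt_def field_simps)
  then show "s \<in> pt ` {0..1}" by blast
qed

lemma pt_ends: "pt 0 = - E" "pt 1 = E"
  by (simp_all add: pt_def)

lemma path_image_\<gamma>1: "path_image \<gamma>1 = \<Gamma> ` {-E..E}"
  unfolding path_image_def \<gamma>1_def pt_image[symmetric] by (simp add: image_image)

lemma path_image_\<gamma>2: "path_image \<gamma>2 = rot ` path_image \<gamma>1"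
  unfolding path_image_def \<gamma>2_def by (simp add: image_image)

lemma \<gamma>1_vel: "(\<gamma>1 has_vector_derivative v1 t) (at t within D)"
proof -
  have "((\<Gamma> \<circ> pt) has_vector_derivative (2 * E) *\<^sub>R T (A (pt t))) (at t)"
    by (rule vector_diff_chain_at) (use pt_derivative \<Gamma>_derivative has_real_derivative_iff_has_vector_derivative in auto)
  then show ?thesis by (simp add: \<gamma>1_def[abs_def] v1_def o_def has_vector_derivative_at_within)
qed

lemma continuous_pt: "continuous_on D pt"
  unfolding pt_def[abs_def] by (intro continuous_intros)

lemma continuous_v1: "continuous_on D v1"
  unfolding v1_def[abs_def]
  by (intro continuous_on_scaleR continuous_on_const continuous_on_compose2[OF continuous_T[of UNIV]]
      continuous_on_compose2[OF continuous_A continuous_pt]) auto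

lemma norm_v1: "norm (v1 t) = 2 * E"
  using E by (simp add: v1_def norm_T)

lemma v1_nz: "v1 t \<noteq> 0"
  using norm_v1[of t] E by auto

lemma velocity_\<gamma>1: "t \<in> {0..1} \<Longrightarrow> velocity \<gamma>1 t = v1 t"
  using vector_derivative_within_cbox[of 0 1 t \<gamma>1 "v1 t"] \<gamma>1_vel by simp

lemma unit_tangent_\<gamma>1: "t \<in> {0..1} \<Longrightarrow> unit_tangent \<gamma>1 t = T (A (pt t))"
  using E norm_T[of "A (pt t)"] by (simp add: unit_tangent_def velocity_\<gamma>1 v1_def sgn_scaleR sgn_div_norm)

lemma \<gamma>2_vel: "(\<gamma>2 has_vector_derivative rot (v1 t)) (at t within D)"
  unfolding \<gamma>2_def[abs_def] by (rule has_vector_derivative_linear[OF linear_rot \<gamma>1_vel])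

lemma velocity_\<gamma>2: "t \<in> {0..1} \<Longrightarrow> velocity \<gamma>2 t = rot (v1 t)"
  using vector_derivative_within_cbox[of 0 1 t \<gamma>2 "rot (v1 t)"] \<gamma>2_vel by simp

lemma rot_scale: "rot (r *\<^sub>R x) = r *\<^sub>R rot x"
  by (rule linear_cmul[OF linear_rot])

lemma unit_tangent_\<gamma>2: "t \<in> {0..1} \<Longrightarrow> unit_tangent \<gamma>2 t = rot (T (A (pt t)))"
  using E norm_T[of "A (pt t)"] by (simp add: unit_tangent_def velocity_\<gamma>2 v1_def rot_scale sgn_scaleR sgn_div_norm rot_norm)

lemma continuous_rot: "continuous_on D rot"
  using linear_rot by (simp add: linear_continuous_on linear_conv_bounded_linear)

lemma inj_pt: "inj pt"
  using E by (auto intro!: injI simp: pt_def)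

lemma inj_rot: "inj rot"
  by (rule injI) (metis rot_dist dist_eq_0_iff)

lemma C1_arc_\<gamma>1: "C1_arc \<gamma>1"
  unfolding C1_arc_def arc_def path_def
proof (intro conjI ballI)
  show "continuous_on {0..1} \<gamma>1"
    unfolding \<gamma>1_def[abs_def] by (rule continuous_on_compose2[OF continuous_\<Gamma>[of UNIV] continuous_pt]) simp
  show "inj_on \<gamma>1 {0..1}"
    using inj_\<Gamma> inj_pt by (auto simp: \<gamma>1_def inj_on_def)
  show "continuous_on {0..1} (velocity \<gamma>1)"
    by (rule continuous_on_eq[OF continuous_v1]) (simp add: velocity_\<gamma>1)
  fix t :: real assume t: "t \<in> {0..1}"
  show "\<gamma>1 differentiable at t within {0..1}"
    using \<gamma>1_vel unfolding differentiable_def has_vector_derivative_def by blast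
  show "velocity \<gamma>1 t \<noteq> 0" using velocity_\<gamma>1[OF t] v1_nz by simp
qed

lemma C1_arc_\<gamma>2: "C1_arc \<gamma>2"
  unfolding C1_arc_def arc_def path_def
proof (intro conjI ballI)
  have arc: "continuous_on {0..1} \<gamma>1" "inj_on \<gamma>1 {0..1}"
    using C1_arc_\<gamma>1 by (simp_all add: C1_arc_def arc_def path_def)
  show "continuous_on {0..1} \<gamma>2"
    unfolding \<gamma>2_def[abs_def] by (rule continuous_on_compose2[OF continuous_rot[of UNIV] arc(1)]) simp
  show "inj_on \<gamma>2 {0..1}"
    using arc(2) inj_rot by (auto simp: \<gamma>2_def inj_on_def)
  have "continuous_on {0..1} (\<lambda>t. rot (v1 t))"
    by (rule continuous_on_compose2[OF continuous_rot[of UNIV] continuous_v1]) simp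
  then show "continuous_on {0..1} (velocity \<gamma>2)"
    by (rule continuous_on_eq) (simp add: velocity_\<gamma>2)
  fix t :: real assume t: "t \<in> {0..1}"
  show "\<gamma>2 differentiable at t within {0..1}"
    using \<gamma>2_vel unfolding differentiable_def has_vector_derivative_def by blast
  show "velocity \<gamma>2 t \<noteq> 0" using velocity_\<gamma>2[OF t] v1_nz[of t] rot_norm[of "v1 t"] by auto
qed

lemma T_lipschitz: "dist (T a) (T b) \<le> \<bar>a - b\<bar>"
proof -
  have "norm (T a - T b) \<le> 1 * norm (a - b)"
  proof (rule differentiable_bound[of UNIV])
    show "(T has_derivative (\<lambda>r. r *\<^sub>R N x)) (at x within UNIV)" for x
      using T_derivative[of x] by (simp add: has_vector_derivative_def)
    show "onorm (\<lambda>r. r *\<^sub>R N x) \<le> 1" for x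
      by (rule onorm_le) (simp add: norm_N)
  qed auto
  then show ?thesis by (simp add: dist_norm)
qed

lemma C11_arcs:
  assumes "\<tau> < 1"
  shows "C11_arc \<gamma>1" "C11_arc \<gamma>2"
proof -
  have c0: "c > 0" using assms c_pos_iff by simp
  have AL: "\<bar>A s - A t\<bar> \<le> \<bar>s - t\<bar> / c" for s t
    using A_lipschitz[OF assms, of s t] A_lipschitz[OF assms, of t s] A_mono[of s t] A_mono[of t s]
    by (cases "s \<le> t") (auto simp: abs_if)
  have TL: "dist (T (A (pt s))) (T (A (pt t))) \<le> 2 * E / c * dist s t" for s t
  proof -
    have "dist (T (A (pt s))) (T (A (pt t))) \<le> \<bar>A (pt s) - A (pt t)\<bar>" by (rule T_lipschitz)
    also have "\<dots> \<le> \<bar>pt s - pt t\<bar> / c" by (rule AL)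
    also have "pt s - pt t = 2 * E * (s - t)" by (simp add: pt_def algebra_simps)
    finally show ?thesis using E by (simp add: dist_real_def abs_mult)
  qed
  have k: "0 \<le> 2 * E / c" using E c0 by simp
  show "C11_arc \<gamma>1"
    unfolding C11_arc_def using C1_arc_\<gamma>1 TL k
    by (intro conjI exI[of _ "2 * E / c"] lipschitz_onI) (auto simp: unit_tangent_\<gamma>1)
  show "C11_arc \<gamma>2"
    unfolding C11_arc_def using C1_arc_\<gamma>2 TL k
    by (intro conjI exI[of _ "2 * E / c"] lipschitz_onI) (auto simp: unit_tangent_\<gamma>2 rot_dist)
qed

definition acc1 :: "real \<Rightarrow> real^3" where
  "acc1 t = ((2 * E)\<^sup>2 * inverse (Rx (B (pt t)))) *\<^sub>R N (B (pt t))"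

text \<open>For \<tau> = 0 the clasp shrinks to a point, \<open>l = 0\<close>, and a middle piece
  would be degenerate; the arc is then a single straight piece.\<close>

definition P1 :: "(real \<times> real \<times> (real \<Rightarrow> real^3)) set" where
  "P1 = (if \<tau> = 0 then {(0, 1, \<lambda>_. 0)}
     else {(0, (E - l) / (2 * E), \<lambda>_. 0), ((E - l) / (2 * E), (E + l) / (2 * E), acc1), ((E + l) / (2 * E), 1, \<lambda>_. 0)})"

lemma pw_curve_\<gamma>1:
  assumes \<tau>1: "\<tau> < 1"
  shows "pw_curve \<gamma>1 v1 P1"
proof
  show "finite P1" by (simp add: P1_def)
  show "\<exists>a b A. (a, b, A) \<in> P1 \<and> s \<in> {a..b}" if "s \<in> {0..1}" for s
  proof (cases "\<tau> = 0")
    case True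
    then have "P1 = {(0, 1, \<lambda>_. 0)}" unfolding P1_def by simp
    then show ?thesis using that by blast
  next
    case False
    let ?p = "(E - l) / (2 * E)" and ?q = "(E + l) / (2 * E)"
    have "(0, ?p, \<lambda>_. 0) \<in> P1" "(?p, ?q, acc1) \<in> P1" "(?q, 1, \<lambda>_. 0) \<in> P1"
      using False by (simp_all add: P1_def)
    moreover have "s \<in> {0..?p} \<or> s \<in> {?p..?q} \<or> s \<in> {?q..1}"
      unfolding atLeastAtMost_iff using that by (metis atLeastAtMost_iff linear)
    ultimately show ?thesis by blast
  qed
  have l0: "0 < l" if "\<tau> \<noteq> 0" using l_pos that \<tau> by auto
  show "0 \<le> a \<and> a < b \<and> b \<le> 1" if P: "(a, b, A) \<in> P1" for a b A
  proof (cases "\<tau> = 0")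
    case True
    then have "P1 = {(0, 1, \<lambda>_. 0)}" unfolding P1_def by simp
    then show ?thesis using P by auto
  next
    case False
    have pq: "0 < (E - l) / (2 * E)" "(E - l) / (2 * E) < (E + l) / (2 * E)" "(E + l) / (2 * E) < 1"
      using l0[OF False] E by (simp, intro divide_strict_right_mono, auto simp: pos_divide_less_eq)
    consider "a = 0" "b = (E - l) / (2 * E)" | "a = (E - l) / (2 * E)" "b = (E + l) / (2 * E)"
      | "a = (E + l) / (2 * E)" "b = 1" using P False by (auto simp: P1_def)
    then show ?thesis using pq by cases linarith+
  qed
  show "(\<gamma>1 has_vector_derivative v1 s) (at s within {0..1})" for s by (rule \<gamma>1_vel)
  show "v1 s \<noteq> 0" for s by (rule v1_nz)
  show "continuous_on {0..1} v1" by (rule continuous_v1)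
  have const: "(v1 has_vector_derivative 0) (at s within {a..b})"
    if "s \<in> {a..b}" "\<And>t. t \<in> {a..b} \<Longrightarrow> A (pt t) = \<beta>" for s a b \<beta>
    by (rule has_vector_derivative_transform[OF that(1) _ has_vector_derivative_const[of "(2 * E) *\<^sub>R T \<beta>"]])
      (simp add: v1_def that(2))
  have cB: "continuous_on D (\<lambda>t. B (pt t))" for D
    by (rule continuous_on_compose2[OF _ continuous_pt]) (auto intro!: continuous_at_imp_continuous_on isCont_B)
  have Rpos: "Rx \<alpha> \<noteq> 0" for \<alpha> using Rx_pos[of \<alpha>] \<tau>1 by auto
  have cacc: "continuous_on D acc1" for D
    unfolding acc1_def[abs_def]
    by (intro continuous_intros continuous_on_compose2[OF continuous_Rx cB] continuous_on_compose2[OF continuous_N[of UNIV] cB])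
      (auto simp: Rpos)
  have mid: "(v1 has_vector_derivative acc1 s) (at s within {(E - l) / (2 * E)..(E + l) / (2 * E)})"
    if s: "s \<in> {(E - l) / (2 * E)..(E + l) / (2 * E)}" for s
  proof -
    have dB: "((\<lambda>t. B (pt t)) has_real_derivative inverse (Rx (B (pt s))) * (2 * E)) (at s)"
      by (rule DERIV_chain2[OF B_derivative pt_derivative]) (simp add: \<tau>1)
    have "((T \<circ> (\<lambda>t. B (pt t))) has_vector_derivative (inverse (Rx (B (pt s))) * (2 * E)) *\<^sub>R N (B (pt s))) (at s)"
      by (rule vector_diff_chain_at) (use dB T_derivative has_real_derivative_iff_has_vector_derivative in auto)
    then have "((\<lambda>t. (2 * E) *\<^sub>R T (B (pt t))) has_vector_derivative (2 * E) *\<^sub>R ((inverse (Rx (B (pt s))) * (2 * E)) *\<^sub>R N (B (pt s)))) (at s)"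
      unfolding o_def by (rule bounded_linear.has_vector_derivative[OF bounded_linear_scaleR_right])
    moreover have "(2 * E) *\<^sub>R ((inverse (Rx (B (pt s))) * (2 * E)) *\<^sub>R N (B (pt s))) = acc1 s"
      by (simp add: acc1_def power2_eq_square mult_ac)
    ultimately have *: "((\<lambda>t. (2 * E) *\<^sub>R T (B (pt t))) has_vector_derivative acc1 s) (at s within {(E - l) / (2 * E)..(E + l) / (2 * E)})"
      by (simp add: has_vector_derivative_at_within)
    show ?thesis
    proof (rule has_vector_derivative_transform[OF s _ *])
      fix t assume "t \<in> {(E - l) / (2 * E)..(E + l) / (2 * E)}"
      then have "pt t \<in> {-l..l}" using E by (auto simp: pt_def divide_simps algebra_simps)
      then show "v1 t = (2 * E) *\<^sub>R T (B (pt t))" by (simp add: v1_def A_eq_B)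
    qed
  qed
  show "continuous_on {a..b} A" if "(a, b, A) \<in> P1" for a b A
    using that cacc by (auto simp: P1_def split: if_splits)
  show "(v1 has_vector_derivative A s) (at s within {a..b})" if P: "(a, b, A) \<in> P1" and s: "s \<in> {a..b}" for a b A s
  proof (cases "\<tau> = 0")
    case True
    then have "P1 = {(0, 1, \<lambda>_. 0)}" unfolding P1_def by simp
    then have ab: "a = 0" "b = 1" "A = (\<lambda>_. 0)" using P by auto
    have "\<theta> = 0" unfolding \<theta>_def using True by simp
    then have "clasp_param.A \<tau> t = 0" for t using A_mem[of t] by simp
    then show ?thesis unfolding ab(3) by (intro const[OF s]) auto
  next
    case False
    then consider "a = 0" "b = (E - l) / (2 * E)" "A = (\<lambda>_. 0)" | "a = (E - l) / (2 * E)" "b = (E + l) / (2 * E)" "A = acc1"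
      | "a = (E + l) / (2 * E)" "b = 1" "A = (\<lambda>_. 0)" using P by (auto simp: P1_def)
    then show ?thesis
    proof cases
      case 1
      have "clasp_param.A \<tau> (pt t) = - \<theta>" if "t \<in> {a..b}" for t
        using that 1 E by (intro A_left) (auto simp: pt_def divide_simps algebra_simps)
      then show ?thesis unfolding 1(3) by (intro const[OF s]) auto
    next
      case 2
      then show ?thesis using mid s by simp
    next
      case 3
      have "clasp_param.A \<tau> (pt t) = \<theta>" if "t \<in> {a..b}" for t
        using that 3 E by (intro A_right) (auto simp: pt_def divide_simps algebra_simps)
      then show ?thesis unfolding 3(3) by (intro const[OF s]) auto
    qed
  qed
qed

definition P2 where "P2 = (\<lambda>(a, b, A). (a, b, \<lambda>s. rot (A s))) ` P1"

lemma two_pw_curves_\<gamma>: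
  assumes "\<tau> < 1"
  shows "two_pw_curves \<gamma>1 v1 P1 \<gamma>2 (\<lambda>s. rot (v1 s)) P2"
proof -
  have "pw_curve \<gamma>2 (\<lambda>s. rot (v1 s)) P2"
    unfolding \<gamma>2_def[abs_def] P2_def by (rule pw_curve_isometric[OF isometric_linear_rot pw_curve_\<gamma>1[OF assms]])
  then show ?thesis using pw_curve_\<gamma>1[OF assms] by (simp add: two_pw_curves_def)
qed

text \<open>\<open>acc1\<close> is built from \<open>B\<close> and \<open>v1\<close> from
  \<open>A\<close>, so the curvature formula makes sense only where the two angles agree, as on the
  middle piece; hence the disjunction.\<close>

lemma ksq_acc1_le:
  assumes "\<tau> < 1"
  shows "ksq (v1 t) (acc1 t) \<le> (1 / c)\<^sup>2 \<or> B (pt t) \<noteq> A (pt t)"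
proof (cases "B (pt t) = A (pt t)")
  case True
  have c0: "c > 0" using assms c_pos_iff by simp
  define R where "R = Rx (B (pt t))"
  have R: "c \<le> R" using Rx_bounds(1) by (simp add: R_def)
  have acc: "acc1 t = ((2 * E)\<^sup>2 * inverse R) *\<^sub>R N (A (pt t))"
    using True by (simp add: acc1_def R_def)
  have "ksq (v1 t) (acc1 t) = inverse R ^ 2"
    using E c0 R by (simp add: ksq_def v1_def acc T_N norm_eq_1[THEN iffD1, OF norm_T] norm_eq_1[THEN iffD1, OF norm_N] field_simps eval_nat_numeral)
  also have "\<dots> \<le> (1 / c)\<^sup>2"
    using R c0 by (intro power_mono) (auto simp: inverse_eq_divide intro: divide_left_mono)
  finally show ?thesis by simp
qed simp

lemma all_max_ksq_le:
  assumes "\<tau> < 1"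
  shows "c * sqrt (two_pw_curves.all_max_ksq \<gamma>1 v1 P1 \<gamma>2 (\<lambda>s. rot (v1 s)) P2) \<le> 1"
proof -
  interpret two_pw_curves \<gamma>1 v1 P1 \<gamma>2 "\<lambda>s. rot (v1 s)" P2 by (rule two_pw_curves_\<gamma>[OF assms])
  have c0: "c > 0" using assms c_pos_iff by simp
  have b1: "ksq (v1 s) (A s) \<le> (1 / c)\<^sup>2" if P: "(a, b, A) \<in> P1" and s: "s \<in> {a..b}" for a b A s
  proof (cases "A = acc1 \<and> \<tau> \<noteq> 0 \<and> a = (E - l) / (2 * E) \<and> b = (E + l) / (2 * E)")
    case True
    then have "(E - l) / (2 * E) \<le> s" "s \<le> (E + l) / (2 * E)" using s by auto
    then have "E - l \<le> s * (2 * E)" "s * (2 * E) \<le> E + l" using E by (simp_all add: pos_divide_le_eq pos_le_divide_eq)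
    then have "pt s \<in> {-l..l}" by (auto simp: pt_def algebra_simps)
    then show ?thesis using ksq_acc1_le[OF assms, of s] True by (simp add: A_eq_B)
  next
    case False
    then have "A = (\<lambda>_. 0)" using P by (auto simp: P1_def split: if_splits)
    then show ?thesis by (simp add: ksq_def)
  qed
  have m1: "c1.max_ksq \<le> (1 / c)\<^sup>2"
  proof -
    obtain x V B where "(x, V, B) \<in> c1.jets" "ksq V B = c1.max_ksq" by (rule c1.max_ksq_attained)
    then show ?thesis by (auto elim!: c1.jetsE dest: b1)
  qed
  have m2: "c2.max_ksq \<le> (1 / c)\<^sup>2"
  proof -
    obtain x V B where j: "(x, V, B) \<in> c2.jets" "ksq V B = c2.max_ksq" by (rule c2.max_ksq_attained)
    from j(1) obtain a b A' s where P: "(a, b, A') \<in> P2" "s \<in> {a..b}" "(x, V, B) = (\<gamma>2 s, rot (v1 s), A' s)"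
      by (rule c2.jetsE)
    then obtain A where "(a, b, A) \<in> P1" "A' = (\<lambda>s. rot (A s))" by (auto simp: P2_def)
    then show ?thesis using b1[of a b A s] P j(2) ksq_isometric[OF isometric_linear_rot] by auto
  qed
  have "sqrt all_max_ksq \<le> 1 / c"
    using m1 m2 c0 by (intro real_le_lsqrt) (auto simp: all_max_ksq_eq)
  then show ?thesis using c0 by (simp add: field_simps)
qed

lemma far_points:
  assumes "1/2 \<le> c" "0 \<le> a" "a < b" "b \<le> 1" "9/10 * pi * c \<le> 2 * E * (b - a)"
  shows "26/25 \<le> dist (\<gamma>1 a) (\<gamma>1 b)" "26/25 \<le> dist (\<gamma>2 a) (\<gamma>2 b)"
proof -
  have "pt b - pt a = 2 * E * (b - a)" by (simp add: pt_def algebra_simps)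
  moreover have "0 < 2 * E * (b - a)" using E assms by simp
  ultimately have "pt a \<le> pt b" "9/10 * pi * c \<le> pt b - pt a" using assms(5) by linarith+
  then have "26/25 \<le> dist (\<Gamma> (pt a)) (\<Gamma> (pt b))" by (rule long_chord[OF assms(1)])
  then show "26/25 \<le> dist (\<gamma>1 a) (\<gamma>1 b)" "26/25 \<le> dist (\<gamma>2 a) (\<gamma>2 b)" by (simp_all add: \<gamma>1_def \<gamma>2_def rot_dist)
qed

lemma setdist_\<gamma>: "setdist (path_image \<gamma>1) (path_image \<gamma>2) = 1"
  and setdist_curves: "setdist (\<Gamma> ` {-l..l}) (rot ` \<Gamma> ` {-l..l}) = 1"
proof -
  have ge: "1 \<le> setdist (\<Gamma> ` X) (rot ` \<Gamma> ` X)" if "X \<noteq> {}" for X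
    by (rule le_setdistI) (use that dsq_ge_1 in \<open>auto simp: dist_\<Gamma>_rot\<close>)
  have le: "setdist (\<Gamma> ` X) (rot ` \<Gamma> ` X) \<le> 1" if "0 \<in> X" "l \<in> X" for X
  proof -
    \<comment> \<open>The strut from the tip of one component to a junction of the other realizes
      the distance.\<close>
    have "mate 0 = l" by (simp add: mate_def A_0 l_def \<theta>_def)
    then have "dsq 0 l = 1" using strut(2)[of 0] l_nonneg by (simp add: dsq_def)
    then have "dist (\<Gamma> 0) (rot (\<Gamma> l)) = 1" by (simp add: dist_\<Gamma>_rot)
    moreover have "setdist (\<Gamma> ` X) (rot ` \<Gamma> ` X) \<le> dist (\<Gamma> 0) (rot (\<Gamma> l))"
      using that by (intro setdist_le_dist) auto
    ultimately show ?thesis by simp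
  qed
  show "setdist (path_image \<gamma>1) (path_image \<gamma>2) = 1"
    unfolding path_image_\<gamma>2 path_image_\<gamma>1 using ge[of "{-E..E}"] le[of "{-E..E}"] E l_nonneg by force
  show "setdist (\<Gamma> ` {-l..l}) (rot ` \<Gamma> ` {-l..l}) = 1"
    using ge[of "{-l..l}"] le[of "{-l..l}"] l_nonneg by force
qed

lemma mirror_inner: "mirror p \<bullet> mirror q = p \<bullet> q"
  by (simp add: mirror_def inner_vec_def sum_3)

lemma normal1_minus: "normal1 \<tau> (- 1) = mirror (T \<theta>)"
  by (simp add: normal1_def T_def mirror_def \<theta> c_def)

lemma normal2_eq: "normal2 \<tau> s = rot (normal1 \<tau> s)"
  by (simp add: normal1_def normal2_def rot_vector)

lemma extended_eq: "extended_clasp_curve \<tau> h = path_image \<gamma>1"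
proof -
  have seg: "closed_segment p (p + e *\<^sub>R w) = (\<lambda>r. p + r *\<^sub>R w) ` {0..e}" if "0 \<le> e" for p w :: "real^3" and e
  proof (intro equalityI subsetI)
    fix x assume "x \<in> closed_segment p (p + e *\<^sub>R w)"
    then obtain u where u: "0 \<le> u" "u \<le> 1" "x = (1 - u) *\<^sub>R p + u *\<^sub>R (p + e *\<^sub>R w)" by (auto simp: in_segment)
    have "x = p + (u * e) *\<^sub>R w" using u by (simp add: algebra_simps)
    moreover have "u * e \<le> 1 * e" using u that by (intro mult_right_mono) auto
    ultimately show "x \<in> (\<lambda>r. p + r *\<^sub>R w) ` {0..e}" using u that by auto
  next
    fix x assume "x \<in> (\<lambda>r. p + r *\<^sub>R w) ` {0..e}"
    then obtain r where r: "0 \<le> r" "r \<le> e" "x = p + r *\<^sub>R w" by auto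
    show "x \<in> closed_segment p (p + e *\<^sub>R w)"
    proof (cases "e = 0")
      case False
      then have "x = (1 - r / e) *\<^sub>R p + (r / e) *\<^sub>R (p + e *\<^sub>R w)" "r / e \<le> 1" "0 \<le> r / e"
        using r that by (auto simp: algebra_simps)
      then show ?thesis unfolding in_segment by blast
    qed (use r in auto)
  qed
  have s1: "tangent_segment \<tau> h 1 = \<Gamma> ` {l..E}"
  proof -
    have "tangent_segment \<tau> h 1 = (\<lambda>r. \<Gamma> l + r *\<^sub>R T \<theta>) ` {0..ext}"
      using seg[of ext "\<Gamma> l" "T \<theta>"] E by (simp add: tangent_segment_def Let_def clasp_point_end normal1_eq ext_def)
    also have "\<dots> = (\<lambda>r. \<Gamma> (l + r)) ` {0..ext}"
      by (rule image_cong) (use \<Gamma>_right[of "l + r" for r] in auto)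
    also have "\<dots> = \<Gamma> ` ((+) l ` {0..ext})" unfolding image_image ..
    also have "(+) l ` {0..ext} = {l..E}" by (simp add: E_def add.commute)
    finally show ?thesis .
  qed
  have s2: "tangent_segment \<tau> h (- 1) = \<Gamma> ` {-E..-l}"
  proof -
    have "tangent_segment \<tau> h (- 1) = (\<lambda>r. mirror (\<Gamma> l) + r *\<^sub>R mirror (T \<theta>)) ` {0..ext}"
      using seg[of ext "mirror (\<Gamma> l)" "mirror (T \<theta>)"] E
      by (simp add: tangent_segment_def Let_def clasp_point_end normal1_minus ext_def \<Gamma>_minus mirror_inner)
    also have "\<dots> = (\<lambda>r. \<Gamma> (- (l + r))) ` {0..ext}"
    proof (rule image_cong)
      fix r assume "r \<in> {0..ext}"
      then have "\<Gamma> (- (l + r)) = mirror (\<Gamma> l + r *\<^sub>R T \<theta>)" using \<Gamma>_right[of "l + r"] \<Gamma>_minus[of "l + r"] by simp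
      then show "mirror (\<Gamma> l) + r *\<^sub>R mirror (T \<theta>) = \<Gamma> (- (l + r))"
        by (simp add: mirror_def vec_eq_iff forall_3)
    qed simp
    also have "\<dots> = \<Gamma> ` (uminus ` ((+) l ` {0..ext}))" unfolding image_image ..
    also have "uminus ` ((+) l ` {0..ext}) = {-E..-l}" by (simp add: E_def add.commute)
    finally show ?thesis .
  qed
  have "{-l..l} \<union> {l..E} \<union> {-E..-l} = {-E..E}" using E l_nonneg by auto
  then show ?thesis
    unfolding extended_clasp_curve_def s1 s2 clasp_curve_eq path_image_\<gamma>1 image_Un[symmetric] by simp
qed

lemma \<Gamma>_E: "\<Gamma> E = \<Gamma> l + ext *\<^sub>R T \<theta>"
  using \<Gamma>_right[of E] E by (simp add: E_def)

lemma path_ends: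
  "pathfinish \<gamma>1 = \<Gamma> E" "pathstart \<gamma>1 = \<Gamma> (- E)" "pathfinish \<gamma>2 = rot (\<Gamma> E)" "pathstart \<gamma>2 = rot (\<Gamma> (- E))"
  by (simp_all add: pathfinish_def pathstart_def \<gamma>1_def \<gamma>2_def pt_ends)

lemma endpoints: "endpoint_constraints \<tau> h \<gamma>1 \<gamma>2"
proof -
  have "T \<theta> \<bullet> T \<theta> = 1" using norm_T by (simp add: norm_eq_1)
  then have "T \<theta> \<bullet> \<Gamma> E = h" by (simp add: \<Gamma>_E inner_add_right ext_def)
  then show ?thesis
    by (simp add: endpoint_constraints_def face1_def face2_def path_ends normal2_eq rot_inner normal1_minus normal1_eq(1) \<Gamma>_minus mirror_inner)
qed

lemma symmetric_images:
  assumes "\<And>s. s \<in> X \<Longrightarrow> - s \<in> X"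
  shows "symmetric_2star2 (\<Gamma> ` X \<union> rot ` \<Gamma> ` X)"
proof (rule symmetric_2star2I)
  show "p $ 2 = 0" if "p \<in> \<Gamma> ` X" for p using that by (auto simp: \<Gamma>_def)
  show "vector [- p $ 1, p $ 2, p $ 3] \<in> \<Gamma> ` X" if "p \<in> \<Gamma> ` X" for p
  proof -
    obtain s where s: "s \<in> X" "p = \<Gamma> s" using \<open>p \<in> \<Gamma> ` X\<close> by blast
    then have "vector [- p $ 1, p $ 2, p $ 3] = \<Gamma> (- s)" by (simp add: \<Gamma>_minus mirror_def)
    then show ?thesis using assms[OF s(1)] by simp
  qed
qed

end

section \<open>Balance of length and strut forces\<close>

text \<open>Inverse and adjoint of \<open>rot\<close>. It pulls a vector field along the second
  component back to the first one.\<close>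

definition rotinv :: "real^3 \<Rightarrow> real^3" where
  "rotinv p = vector [p$2, - p$1, - p$3]"

lemma linear_rotinv: "linear rotinv"
  by (rule linearI) (simp_all add: rotinv_def vec_eq_iff forall_3)

lemma rot_adjoint: "rot x \<bullet> y = x \<bullet> rotinv y" "rotinv y \<bullet> x = y \<bullet> rot x"
  by (simp_all add: rot_def rotinv_def inner_vec_def sum_3)

lemma integral_symmetric:
  fixes f :: "real \<Rightarrow> real"
  assumes "0 \<le> a" "continuous_on {-a..a} f"
  shows "integral {-a..a} f = integral {0..a} (\<lambda>x. f x + f (- x))"
proof -
  have c: "continuous_on {0..a} f" "continuous_on {-a..0} f" "continuous_on {0..a} (\<lambda>x. f (- x))"
    using assms by (auto intro: continuous_on_subset[OF assms(2)] intro!: continuous_on_compose2[OF assms(2)] continuous_intros)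
  have "integral {-a..a} f = integral {-a..0} f + integral {0..a} f"
    by (rule Henstock_Kurzweil_Integration.integral_combine[symmetric])
      (use assms in \<open>auto intro!: integrable_continuous_interval\<close>)
  also have "integral {-a..0} f = integral {0..a} (\<lambda>x. f (- x))"
    using Henstock_Kurzweil_Integration.integral_reflect_real[of a 0 "\<lambda>x. f (- x)"] by simp
  also have "integral {0..a} (\<lambda>x. f (- x)) + integral {0..a} f = integral {0..a} (\<lambda>x. f (- x) + f x)"
    by (rule integral_add[symmetric]) (use c in \<open>auto intro!: integrable_continuous_interval\<close>)
  finally show ?thesis by (simp add: add.commute)
qed

section \<open>First variation of length as a sum over struts\<close>

context clasp_arcs
begin

text \<open>Integration by parts with dT/d\<alpha> = N. The straight ends give boundary terms only:
  those at the faces vanish by \<open>bc\<close>, those at the junctions cancel. With the angle as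
  variable the result contains no curvature, which is infinite at the tip for \<tau> = 1.\<close>

lemma length_integral:
  assumes \<eta>: "\<And>x. (\<eta> has_derivative \<eta>' x) (at x)"
    and c\<eta>': "continuous_on UNIV (\<lambda>s. \<eta>' (\<Gamma> s) (T (A s)))"
    and bc: "T \<theta> \<bullet> \<eta> (\<Gamma> E) = 0" "T (- \<theta>) \<bullet> \<eta> (\<Gamma> (- E)) = 0"
  shows "integral {0..1} (\<lambda>t. \<eta>' (\<gamma>1 t) (v1 t) \<bullet> T (A (pt t))) = - integral {-\<theta>..\<theta>} (\<lambda>\<alpha>. \<eta> (\<Gamma> (S \<alpha>)) \<bullet> N \<alpha>)"
proof -
  define \<phi> where "\<phi> s = \<eta>' (\<Gamma> s) (T (A s)) \<bullet> T (A s)" for s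
  have lin: "\<eta>' x (r *\<^sub>R y) = r *\<^sub>R \<eta>' x y" for x r y
    using has_derivative_linear[OF \<eta>] by (rule linear_cmul)
  have cT: "continuous_on UNIV (\<lambda>s. T (A s))"
    by (rule continuous_on_compose2[OF continuous_T[of UNIV] continuous_A]) simp
  have c\<phi>: "continuous_on D \<phi>" for D
    unfolding \<phi>_def[abs_def] by (rule continuous_on_subset[OF continuous_on_inner[OF c\<eta>' cT]]) simp
  have int\<phi>: "\<phi> integrable_on {a..b}" for a b by (rule integrable_continuous_interval[OF c\<phi>])
  have d\<Gamma>: "((\<lambda>s. \<eta> (\<Gamma> s)) has_vector_derivative \<eta>' (\<Gamma> s) (T (A s))) (at s within D)" for s D
    using vector_derivative_diff_chain_within[OF has_vector_derivative_at_within[OF \<Gamma>_derivative] has_derivative_at_withinI[OF \<eta>]]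
    by (simp add: o_def)
  have "((\<lambda>t. (2 * E) *\<^sub>R \<phi> (pt t)) has_integral integral {pt 0..pt 1} \<phi> - integral {pt 1..pt 0} \<phi>) {0..1}"
  proof (rule has_integral_substitution_general[where s="{}" and c="-E" and d=E])
    show "(pt has_real_derivative 2 * E) (at x within {0..1})" for x
      by (rule DERIV_subset[OF pt_derivative]) simp
  qed (use pt_image continuous_pt c\<phi> in auto)
  moreover have "integral {pt 1..pt 0} \<phi> = 0" using E by (simp add: pt_ends)
  moreover have "(2 * E) *\<^sub>R \<phi> (pt t) = \<eta>' (\<gamma>1 t) (v1 t) \<bullet> T (A (pt t))" for t
    by (simp add: \<phi>_def \<gamma>1_def v1_def lin)
  ultimately have "integral {0..1} (\<lambda>t. \<eta>' (\<gamma>1 t) (v1 t) \<bullet> T (A (pt t))) = integral {-E..E} \<phi>"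
    by (simp add: pt_ends integral_unique)
  also have "\<dots> = integral {-E..-l} \<phi> + (integral {-l..l} \<phi> + integral {l..E} \<phi>)"
    using Henstock_Kurzweil_Integration.integral_combine[OF _ _ int\<phi>, of "-E" "-l" E]
      Henstock_Kurzweil_Integration.integral_combine[OF _ _ int\<phi>, of "-l" l E] E l_nonneg by simp
  also have "integral {l..E} \<phi> = \<eta> (\<Gamma> E) \<bullet> T \<theta> - \<eta> (\<Gamma> l) \<bullet> T \<theta>"
  proof (rule integral_unique, rule fundamental_theorem_of_calculus)
    fix s assume s: "s \<in> {l..E}"
    have "((\<lambda>s. \<eta> (\<Gamma> s) \<bullet> T \<theta>) has_vector_derivative \<eta>' (\<Gamma> s) (T (A s)) \<bullet> T \<theta>) (at s within {l..E})"
      by (rule bounded_linear.has_vector_derivative[OF bounded_linear_inner_left d\<Gamma>])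
    then show "((\<lambda>s. \<eta> (\<Gamma> s) \<bullet> T \<theta>) has_vector_derivative \<phi> s) (at s within {l..E})"
      using A_right[of s] s by (simp add: \<phi>_def)
  qed (use E in simp)
  also have "integral {-E..-l} \<phi> = \<eta> (\<Gamma> (- l)) \<bullet> T (- \<theta>) - \<eta> (\<Gamma> (- E)) \<bullet> T (- \<theta>)"
  proof (rule integral_unique, rule fundamental_theorem_of_calculus)
    fix s assume s: "s \<in> {-E..-l}"
    have "((\<lambda>s. \<eta> (\<Gamma> s) \<bullet> T (- \<theta>)) has_vector_derivative \<eta>' (\<Gamma> s) (T (A s)) \<bullet> T (- \<theta>)) (at s within {-E..-l})"
      by (rule bounded_linear.has_vector_derivative[OF bounded_linear_inner_left d\<Gamma>])
    then show "((\<lambda>s. \<eta> (\<Gamma> s) \<bullet> T (- \<theta>)) has_vector_derivative \<phi> s) (at s within {-E..-l})"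
      using A_left[of s] s by (simp add: \<phi>_def)
  qed (use E in simp)
  also have "integral {-l..l} \<phi> = \<eta> (\<Gamma> l) \<bullet> T \<theta> - \<eta> (\<Gamma> (- l)) \<bullet> T (- \<theta>) - integral {-\<theta>..\<theta>} (\<lambda>\<alpha>. \<eta> (\<Gamma> (S \<alpha>)) \<bullet> N \<alpha>)"
  proof -
    have cS: "continuous_on D S" for D by (simp add: continuous_at_imp_continuous_on isCont_S)
    have "((\<lambda>\<alpha>. Rx \<alpha> *\<^sub>R \<phi> (S \<alpha>)) has_integral integral {S (- \<theta>)..S \<theta>} \<phi> - integral {S \<theta>..S (- \<theta>)} \<phi>) {-\<theta>..\<theta>}"
    proof (rule has_integral_substitution_general[where s="{}" and c="-l" and d=l])
      show "(S has_real_derivative Rx x) (at x within {-\<theta>..\<theta>})" for x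
        by (rule DERIV_subset[OF S_derivative]) simp
      show "S ` {-\<theta>..\<theta>} \<subseteq> {-l..l}" using S_mem by blast
    qed (use \<theta>(1) cS c\<phi> in auto)
    moreover have "integral {S \<theta>..S (- \<theta>)} \<phi> = 0"
      using l_nonneg by (cases "l = 0") (auto simp: S_odd l_def[symmetric])
    ultimately have 1: "((\<lambda>\<alpha>. Rx \<alpha> * \<phi> (S \<alpha>)) has_integral integral {-l..l} \<phi>) {-\<theta>..\<theta>}"
      by (simp add: S_odd l_def)
    define G where "G \<alpha> = \<eta> (\<Gamma> (S \<alpha>)) \<bullet> T \<alpha>" for \<alpha>
    have "((\<lambda>\<alpha>. Rx \<alpha> * \<phi> (S \<alpha>) + \<eta> (\<Gamma> (S \<alpha>)) \<bullet> N \<alpha>) has_integral G \<theta> - G (- \<theta>)) {-\<theta>..\<theta>}"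
    proof (rule fundamental_theorem_of_calculus)
      fix \<alpha> assume \<alpha>: "\<alpha> \<in> {-\<theta>..\<theta>}"
      have "(((\<lambda>s. \<eta> (\<Gamma> s)) \<circ> S) has_vector_derivative Rx \<alpha> *\<^sub>R \<eta>' (\<Gamma> (S \<alpha>)) (T (A (S \<alpha>)))) (at \<alpha>)"
        by (rule vector_diff_chain_at) (use S_derivative d\<Gamma>[of _ UNIV] has_real_derivative_iff_has_vector_derivative in auto)
      from inner_has_real_derivative[OF this T_derivative]
      have "(G has_real_derivative Rx \<alpha> * \<phi> (S \<alpha>) + \<eta> (\<Gamma> (S \<alpha>)) \<bullet> N \<alpha>) (at \<alpha>)"
        by (simp add: G_def[abs_def] \<phi>_def A_S[OF \<alpha>])
      then show "(G has_vector_derivative Rx \<alpha> * \<phi> (S \<alpha>) + \<eta> (\<Gamma> (S \<alpha>)) \<bullet> N \<alpha>) (at \<alpha> within {-\<theta>..\<theta>})"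
        by (simp add: has_real_derivative_iff_has_vector_derivative has_vector_derivative_at_within)
    qed (use \<theta>(1) in simp)
    from has_integral_diff[OF this 1]
    have "((\<lambda>\<alpha>. \<eta> (\<Gamma> (S \<alpha>)) \<bullet> N \<alpha>) has_integral G \<theta> - G (- \<theta>) - integral {-l..l} \<phi>) {-\<theta>..\<theta>}"
      by simp
    then show ?thesis by (simp add: integral_unique G_def S_odd l_def)
  qed
  finally show ?thesis using bc by (simp add: inner_commute)
qed

lemma mate_derivative:
  assumes "\<alpha> \<in> {0<..<\<theta>}"
  shows "((\<lambda>\<alpha>. arcsin (\<tau> - sin \<alpha>)) has_real_derivative - cos \<alpha> / cos (arcsin (\<tau> - sin \<alpha>))) (at \<alpha>)"
proof -
  have "0 < sin \<alpha>" "sin \<alpha> < sin \<theta>"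
    using sin_monotone_2pi[of 0 \<alpha>] sin_monotone_2pi[of \<alpha> \<theta>] assms \<theta> by auto
  then have u: "- 1 < \<tau> - sin \<alpha>" "\<tau> - sin \<alpha> < 1" using \<tau> \<theta> by auto
  have "((\<lambda>\<alpha>. \<tau> - sin \<alpha>) has_real_derivative 0 - cos \<alpha>) (at \<alpha>)"
    by (intro DERIV_diff DERIV_const DERIV_sin)
  from DERIV_chain2[OF DERIV_arcsin[OF u] this] show ?thesis
    using u by (simp add: cos_arcsin field_simps)
qed

text \<open>Mirror images share their struts, so each of the four points carries two. At each point
  their sum is normal to the curve: the components across its plane cancel, and the tangential ones
  vanish by perpendicularity. The factor \<open>- cos \<alpha> / cos \<beta>\<close> is
  d\<beta>/d\<alpha>; with it the same weight \<open>m\<close> balances both ends of the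
  struts.\<close>

lemma strut_sum:
  fixes \<xi> :: "real^3 \<Rightarrow> real^3"
  assumes \<alpha>: "\<alpha> \<in> {0<..<\<theta>}"
  defines "\<beta> \<equiv> arcsin (\<tau> - sin \<alpha>)"
  defines "\<eta> \<equiv> \<lambda>p. rotinv (\<xi> (rot p))"
  defines "p \<equiv> \<lambda>i. \<Gamma> (i * S \<alpha>)" and "q \<equiv> \<lambda>i. rot (\<Gamma> (i * S \<beta>))"
  defines "Q \<equiv> \<lambda>i j. (p i - q j) \<bullet> (\<xi> (p i) - \<xi> (q j))"
  shows "\<exists>m>0. - (\<xi> (\<Gamma> (S \<alpha>)) \<bullet> N \<alpha> + \<xi> (\<Gamma> (S (- \<alpha>))) \<bullet> N (- \<alpha>))
    + (- cos \<alpha> / cos \<beta>) * (\<eta> (\<Gamma> (S \<beta>)) \<bullet> N \<beta> + \<eta> (\<Gamma> (S (- \<beta>))) \<bullet> N (- \<beta>))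
    = m * (Q 1 1 + Q 1 (- 1) + Q (- 1) 1 + Q (- 1) (- 1))"
    "\<And>i j. i \<in> {1, - 1} \<Longrightarrow> j \<in> {1, - 1} \<Longrightarrow> dist (p i) (q j) = 1"
proof -
  define s where "s = S \<alpha>"
  define t where "t = S \<beta>"
  have \<alpha>': "\<alpha> \<in> {-\<theta>..\<theta>}" using \<alpha> by auto
  have sA: "A s = \<alpha>" using A_S[OF \<alpha>'] by (simp add: s_def)
  have sin: "0 < sin \<alpha>" "sin \<alpha> < \<tau>"
    using sin_monotone_2pi[of 0 \<alpha>] sin_monotone_2pi[of \<alpha> \<theta>] \<alpha> \<theta> by auto
  have u: "\<tau> - sin \<alpha> \<in> {-\<tau>..\<tau>}" using sin \<tau> by auto
  have tA: "A t = \<beta>" unfolding t_def \<beta>_def by (rule A_S_arcsin[OF u])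
  have t_mate: "t = mate s" by (simp add: t_def \<beta>_def mate_def sA)
  have sl: "s \<in> {0..l}"
    using strict_mono_less_eq[OF S_strict_mono, of 0 \<alpha>] strict_mono_less_eq[OF S_strict_mono, of \<alpha> \<theta>] \<alpha> S_0
    by (auto simp: s_def l_def)
  have tl: "t \<in> {0..l}" unfolding t_mate using sl by (intro mate_mem) auto
  have t_mate': "s = mate t" using mate_mate[OF sl] t_mate by simp
  define Z where "Z = - (zs s + zs t)"
  have ca: "cos \<alpha> > 0" using \<alpha> \<theta> by (intro cos_gt_zero) auto
  have cb: "cos \<beta> > 0"
  proof -
    have "\<bar>\<tau> - sin \<alpha>\<bar> < 1" using sin \<tau> by auto
    then show ?thesis by (simp add: \<beta>_def cos_arcsin abs_less_iff abs_square_less_1)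
  qed
  have x: "xs s * cos \<alpha> = Z * sin \<alpha>" "xs t * cos \<beta> = Z * sin \<beta>"
    using strut(1)[OF sl, folded t_mate, unfolded sA] strut(1)[OF tl, folded t_mate', unfolded tA]
    by (simp_all add: Z_def add.commute)
  have Zpos: "Z > 0"
  proof -
    have "0 < s" using strict_mono_less[OF S_strict_mono, of 0 \<alpha>] \<alpha> S_0 by (simp add: s_def)
    then have "xs 0 < xs s" using sl by (intro xs_strict_mono_inside) auto
    then have "0 < xs s * cos \<alpha>" using ca xs_0 by simp
    then have "0 < Z * sin \<alpha>" using x by simp
    then show ?thesis using sin by (simp add: zero_less_mult_iff)
  qed
  have xv: "xs s = Z * sin \<alpha> / cos \<alpha>" "xs t = Z * sin \<beta> / cos \<beta>"
    using x ca cb by (auto simp: field_simps)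
  have pm: "p 1 = vector [xs s, 0, zs s]" "p (- 1) = vector [- xs s, 0, zs s]"
    "q 1 = vector [0, xs t, - zs t]" "q (- 1) = vector [0, - xs t, - zs t]"
    using xs_odd[of s] zs_even[of s] xs_odd[of t] zs_even[of t]
    by (simp_all add: p_def q_def \<Gamma>_def s_def[symmetric] t_def[symmetric] rot_vector)
  have G: "\<Gamma> (S \<alpha>) = p 1" "\<Gamma> (S (- \<alpha>)) = p (- 1)" "rot (\<Gamma> (S \<beta>)) = q 1" "rot (\<Gamma> (S (- \<beta>))) = q (- 1)"
    by (simp_all add: p_def q_def S_odd)
  \<comment> \<open>At a point of the first component the two struts add up to horizontal part
    \<open>2 * xs s\<close> and vertical part \<open>- 2 * Z\<close>, which is a multiple of the
    normal because \<open>xs s = Z * sin \<alpha> / cos \<alpha>\<close>. \<open>M\<close> is the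
    same factor at the other end.\<close>
  define K where "K = - 2 * Z / cos \<alpha>"
  define M where "M = - 2 * Z / cos \<beta>"
  have K: "K * sin \<alpha> = - (2 * xs s)" "K * cos \<alpha> = 2 * (zs s + zs t)"
    and M: "M * sin \<beta> = - (2 * xs t)" "M * cos \<beta> = 2 * (zs s + zs t)"
  proof -
    have a: "- 2 * Z / y * y = - 2 * Z" "- 2 * Z / y * r = - (2 * (Z * r / y))" if "0 < y" for y r :: real
      using that by simp_all
    have z: "2 * (zs s + zs t) = - 2 * Z" unfolding Z_def by simp
    show "K * sin \<alpha> = - (2 * xs s)" "M * sin \<beta> = - (2 * xs t)"
      unfolding K_def M_def a(2)[OF ca] a(2)[OF cb] xv by (rule refl)+
    show "K * cos \<alpha> = 2 * (zs s + zs t)" "M * cos \<beta> = 2 * (zs s + zs t)"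
      unfolding K_def M_def a(1)[OF ca] a(1)[OF cb] z by (rule refl)+
  qed
  have e1: "2 *\<^sub>R p 1 - q 1 - q (- 1) = K *\<^sub>R N \<alpha>"
    "2 *\<^sub>R p (- 1) - q 1 - q (- 1) = K *\<^sub>R N (- \<alpha>)"
    "2 *\<^sub>R q 1 - p 1 - p (- 1) = M *\<^sub>R rot (N \<beta>)"
    "2 *\<^sub>R q (- 1) - p 1 - p (- 1) = M *\<^sub>R rot (N (- \<beta>))"
    unfolding pm N_def rot_vector by (simp_all add: vec_eq_iff forall_3 K M)
  have sum: "Q 1 1 + Q 1 (- 1) + Q (- 1) 1 + Q (- 1) (- 1) =
      (2 *\<^sub>R p 1 - q 1 - q (- 1)) \<bullet> \<xi> (p 1) + (2 *\<^sub>R p (- 1) - q 1 - q (- 1)) \<bullet> \<xi> (p (- 1))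
    + (2 *\<^sub>R q 1 - p 1 - p (- 1)) \<bullet> \<xi> (q 1) + (2 *\<^sub>R q (- 1) - p 1 - p (- 1)) \<bullet> \<xi> (q (- 1))"
    by (simp add: Q_def inner_diff_left inner_diff_right)
  have \<eta>N: "\<eta> y \<bullet> N r = rot (N r) \<bullet> \<xi> (rot y)" for y r
    by (simp add: \<eta>_def rot_adjoint inner_commute)
  show "\<exists>m>0. - (\<xi> (\<Gamma> (S \<alpha>)) \<bullet> N \<alpha> + \<xi> (\<Gamma> (S (- \<alpha>))) \<bullet> N (- \<alpha>))
    + (- cos \<alpha> / cos \<beta>) * (\<eta> (\<Gamma> (S \<beta>)) \<bullet> N \<beta> + \<eta> (\<Gamma> (S (- \<beta>))) \<bullet> N (- \<beta>))
    = m * (Q 1 1 + Q 1 (- 1) + Q (- 1) 1 + Q (- 1) (- 1))"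
  proof (intro exI conjI)
    show "0 < cos \<alpha> / (2 * Z)" using ca Zpos by simp
    show "- (\<xi> (\<Gamma> (S \<alpha>)) \<bullet> N \<alpha> + \<xi> (\<Gamma> (S (- \<alpha>))) \<bullet> N (- \<alpha>))
    + (- cos \<alpha> / cos \<beta>) * (\<eta> (\<Gamma> (S \<beta>)) \<bullet> N \<beta> + \<eta> (\<Gamma> (S (- \<beta>))) \<bullet> N (- \<beta>))
    = cos \<alpha> / (2 * Z) * (Q 1 1 + Q 1 (- 1) + Q (- 1) 1 + Q (- 1) (- 1))"
      unfolding sum e1 \<eta>N G K_def M_def using ca cb Zpos by (simp add: inner_commute field_simps)
  qed
  show "dist (p i) (q j) = 1" if "i \<in> {1, - 1}" "j \<in> {1, - 1}" for i j
  proof -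
    have "dsq (i * s) (j * t) = dsq s t"
      using that dsq_abs[of "i * s" "j * t"] sl tl by auto
    also have "\<dots> = 1" using strut(2)[OF sl] t_mate by (simp add: dsq_def)
    finally show ?thesis by (simp add: p_def q_def dist_\<Gamma>_rot s_def t_def)
  qed
qed

text \<open>Both variations are folded to nonnegative angles, and the second is rewritten in the
  angle of the partner; then the integrands combine to nonnegative multiples of strut
  variations.\<close>

lemma length_variation_nonneg:
  assumes "C2_map \<xi>" and tan: "tangent_at_endpoints \<tau> \<gamma>1 \<gamma>2 \<xi>"
    and struts: "\<And>p q. p \<in> path_image \<gamma>1 \<Longrightarrow> q \<in> path_image \<gamma>2 \<Longrightarrow> dist p q = 1 \<Longrightarrow> 0 \<le> (p - q) \<bullet> (\<xi> p - \<xi> q)"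
  shows "0 \<le> length_variation \<xi> \<gamma>1 + length_variation \<xi> \<gamma>2"
proof -
  obtain \<xi>' \<xi>2 where \<xi>: "\<And>x. (\<xi> has_derivative blinfun_apply (\<xi>' x)) (at x)"
    and \<xi>2: "\<And>x. (\<xi>' has_derivative blinfun_apply (\<xi>2 x)) (at x)"
    using assms(1) unfolding C2_map_def by blast
  have c\<xi>': "continuous_on UNIV \<xi>'"
    by (rule has_derivative_continuous_on) (rule has_derivative_at_withinI[OF \<xi>2])
  have c\<xi>: "continuous_on UNIV \<xi>" by (rule C2_map_continuous[OF assms(1)])
  define \<eta> where "\<eta> p = rotinv (\<xi> (rot p))" for p
  have bl: "bounded_linear rot" "bounded_linear rotinv"
    using linear_rot linear_rotinv by (simp_all add: linear_conv_bounded_linear)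
  have cri: "continuous_on UNIV rotinv" by (rule linear_continuous_on[OF bl(2)])
  have d\<eta>: "(\<eta> has_derivative (\<lambda>w. rotinv (blinfun_apply (\<xi>' (rot x)) (rot w)))) (at x)" for x
    unfolding \<eta>_def[abs_def]
    by (rule bounded_linear.has_derivative[OF bl(2)], rule has_derivative_compose[OF bounded_linear_imp_has_derivative[OF bl(1)] \<xi>])
  have cT: "continuous_on UNIV (\<lambda>s. T (A s))"
    by (rule continuous_on_compose2[OF continuous_T[of UNIV] continuous_A]) simp
  note ba = bounded_bilinear.continuous_on[OF bounded_bilinear_blinfun_apply]
  have c1: "continuous_on UNIV (\<lambda>s. blinfun_apply (\<xi>' (\<Gamma> s)) (T (A s)))"
    by (intro ba cT continuous_on_compose2[OF c\<xi>' continuous_\<Gamma>]) simp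
  have c2: "continuous_on UNIV (\<lambda>s. rotinv (blinfun_apply (\<xi>' (rot (\<Gamma> s))) (rot (T (A s)))))"
    by (intro continuous_on_compose2[OF cri] ba continuous_on_compose2[OF c\<xi>'] continuous_on_compose2[OF continuous_rot[of UNIV]]
        continuous_\<Gamma> cT) auto
  have chain: "velocity (\<xi> \<circ> \<gamma>) t = blinfun_apply (\<xi>' (\<gamma> t)) v"
    if "(\<gamma> has_vector_derivative v) (at t within {0..1})" "t \<in> {0..1}" for \<gamma> v t
    using vector_derivative_diff_chain_within[OF that(1) has_derivative_at_withinI[OF \<xi>]] that(2)
      vector_derivative_within_cbox[of 0 1 t] by simp
  have L1: "length_variation \<xi> \<gamma>1 = - integral {-\<theta>..\<theta>} (\<lambda>\<alpha>. \<xi> (\<Gamma> (S \<alpha>)) \<bullet> N \<alpha>)"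
  proof -
    have "length_variation \<xi> \<gamma>1 = integral {0..1} (\<lambda>t. blinfun_apply (\<xi>' (\<gamma>1 t)) (v1 t) \<bullet> T (A (pt t)))"
      unfolding length_variation_def
      by (rule Henstock_Kurzweil_Integration.integral_cong) (simp add: chain[OF \<gamma>1_vel] unit_tangent_\<gamma>1)
    then show ?thesis
      using length_integral[OF \<xi> c1] tan by (simp add: tangent_at_endpoints_def path_ends normal1_eq)
  qed
  have L2: "length_variation \<xi> \<gamma>2 = - integral {-\<theta>..\<theta>} (\<lambda>\<alpha>. \<eta> (\<Gamma> (S \<alpha>)) \<bullet> N \<alpha>)"
  proof -
    have "length_variation \<xi> \<gamma>2 = integral {0..1} (\<lambda>t. rotinv (blinfun_apply (\<xi>' (rot (\<gamma>1 t))) (rot (v1 t))) \<bullet> T (A (pt t)))"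
      unfolding length_variation_def
      by (rule Henstock_Kurzweil_Integration.integral_cong)
        (simp add: chain[OF \<gamma>2_vel] unit_tangent_\<gamma>2 rot_adjoint, simp add: \<gamma>2_def)
    moreover have "T \<theta> \<bullet> \<eta> (\<Gamma> E) = 0" "T (- \<theta>) \<bullet> \<eta> (\<Gamma> (- E)) = 0"
      using tan linear_neg[OF linear_rot, of "T (- \<theta>)"]
      by (simp_all add: tangent_at_endpoints_def path_ends normal2_eq normal1_eq \<eta>_def rot_adjoint(1)[symmetric])
    ultimately show ?thesis using length_integral[OF d\<eta> c2] by simp
  qed
  have c\<eta>: "continuous_on UNIV \<eta>"
    unfolding \<eta>_def[abs_def]
    by (intro continuous_on_compose2[OF cri] continuous_on_compose2[OF c\<xi>] continuous_rot) auto
  have cS: "continuous_on D S" for D by (simp add: continuous_at_imp_continuous_on isCont_S)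
  have cN: "continuous_on D (\<lambda>\<alpha>. \<zeta> (\<Gamma> (S \<alpha>)) \<bullet> N \<alpha>)" if "continuous_on UNIV \<zeta>" for \<zeta> D
    by (intro continuous_on_inner continuous_N continuous_on_compose2[OF that] continuous_on_compose2[OF continuous_\<Gamma>[of UNIV]] cS) auto
  define F1 where "F1 \<alpha> = \<xi> (\<Gamma> (S \<alpha>)) \<bullet> N \<alpha> + \<xi> (\<Gamma> (S (- \<alpha>))) \<bullet> N (- \<alpha>)" for \<alpha>
  define F2 where "F2 \<alpha> = \<eta> (\<Gamma> (S \<alpha>)) \<bullet> N \<alpha> + \<eta> (\<Gamma> (S (- \<alpha>))) \<bullet> N (- \<alpha>)" for \<alpha>
  have cF: "continuous_on D F1" "continuous_on D F2" for D
    unfolding F1_def[abs_def] F2_def[abs_def]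
    by (intro continuous_on_add cN c\<xi> c\<eta> continuous_on_compose2[OF cN[OF c\<xi>, of UNIV], where f=uminus]
        continuous_on_compose2[OF cN[OF c\<eta>, of UNIV], where f=uminus] continuous_intros; simp)+
  have I1: "length_variation \<xi> \<gamma>1 = - integral {0..\<theta>} F1" "length_variation \<xi> \<gamma>2 = - integral {0..\<theta>} F2"
    unfolding L1 L2 F1_def[abs_def] F2_def[abs_def]
    using integral_symmetric[OF \<theta>(1) cN[OF c\<xi>]] integral_symmetric[OF \<theta>(1) cN[OF c\<eta>]] by simp_all
  define \<beta> where "\<beta> \<alpha> = arcsin (\<tau> - sin \<alpha>)" for \<alpha>
  have \<beta>_mem: "\<tau> - sin \<alpha> \<in> {0..\<tau>}" if "\<alpha> \<in> {0..\<theta>}" for \<alpha>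
    using sin_monotone_2pi_le[of 0 \<alpha>] sin_monotone_2pi_le[of \<alpha> \<theta>] that \<theta> by auto
  \<comment> \<open>\<open>\<beta>\<close> exchanges 0 and \<open>\<theta>\<close>. The reversed
    orientation makes the first integral vanish and leaves the second with a minus sign.\<close>
  have "((\<lambda>\<alpha>. (- cos \<alpha> / cos (\<beta> \<alpha>)) *\<^sub>R F2 (\<beta> \<alpha>)) has_integral
      integral {\<beta> 0..\<beta> \<theta>} F2 - integral {\<beta> \<theta>..\<beta> 0} F2) {0..\<theta>}"
  proof (rule has_integral_substitution_general[where s="{0, \<theta>}" and c=0 and d=\<theta>])
    show "\<beta> ` {0..\<theta>} \<subseteq> {0..\<theta>}"
    proof
      fix y assume "y \<in> \<beta> ` {0..\<theta>}"
      then obtain \<alpha> where \<alpha>: "\<alpha> \<in> {0..\<theta>}" "y = \<beta> \<alpha>" by blast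
      have "arcsin 0 \<le> arcsin (\<tau> - sin \<alpha>)" "arcsin (\<tau> - sin \<alpha>) \<le> arcsin \<tau>"
        by (rule arcsin_le_arcsin; use \<beta>_mem[OF \<alpha>(1)] \<tau> in auto)+
      then show "y \<in> {0..\<theta>}" using \<alpha> by (simp add: \<beta>_def \<theta>_def)
    qed
    show "continuous_on {0..\<theta>} \<beta>"
      unfolding \<beta>_def[abs_def] by (intro continuous_on_arcsin continuous_intros) (use \<beta>_mem \<tau> in force)
    show "(\<beta> has_real_derivative - cos x / cos (\<beta> x)) (at x within {0..\<theta>})" if "x \<in> {0..\<theta>} - {0, \<theta>}" for x
      unfolding \<beta>_def[abs_def] by (rule DERIV_subset[OF mate_derivative]) (use that in auto)
  qed (use \<theta>(1) cF in auto)
  moreover have "\<beta> 0 = \<theta>" "\<beta> \<theta> = 0" by (simp_all add: \<beta>_def \<theta>_def[symmetric] \<theta>)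
  moreover have "integral {\<theta>..0} F2 = 0" using \<theta>(1) by (cases "\<theta> = 0") auto
  ultimately have h2: "((\<lambda>\<alpha>. (- cos \<alpha> / cos (\<beta> \<alpha>)) * F2 (\<beta> \<alpha>)) has_integral - integral {0..\<theta>} F2) {0..\<theta>}"
    by simp
  have "(F1 has_integral integral {0..\<theta>} F1) {0..\<theta>}"
    by (intro integrable_integral integrable_continuous_interval cF)
  from has_integral_add[OF has_integral_neg[OF this] h2]
  have "((\<lambda>\<alpha>. - F1 \<alpha> + (- cos \<alpha> / cos (\<beta> \<alpha>)) * F2 (\<beta> \<alpha>)) has_integral
      length_variation \<xi> \<gamma>1 + length_variation \<xi> \<gamma>2) {0..\<theta>}"
    by (simp add: I1)
  \<comment> \<open>\<open>strut_sum\<close> covers the open interval; at \<tau> = 1 a cosine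
    vanishes at each of its ends.\<close>
  then have "((\<lambda>\<alpha>. if \<alpha> \<in> {0, \<theta>} then 0 else - F1 \<alpha> + (- cos \<alpha> / cos (\<beta> \<alpha>)) * F2 (\<beta> \<alpha>)) has_integral
      length_variation \<xi> \<gamma>1 + length_variation \<xi> \<gamma>2) {0..\<theta>}"
    by (rule has_integral_spike_finite[rotated 2, of _ _ _ "{0, \<theta>}"]) auto
  then show ?thesis
  proof (rule has_integral_nonneg)
    fix \<alpha> assume \<alpha>: "\<alpha> \<in> {0..\<theta>}"
    show "0 \<le> (if \<alpha> \<in> {0, \<theta>} then 0 else - F1 \<alpha> + (- cos \<alpha> / cos (\<beta> \<alpha>)) * F2 (\<beta> \<alpha>))"
    proof (cases "\<alpha> \<in> {0, \<theta>}")
      case False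
      then have a: "\<alpha> \<in> {0<..<\<theta>}" using \<alpha> by auto
      define p where "p i = \<Gamma> (i * S \<alpha>)" for i
      define q where "q i = rot (\<Gamma> (i * S (\<beta> \<alpha>)))" for i
      define Q where "Q i j = (p i - q j) \<bullet> (\<xi> (p i) - \<xi> (q j))" for i j
      have mem: "S \<alpha> \<in> {-E..E}" "S (\<beta> \<alpha>) \<in> {-E..E}"
      proof -
        have "\<beta> \<alpha> \<in> {-\<theta>..\<theta>}" unfolding \<beta>_def using \<beta>_mem[OF \<alpha>] \<tau> by (intro arcsin_mem) auto
        then show "S \<alpha> \<in> {-E..E}" "S (\<beta> \<alpha>) \<in> {-E..E}"
          using S_mem[of \<alpha>] S_mem[of "\<beta> \<alpha>"] \<alpha> E by fastforce+
      qed
      have Qpos: "0 \<le> Q i j" if ij: "i \<in> {1, - 1}" "j \<in> {1, - 1}" for i j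
      proof -
        have "p i \<in> path_image \<gamma>1" "q j \<in> path_image \<gamma>2"
          unfolding path_image_\<gamma>2 path_image_\<gamma>1 p_def q_def using mem ij by auto
        moreover have "dist (p i) (q j) = 1"
          using strut_sum(2)[OF a ij] by (simp add: p_def q_def \<beta>_def)
        ultimately show ?thesis unfolding Q_def by (rule struts)
      qed
      obtain m where "m > 0" "- F1 \<alpha> + (- cos \<alpha> / cos (\<beta> \<alpha>)) * F2 (\<beta> \<alpha>) = m * (Q 1 1 + Q 1 (- 1) + Q (- 1) 1 + Q (- 1) (- 1))"
        using strut_sum(1)[OF a, of \<xi>] by (auto simp: F1_def F2_def \<eta>_def \<beta>_def Q_def p_def q_def)
      then show ?thesis using Qpos False by simp
    qed simp
  qed
qed

end

section \<open>The Hopf link\<close>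

definition radial :: "real \<Rightarrow> (real^3 \<Rightarrow> real) \<Rightarrow> real^3 \<Rightarrow> real^3" where
  "radial k G p = (exp (G (sgn p)) * norm p powr k) *\<^sub>R sgn p"

lemma radial_0 [simp]: "radial k G 0 = 0"
  by (simp add: radial_def)

lemma norm_radial: "p \<noteq> 0 \<Longrightarrow> norm (radial k G p) = exp (G (sgn p)) * norm p powr k"
  by (simp add: radial_def norm_sgn)

lemma sgn_radial: "sgn (radial k G p) = sgn p"
proof (cases "p = 0")
  case False
  then have "0 < exp (G (sgn p)) * norm p powr k" by simp
  moreover have "sgn (sgn p) = sgn p" using False by (simp add: sgn_div_norm[of "sgn p"] norm_sgn)
  ultimately show ?thesis by (simp add: radial_def sgn_scaleR)
qed simp

text \<open>On each ray the map is affine in the logarithm of the distance, with slope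
  \<open>k\<close> and shift \<open>G\<close>; so its inverse has the same form.\<close>

lemma radial_inverse:
  assumes k: "k > 0"
  shows "radial (1 / k) (\<lambda>x. - G x / k) (radial k G p) = p"
proof (cases "p = 0")
  case False
  have n: "norm p > 0" using False by simp
  have "(exp (G (sgn p)) * norm p powr k) powr (1 / k) = exp (G (sgn p) / k) * norm p"
    using n k by (simp add: powr_mult powr_powr exp_powr_real)
  then have "exp (- G (sgn p) / k) * norm (radial k G p) powr (1 / k) = norm p"
    using False k by (simp add: norm_radial exp_minus field_simps)
  then show ?thesis
    using False by (simp add: radial_def[of "1 / k"] sgn_radial) (simp add: sgn_div_norm)
qed simp

lemma continuous_radial:
  assumes k: "k > 0" and G: "continuous_on UNIV G"
  shows "continuous_on UNIV (radial k G)"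
proof -
  have "compact (G ` sphere 0 1)" by (intro compact_continuous_image continuous_on_subset[OF G]) auto
  then obtain C where C: "\<And>x. x \<in> sphere 0 1 \<Longrightarrow> \<bar>G x\<bar> \<le> C"
    using compact_imp_bounded bounded_iff by (metis image_eqI real_norm_def)
  have "isCont (radial k G) p" for p
  proof (cases "p = 0")
    case False
    have "continuous_on (- {0}) (radial k G)"
      unfolding radial_def
      by (intro continuous_intros continuous_on_compose2[OF G] continuous_on_sgn) auto
    then show ?thesis using False by (simp add: continuous_on_eq_continuous_at open_Compl)
  next
    case True
    \<comment> \<open>At the origin \<open>G (sgn p)\<close> has no limit in general, but
      \<open>G\<close> is bounded on the unit sphere, so the image is squeezed to 0.\<close>
    have "((\<lambda>p. exp C * norm p powr k) \<longlongrightarrow> exp C * 0) (at (0 :: real^3))"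
    proof (intro tendsto_mult_left)
      have "((\<lambda>p. norm p powr k) \<longlongrightarrow> norm (0 :: real^3) powr k) (at (0 :: real^3))"
        using k by (intro tendsto_powr' tendsto_norm tendsto_ident_at tendsto_const) auto
      then show "((\<lambda>p. norm p powr k) \<longlongrightarrow> 0) (at (0 :: real^3))" by simp
    qed
    moreover have "\<forall>\<^sub>F p in at (0 :: real^3). norm (radial k G p) \<le> exp C * norm p powr k"
    proof (rule always_eventually, rule allI)
      fix p :: "real^3"
      show "norm (radial k G p) \<le> exp C * norm p powr k"
      proof (cases "p = 0")
        case False
        then have "sgn p \<in> sphere 0 1" by (simp add: norm_sgn)
        then have "exp (G (sgn p)) \<le> exp C" using C[of "sgn p"] by simp
        then show ?thesis unfolding norm_radial[OF False] by (intro mult_right_mono) auto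
      qed simp
    qed
    ultimately have "(radial k G \<longlongrightarrow> 0) (at 0)"
      by (intro Lim_null_comparison[of "radial k G" _ "at 0"]) auto
    then show ?thesis using True by (simp add: isCont_def)
  qed
  then show ?thesis by (simp add: continuous_at_imp_continuous_on)
qed

lemma homeomorphism_radial:
  assumes k: "k > 0" and G: "continuous_on UNIV G"
  shows "homeomorphism UNIV UNIV (radial k G) (radial (1 / k) (\<lambda>x. - G x / k))"
proof -
  have inv: "radial k G (radial (1 / k) (\<lambda>x. - G x / k) p) = p" for p
  proof -
    have "radial (1 / (1 / k)) (\<lambda>x. - (- G x / k) / (1 / k)) (radial (1 / k) (\<lambda>x. - G x / k) p) = p"
      by (rule radial_inverse) (use k in simp)
    then show ?thesis using k by simp
  qed
  show ?thesis
  proof (rule homeomorphismI)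
    show "continuous_on UNIV (radial (1 / k) (\<lambda>x. - G x / k))"
      by (intro continuous_radial continuous_on_divide continuous_on_minus G continuous_on_const) (use k in auto)
  qed (use continuous_radial[OF k G] radial_inverse[OF k] inv in auto)
qed

section \<open>Standard and star-shaped models of the Hopf link\<close>

definition height :: "real^3 \<Rightarrow> real" where "height p = p$3 / norm p"

lemma height_sgn: "sgn p $ 3 = height p"
  by (simp add: height_def sgn_div_norm divide_inverse mult.commute)

lemma norm_sq_3: "(norm p)\<^sup>2 = (p$1)\<^sup>2 + (p$2)\<^sup>2 + (p$3)\<^sup>2" for p :: "real^3"
  unfolding power2_norm_eq_inner by (simp add: inner_vec_def sum_3 power2_eq_square)

lemma height_bounds: "p \<noteq> 0 \<Longrightarrow> height p \<in> {-1..1}"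
proof -
  assume "p \<noteq> 0"
  moreover have "\<bar>p$3\<bar> \<le> norm p" by (rule component_le_norm_cart)
  ultimately show ?thesis by (auto simp: height_def divide_simps abs_le_iff)
qed

text \<open>Of the two circles in \<open>hopf_link\<close> one passes through the origin. These
  circles of radius 2 with centres at heights 1 and -1 both enclose it, so they can serve as targets
  of a radial map.\<close>

lemma hopf_link_standard:
  "hopf_link {p. p$2 = 0 \<and> (p$1)\<^sup>2 + (p$3 - 1)\<^sup>2 = 4} {p. p$1 = 0 \<and> (p$2)\<^sup>2 + (p$3 + 1)\<^sup>2 = 4}"
proof -
  define W :: "real^3 \<Rightarrow> real^3" where "W p = vector [(1 - p$3) / 2, p$1 / 2, p$2 / 2]" for p
  define W' :: "real^3 \<Rightarrow> real^3" where "W' p = vector [2 * p$2, 2 * p$3, 1 - 2 * p$1]" for p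
  have inv: "W' (W p) = p" "W (W' p) = p" for p
    by (simp_all add: W_def W'_def vec_eq_iff forall_3 field_simps)
  have cW: "continuous_on UNIV W" "continuous_on UNIV W'"
    unfolding W_def[abs_def] W'_def[abs_def] by (intro continuous_on_vector3 continuous_intros; simp)+
  have "homeomorphism UNIV UNIV W W'"
    by (rule homeomorphismI) (use inv cW in auto)
  moreover have "W ` {p. p$2 = 0 \<and> (p$1)\<^sup>2 + (p$3 - 1)\<^sup>2 = 4} = {p. p$3 = 0 \<and> (p$1)\<^sup>2 + (p$2)\<^sup>2 = 1}"
  proof (intro equalityI subsetI)
    fix q :: "real^3" assume q: "q \<in> {p. p$3 = 0 \<and> (p$1)\<^sup>2 + (p$2)\<^sup>2 = 1}"
    have "W' q \<in> {p. p$2 = 0 \<and> (p$1)\<^sup>2 + (p$3 - 1)\<^sup>2 = 4}" using q by (simp add: W'_def power2_eq_square algebra_simps)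
    then have "W (W' q) \<in> W ` {p. p$2 = 0 \<and> (p$1)\<^sup>2 + (p$3 - 1)\<^sup>2 = 4}" by (rule imageI)
    then show "q \<in> W ` {p. p$2 = 0 \<and> (p$1)\<^sup>2 + (p$3 - 1)\<^sup>2 = 4}" unfolding inv .
  next
    fix q assume "q \<in> W ` {p. p$2 = 0 \<and> (p$1)\<^sup>2 + (p$3 - 1)\<^sup>2 = 4}"
    then obtain p where p: "q = W p" "p$2 = 0" "(p$1)\<^sup>2 + (p$3 - 1)\<^sup>2 = 4" by blast
    have "((1 - y) / 2)\<^sup>2 + (x / 2)\<^sup>2 = (x\<^sup>2 + (y - 1)\<^sup>2) / 4" for x y :: real
      by (simp add: power2_eq_square field_simps)
    from this[of "p$3" "p$1"] have "((1 - p$3) / 2)\<^sup>2 + (p$1 / 2)\<^sup>2 = 1" unfolding p(3) by simp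
    then show "q \<in> {p. p$3 = 0 \<and> (p$1)\<^sup>2 + (p$2)\<^sup>2 = 1}" using p by (simp add: W_def)
  qed
  moreover have "W ` {p. p$1 = 0 \<and> (p$2)\<^sup>2 + (p$3 + 1)\<^sup>2 = 4} = {p. p$2 = 0 \<and> (p$1 - 1)\<^sup>2 + (p$3)\<^sup>2 = 1}"
  proof (intro equalityI subsetI)
    fix q :: "real^3" assume q: "q \<in> {p. p$2 = 0 \<and> (p$1 - 1)\<^sup>2 + (p$3)\<^sup>2 = 1}"
    have "W' q \<in> {p. p$1 = 0 \<and> (p$2)\<^sup>2 + (p$3 + 1)\<^sup>2 = 4}" using q by (simp add: W'_def power2_eq_square algebra_simps)
    then have "W (W' q) \<in> W ` {p. p$1 = 0 \<and> (p$2)\<^sup>2 + (p$3 + 1)\<^sup>2 = 4}" by (rule imageI)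
    then show "q \<in> W ` {p. p$1 = 0 \<and> (p$2)\<^sup>2 + (p$3 + 1)\<^sup>2 = 4}" unfolding inv .
  next
    fix q assume "q \<in> W ` {p. p$1 = 0 \<and> (p$2)\<^sup>2 + (p$3 + 1)\<^sup>2 = 4}"
    then obtain p where p: "q = W p" "p$1 = 0" "(p$2)\<^sup>2 + (p$3 + 1)\<^sup>2 = 4" by blast
    have "((1 - y) / 2 - 1)\<^sup>2 + (x / 2)\<^sup>2 = (x\<^sup>2 + (y + 1)\<^sup>2) / 4" for x y :: real
      by (simp add: power2_eq_square field_simps)
    from this[of "p$3" "p$2"] have "((1 - p$3) / 2 - 1)\<^sup>2 + (p$2 / 2)\<^sup>2 = 1" unfolding p(3) by simp
    then show "q \<in> {p. p$2 = 0 \<and> (p$1 - 1)\<^sup>2 + (p$3)\<^sup>2 = 1}" using p by (simp add: W_def)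
  qed
  ultimately show "hopf_link {p. p$2 = 0 \<and> (p$1)\<^sup>2 + (p$3 - 1)\<^sup>2 = 4} {p. p$1 = 0 \<and> (p$2)\<^sup>2 + (p$3 + 1)\<^sup>2 = 4}"
    unfolding hopf_link_def by blast
qed

lemma hopf_link_homeomorphic:
  fixes A B :: "(real^3) set" and f g :: "real^3 \<Rightarrow> real^3"
  assumes h: "homeomorphism UNIV UNIV f g" and "hopf_link (f ` A) (f ` B)"
  shows "hopf_link A B"
proof -
  from assms(2) obtain f' g' where "homeomorphism UNIV UNIV f' g'" "f' ` f ` A = {p :: real^3. p$3 = 0 \<and> (p$1)\<^sup>2 + (p$2)\<^sup>2 = 1}"
    "f' ` f ` B = {p :: real^3. p$2 = 0 \<and> (p$1 - 1)\<^sup>2 + (p$3)\<^sup>2 = 1}" unfolding hopf_link_def by blast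
  moreover from homeomorphism_compose[OF h this(1)] have "homeomorphism UNIV UNIV (f' \<circ> f) (g \<circ> g')" .
  ultimately show ?thesis
    unfolding hopf_link_def by (intro exI[of _ "f' \<circ> f"] exI[of _ "g \<circ> g'"]) (simp add: image_comp)
qed

text \<open>Two curves in the planes \<open>y = 0\<close> and \<open>x = 0\<close>, star-shaped about the origin, are carried to
  round circles by a radial homeomorphism. Its exponent \<open>k\<close> is chosen so that the two prescribed
  scalings agree on the common axis of the two planes.\<close>

lemma hopf_link_star_shaped:
  assumes \<rho>: "continuous_on {-1..1} \<rho>" "\<And>z. z \<in> {-1..1} \<Longrightarrow> 0 < \<rho> z" and less: "\<rho> (- 1) < \<rho> 1"
  shows "hopf_link {p. p \<noteq> 0 \<and> p$2 = 0 \<and> norm p = \<rho> (height p)} {p. p \<noteq> 0 \<and> p$1 = 0 \<and> norm p = \<rho> (- height p)}"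
proof -
  \<comment> \<open>The target circle meets the axis at distances 3 and 1 from the origin; their
    ratio gives \<open>ln 3\<close>.\<close>
  define k where "k = ln 3 / (ln (\<rho> 1) - ln (\<rho> (- 1)))"
  have "ln (\<rho> (- 1)) < ln (\<rho> 1)" using less \<rho>(2)[of "- 1"] \<rho>(2)[of 1] by simp
  then have k: "k > 0" "k * (ln (\<rho> 1) - ln (\<rho> (- 1))) = ln 3" by (simp_all add: k_def)
  \<comment> \<open>Polar equation of the target circle: the positive root r of
    \<open>r\<^sup>2 - 2 * z * r = 3\<close>.\<close>
  define \<rho>' :: "real \<Rightarrow> real" where "\<rho>' z = z + sqrt (z\<^sup>2 + 3)" for z
  have \<rho>': "\<rho>' z > 0" for z
  proof -
    have "\<bar>z\<bar> < sqrt (z\<^sup>2 + 3)" by (rule real_less_rsqrt) simp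
    then show ?thesis by (simp add: \<rho>'_def abs_less_iff)
  qed
  define m where "m z = ln (\<rho>' z) - k * ln (\<rho> z)" for z
  have cm: "continuous_on {-1..1} m"
    unfolding m_def \<rho>'_def
    by (intro continuous_intros \<rho>(1)) (use \<rho>' \<rho>(2) in \<open>auto simp: \<rho>'_def less_imp_neq[symmetric] dest: less_imp_neq\<close>)
  have "\<rho>' 1 = 3" "\<rho>' (- 1) = 1" by (simp_all add: \<rho>'_def)
  then have m1: "m 1 = m (- 1)" using k(2) by (simp add: m_def right_diff_distrib)
  define X where "X = {\<omega> :: real^3. norm \<omega> = 1 \<and> \<omega>$2 = 0}"
  define Y where "Y = {\<omega> :: real^3. norm \<omega> = 1 \<and> \<omega>$1 = 0}"
  have cl: "closed X" "closed Y"
    unfolding X_def Y_def by (intro closed_Collect_conj closed_Collect_eq continuous_intros)+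
  have third: "\<omega>$3 \<in> {-1..1}" if "norm \<omega> = 1" for \<omega> :: "real^3"
    using component_le_norm_cart[of \<omega> 3] that by (simp add: abs_le_iff)
  define f where "f \<omega> = (if \<omega>$2 = 0 then m (\<omega>$3) else m (- (\<omega>$3)))" for \<omega> :: "real^3"
  have cf: "continuous_on (X \<union> Y) f"
    unfolding f_def[abs_def]
  proof (rule continuous_on_cases[OF cl])
    show "continuous_on X (\<lambda>\<omega>. m (\<omega>$3))"
      by (rule continuous_on_compose2[OF cm]) (use third in \<open>auto simp: X_def intro!: continuous_intros\<close>)
    show "continuous_on Y (\<lambda>\<omega>. m (- (\<omega>$3)))"
      by (rule continuous_on_compose2[OF cm]) (use third in \<open>force simp: Y_def intro!: continuous_intros\<close>)+
    show "\<forall>\<omega>. \<omega> \<in> X \<and> \<not> \<omega>$2 = 0 \<or> \<omega> \<in> Y \<and> \<omega>$2 = 0 \<longrightarrow> m (\<omega>$3) = m (- (\<omega>$3))"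
    proof (intro allI impI)
      fix \<omega> :: "real^3" assume "\<omega> \<in> X \<and> \<not> \<omega>$2 = 0 \<or> \<omega> \<in> Y \<and> \<omega>$2 = 0"
      then have "(\<omega>$3)\<^sup>2 = 1" using norm_sq_3[of \<omega>] by (auto simp: X_def Y_def)
      then have "\<omega>$3 = 1 \<or> \<omega>$3 = - 1" by (simp add: power2_eq_1_iff)
      then show "m (\<omega>$3) = m (- (\<omega>$3))" using m1 by auto
    qed
  qed
  obtain C where "\<forall>z\<in>{-1..1}. \<bar>m z\<bar> \<le> C"
    using compact_imp_bounded[OF compact_continuous_image[OF cm]] by (auto simp: bounded_iff)
  then have bf: "norm (f \<omega>) \<le> \<bar>C\<bar>" if "\<omega> \<in> X \<union> Y" for \<omega>
    using third[of \<omega>] that by (force simp: f_def X_def Y_def intro: order_trans[OF _ abs_ge_self])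
  have cd: "closedin (top_of_set UNIV) (X \<union> Y)" using cl by (simp add: closed_Un)
  \<comment> \<open>The scaling is prescribed on two great circles only; Tietze's theorem extends it
    to all directions.\<close>
  obtain G where G: "continuous_on UNIV G" "\<And>\<omega>. \<omega> \<in> X \<union> Y \<Longrightarrow> G \<omega> = f \<omega>"
  proof (rule Tietze[OF cf cd abs_ge_zero bf])
    fix g assume "continuous_on UNIV g" "\<And>\<omega>. \<omega> \<in> X \<union> Y \<Longrightarrow> g \<omega> = f \<omega>"
    then show thesis by (rule that)
  qed
  have GX: "G \<omega> = m (\<omega>$3)" if "\<omega> \<in> X" for \<omega> using that G(2)[of \<omega>] by (simp add: X_def f_def)
  have GY: "G \<omega> = m (- (\<omega>$3))" if "\<omega> \<in> Y" for \<omega>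
  proof (cases "\<omega>$2 = 0")
    case True
    then have "(\<omega>$3)\<^sup>2 = 1" using norm_sq_3[of \<omega>] that by (auto simp: Y_def)
    then have "\<omega>$3 = 1 \<or> \<omega>$3 = - 1" by (simp add: power2_eq_1_iff)
    then show ?thesis using m1 GX[of \<omega>] that True by (auto simp: X_def Y_def)
  next
    case False
    then show ?thesis using G(2)[of \<omega>] that by (simp add: f_def)
  qed
  define H where "H = radial k G"
  have hom: "homeomorphism UNIV UNIV H (radial (1 / k) (\<lambda>x. - G x / k))"
    unfolding H_def by (rule homeomorphism_radial[OF k(1) G(1)])
  have H0: "H p = 0 \<longleftrightarrow> p = 0" for p
    using sgn_radial[of k G p] by (auto simp: H_def sgn_zero_iff)
  have comp: "p$i = norm p * sgn p $ i" for p :: "real^3" and i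
    by (cases "p = 0") (auto simp: sgn_div_norm)
  have scale: "norm (H p) = \<rho>' z \<longleftrightarrow> norm p = \<rho> z" if p: "p \<noteq> 0" "z \<in> {-1..1}" "G (sgn p) = m z" for p z
  proof -
    have "norm (H p) = exp (m z) * norm p powr k" using p by (simp add: H_def norm_radial)
    also have "exp (m z) = \<rho>' z / \<rho> z powr k"
      using \<rho>'[of z] \<rho>(2)[OF p(2)] by (simp add: m_def exp_diff powr_def)
    finally have "norm (H p) = \<rho>' z \<longleftrightarrow> norm p powr k = \<rho> z powr k"
      using \<rho>'[of z] \<rho>(2)[OF p(2)] by (auto simp: field_simps)
    also have "\<dots> \<longleftrightarrow> norm p = \<rho> z"
      using powr_less_mono2[OF k(1), of "norm p" "\<rho> z"] powr_less_mono2[OF k(1), of "\<rho> z" "norm p"] \<rho>(2)[OF p(2)]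
      by (cases "norm p" "\<rho> z" rule: linorder_cases) auto
    finally show ?thesis .
  qed
  have circle: "norm q = \<rho>' z \<longleftrightarrow> (norm q)\<^sup>2 - 2 * z * norm q = 3" for q :: "real^3" and z
  proof -
    have "(norm q)\<^sup>2 - 2 * z * norm q = 3 \<longleftrightarrow> (norm q - z)\<^sup>2 = z\<^sup>2 + 3" by (simp add: power2_eq_square algebra_simps)
    also have "\<dots> \<longleftrightarrow> \<bar>norm q - z\<bar> = sqrt (z\<^sup>2 + 3)"
      by (metis abs_ge_zero power2_abs real_sqrt_abs real_sqrt_pow2 add_nonneg_nonneg zero_le_power2 zero_le_numeral)
    also have "\<dots> \<longleftrightarrow> norm q = \<rho>' z"
    proof -
      have "\<bar>z\<bar> < sqrt (z\<^sup>2 + 3)" by (rule real_less_rsqrt) simp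
      then show ?thesis using norm_ge_zero[of q] unfolding \<rho>'_def by (smt (verit))
    qed
    finally show ?thesis by simp
  qed
  have sgnH: "sgn (H p) = sgn p" for p by (simp add: H_def sgn_radial)
  have surjH: "surj H" using hom by (auto simp: homeomorphism_def)
  have A: "H ` {p. p \<noteq> 0 \<and> p$2 = 0 \<and> norm p = \<rho> (height p)} = {p. p$2 = 0 \<and> (p$1)\<^sup>2 + (p$3 - 1)\<^sup>2 = 4}"
  proof -
    have iff: "p \<noteq> 0 \<and> p$2 = 0 \<and> norm p = \<rho> (height p) \<longleftrightarrow> H p $ 2 = 0 \<and> (H p $ 1)\<^sup>2 + (H p $ 3 - 1)\<^sup>2 = 4" for p
    proof (cases "p = 0")
      case True
      then show ?thesis by (simp add: H_def)
    next
      case False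
      have H2: "H p $ 2 = 0 \<longleftrightarrow> p$2 = 0" using comp[of p 2] comp[of "H p" 2] sgnH H0[of p] False by simp
      show ?thesis
      proof (cases "p$2 = 0")
        case True
        have "sgn p \<in> X" using True False comp[of p 2] by (simp add: X_def norm_sgn)
        then have "norm (H p) = \<rho>' (height p) \<longleftrightarrow> norm p = \<rho> (height p)"
          using scale[OF False height_bounds[OF False]] GX by (simp add: height_sgn)
        moreover have "H p $ 3 = norm (H p) * height p" using comp[of "H p" 3] by (simp add: sgnH height_sgn)
        then have "(H p $ 1)\<^sup>2 + (H p $ 3 - 1)\<^sup>2 = 4 \<longleftrightarrow> (norm (H p))\<^sup>2 - 2 * height p * norm (H p) = 3"
          using norm_sq_3[of "H p"] H2 True by (simp add: power2_eq_square algebra_simps)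
        ultimately show ?thesis using False True H2 circle by simp
      qed (simp add: H2)
    qed
    show ?thesis
    proof (intro equalityI subsetI)
      fix q :: "real^3" assume q: "q \<in> {p. p$2 = 0 \<and> (p$1)\<^sup>2 + (p$3 - 1)\<^sup>2 = 4}"
      obtain p where "q = H p" using surjH by (metis surjD)
      then show "q \<in> H ` {p. p \<noteq> 0 \<and> p$2 = 0 \<and> norm p = \<rho> (height p)}" using q iff by auto
    qed (use iff in auto)
  qed
  have B: "H ` {p. p \<noteq> 0 \<and> p$1 = 0 \<and> norm p = \<rho> (- height p)} = {p. p$1 = 0 \<and> (p$2)\<^sup>2 + (p$3 + 1)\<^sup>2 = 4}"
  proof -
    have iff: "p \<noteq> 0 \<and> p$1 = 0 \<and> norm p = \<rho> (- height p) \<longleftrightarrow> H p $ 1 = 0 \<and> (H p $ 2)\<^sup>2 + (H p $ 3 + 1)\<^sup>2 = 4" for p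
    proof (cases "p = 0")
      case True
      then show ?thesis by (simp add: H_def)
    next
      case False
      have H2: "H p $ 1 = 0 \<longleftrightarrow> p$1 = 0" using comp[of p 1] comp[of "H p" 1] sgnH H0[of p] False by simp
      show ?thesis
      proof (cases "p$1 = 0")
        case True
        have "sgn p \<in> Y" using True False comp[of p 1] by (simp add: Y_def norm_sgn)
        moreover have "- height p \<in> {-1..1}" using height_bounds[OF False] by auto
        ultimately have "norm (H p) = \<rho>' (- height p) \<longleftrightarrow> norm p = \<rho> (- height p)"
          using scale[OF False] GY by (simp add: height_sgn)
        moreover have "H p $ 3 = norm (H p) * height p" using comp[of "H p" 3] by (simp add: sgnH height_sgn)
        then have "(H p $ 2)\<^sup>2 + (H p $ 3 + 1)\<^sup>2 = 4 \<longleftrightarrow> (norm (H p))\<^sup>2 - 2 * (- height p) * norm (H p) = 3"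
          using norm_sq_3[of "H p"] H2 True by (simp add: power2_eq_square algebra_simps)
        ultimately show ?thesis using False True H2 circle by simp
      qed (simp add: H2)
    qed
    show ?thesis
    proof (intro equalityI subsetI)
      fix q :: "real^3" assume q: "q \<in> {p. p$1 = 0 \<and> (p$2)\<^sup>2 + (p$3 + 1)\<^sup>2 = 4}"
      obtain p where "q = H p" using surjH by (metis surjD)
      then show "q \<in> H ` {p. p \<noteq> 0 \<and> p$1 = 0 \<and> norm p = \<rho> (- height p)}" using q iff by auto
    qed (use iff in auto)
  qed
  show ?thesis
    by (rule hopf_link_homeomorphic[OF hom]) (simp only: A B hopf_link_standard)
qed

text \<open>Injectivity of \<open>height\<close> makes the direction from the origin monotone along the arc.\<close>

definition fan :: "(real^3) set \<Rightarrow> real^3 \<Rightarrow> real^3 \<Rightarrow> bool" where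
  "fan X p q \<longleftrightarrow> compact X \<and> connected X \<and> p \<in> X \<and> q \<in> X \<and> inj_on height X \<and>
     (\<forall>x\<in>X. x \<noteq> 0 \<and> x$2 = 0 \<and> 0 \<le> x$1 \<and> height p \<le> height x \<and> height x \<le> height q)"

definition cross :: "real^3 \<Rightarrow> real^3 \<Rightarrow> real" where "cross p q = p$1 * q$3 - p$3 * q$1"

lemma fan_join:
  assumes X: "fan X p q" and Y: "fan Y q r"
  shows "fan (X \<union> Y) p r"
proof -
  have "inj_on height (X \<union> Y)"
  proof (rule inj_onI)
    have *: "x = y" if "x \<in> X" "y \<in> Y" "height x = height y" for x y
    proof -
      have "height x = height q" "height y = height q" using that X Y by (force simp: fan_def)+
      then have "x = q" "y = q" using that X Y by (auto simp: fan_def dest: inj_onD)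
      then show ?thesis by simp
    qed
    fix x y assume "x \<in> X \<union> Y" "y \<in> X \<union> Y" "height x = height y"
    then show "x = y" using X Y *[of x y] *[of y x] by (auto simp: fan_def dest: inj_onD)
  qed
  moreover have "connected (X \<union> Y)" using X Y by (intro connected_Un) (auto simp: fan_def)
  moreover have "height p \<le> height q" "height q \<le> height r" using X Y by (auto simp: fan_def)
  ultimately show ?thesis using X Y by (auto simp: fan_def compact_Un intro: order_trans)
qed

text \<open>In the half-plane x >= 0 the height is the sine of the latitude, and a positive
  \<open>cross\<close> means that \<open>q\<close> has the larger latitude. The proof compares the
  normalized vectors according to the signs of their heights.\<close>

lemma height_less:
  assumes p: "0 \<le> p$1" "p$2 = 0" and q: "0 \<le> q$1" "q$2 = 0" and cross: "cross p q > 0"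
  shows "height p < height q"
proof -
  define P where "P = norm p"
  define Q where "Q = norm q"
  have "p \<noteq> 0" "q \<noteq> 0" using cross by (auto simp: cross_def)
  then have pos: "P > 0" "Q > 0" by (simp_all add: P_def Q_def)
  define a where "a = p$1 / P"
  define b where "b = q$1 / Q"
  define z where "z = p$3 / P"
  define y where "y = q$3 / Q"
  have ab: "0 \<le> a" "0 \<le> b" using p q pos by (simp_all add: a_def b_def)
  have sq: "a\<^sup>2 + z\<^sup>2 = 1" "b\<^sup>2 + y\<^sup>2 = 1"
  proof -
    have "a\<^sup>2 + z\<^sup>2 = ((p$1)\<^sup>2 + (p$3)\<^sup>2) / P\<^sup>2" "b\<^sup>2 + y\<^sup>2 = ((q$1)\<^sup>2 + (q$3)\<^sup>2) / Q\<^sup>2"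
      by (simp_all add: a_def b_def z_def y_def power_divide add_divide_distrib)
    moreover have "(p$1)\<^sup>2 + (p$3)\<^sup>2 = P\<^sup>2" "(q$1)\<^sup>2 + (q$3)\<^sup>2 = Q\<^sup>2"
      using norm_sq_3[of p] norm_sq_3[of q] p q by (simp_all add: P_def Q_def)
    ultimately show "a\<^sup>2 + z\<^sup>2 = 1" "b\<^sup>2 + y\<^sup>2 = 1" using pos by simp_all
  qed
  have "a * y - z * b = cross p q / (P * Q)" using pos by (simp add: cross_def a_def b_def z_def y_def field_simps)
  then have c: "z * b < a * y" using cross pos by (metis diff_gt_0_iff_gt divide_pos_pos mult_pos_pos)
  have "z < y"
  proof (rule ccontr)
    assume "\<not> z < y"
    then have yz: "y \<le> z" by simp
    consider "0 \<le> y" | "y < 0" "0 \<le> z" | "z < 0" by linarith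
    then show False
    proof cases
      case 1
      then have "y\<^sup>2 \<le> z\<^sup>2" using yz by (intro power_mono)
      then have "a\<^sup>2 \<le> b\<^sup>2" using sq by linarith
      then have "a \<le> b" by (rule power2_le_imp_le) (use ab in simp)
      then have "a * y \<le> b * z" using ab yz 1 by (intro mult_mono) auto
      then show False using c by (simp add: mult.commute)
    next
      case 2
      then have "a * y \<le> 0" "0 \<le> z * b" using ab by (auto intro: mult_nonneg_nonpos)
      then show False using c by simp
    next
      case 3
      then have "(- z)\<^sup>2 \<le> (- y)\<^sup>2" using yz by (intro power_mono) auto
      then have "b\<^sup>2 \<le> a\<^sup>2" using sq by simp
      then have "b \<le> a" by (rule power2_le_imp_le) (use ab in simp)
      then have "b * (- z) \<le> a * (- y)" using ab yz 3 by (intro mult_mono) auto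
      then show False using c by (simp add: mult.commute)
    qed
  qed
  then show ?thesis by (simp add: height_def z_def y_def P_def Q_def)
qed

lemma fan_of_path:
  fixes g :: "real \<Rightarrow> real^3"
  assumes ab: "a < b" and c: "continuous_on {a..b} g"
    and half: "\<And>s. s \<in> {a..b} \<Longrightarrow> 0 \<le> g s $ 1 \<and> g s $ 2 = 0"
    and cross: "\<And>s t. a \<le> s \<Longrightarrow> s < t \<Longrightarrow> t \<le> b \<Longrightarrow> cross (g s) (g t) > 0"
  shows "fan (g ` {a..b}) (g a) (g b)"
proof -
  have less: "height (g s) < height (g t)" if "a \<le> s" "s < t" "t \<le> b" for s t
    using half[of s] half[of t] cross[OF that] that by (intro height_less) auto
  have le: "height (g s) \<le> height (g t)" if "a \<le> s" "s \<le> t" "t \<le> b" for s t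
    using less[of s t] that by (cases "s = t") auto
  have "g s \<noteq> 0" if "s \<in> {a..b}" for s
  proof (cases "s = a")
    case True
    then show ?thesis using cross[of a b] ab by (auto simp: cross_def)
  next
    case False
    then show ?thesis using cross[of a s] that by (auto simp: cross_def)
  qed
  moreover have "inj_on height (g ` {a..b})"
  proof (rule inj_onI)
    fix x y assume xy: "x \<in> g ` {a..b}" "y \<in> g ` {a..b}" "height x = height y"
    then obtain s t where st: "x = g s" "y = g t" "s \<in> {a..b}" "t \<in> {a..b}" by auto
    then show "x = y" using less[of s t] less[of t s] xy by (cases s t rule: linorder_cases) auto
  qed
  ultimately show ?thesis
    using ab half le c unfolding fan_def
    by (auto intro!: compact_continuous_image connected_continuous_image)
qed

lemma fan_segment:
  assumes "0 \<le> p$1" "p$2 = 0" "0 \<le> q$1" "q$2 = 0" "cross p q > 0"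
  shows "fan (closed_segment p q) p q"
proof -
  have "fan ((\<lambda>u. (1 - u) *\<^sub>R p + u *\<^sub>R q) ` {0..1}) ((1 - 0) *\<^sub>R p + 0 *\<^sub>R q) ((1 - 1) *\<^sub>R p + 1 *\<^sub>R q)"
  proof (rule fan_of_path)
    fix s t :: real assume st: "0 \<le> s" "s < t" "t \<le> 1"
    have "cross ((1 - s) *\<^sub>R p + s *\<^sub>R q) ((1 - t) *\<^sub>R p + t *\<^sub>R q) = (t - s) * cross p q"
      by (simp add: cross_def algebra_simps)
    then show "cross ((1 - s) *\<^sub>R p + s *\<^sub>R q) ((1 - t) *\<^sub>R p + t *\<^sub>R q) > 0" using st assms by simp
  qed (use assms in \<open>auto intro!: continuous_intros\<close>)
  then show ?thesis by (simp add: closed_segment_image_interval)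
qed

text \<open>The polar function is the distance from the origin of the unique point of
  \<open>X\<close> at a given height; it is continuous because \<open>X\<close> is compact. The
  mirror image completes \<open>X\<close> to the full curve in its plane, and \<open>rot\<close>
  changes the sign of the height. The inequality \<open>less\<close> makes the two crossings of the
  axis unequally distant, as the exponent of the radial map requires.\<close>

lemma hopf_link_fan:
  assumes X: "fan X p q" and p: "p$1 = 0" "p$3 < 0" and q: "q$1 = 0" "0 < q$3" and less: "- p$3 < q$3"
  shows "hopf_link (X \<union> mirror ` X) (rot ` (X \<union> mirror ` X))"
proof -
  have props: "compact X" "connected X" "p \<in> X" "q \<in> X" "inj_on height X"
    "\<And>x. x \<in> X \<Longrightarrow> x \<noteq> 0 \<and> x$2 = 0 \<and> 0 \<le> x$1" using X by (auto simp: fan_def)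
  have np: "norm p = - p$3" "norm q = q$3"
  proof -
    have "p$2 = 0" "q$2 = 0" using props(6)[OF props(3)] props(6)[OF props(4)] by blast+
    then have n: "(norm p)\<^sup>2 = (- p$3)\<^sup>2" "(norm q)\<^sup>2 = (q$3)\<^sup>2"
      unfolding norm_sq_3 by (simp_all add: p q)
    show "norm p = - p$3" "norm q = q$3"
      using power2_eq_imp_eq[OF n(1)] power2_eq_imp_eq[OF n(2)] p q by simp_all
  qed
  have hp: "height p = - 1" "height q = 1" using np p q by (auto simp: height_def)
  have ch: "continuous_on X height"
    unfolding height_def by (intro continuous_intros) (use props in auto)
  have "height ` X = {-1..1}"
  proof (intro equalityI subsetI)
    fix z assume "z \<in> height ` X"
    then show "z \<in> {-1..1}" using height_bounds props by auto
  next
    fix z :: real assume z: "z \<in> {-1..1}"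
    have "connected (height ` X)" by (rule connected_continuous_image[OF ch props(2)])
    moreover have "- 1 \<in> height ` X" "1 \<in> height ` X" using hp props by (metis imageI)+
    ultimately show "z \<in> height ` X" using z unfolding connected_iff_interval by (meson atLeastAtMost_iff)
  qed
  define r where "r = inv_into X height"
  have r: "r (height x) = x" if "x \<in> X" for x unfolding r_def by (rule inv_into_f_f[OF props(5) that])
  have rX: "r z \<in> X" "height (r z) = z" if "z \<in> {-1..1}" for z
    using that \<open>height ` X = {-1..1}\<close> by (auto simp: r_def intro: inv_into_into f_inv_into_f)
  have "continuous_on (height ` X) r"
    by (rule continuous_on_inv[OF ch props(1)]) (use r in auto)
  then have c\<rho>: "continuous_on {-1..1} (\<lambda>z. norm (r z))"
    using \<open>height ` X = {-1..1}\<close> by (intro continuous_on_norm) simp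
  have mir: "norm (mirror x) = norm x" "height (mirror x) = height x" for x
  proof -
    have "(norm (mirror x))\<^sup>2 = (norm x)\<^sup>2" by (simp add: norm_sq_3 mirror_def)
    then show "norm (mirror x) = norm x" by simp
    then show "height (mirror x) = height x" by (simp add: height_def mirror_def)
  qed
  have K: "X \<union> mirror ` X = {x. x \<noteq> 0 \<and> x$2 = 0 \<and> norm x = norm (r (height x))}"
  proof (intro equalityI subsetI)
    fix x assume "x \<in> X \<union> mirror ` X"
    then consider "x \<in> X" | y where "y \<in> X" "x = mirror y" by blast
    then show "x \<in> {x. x \<noteq> 0 \<and> x$2 = 0 \<and> norm x = norm (r (height x))}"
    proof cases
      case 1
      then show ?thesis using props(6) r by auto
    next
      case 2
      have "norm x \<noteq> 0" using 2 props(6)[of y] mir(1)[of y] by simp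
      then show ?thesis using 2 props(6)[of y] r[of y] mir[of y] by (auto simp: mirror_def)
    qed
  next
    fix x assume x: "x \<in> {x. x \<noteq> 0 \<and> x$2 = 0 \<and> norm x = norm (r (height x))}"
    define y where "y = r (height x)"
    have y: "y \<in> X" "height y = height x" using rX[of "height x"] height_bounds[of x] x by (auto simp: y_def)
    have n: "norm x = norm y" using x by (simp add: y_def)
    then have 3: "x$3 = y$3" using y(2) x by (auto simp: height_def)
    have "(x$1)\<^sup>2 = (y$1)\<^sup>2" using norm_sq_3[of x] norm_sq_3[of y] n 3 x props(6)[OF y(1)] by simp
    then have "x$1 = y$1 \<or> x$1 = - y$1" by (simp add: power2_eq_iff)
    then have "x = y \<or> x = mirror y" using 3 x props(6)[OF y(1)] by (auto simp: vec_eq_iff forall_3 mirror_def)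
    then show "x \<in> X \<union> mirror ` X" using y(1) by blast
  qed
  have nr: "norm (rot x) = norm x" "height (rot x) = - height x" for x
    by (simp_all add: rot_norm height_def) (simp add: rot_def)
  have K2: "rot ` (X \<union> mirror ` X) = {x. x \<noteq> 0 \<and> x$1 = 0 \<and> norm x = norm (r (- height x))}"
    unfolding K
  proof (intro equalityI subsetI)
    fix x assume "x \<in> rot ` {x. x \<noteq> 0 \<and> x$2 = 0 \<and> norm x = norm (r (height x))}"
    then obtain y where y: "y \<noteq> 0" "y$2 = 0" "norm y = norm (r (height y))" "x = rot y" by blast
    have "norm x \<noteq> 0" using y(1,4) nr(1)[of y] by simp
    then show "x \<in> {x. x \<noteq> 0 \<and> x$1 = 0 \<and> norm x = norm (r (- height x))}"
      using y nr[of y] by (auto simp: rot_def)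
  next
    fix x assume x: "x \<in> {x. x \<noteq> 0 \<and> x$1 = 0 \<and> norm x = norm (r (- height x))}"
    define y where "y = rotinv x"
    have xy: "x = rot y" by (simp add: y_def rot_def rotinv_def vec_eq_iff forall_3)
    have "norm y \<noteq> 0" using x nr[of y] xy by auto
    moreover have "y$2 = 0" using x by (simp add: y_def rotinv_def)
    moreover have "norm y = norm (r (height y))" using x nr[of y] xy by simp
    ultimately show "x \<in> rot ` {x. x \<noteq> 0 \<and> x$2 = 0 \<and> norm x = norm (r (height x))}" using xy by auto
  qed
  have "r (- 1) = p" "r 1 = q" using r[OF props(3)] r[OF props(4)] hp by auto
  then show ?thesis
    unfolding K2 unfolding K
    by (intro hopf_link_star_shaped[OF c\<rho>]) (use rX props np less in auto)
qed

lemma linear_mirror: "linear mirror"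
  by (rule linearI) (simp_all add: mirror_def vec_eq_iff forall_3)

section \<open>The clasp components are star-shaped about the origin and linked\<close>

context clasp_arcs
begin

lemma xs_pos:
  assumes "0 < t"
  shows "0 < xs t"
proof (cases "\<tau> < 1")
  case True
  obtain z where z: "xs t - xs 0 = (t - 0) * cos (A z)" using MVT2[OF assms xs_derivative] by blast
  have "0 < cos (A z)" using cos_A(1)[of z] c_pos_iff True by linarith
  then show ?thesis using z assms by (simp add: xs_0)
next
  case False
  then have "0 < l" using \<tau> by (intro l_pos) auto
  then have "xs 0 < xs (min t l)" using assms by (intro xs_strict_mono_inside) auto
  also have "\<dots> \<le> xs t" by (rule xs_mono) simp
  finally show ?thesis by (simp add: xs_0)
qed

text \<open>The derivative in the second argument pairs \<open>\<Gamma> s\<close> with the tangent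
  at a later parameter \<open>r\<close>. This pairing grows along the curve from the tip to
  \<open>s\<close> because the angle increases, and at the tip it is
  \<open>- zs 0 * cos (A r)\<close>, nonnegative as the tip lies below the origin. Where the cosine
  vanishes the tangent is vertical, and \<open>xs s > 0\<close> gives strictness.\<close>

lemma cross_\<Gamma>:
  assumes st: "0 \<le> s" "s < t"
  shows "0 < cross (\<Gamma> s) (\<Gamma> t)"
proof (cases "s = 0")
  case True
  then show ?thesis using xs_pos[of t] zs_0_neg st by (simp add: cross_def \<Gamma>_def xs_0 mult_neg_pos)
next
  case False
  then have s: "0 < s" using st by simp
  define C where "C r = xs s * zs r - zs s * xs r" for r
  have "C s < C t"
  proof (rule DERIV_pos_imp_increasing[OF st(2)])
    fix r assume r: "s \<le> r" "r \<le> t"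
    define Q where "Q r' = xs r' * sin (A r) - zs r' * cos (A r)" for r'
    have "Q 0 \<le> Q s"
    proof (rule DERIV_nonneg_imp_nondecreasing[where f=Q and a=0 and b=s, OF st(1)])
      fix r' assume r': "0 \<le> r'" "r' \<le> s"
      have "A r' \<le> A r" using r r' by (intro A_mono) simp
      then have "0 \<le> sin (A r - A r')" using A_nonneg[of r'] A_mem[of r] \<theta> r' by (intro sin_ge_zero) auto
      moreover have "(Q has_real_derivative cos (A r') * sin (A r) - sin (A r') * cos (A r)) (at r')"
        unfolding Q_def[abs_def] by (intro DERIV_diff DERIV_cmult_right xs_derivative zs_derivative)
      ultimately show "\<exists>y. (Q has_real_derivative y) (at r') \<and> 0 \<le> y" by (auto simp: sin_diff mult.commute)
    qed
    then have Q: "- zs 0 * cos (A r) \<le> Q s" by (simp add: Q_def xs_0)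
    have "0 < Q s"
    proof (cases "cos (A r) = 0")
      case True
      then have "sin (A r) = 1" using sin_cos_squared_add[of "A r"] sin_A(1)[of r] r s by (auto simp: power2_eq_1_iff)
      then show ?thesis using True xs_pos[OF s] by (simp add: Q_def)
    next
      case False
      then have "0 < cos (A r)" using cos_A(1)[of r] c by auto
      then have "0 < - zs 0 * cos (A r)" using zs_0_neg by (simp add: mult_neg_pos)
      then show ?thesis using Q by simp
    qed
    moreover have "(C has_real_derivative xs s * sin (A r) - zs s * cos (A r)) (at r)"
      unfolding C_def[abs_def] by (intro DERIV_diff DERIV_cmult xs_derivative zs_derivative)
    ultimately show "\<exists>y. (C has_real_derivative y) (at r) \<and> 0 < y" by (auto simp: Q_def)
  qed
  then show ?thesis by (simp add: C_def cross_def \<Gamma>_def mult.commute)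
qed

lemma fan_\<Gamma>: "fan (\<Gamma> ` {0..E}) (\<Gamma> 0) (\<Gamma> E)"
proof (rule fan_of_path[OF E(2) continuous_\<Gamma>])
  show "0 \<le> \<Gamma> s $ 1 \<and> \<Gamma> s $ 2 = 0" if "s \<in> {0..E}" for s
    using xs_mono[of 0 s] that by (simp add: \<Gamma>_def xs_0)
qed (rule cross_\<Gamma>)

lemma \<Gamma>_halves: "\<Gamma> ` {-E..E} = \<Gamma> ` {0..E} \<union> mirror ` \<Gamma> ` {0..E}"
proof -
  have "mirror ` \<Gamma> ` {0..E} = \<Gamma> ` uminus ` {0..E}" unfolding image_image \<Gamma>_minus ..
  also have "uminus ` {0..E} = {-E..0}" by simp
  finally have "\<Gamma> ` {0..E} \<union> mirror ` \<Gamma> ` {0..E} = \<Gamma> ` ({0..E} \<union> {-E..0})" by (simp only: image_Un)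
  also have "{0..E} \<union> {-E..0} = {-E..E}" using E by auto
  finally show ?thesis by simp
qed

lemma mirror_segment: "mirror ` closed_segment a b = closed_segment (mirror a) (mirror b)"
  and rot_segment: "rot ` closed_segment a b = closed_segment (rot a) (rot b)"
  by (simp_all add: closed_segment_linear_image linear_mirror linear_rot)

text \<open>\<open>Y\<close> is one half of the closing path, from the end of the arc up to the
  axis. The tip is at most 4 below the origin, so height above 4 secures the inequality in
  \<open>hopf_link_fan\<close>.\<close>

lemma hopf_link_closed:
  assumes roof: "fan Y (\<Gamma> E) q" and q: "q$1 = 0" "4 < q$3"
  shows "hopf_link (path_image \<gamma>1 \<union> (Y \<union> mirror ` Y)) (rot ` (path_image \<gamma>1 \<union> (Y \<union> mirror ` Y)))"
proof -
  have "hopf_link ((\<Gamma> ` {0..E} \<union> Y) \<union> mirror ` (\<Gamma> ` {0..E} \<union> Y)) (rot ` ((\<Gamma> ` {0..E} \<union> Y) \<union> mirror ` (\<Gamma> ` {0..E} \<union> Y)))"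
    by (rule hopf_link_fan[OF fan_join[OF fan_\<Gamma> roof]]) (use q zs_0_neg zs_bounds in \<open>auto simp: \<Gamma>_def xs_0\<close>)
  moreover have "(\<Gamma> ` {0..E} \<union> Y) \<union> mirror ` (\<Gamma> ` {0..E} \<union> Y) = path_image \<gamma>1 \<union> (Y \<union> mirror ` Y)"
    unfolding path_image_\<gamma>1 \<Gamma>_halves by (auto simp: image_Un)
  ultimately show ?thesis by simp
qed

lemma \<Gamma>_E_coords: "0 < \<Gamma> E $ 1" "\<Gamma> E $ 2 = 0" "\<Gamma> E $ 3 = zs E" "- 4 \<le> zs E"
  using xs_pos[OF E(2)] zs_mono[of 0 E] E zs_bounds by (simp_all add: \<Gamma>_def)

lemma hooked_\<gamma>: "hooked \<tau> h \<gamma>1 \<gamma>2"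
proof (cases "\<tau> = 0")
  case True
  \<comment> \<open>\<open>zs E\<close> is at least -4, so this \<open>R\<close> lifts the closing
    segment above height 4.\<close>
  have "hopf_link (far_closure \<gamma>1 R) (far_closure \<gamma>2 (- R))" if R: "R > 10" for R
  proof -
    define v :: "real^3" where "v = vector [0, 0, R]"
    \<comment> \<open>The middle of the closing segment; its other half is the mirror image.\<close>
    define m :: "real^3" where "m = vector [0, 0, zs E + R]"
    define Y where "Y = closed_segment (\<Gamma> E) (\<Gamma> E + v) \<union> closed_segment (\<Gamma> E + v) m"
    have "fan Y (\<Gamma> E) m"
      unfolding Y_def
    proof (rule fan_join; rule fan_segment)
      show "0 < cross (\<Gamma> E) (\<Gamma> E + v)" using \<Gamma>_E_coords R by (simp add: cross_def v_def algebra_simps)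
      have "0 < xs E * (zs E + R)" using \<Gamma>_E_coords R by (intro mult_pos_pos) (auto simp: \<Gamma>_def)
      then show "0 < cross (\<Gamma> E + v) m" by (simp add: cross_def v_def m_def \<Gamma>_def)
    qed (use \<Gamma>_E_coords in \<open>auto simp: v_def m_def\<close>)
    from hopf_link_closed[OF this]
    have hl: "hopf_link (path_image \<gamma>1 \<union> (Y \<union> mirror ` Y)) (rot ` (path_image \<gamma>1 \<union> (Y \<union> mirror ` Y)))"
      using \<Gamma>_E_coords(4) R by (simp add: m_def)
    have mir: "mirror (\<Gamma> E) = \<Gamma> (- E)" "mirror (\<Gamma> E + v) = \<Gamma> (- E) + v" "mirror m = m"
      by (simp_all add: \<Gamma>_minus mirror_def v_def m_def vec_eq_iff forall_3)
    have "m = midpoint (\<Gamma> E + v) (\<Gamma> (- E) + v)"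
      by (simp add: midpoint_def m_def v_def \<Gamma>_def xs_odd zs_even vec_eq_iff forall_3)
    then have "m \<in> closed_segment (\<Gamma> E + v) (\<Gamma> (- E) + v)" by simp
    then have top: "closed_segment (\<Gamma> E + v) m \<union> closed_segment m (\<Gamma> (- E) + v) = closed_segment (\<Gamma> E + v) (\<Gamma> (- E) + v)"
      by (rule Un_closed_segment)
    have far1: "far_closure \<gamma>1 R = path_image \<gamma>1 \<union> (Y \<union> mirror ` Y)"
      unfolding far_closure_def Let_def path_ends v_def[symmetric] Y_def image_Un mirror_segment mir top[symmetric]
        closed_segment_commute[of "\<Gamma> (- E) + v"] by blast
    have rv: "rot v = vector [0, 0, - R]" by (simp add: v_def rot_vector)
    have "far_closure \<gamma>2 (- R) = rot ` far_closure \<gamma>1 R"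
      unfolding far_closure_def Let_def path_ends v_def[symmetric] rv[symmetric] image_Un rot_segment path_image_\<gamma>2
      by (simp add: linear_add[OF linear_rot])
    then show ?thesis using hl far1 by simp
  qed
  then have "\<forall>\<^sub>F R in at_top. hopf_link (far_closure \<gamma>1 R) (far_closure \<gamma>2 (- R))"
    using eventually_gt_at_top[of 10] by (rule eventually_mono[rotated])
  then show ?thesis using True by (simp add: hooked_def)
next
  case False
  then have \<tau>0: "0 < \<tau>" using \<tau> by simp
  \<comment> \<open>The point where the shared edge of the two faces meets the axis: both normals
    have third component \<open>\<tau>\<close>.\<close>
  define e :: "real^3" where "e = vector [0, 0, h / \<tau>]"
  have he: "10 \<le> h / \<tau>" using \<tau>0 \<tau> h by (simp add: pos_le_divide_eq)
  have "0 < xs E * (h / \<tau>)" using \<Gamma>_E_coords he by (intro mult_pos_pos) (auto simp: \<Gamma>_def)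
  then have "fan (closed_segment (\<Gamma> E) e) (\<Gamma> E) e"
    using \<Gamma>_E_coords by (intro fan_segment) (auto simp: cross_def e_def \<Gamma>_def)
  from hopf_link_closed[OF this]
  have hl: "hopf_link (path_image \<gamma>1 \<union> (closed_segment (\<Gamma> E) e \<union> mirror ` closed_segment (\<Gamma> E) e))
      (rot ` (path_image \<gamma>1 \<union> (closed_segment (\<Gamma> E) e \<union> mirror ` closed_segment (\<Gamma> E) e)))"
    using he by (simp add: e_def)
  have me: "mirror e = e" by (simp add: e_def mirror_def)
  have c1: "edge_closure \<gamma>1 e = path_image \<gamma>1 \<union> (closed_segment (\<Gamma> E) e \<union> mirror ` closed_segment (\<Gamma> E) e)"
    unfolding edge_closure_def path_ends mirror_segment me \<Gamma>_minus closed_segment_commute[of e] by blast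
  have c2: "edge_closure \<gamma>2 (rot e) = rot ` edge_closure \<gamma>1 e"
    unfolding edge_closure_def path_ends image_Un rot_segment path_image_\<gamma>2 ..
  have e1: "e \<in> tetrahedron \<tau> h \<inter> face1 \<tau> h 1 \<inter> face1 \<tau> h (- 1)"
    using \<tau>0 h by (simp add: tetrahedron_def face1_def e_def normal1_def normal2_def inner_vector3)
  have e2: "rot e \<in> tetrahedron \<tau> h \<inter> face2 \<tau> h 1 \<inter> face2 \<tau> h (- 1)"
    using \<tau>0 h by (simp add: tetrahedron_def face2_def e_def rot_vector normal1_def normal2_def inner_vector3)
  have "hopf_link (edge_closure \<gamma>1 e) (edge_closure \<gamma>2 (rot e))" unfolding c2 unfolding c1 by (rule hl)
  then show ?thesis
    unfolding hooked_def if_not_P[OF False] using e1 e2 by blast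
qed

section \<open>Thickness and criticality of the clasp\<close>

lemma arclen_\<gamma>:
  assumes "\<tau> < 1" "0 \<le> s"
  shows "pw_curve.arclen v1 s = 2 * E * s" "pw_curve.arclen (\<lambda>t. rot (v1 t)) s = 2 * E * s"
proof -
  interpret two_pw_curves \<gamma>1 v1 P1 \<gamma>2 "\<lambda>s. rot (v1 s)" P2 by (rule two_pw_curves_\<gamma>[OF assms(1)])
  show "c1.arclen s = 2 * E * s" "c2.arclen s = 2 * E * s"
    using assms(2) by (simp_all add: c1.arclen_def c2.arclen_def norm_v1 rot_norm)
qed

lemma C1_compact: "compact (path_image \<gamma>1)" "compact (path_image \<gamma>2)"
  using C1_arc_\<gamma>1 C1_arc_\<gamma>2 by (auto simp: C1_arc_def intro: compact_path_image arc_imp_path)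

text \<open>If \<sigma> is positive then so is \<open>c\<close>, hence \<tau> < 1 and the arcs are
  piecewise twice differentiable. The case \<sigma> = 0 includes \<tau> = 1, where the curvature is
  infinite at the tip but thickness is the distance of the components.\<close>

lemma thickness_and_variation:
  assumes \<sigma>: "0 \<le> \<sigma>" "\<sigma> \<le> c"
  shows "thickness \<sigma> \<gamma>1 \<gamma>2 = 1"
    "\<And>\<xi> p q. C2_map \<xi> \<Longrightarrow> p \<in> path_image \<gamma>1 \<Longrightarrow> q \<in> path_image \<gamma>2 \<Longrightarrow> dist p q = 1 \<Longrightarrow>
      (p - q) \<bullet> (\<xi> p - \<xi> q) < 0 \<Longrightarrow> \<exists>d<0. has_thickness_variation \<sigma> \<gamma>1 \<gamma>2 \<xi> d"
proof -
  have "thickness \<sigma> \<gamma>1 \<gamma>2 = 1 \<and> (\<forall>\<xi> p q. C2_map \<xi> \<longrightarrow> p \<in> path_image \<gamma>1 \<longrightarrow> q \<in> path_image \<gamma>2 \<longrightarrow> dist p q = 1 \<longrightarrow>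
      (p - q) \<bullet> (\<xi> p - \<xi> q) < 0 \<longrightarrow> (\<exists>d<0. has_thickness_variation \<sigma> \<gamma>1 \<gamma>2 \<xi> d))"
  proof (cases "\<sigma> = 0")
    case True
    then show ?thesis
      using thickness_0_variation[OF C1_compact setdist_\<gamma>] by (auto simp: thickness_def setdist_\<gamma>)
  next
    case False
    then have \<sigma>0: "0 < \<sigma>" using \<sigma> by simp
    then have \<tau>1: "\<tau> < 1" using \<sigma> c_pos_iff by simp
    interpret two_pw_curves \<gamma>1 v1 P1 \<gamma>2 "\<lambda>s. rot (v1 s)" P2 by (rule two_pw_curves_\<gamma>[OF \<tau>1])
    have far: "dist (\<gamma>1 a) (\<gamma>1 b) \<ge> 26/25" "dist (\<gamma>2 a) (\<gamma>2 b) \<ge> 26/25"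
      if "1/2 \<le> \<sigma>" "0 \<le> a" "a < b" "b \<le> 1" "9/10 * pi * c \<le> 2 * E * b - 2 * E * a" for a b
      using far_points[of a b] that \<sigma> by (auto simp: right_diff_distrib)
    have far1: "dist (\<gamma>1 a) (\<gamma>1 b) \<ge> 26/25"
      if "1/2 \<le> \<sigma>" "0 \<le> a" "a < b" "b \<le> 1" "9/10 * pi * c \<le> c1.arclen b - c1.arclen a" for a b
      using far(1)[of a b] that arclen_\<gamma>[OF \<tau>1] by simp
    have far2: "dist (\<gamma>2 a) (\<gamma>2 b) \<ge> 26/25"
      if "1/2 \<le> \<sigma>" "0 \<le> a" "a < b" "b \<le> 1" "9/10 * pi * c \<le> c2.arclen b - c2.arclen a" for a b
      using far(2)[of a b] that arclen_\<gamma>[OF \<tau>1] by simp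
    note facts = \<sigma>0 \<sigma>(2) c(2) all_max_ksq_le[OF \<tau>1] setdist_\<gamma> far1 far2
    show ?thesis using thickness_eq_1[OF facts] thickness_variation[OF facts] by blast
  qed
  then show "thickness \<sigma> \<gamma>1 \<gamma>2 = 1"
    "\<And>\<xi> p q. C2_map \<xi> \<Longrightarrow> p \<in> path_image \<gamma>1 \<Longrightarrow> q \<in> path_image \<gamma>2 \<Longrightarrow> dist p q = 1 \<Longrightarrow>
      (p - q) \<bullet> (\<xi> p - \<xi> q) < 0 \<Longrightarrow> \<exists>d<0. has_thickness_variation \<sigma> \<gamma>1 \<gamma>2 \<xi> d" by blast+
qed

lemma clasp_critical_\<gamma>:
  assumes \<sigma>: "0 \<le> \<sigma>" "\<sigma> \<le> c"
  shows "clasp_critical \<tau> \<sigma> h \<gamma>1 \<gamma>2"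
proof -
  have "path_image \<gamma>1 \<inter> path_image \<gamma>2 = {}"
    using setdist_\<gamma> setdist_eq_0I by (metis disjoint_iff zero_neq_one)
  moreover have "C11_arc \<gamma>1 \<and> C11_arc \<gamma>2" if "\<sigma> > 0"
    using C11_arcs c_pos_iff \<sigma> that by simp
  ultimately have link: "clasp_link \<tau> \<sigma> h \<gamma>1 \<gamma>2"
    using C1_arc_\<gamma>1 C1_arc_\<gamma>2 endpoints hooked_\<gamma> by (simp add: clasp_link_def)
  have "\<exists>d<0. has_thickness_variation \<sigma> \<gamma>1 \<gamma>2 \<xi> d"
    if \<xi>: "C2_map \<xi>" "tangent_at_endpoints \<tau> \<gamma>1 \<gamma>2 \<xi>" "length_variation \<xi> \<gamma>1 + length_variation \<xi> \<gamma>2 < 0" for \<xi>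
  proof -
    have "\<not> (\<forall>p\<in>path_image \<gamma>1. \<forall>q\<in>path_image \<gamma>2. dist p q = 1 \<longrightarrow> 0 \<le> (p - q) \<bullet> (\<xi> p - \<xi> q))"
      using length_variation_nonneg[OF \<xi>(1,2)] \<xi>(3) by (meson not_le)
    then obtain p q where "p \<in> path_image \<gamma>1" "q \<in> path_image \<gamma>2" "dist p q = 1" "(p - q) \<bullet> (\<xi> p - \<xi> q) < 0"
      by (auto simp: not_le)
    then show ?thesis by (rule thickness_and_variation(2)[OF \<sigma> \<xi>(1)])
  qed
  then show ?thesis
    using link thickness_and_variation(1)[OF \<sigma>] by (simp add: clasp_critical_def)
qed

end

theorem theorem7p7:
  shows "\<exists>h0::real. \<forall>h\<ge>h0. \<forall>\<tau> \<sigma>. 0 \<le> \<tau> \<longrightarrow> \<tau> \<le> 1 \<longrightarrow> 0 \<le> \<sigma> \<longrightarrow> \<sigma> \<le> sqrt (1 - \<tau>\<^sup>2) \<longrightarrow>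
    (\<exists>(C2 :: (real^3) set) (f :: real^3 \<Rightarrow> real^3). C2 \<subseteq> {p. p$1 = 0} \<and>
       space_isometry f \<and> C2 = f ` clasp_curve \<tau> \<and>
       setdist (clasp_curve \<tau>) C2 = 1 \<and>
       symmetric_2star2 (clasp_curve \<tau> \<union> C2) \<and>
       (\<exists>\<gamma>1 \<gamma>2 :: real \<Rightarrow> real^3. path_image \<gamma>1 = extended_clasp_curve \<tau> h \<and>
          path_image \<gamma>2 = f ` extended_clasp_curve \<tau> h \<and>
          symmetric_2star2 (path_image \<gamma>1 \<union> path_image \<gamma>2) \<and>
          thickness \<sigma> \<gamma>1 \<gamma>2 = 1 \<and>
          clasp_critical \<tau> \<sigma> h \<gamma>1 \<gamma>2))"
\<comment> \<open>10 is the lower bound on \<open>h\<close> fixed in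
  \<open>clasp_arcs\<close>.\<close>
proof (intro exI[of _ 10] allI impI)
  fix h \<tau> \<sigma> :: real
  assume h: "10 \<le> h" and \<tau>: "0 \<le> \<tau>" "\<tau> \<le> 1" and \<sigma>: "0 \<le> \<sigma>" "\<sigma> \<le> sqrt (1 - \<tau>\<^sup>2)"
  interpret clasp_arcs \<tau> h by unfold_locales (use h \<tau> in auto)
  have \<sigma>c: "\<sigma> \<le> c" using \<sigma> by (simp add: c_def)
  show "\<exists>(C2 :: (real^3) set) (f :: real^3 \<Rightarrow> real^3). C2 \<subseteq> {p. p$1 = 0} \<and>
       space_isometry f \<and> C2 = f ` clasp_curve \<tau> \<and>
       setdist (clasp_curve \<tau>) C2 = 1 \<and>
       symmetric_2star2 (clasp_curve \<tau> \<union> C2) \<and>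
       (\<exists>\<gamma>1 \<gamma>2 :: real \<Rightarrow> real^3. path_image \<gamma>1 = extended_clasp_curve \<tau> h \<and>
          path_image \<gamma>2 = f ` extended_clasp_curve \<tau> h \<and>
          symmetric_2star2 (path_image \<gamma>1 \<union> path_image \<gamma>2) \<and>
          thickness \<sigma> \<gamma>1 \<gamma>2 = 1 \<and>
          clasp_critical \<tau> \<sigma> h \<gamma>1 \<gamma>2)"
  proof (intro exI conjI)
    show "rot ` clasp_curve \<tau> \<subseteq> {p. p$1 = 0}" by (auto simp: clasp_curve_eq \<Gamma>_def rot_vector)
    show "space_isometry rot" by (simp add: space_isometry_def rot_dist)
    show "setdist (clasp_curve \<tau>) (rot ` clasp_curve \<tau>) = 1" unfolding clasp_curve_eq by (rule setdist_curves)
    show "symmetric_2star2 (clasp_curve \<tau> \<union> rot ` clasp_curve \<tau>)"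
      unfolding clasp_curve_eq by (rule symmetric_images) auto
    show "path_image \<gamma>1 = extended_clasp_curve \<tau> h" by (simp add: extended_eq)
    show "path_image \<gamma>2 = rot ` extended_clasp_curve \<tau> h" by (simp add: extended_eq path_image_\<gamma>2)
    show "symmetric_2star2 (path_image \<gamma>1 \<union> path_image \<gamma>2)"
      unfolding path_image_\<gamma>2 path_image_\<gamma>1 by (rule symmetric_images) auto
    show "thickness \<sigma> \<gamma>1 \<gamma>2 = 1" by (rule thickness_and_variation(1)[OF \<sigma>(1) \<sigma>c])
    show "clasp_critical \<tau> \<sigma> h \<gamma>1 \<gamma>2" by (rule clasp_critical_\<gamma>[OF \<sigma>(1) \<sigma>c])
  qed simp
qed

end
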